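(* Let $\mathcal{F}_0$ be any (smooth) singular foliation on $\mathbb{O}^2$ having the singular octonionic Hopf leaf decomposition $\mathcal{L}_{OH}$ as its leaf decomposition. Then $(\mathbb{O}^2,\mathcal{F}_0)$ is not Hausdorff Morita equivalent to $(M,\mathcal{F})$ for any singular foliation $\mathcal{F}$ on some Riemannian manifold $(M,g)$ which is locally homogeneous, i.e. whose leaf decomposition is locally given by the orbits of some isometric Lie group action.
   Context: $\mathbb{O}\cong\mathbb{R}^8$ denotes the octonions: the real unital non-associative algebra with orthonormal basis $e_0=1,e_1,\dots,e_7$ and $e_i\cdot e_j=-\delta_{ij}1+\sum_k\epsilon_{ijk}e_k$ for $1\le i,j\le 7$, where $\epsilon_{ijk}$ is completely antisymmetric, equal to $1$ for $ijk\in\{123,145,176,246,257,347,365\}$, and $0$ for all triples that are not permutations of these; $\|\cdot\|$ is the Euclidean norm. Singular octonionic Hopf leaf decomposition $\mathcal{L}_{OH}$ of $\mathbb{O}^2$: for $m\in\mathbb{O}$ let $l_m=\{(x,m\cdot x):x\in\mathbb{O}\}$ and let $l_\infty=\{(0,x):x\in\mathbb{O}\}$. For $r>0$ let $\mathrm{S}(r)=\{(x,y)\in\mathbb{O}^2:\|x\|^2+\|y\|^2=r^2\}$. The leaves of $\mathcal{L}_{OH}$ are $l_m\cap \mathrm{S}(r)$, $l_\infty\cap \mathrm{S}(r)$ ($m\in\mathbb{O}$, $r>0$), and the origin. Smooth singular foliation on a manifold $M$: a $C^\infty(M)$-submodule $\mathcal{F}$ of the compactly supported vector fields $\mathfrak{X}_c(M)$,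 closed under the Lie bracket and locally finitely generated: every $q\in M$ has an open neighbourhood $U$ and $X_1,\dots,X_N\in\mathfrak{X}(U)$ such that $\iota_U^{-1}(\mathcal{F}):=\{X|_U: X\in\mathcal{F},\ \mathrm{supp}(X)\subset U\}$ equals $\langle X_1,\dots,X_N\rangle_{C_c^\infty(U)}$. The leaf through $q$ is the set of points that can be joined to $q$ by flows of finitely many vector fields in $\mathcal{F}$. Pullback: for a surjective submersion $\pi:N\to M$ and a singular foliation $\mathcal{F}$ on $M$, a vector field $V\in\mathfrak{X}(N)$ is projectable to $\mathcal{F}$ if there is $X\in\mathcal{F}$ with $\mathrm{d}_q\pi(V|_q)=X|_{\pi(q)}$ for all $q\in N$; $\pi^{-1}\mathcal{F}$ is the singular foliation on $N$ consisting of $C_c^\infty(N)$-linear combinations of vector fields projectable to $\mathcal{F}$. Hausdorff Morita equivalence: $(M_1,\mathcal{F}_1)$ and $(M_2,\mathcal{F}_2)$ are Hausdorff Morita equivalent if there are a smooth manifold $N$ and surjective submersions with connected fibers $\pi_i:N\to M_i$ ($i=1,2$) with $\pi_1^{-1}\mathcal{F}_1=\pi_2^{-1}\mathcal{F}_2$. Homogeneity: a singular foliation $\mathcal{F}$ on a Riemannian manifold $(M,g)$ is homogeneous if there is a Lie group of isometries $G\subset\mathrm{Isom}(M,g)$ whose orbits are the leaves of $\mathcal{F}$; it is locally homogeneous if every $q\in M$ has an open neighbourhood $U$ such that $\iota_U^{-1}\mathcal{F}$ is homogeneous on $(U,g|_U)$. *)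

theory Defs
  imports "HOL-Analysis.Analysis" "HOL-Algebra.Bij"
begin

section \<open>Octonions\<close>

type_synonym octonion = "real ^ 8"

text \<open>The coordinates of an octonion are indexed by the numerals 0, ..., 7 of the type 8.\<close>

definition oct_triples :: "(8 \<times> 8 \<times> 8) set" where
  "oct_triples = {(1,2,3), (1,4,5), (1,7,6), (2,4,6), (2,5,7), (3,4,7), (3,6,5)}"

definition oct_cyclic_triples :: "(8 \<times> 8 \<times> 8) set" where
  "oct_cyclic_triples =
     {(i,j,k). (i,j,k) \<in> oct_triples \<or> (j,k,i) \<in> oct_triples \<or> (k,i,j) \<in> oct_triples}"

definition oct_eps :: "8 \<Rightarrow> 8 \<Rightarrow> 8 \<Rightarrow> real" where
  "oct_eps i j k =
     (if (i,j,k) \<in> oct_cyclic_triples then 1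
      else if (j,i,k) \<in> oct_cyclic_triples then -1 else 0)"

abbreviation oct_basis :: "8 \<Rightarrow> octonion" where
  "oct_basis i \<equiv> axis i 1"

definition oct_basis_mult :: "8 \<Rightarrow> 8 \<Rightarrow> octonion" where
  "oct_basis_mult i j =
     (if i = 0 then oct_basis j else if j = 0 then oct_basis i
      else (if i = j then - oct_basis 0 else 0)
           + (\<Sum>k\<in>UNIV - {0}. oct_eps i j k *\<^sub>R oct_basis k))"

definition oct_mult :: "octonion \<Rightarrow> octonion \<Rightarrow> octonion" (infixl "\<cdot>\<^sub>O" 70) where
  "x \<cdot>\<^sub>O y = (\<Sum>i\<in>UNIV. \<Sum>j\<in>UNIV. (x $ i * y $ j) *\<^sub>R oct_basis_mult i j)"

definition oct_line :: "octonion \<Rightarrow> (octonion \<times> octonion) set" where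
  "oct_line m = {(x, m \<cdot>\<^sub>O x) | x. True}"

definition oct_line_inf :: "(octonion \<times> octonion) set" where
  "oct_line_inf = {(0, x) | x. True}"

definition oct_sphere :: "real \<Rightarrow> (octonion \<times> octonion) set" where
  "oct_sphere r = {(x, y). (norm x)\<^sup>2 + (norm y)\<^sup>2 = r\<^sup>2}"

definition octonionic_hopf_leaves :: "(octonion \<times> octonion) set set" where
  "octonionic_hopf_leaves =
     {oct_line m \<inter> oct_sphere r | m r. r > 0}
     \<union> {oct_line_inf \<inter> oct_sphere r | r. r > 0} \<union> {{(0, 0)}}"


section \<open>Smooth maps between open subsets of finite-dimensional subspaces\<close>

text \<open>
  Below, V is a finite-dimensional linear subspace of a normed space and S is a relatively open
  subset of V. A map on S is k times continuously differentiable iff all its iterated directional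
  derivatives along V up to order k exist and are continuous. The values of the map outside S are
  irrelevant.
\<close>

definition dir_deriv ::
  "('e::real_normed_vector \<Rightarrow> 'f::real_normed_vector) \<Rightarrow> 'e \<Rightarrow> 'e \<Rightarrow> 'f" where
  "dir_deriv f x v = vector_derivative (\<lambda>t. f (x + t *\<^sub>R v)) (at 0)"

primrec Ck_on ::
  "nat \<Rightarrow> 'e::real_normed_vector set \<Rightarrow> 'e set \<Rightarrow> ('e \<Rightarrow> 'f::real_normed_vector) \<Rightarrow> bool" where
  "Ck_on 0 V S f \<longleftrightarrow> continuous_on S f"
| "Ck_on (Suc k) V S f \<longleftrightarrow> continuous_on S f \<and>
     (\<forall>v\<in>V. (\<forall>x\<in>S. (\<lambda>t::real. f (x + t *\<^sub>R v)) differentiable (at 0)) \<and>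
            Ck_on k V S (\<lambda>x. dir_deriv f x v))"

definition Cinf_on ::
  "'e::real_normed_vector set \<Rightarrow> 'e set \<Rightarrow> ('e \<Rightarrow> 'f::real_normed_vector) \<Rightarrow> bool" where
  "Cinf_on V S f \<longleftrightarrow> (\<forall>k. Ck_on k V S f)"


section \<open>Smooth manifolds\<close>

text \<open>
  A smooth structure is given by a topology and, for each point p, a chosen chart with domain
  cdom p (containing p) and coordinate map cmap p; these charts form the atlas. The model space is
  a finite-dimensional subspace of an arbitrary normed space, so that every dimension (including 0)
  occurs and the dimension may be quantified inside a formula.

  The tangent space at p is identified with the model space by means of the chosen chart at p.
  A vector field is thus a function from points to model vectors (set to 0 off the manifold).
  Passing to an open subset keeps the coordinate maps, hence also the tangent spaces.
\<close>

record ('m, 'e) manifold =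
  mtop :: "'m topology"
  model :: "'e set"
  cdom :: "'m \<Rightarrow> 'm set"
  cmap :: "'m \<Rightarrow> 'm \<Rightarrow> 'e"

abbreviation points :: "('m, 'e) manifold \<Rightarrow> 'm set" where
  "points M \<equiv> topspace (mtop M)"

definition cinv :: "('m, 'e) manifold \<Rightarrow> 'm \<Rightarrow> 'e \<Rightarrow> 'm" where
  "cinv M p = inv_into (cdom M p) (cmap M p)"

definition smooth_manifold :: "('m, 'e::real_normed_vector) manifold \<Rightarrow> bool" where
  "smooth_manifold M \<longleftrightarrow>
     Hausdorff_space (mtop M) \<and> second_countable (mtop M) \<and>
     subspace (model M) \<and> (\<exists>B. finite B \<and> span B = model M) \<and>
     (\<forall>p\<in>points M.
        p \<in> cdom M p \<and> openin (mtop M) (cdom M p) \<and>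
        openin (top_of_set (model M)) (cmap M p ` cdom M p) \<and>
        homeomorphic_map (subtopology (mtop M) (cdom M p))
          (top_of_set (cmap M p ` cdom M p)) (cmap M p)) \<and>
     (\<forall>p\<in>points M. \<forall>q\<in>points M.
        Cinf_on (model M) (cmap M p ` (cdom M p \<inter> cdom M q)) (cmap M q \<circ> cinv M p))"

definition standard_manifold :: "('e::real_normed_vector, 'e) manifold" where
  "standard_manifold =
     \<lparr>mtop = euclidean, model = UNIV, cdom = (\<lambda>_. UNIV), cmap = (\<lambda>_ x. x)\<rparr>"

definition open_submanifold :: "('m, 'e) manifold \<Rightarrow> 'm set \<Rightarrow> ('m, 'e) manifold" where
  "open_submanifold M U =
     M\<lparr>mtop := subtopology (mtop M) U, cdom := (\<lambda>p. cdom M p \<inter> U)\<rparr>"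

definition prod_manifold ::
  "('m, 'e) manifold \<Rightarrow> ('n, 'f) manifold \<Rightarrow> ('m \<times> 'n, 'e \<times> 'f) manifold" where
  "prod_manifold M N =
     \<lparr>mtop = prod_topology (mtop M) (mtop N),
      model = model M \<times> model N,
      cdom = (\<lambda>(p, q). cdom M p \<times> cdom N q),
      cmap = (\<lambda>(p, q). map_prod (cmap M p) (cmap N q))\<rparr>"

definition smooth_map ::
  "('m, 'e::real_normed_vector) manifold \<Rightarrow> ('n, 'f::real_normed_vector) manifold
     \<Rightarrow> ('m \<Rightarrow> 'n) \<Rightarrow> bool" where
  "smooth_map M N f \<longleftrightarrow>
     continuous_map (mtop M) (mtop N) f \<and>
     (\<forall>p\<in>points M.
        Cinf_on (model M) (cmap M p ` {q \<in> cdom M p. f q \<in> cdom N (f p)})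
          (cmap N (f p) \<circ> f \<circ> cinv M p))"

definition tangent_map ::
  "('m, 'e::real_normed_vector) manifold \<Rightarrow> ('n, 'f::real_normed_vector) manifold
     \<Rightarrow> ('m \<Rightarrow> 'n) \<Rightarrow> 'm \<Rightarrow> 'e \<Rightarrow> 'f" where
  "tangent_map M N f p v = dir_deriv (cmap N (f p) \<circ> f \<circ> cinv M p) (cmap M p p) v"

definition surjective_submersion ::
  "('n, 'f::real_normed_vector) manifold \<Rightarrow> ('m, 'e::real_normed_vector) manifold
     \<Rightarrow> ('n \<Rightarrow> 'm) \<Rightarrow> bool" where
  "surjective_submersion N M \<pi> \<longleftrightarrow>
     smooth_map N M \<pi> \<and> \<pi> ` points N = points M \<and>
     (\<forall>q\<in>points N. tangent_map N M \<pi> q ` model N = model M)"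

definition compact_support :: "('m, 'e) manifold \<Rightarrow> ('m \<Rightarrow> 'a::zero) \<Rightarrow> bool" where
  "compact_support M f \<longleftrightarrow> compactin (mtop M) (mtop M closure_of {p \<in> points M. f p \<noteq> 0})"

definition smooth_functions :: "('m, 'e::real_normed_vector) manifold \<Rightarrow> ('m \<Rightarrow> real) set" where
  "smooth_functions M = {f. smooth_map M standard_manifold f}"

definition smooth_functions_cc :: "('m, 'e::real_normed_vector) manifold \<Rightarrow> ('m \<Rightarrow> real) set" where
  "smooth_functions_cc M = {f \<in> smooth_functions M. compact_support M f}"


section \<open>Vector fields\<close>

text \<open>The coordinate representation of a vector field in the chosen chart at p: at the point q
  with coordinates x, the vector is carried from the chosen chart at q to the one at p.\<close>

definition vf_rep ::
  "('m, 'e::real_normed_vector) manifold \<Rightarrow> 'm \<Rightarrow> ('m \<Rightarrow> 'e) \<Rightarrow> 'e \<Rightarrow> 'e" where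
  "vf_rep M p X x =
     (let q = cinv M p x in dir_deriv (cmap M p \<circ> cinv M q) (cmap M q q) (X q))"

definition vector_fields :: "('m, 'e::real_normed_vector) manifold \<Rightarrow> ('m \<Rightarrow> 'e) set" where
  "vector_fields M =
     {X. (\<forall>p\<in>points M. X p \<in> model M \<and> Cinf_on (model M) (cmap M p ` cdom M p) (vf_rep M p X))
         \<and> (\<forall>p. p \<notin> points M \<longrightarrow> X p = 0)}"

definition vector_fields_cc :: "('m, 'e::real_normed_vector) manifold \<Rightarrow> ('m \<Rightarrow> 'e) set" where
  "vector_fields_cc M = {X \<in> vector_fields M. compact_support M X}"

text \<open>In a chart, the bracket of X and Y is DY(X) - DX(Y); at p the chosen chart at p is used, in
  which the vectors at p are represented by X p and Y p themselves.\<close>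

definition lie_bracket ::
  "('m, 'e::real_normed_vector) manifold \<Rightarrow> ('m \<Rightarrow> 'e) \<Rightarrow> ('m \<Rightarrow> 'e) \<Rightarrow> 'm \<Rightarrow> 'e" where
  "lie_bracket M X Y p =
     (if p \<in> points M
      then dir_deriv (vf_rep M p Y) (cmap M p p) (X p) - dir_deriv (vf_rep M p X) (cmap M p p) (Y p)
      else 0)"

definition cc_span ::
  "('m, 'e::real_normed_vector) manifold \<Rightarrow> ('m \<Rightarrow> 'e) set \<Rightarrow> ('m \<Rightarrow> 'e) set" where
  "cc_span M S =
     {(\<lambda>p. \<Sum>i<n. f i p *\<^sub>R X i p) | (n::nat) f X.
        \<forall>i<n. f i \<in> smooth_functions_cc M \<and> X i \<in> S}"

definition integral_curve ::
  "('m, 'e::real_normed_vector) manifold \<Rightarrow> ('m \<Rightarrow> 'e) \<Rightarrow> (real \<Rightarrow> 'm) \<Rightarrow> bool" where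
  "integral_curve M X \<gamma> \<longleftrightarrow>
     continuous_map euclideanreal (mtop M) \<gamma> \<and>
     (\<forall>t. ((\<lambda>s. cmap M (\<gamma> t) (\<gamma> s)) has_vector_derivative X (\<gamma> t)) (at t))"


section \<open>Singular foliations\<close>

definition restrict_foliation ::
  "('m, 'e::real_normed_vector) manifold \<Rightarrow> 'm set \<Rightarrow> ('m \<Rightarrow> 'e) set \<Rightarrow> ('m \<Rightarrow> 'e) set" where
  "restrict_foliation M U F =
     {(\<lambda>p. if p \<in> U then X p else 0) | X.
        X \<in> F \<and> mtop M closure_of {p \<in> points M. X p \<noteq> 0} \<subseteq> U}"

definition singular_foliation ::
  "('m, 'e::real_normed_vector) manifold \<Rightarrow> ('m \<Rightarrow> 'e) set \<Rightarrow> bool" where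
  "singular_foliation M F \<longleftrightarrow>
     F \<subseteq> vector_fields_cc M \<and>
     (\<lambda>_. 0) \<in> F \<and>
     (\<forall>X\<in>F. \<forall>Y\<in>F. (\<lambda>p. X p + Y p) \<in> F) \<and>
     (\<forall>f\<in>smooth_functions M. \<forall>X\<in>F. (\<lambda>p. f p *\<^sub>R X p) \<in> F) \<and>
     (\<forall>X\<in>F. \<forall>Y\<in>F. lie_bracket M X Y \<in> F) \<and>
     (\<forall>q\<in>points M. \<exists>U S. openin (mtop M) U \<and> q \<in> U \<and>
        finite S \<and> S \<subseteq> vector_fields (open_submanifold M U) \<and>
        restrict_foliation M U F = cc_span (open_submanifold M U) S)"

text \<open>Compactly supported vector fields are complete, so flow lines are defined on all reals.\<close>

definition leaf ::
  "('m, 'e::real_normed_vector) manifold \<Rightarrow> ('m \<Rightarrow> 'e) set \<Rightarrow> 'm \<Rightarrow> 'm set" where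
  "leaf M F q =
     {q'. (\<lambda>a b. \<exists>X\<in>F. \<exists>\<gamma> t. integral_curve M X \<gamma> \<and> \<gamma> 0 = a \<and> \<gamma> t = b)\<^sup>*\<^sup>* q q'}"

definition leaf_decomposition ::
  "('m, 'e::real_normed_vector) manifold \<Rightarrow> ('m \<Rightarrow> 'e) set \<Rightarrow> 'm set set" where
  "leaf_decomposition M F = leaf M F ` points M"


section \<open>Pullback and Hausdorff Morita equivalence\<close>

definition projectable ::
  "('n, 'f::real_normed_vector) manifold \<Rightarrow> ('m, 'e::real_normed_vector) manifold
     \<Rightarrow> ('n \<Rightarrow> 'm) \<Rightarrow> ('m \<Rightarrow> 'e) set \<Rightarrow> ('n \<Rightarrow> 'f) \<Rightarrow> bool" where
  "projectable N M \<pi> F V \<longleftrightarrow>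
     V \<in> vector_fields N \<and>
     (\<exists>X\<in>F. \<forall>q\<in>points N. tangent_map N M \<pi> q (V q) = X (\<pi> q))"

definition pullback_foliation ::
  "('n, 'f::real_normed_vector) manifold \<Rightarrow> ('m, 'e::real_normed_vector) manifold
     \<Rightarrow> ('n \<Rightarrow> 'm) \<Rightarrow> ('m \<Rightarrow> 'e) set \<Rightarrow> ('n \<Rightarrow> 'f) set" where
  "pullback_foliation N M \<pi> F = cc_span N {V. projectable N M \<pi> F V}"

definition connected_fibers ::
  "('n, 'f) manifold \<Rightarrow> ('m, 'e) manifold \<Rightarrow> ('n \<Rightarrow> 'm) \<Rightarrow> bool" where
  "connected_fibers N M \<pi> \<longleftrightarrow> (\<forall>p\<in>points M. connectedin (mtop N) {q \<in> points N. \<pi> q = p})"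

text \<open>The first argument only fixes the types over which the manifold N ranges. A statement that
  is polymorphic in these types concerns all manifolds N.\<close>

definition hausdorff_morita_equivalent ::
  "('n, 'f::real_normed_vector) manifold itself
     \<Rightarrow> ('m, 'e::real_normed_vector) manifold \<Rightarrow> ('m \<Rightarrow> 'e) set
     \<Rightarrow> ('k, 'd::real_normed_vector) manifold \<Rightarrow> ('k \<Rightarrow> 'd) set \<Rightarrow> bool" where
  "hausdorff_morita_equivalent _ M1 F1 M2 F2 \<longleftrightarrow>
     (\<exists>(N :: ('n, 'f) manifold) \<pi>1 \<pi>2.
        smooth_manifold N \<and>
        surjective_submersion N M1 \<pi>1 \<and> connected_fibers N M1 \<pi>1 \<and>
        surjective_submersion N M2 \<pi>2 \<and> connected_fibers N M2 \<pi>2 \<and>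
        pullback_foliation N M1 \<pi>1 F1 = pullback_foliation N M2 \<pi>2 F2)"


section \<open>Riemannian metrics and homogeneity\<close>

definition riemannian_metric ::
  "('m, 'e::real_normed_vector) manifold \<Rightarrow> ('m \<Rightarrow> 'e \<Rightarrow> 'e \<Rightarrow> real) \<Rightarrow> bool" where
  "riemannian_metric M g \<longleftrightarrow>
     (\<forall>p\<in>points M. \<forall>u\<in>model M. \<forall>v\<in>model M.
        g p u v = g p v u \<and> (u \<noteq> 0 \<longrightarrow> g p u u > 0) \<and>
        (\<forall>w\<in>model M. \<forall>a b. g p (a *\<^sub>R u + b *\<^sub>R v) w = a * g p u w + b * g p v w)) \<and>
     (\<forall>X\<in>vector_fields M. \<forall>Y\<in>vector_fields M. (\<lambda>p. g p (X p) (Y p)) \<in> smooth_functions M)"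

definition isometries ::
  "('m, 'e::real_normed_vector) manifold \<Rightarrow> ('m \<Rightarrow> 'e \<Rightarrow> 'e \<Rightarrow> real) \<Rightarrow> ('m \<Rightarrow> 'm) set" where
  "isometries M g =
     {\<phi> \<in> Bij (points M).
        smooth_map M M \<phi> \<and> smooth_map M M (inv_into (points M) \<phi>) \<and>
        (\<forall>p\<in>points M. \<forall>u\<in>model M. \<forall>v\<in>model M.
           g (\<phi> p) (tangent_map M M \<phi> p u) (tangent_map M M \<phi> p v) = g p u v)}"

definition isometry_group ::
  "('m, 'e::real_normed_vector) manifold \<Rightarrow> ('m \<Rightarrow> 'e \<Rightarrow> 'e \<Rightarrow> real) \<Rightarrow> ('m \<Rightarrow> 'm) monoid" where
  "isometry_group M g = BijGroup (points M)\<lparr>carrier := isometries M g\<rparr>"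

definition lie_group :: "('g, 'e::real_normed_vector) manifold \<Rightarrow> 'g monoid \<Rightarrow> bool" where
  "lie_group L G \<longleftrightarrow>
     smooth_manifold L \<and> group G \<and> points L = carrier G \<and>
     smooth_map (prod_manifold L L) L (\<lambda>(a, b). a \<otimes>\<^bsub>G\<^esub> b) \<and>
     smooth_map L L (\<lambda>a. inv\<^bsub>G\<^esub> a)"

text \<open>A Lie group of isometries is a subgroup H of the isometry group with a Lie group structure for
  which the action is smooth. The normed space of bounded real sequences contains subspaces of
  every finite dimension, so modelling the Lie group on it does not restrict its dimension.\<close>

definition homogeneous_foliation ::
  "('m, 'e::real_normed_vector) manifold \<Rightarrow> ('m \<Rightarrow> 'e \<Rightarrow> 'e \<Rightarrow> real) \<Rightarrow> ('m \<Rightarrow> 'e) set \<Rightarrow> bool" where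
  "homogeneous_foliation M g F \<longleftrightarrow>
     (\<exists>H (L :: ('m \<Rightarrow> 'm, nat \<Rightarrow>\<^sub>C real) manifold).
        subgroup H (isometry_group M g) \<and>
        lie_group L (isometry_group M g\<lparr>carrier := H\<rparr>) \<and>
        smooth_map (prod_manifold L M) M (\<lambda>(\<phi>, p). \<phi> p) \<and>
        (\<lambda>q. {\<phi> q | \<phi>. \<phi> \<in> H}) ` points M = leaf_decomposition M F)"

definition locally_homogeneous_foliation ::
  "('m, 'e::real_normed_vector) manifold \<Rightarrow> ('m \<Rightarrow> 'e \<Rightarrow> 'e \<Rightarrow> real) \<Rightarrow> ('m \<Rightarrow> 'e) set \<Rightarrow> bool" where
  "locally_homogeneous_foliation M g F \<longleftrightarrow>
     (\<forall>q\<in>points M. \<exists>U. openin (mtop M) U \<and> q \<in> U \<and>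
        homogeneous_foliation (open_submanifold M U) g (restrict_foliation M U F))"

end

theory Submission
  imports Defs
begin

text \<open>
  Let N realise the equivalence and let n be a point of N over the origin. Local sections of the
  two submersions through n yield a slice y from a neighbourhood of the origin into M, and a map P
  from M back to pairs of octonions, with D(P o y) = id at 0. Since the pullback foliations agree, a
  vector tangent to N covers a vector of F0 iff it covers a vector of F. Hence y maps leaves of F0
  into leaves of F restricted to a prescribed neighbourhood, and, the fibres being connected, P maps
  leaves of F into leaves of F0.

  If F were locally homogeneous, then for every small t an isometry f would map y (t e0, 0) to
  y (t e1, 0). The equation satisfied by an isometry in a chart determines its second derivatives in
  terms of its first derivatives (as in the Koszul formula), so f is close to a linear map on small
  balls, uniformly in f. Thus P o f o y, rescaled by 1/t, is close to a linear map A which nearly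
  preserves all leaves and nearly maps (e0, 0) to (e1, 0). A linear map preserving all octonionic
  lines has the form (x, y) \<mapsto> (a x, a y) with a (m x) = m (a x), so that a (e0) = e1 forces
  (m x) e1 = m (x e1) for all m and x. This fails for m = e2 and x = e4, by a margin that absorbs
  the errors.
\<close>

section \<open>Calculus on finite-dimensional subspaces\<close>

text \<open>M and N may have any dimension, so y and P stand in for a diffeomorphism that need not
  exist. That \<open>D(P o y)\<close> is the identity at 0 comes from the leaf of the origin being a
  point: fields of F0 vanish there, so a vector at the point n that is vertical for the map to M is
  also vertical for the map to the octonions.

  The isometry taking y (t e0, 0) to y (t e1, 0) depends on t and need not fix the point below n.
  Instead of a limit of isometries as t tends to 0, its first two derivatives are bounded by
  constants of the metric alone, one small t is fixed, and all errors are compared with the gap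
  between (e2 e4) e1 = e7 and e2 (e4 e1) = -e7. Relative errors of 1/400 in the analysis meet the
  tolerance 1/100 of the linear algebra.

  Model spaces are subspaces of arbitrary normed spaces, whose norm need not be smooth. Calculus is
  therefore developed relative to such a subspace, mostly through coordinates in a chosen
  basis.\<close>

definition fd_subspace :: "'e::real_normed_vector set \<Rightarrow> bool" where
  "fd_subspace V \<longleftrightarrow> subspace V \<and> (\<exists>B. finite B \<and> span B = V)"

lemma fd_subspaceD: "fd_subspace V \<Longrightarrow> subspace V"
  by (simp add: fd_subspace_def)

section \<open>Compactness, closedness and completeness of finite-dimensional subspaces\<close>

lemma closed_if_compact_cballs:
  fixes S :: "'a::real_normed_vector set"
  assumes "\<And>r. compact (S \<inter> cball 0 r)"
  shows "closed S"
  unfolding closed_sequential_limits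
proof (intro allI impI, elim conjE)
  fix x :: "nat \<Rightarrow> 'a" and l
  assume x: "\<forall>n. x n \<in> S" and lim: "x \<longlonglongrightarrow> l"
  obtain r where r: "\<And>n. norm (x n) \<le> r"
    using lim by (metis Bseq_def convergent_def convergent_imp_Bseq)
  have "closed (S \<inter> cball 0 r)" using assms compact_imp_closed by blast
  then have "l \<in> S \<inter> cball 0 r"
    using x r lim by (intro closed_sequentially[of "S \<inter> cball 0 r" x l]) auto
  then show "l \<in> S" by simp
qed

lemma closed_dist_pos:
  fixes S :: "'a::metric_space set"
  assumes "closed S" "a \<notin> S"
  obtains d where "d > 0" "\<And>v. v \<in> S \<Longrightarrow> d \<le> dist a v"
proof (cases "S = {}")
  case False
  then show ?thesis
    using that[of "infdist a S"] infdist_pos_not_in_closed[OF assms(1) False assms(2)] infdist_le by blast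
qed (use that[of 1] in auto)

text \<open>Induction on the spanning set. A new vector \<open>b\<close> outside the closed subspace
  \<open>span B\<close> has positive distance \<open>d\<close> from it, which bounds the coefficient
  of \<open>b\<close> in any vector of given norm. The slice of the larger span is then the image of
  a compact box, cut by a closed ball.\<close>

lemma compact_span_Int_cball:
  fixes B :: "'a::real_normed_vector set"
  assumes "finite B"
  shows "compact (span B \<inter> cball 0 r)"
  using assms
proof (induction B arbitrary: r rule: finite_induct)
  case empty
  then show ?case by (auto intro!: finite_imp_compact finite_Int)
next
  case (insert b B)
  show ?case
  proof (cases "b \<in> span B")
    case True
    then show ?thesis using insert.IH by (simp add: span_redundant)
  next
    case False
    have cl: "closed (span B)"
      by (rule closed_if_compact_cballs) (rule insert.IH)
    then obtain d where d: "d > 0" "\<And>v. v \<in> span B \<Longrightarrow> d \<le> dist b v"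
      using closed_dist_pos[OF cl False] by blast
    have bound: "\<bar>k\<bar> * d \<le> norm (k *\<^sub>R b + v)" if "v \<in> span B" for k v
    proof (cases "k = 0")
      case False
      have "- (inverse k *\<^sub>R v) \<in> span B"
        using that by (simp add: span_neg span_scale)
      then have "d \<le> norm (b + inverse k *\<^sub>R v)"
        using d(2) by (fastforce simp: dist_norm)
      then have "\<bar>k\<bar> * d \<le> \<bar>k\<bar> * norm (b + inverse k *\<^sub>R v)"
        by (simp add: mult_left_mono)
      also have "\<dots> = norm (k *\<^sub>R (b + inverse k *\<^sub>R v))" by simp
      also have "k *\<^sub>R (b + inverse k *\<^sub>R v) = k *\<^sub>R b + v"
        using False by (simp add: scaleR_add_right)
      finally show ?thesis .
    qed simp
    \<comment> \<open>\<open>R\<close> bounds the coefficient of \<open>b\<close>, and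
      \<open>R'\<close> the norm of the remaining component; absolute values cover a negative radius
      \<open>r\<close>.\<close>
    define R where "R = \<bar>r\<bar> / d"
    define R' where "R' = \<bar>r\<bar> + R * norm b"
    let ?im = "(\<lambda>(k, v). k *\<^sub>R b + v) ` ({-R..R} \<times> (span B \<inter> cball 0 R'))"
    have "compact ?im"
      by (intro compact_continuous_image compact_Times insert.IH compact_Icc)
        (auto intro!: continuous_intros simp: case_prod_unfold)
    then have "compact (?im \<inter> cball 0 r)"
      by (simp add: compact_Int_closed)
    moreover have "?im \<inter> cball 0 r = span (insert b B) \<inter> cball 0 r"
    proof (intro equalityI subsetI)
      fix x assume x: "x \<in> span (insert b B) \<inter> cball 0 r"
      then obtain k where k: "x - k *\<^sub>R b \<in> span B" by (auto simp: span_breakdown_eq)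
      have "\<bar>k\<bar> * d \<le> norm x" using bound[OF k, of k] by simp
      then have "\<bar>k\<bar> * d \<le> \<bar>r\<bar>" using x by auto
      then have kR: "\<bar>k\<bar> \<le> R" using d(1) by (simp add: R_def pos_le_divide_eq)
      have "norm (x - k *\<^sub>R b) \<le> norm x + \<bar>k\<bar> * norm b"
        by (metis norm_scaleR norm_triangle_ineq4)
      also have "\<dots> \<le> R'" unfolding R'_def
        using x kR by (intro add_mono mult_right_mono) auto
      finally have "(k, x - k *\<^sub>R b) \<in> {-R..R} \<times> (span B \<inter> cball 0 R')"
        using k kR by auto
      then have "(\<lambda>(k, v). k *\<^sub>R b + v) (k, x - k *\<^sub>R b) \<in> ?im" by (rule imageI)
      then show "x \<in> ?im \<inter> cball 0 r" using x by simp
    next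
      fix x assume "x \<in> ?im \<inter> cball 0 r"
      then obtain k v where "x = k *\<^sub>R b + v" "v \<in> span B" "x \<in> cball 0 r" by auto
      then show "x \<in> span (insert b B) \<inter> cball 0 r"
        by (auto simp: span_breakdown_eq intro!: exI[of _ k])
    qed
    ultimately show ?thesis by simp
  qed
qed

lemma closed_span_finite:
  fixes B :: "'a::real_normed_vector set"
  assumes "finite B" shows "closed (span B)"
  using assms by (intro closed_if_compact_cballs compact_span_Int_cball)

lemma fd_subspace_compact: "fd_subspace V \<Longrightarrow> compact (V \<inter> cball 0 r)"
  unfolding fd_subspace_def using compact_span_Int_cball by blast

lemma fd_subspace_closed: "fd_subspace V \<Longrightarrow> closed V"
  unfolding fd_subspace_def by (auto intro: closed_span_finite)

lemma fd_subspace_compact_cball: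
  assumes "fd_subspace V" shows "compact (V \<inter> cball x r)"
proof -
  have "V \<inter> cball x r = (V \<inter> cball 0 (norm x + r)) \<inter> cball x r"
    using norm_triangle_sub[of _ x] by (auto simp: dist_norm norm_minus_commute) (smt (verit) norm_triangle_sub norm_minus_commute)
  then show ?thesis
    by (metis assms closed_cball compact_Int_closed fd_subspace_compact)
qed

lemma fd_subspace_complete:
  assumes "fd_subspace V" shows "complete V"
  unfolding complete_def
proof (intro allI impI, elim conjE)
  fix f :: "nat \<Rightarrow> 'a" assume f: "\<forall>n. f n \<in> V" and c: "Cauchy f"
  then obtain r where r: "\<And>n. norm (f n) \<le> r"
    by (metis Bseq_def Cauchy_Bseq)
  have "complete (V \<inter> cball 0 r)"
    using fd_subspace_compact[OF assms] compact_imp_complete by blast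
  then show "\<exists>l\<in>V. f \<longlonglongrightarrow> l"
    using f c r unfolding complete_def by (metis Int_iff dist_0_norm mem_cball)
qed

section \<open>Coordinates and bounded linear maps on a subspace\<close>

definition fbasis :: "'e::real_normed_vector set \<Rightarrow> 'e set" where
  "fbasis V = (SOME B. finite B \<and> independent B \<and> span B = V)"

definition coord :: "'e::real_normed_vector set \<Rightarrow> 'e \<Rightarrow> 'e \<Rightarrow> real" where
  "coord V b x = representation (fbasis V) x b"

lemma fbasis:
  assumes "fd_subspace V"
  shows "finite (fbasis V)" "independent (fbasis V)" "span (fbasis V) = V" "fbasis V \<subseteq> V"
proof -
  obtain B where B: "finite B" "span B = V" using assms by (auto simp: fd_subspace_def)
  obtain C where C: "C \<subseteq> B" "independent C" "B \<subseteq> span C"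
    using maximal_independent_subset[of B] by blast
  have "finite C \<and> independent C \<and> span C = V"
    using B C by (metis finite_subset span_mono span_span subset_antisym)
  then have *: "finite (fbasis V) \<and> independent (fbasis V) \<and> span (fbasis V) = V"
    unfolding fbasis_def by (rule someI)
  then show "finite (fbasis V)" "independent (fbasis V)" "span (fbasis V) = V" by auto
  then show "fbasis V \<subseteq> V" using span_superset by blast
qed

lemma coord_sum:
  assumes "fd_subspace V" "x \<in> V"
  shows "(\<Sum>b\<in>fbasis V. coord V b x *\<^sub>R b) = x"
  unfolding coord_def using fbasis[OF assms(1)] assms(2)
  by (intro sum_representation_eq) auto

text \<open>Linearity is asked for on \<open>V\<close> only, because derivatives and tangent maps
  are meaningful only on the model space. The bound is part of the notion so that continuity is at
  hand; in finite dimension \<open>blin_onI\<close> supplies it.\<close>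

definition blin_on :: "'e::real_normed_vector set \<Rightarrow> ('e \<Rightarrow> 'f::real_normed_vector) \<Rightarrow> bool" where
  "blin_on V L \<longleftrightarrow> (\<forall>x\<in>V. \<forall>y\<in>V. L (x + y) = L x + L y) \<and> (\<forall>a. \<forall>x\<in>V. L (a *\<^sub>R x) = a *\<^sub>R L x)
     \<and> (\<exists>K\<ge>0. \<forall>x\<in>V. norm (L x) \<le> K * norm x)"

lemma blin_onD:
  assumes "blin_on V L"
  shows "x \<in> V \<Longrightarrow> y \<in> V \<Longrightarrow> L (x + y) = L x + L y" "x \<in> V \<Longrightarrow> L (a *\<^sub>R x) = a *\<^sub>R L x"
  using assms by (auto simp: blin_on_def)

lemma blin_on_bound:
  assumes "blin_on V L" obtains K where "K \<ge> 0" "\<And>x. x \<in> V \<Longrightarrow> norm (L x) \<le> K * norm x"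
  using assms by (auto simp: blin_on_def)

lemma blin_on_zero: assumes "blin_on V L" "subspace V" shows "L 0 = 0"
  using blin_onD(2)[OF assms(1) subspace_0[OF assms(2)], of 0] by simp

lemma blin_on_diff:
  assumes "blin_on V L" "subspace V" "x \<in> V" "y \<in> V" shows "L (x - y) = L x - L y"
proof -
  have "L (x + (-1) *\<^sub>R y) = L x + (-1) *\<^sub>R L y"
    using assms blin_onD[OF assms(1)] subspace_scale by metis
  then show ?thesis by simp
qed

lemma blin_on_sum:
  assumes "blin_on V L" "subspace V" "\<And>i. i \<in> I \<Longrightarrow> f i \<in> V"
  shows "L (\<Sum>i\<in>I. f i) = (\<Sum>i\<in>I. L (f i))"
  using assms(3)
proof (induction I rule: infinite_finite_induct)
  case (insert x F)
  then show ?case using blin_onD(1)[OF assms(1), of "f x" "sum f F"] assms(2)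
    by (simp add: subspace_sum)
qed (use blin_on_zero[OF assms(1,2)] in auto)

text \<open>A basis vector \<open>b\<close> has positive distance from the closed span of the
  others, and the inverse of this distance bounds its coordinate. For \<open>b\<close> outside the
  basis the coordinate is zero.\<close>

lemma blin_on_coord:
  assumes "fd_subspace V" shows "blin_on V (coord V b)"
proof -
  note B = fbasis[OF assms]
  let ?B = "fbasis V"
  have bd: "\<exists>K\<ge>0. \<forall>x\<in>V. \<bar>coord V b x\<bar> \<le> K * norm x"
  proof (cases "b \<in> ?B")
    case False
    then have "coord V b x = 0" for x
      unfolding coord_def by (meson representation_ne_zero)
    then show ?thesis by (intro exI[of _ 0]) auto
  next
    case True
    have nin: "b \<notin> span (?B - {b})" using B(2) True dependent_def by blast
    have "closed (span (?B - {b}))" using B(1) by (auto intro: closed_span_finite)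
    then obtain d where d: "d > 0" "\<And>v. v \<in> span (?B - {b}) \<Longrightarrow> d \<le> dist b v"
      using closed_dist_pos[OF _ nin] by blast
    have "\<bar>coord V b x\<bar> \<le> inverse d * norm x" if x: "x \<in> V" for x
    proof (cases "coord V b x = 0")
      case False
      define k where "k = coord V b x"
      define v where "v = (\<Sum>b'\<in>?B - {b}. coord V b' x *\<^sub>R b')"
      have xe: "x = k *\<^sub>R b + v"
        using coord_sum[OF assms x] unfolding v_def k_def
        by (simp add: sum.remove[OF B(1) True])
      have "v \<in> span (?B - {b})" unfolding v_def
        by (intro span_sum span_scale span_base)
      then have "- (inverse k *\<^sub>R v) \<in> span (?B - {b})" by (simp add: span_neg span_scale)
      then have "d \<le> norm (b + inverse k *\<^sub>R v)" using d(2) by (fastforce simp: dist_norm)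
      then have "\<bar>k\<bar> * d \<le> \<bar>k\<bar> * norm (b + inverse k *\<^sub>R v)" by (simp add: mult_left_mono)
      also have "\<dots> = norm (k *\<^sub>R (b + inverse k *\<^sub>R v))" by simp
      also have "k *\<^sub>R (b + inverse k *\<^sub>R v) = x"
        using False by (subst xe) (simp add: scaleR_add_right k_def[symmetric])
      finally show ?thesis using d(1) by (simp add: k_def field_simps)
    qed (use d(1) in auto)
    then show ?thesis using d(1) by (intro exI[of _ "inverse d"]) auto
  qed
  show ?thesis
    unfolding blin_on_def
    using bd B by (auto simp: coord_def representation_add representation_scale)
qed

text \<open>The basis expansion reduces the bound to the coordinate functionals, so algebraic
  linearity is all that has to be checked.\<close>

lemma blin_onI:
  assumes fd: "fd_subspace V"
    and add: "\<And>x y. x \<in> V \<Longrightarrow> y \<in> V \<Longrightarrow> L (x + y) = L x + L y"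
    and scale: "\<And>a x. x \<in> V \<Longrightarrow> L (a *\<^sub>R x) = a *\<^sub>R L x"
  shows "blin_on V L"
proof -
  note B = fbasis[OF fd]
  have sub: "subspace V" using fd fd_subspaceD by blast
  have L0: "L 0 = 0" using scale[OF subspace_0[OF sub], of 0] by simp
  have Ls: "L (\<Sum>b\<in>A. k b *\<^sub>R b) = (\<Sum>b\<in>A. k b *\<^sub>R L b)" if "finite A" "A \<subseteq> V" for A k
    using that
  proof (induction A rule: finite_induct)
    case (insert x F)
    then have "(\<Sum>b\<in>F. k b *\<^sub>R b) \<in> V" using sub by (intro subspace_sum subspace_scale) auto
    then show ?case using insert add scale sub by (simp add: subspace_scale)
  qed (use L0 in auto)
  have "\<exists>K. \<forall>b. 0 \<le> K b \<and> (\<forall>x\<in>V. \<bar>coord V b x\<bar> \<le> K b * norm x)"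
    using blin_on_coord[OF fd] unfolding blin_on_def real_norm_def by metis
  then obtain K where K: "\<And>b. 0 \<le> K b" "\<And>b x. x \<in> V \<Longrightarrow> \<bar>coord V b x\<bar> \<le> K b * norm x" by blast
  have "norm (L x) \<le> (\<Sum>b\<in>fbasis V. K b * norm (L b)) * norm x" if x: "x \<in> V" for x
  proof -
    have "L x = (\<Sum>b\<in>fbasis V. coord V b x *\<^sub>R L b)"
      using Ls[OF B(1,4), of "\<lambda>b. coord V b x"] coord_sum[OF fd x] by simp
    then have "norm (L x) \<le> (\<Sum>b\<in>fbasis V. norm (coord V b x *\<^sub>R L b))" by (simp only: norm_sum)
    also have "\<dots> \<le> (\<Sum>b\<in>fbasis V. (K b * norm x) * norm (L b))"
      by (intro sum_mono) (use K(2)[OF x] in \<open>auto intro!: mult_right_mono\<close>)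
    also have "\<dots> = (\<Sum>b\<in>fbasis V. K b * norm (L b)) * norm x"
      by (simp add: sum_distrib_left algebra_simps)
    finally show ?thesis .
  qed
  moreover have "0 \<le> (\<Sum>b\<in>fbasis V. K b * norm (L b))" using K by (auto intro: sum_nonneg)
  ultimately show ?thesis unfolding blin_on_def using add scale by blast
qed

lemma blin_on_expand:
  assumes "fd_subspace V" "blin_on V L" "x \<in> V"
  shows "L x = (\<Sum>b\<in>fbasis V. coord V b x *\<^sub>R L b)"
proof -
  have "subspace V" using assms fd_subspaceD by blast
  have "L x = L (\<Sum>b\<in>fbasis V. coord V b x *\<^sub>R b)" using coord_sum assms by metis
  also have "\<dots> = (\<Sum>b\<in>fbasis V. L (coord V b x *\<^sub>R b))"
    using assms fbasis(4)[OF assms(1)] \<open>subspace V\<close> by (intro blin_on_sum) (auto intro: subspace_scale)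
  also have "\<dots> = (\<Sum>b\<in>fbasis V. coord V b x *\<^sub>R L b)"
    using fbasis(4)[OF assms(1)] by (intro sum.cong refl blin_onD(2)[OF assms(2)]) auto
  finally show ?thesis .
qed

section \<open>Iterated directional derivatives: congruence, locality and algebra\<close>

lemma openin_sub_iff:
  "openin (top_of_set V) S \<longleftrightarrow> S \<subseteq> V \<and> (\<forall>x\<in>S. \<exists>e>0. \<forall>y\<in>V. dist y x < e \<longrightarrow> y \<in> S)"
  for V S :: "'a::metric_space set"
  by (simp add: openin_euclidean_subtopology_iff)

text \<open>This is why a directional derivative at a point of a relatively open set depends only on
  values inside the set.\<close>

lemma openin_sub_line:
  fixes V :: "'a::real_normed_vector set"
  assumes "subspace V" "openin (top_of_set V) S" "x \<in> S" "v \<in> V"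
  obtains d where "d > 0" "\<And>t. \<bar>t\<bar> < d \<Longrightarrow> x + t *\<^sub>R v \<in> S"
proof -
  obtain e where e: "e > 0" "\<And>y. y \<in> V \<Longrightarrow> dist y x < e \<Longrightarrow> y \<in> S"
    using assms(2,3) unfolding openin_sub_iff by blast
  have xV: "x \<in> V" using assms unfolding openin_sub_iff by blast
  show ?thesis
  proof
    \<comment> \<open>The summand 1 keeps the denominator positive when
      \<open>v = 0\<close>.\<close>
    show "e / (norm v + 1) > 0" using e by (simp add: add_nonneg_pos)
    fix t assume t: "\<bar>t\<bar> < e / (norm v + 1)"
    have "\<bar>t\<bar> * norm v \<le> \<bar>t\<bar> * (norm v + 1)" by (simp add: mult_left_mono)
    also have "\<dots> < e" using t by (simp add: pos_less_divide_eq add_nonneg_pos)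
    finally show "x + t *\<^sub>R v \<in> S"
      using e(2)[of "x + t *\<^sub>R v"] assms xV by (simp add: dist_norm subspace_add subspace_scale)
  qed
qed

lemma Ck_deriv:
  assumes "Ck_on (Suc k) V S f" "x \<in> S" "v \<in> V"
  shows "((\<lambda>t. f (x + t *\<^sub>R v)) has_vector_derivative dir_deriv f x v) (at 0)"
  using assms by (simp add: dir_deriv_def vector_derivative_works)

lemma dir_derivI:
  "((\<lambda>t. f (x + t *\<^sub>R v)) has_vector_derivative D) (at 0) \<Longrightarrow> dir_deriv f x v = D"
  by (simp add: dir_deriv_def vector_derivative_at)

lemma Ck_continuous: "Ck_on k V S f \<Longrightarrow> continuous_on S f"
  by (cases k) auto

lemma Ck_subset: "Ck_on k V S f \<Longrightarrow> T \<subseteq> S \<Longrightarrow> Ck_on k V T f"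
  by (induction k arbitrary: f) (auto intro: continuous_on_subset)

lemma Ck_pred: "Ck_on (Suc k) V S f \<Longrightarrow> Ck_on k V S f"
proof (induction k arbitrary: f)
  case (Suc k)
  have "continuous_on S f" using Suc.prems by simp
  moreover have "\<forall>v\<in>V. Ck_on k V S (\<lambda>x. dir_deriv f x v)"
    using Suc.prems Suc.IH by (metis Ck_on.simps(2))
  moreover have "\<forall>v\<in>V. \<forall>x\<in>S. (\<lambda>t. f (x + t *\<^sub>R v)) differentiable at 0"
    using Suc.prems by (metis Ck_on.simps(2))
  ultimately show ?case by simp
qed simp

lemma Cinf_Ck: "Cinf_on V S f \<Longrightarrow> Ck_on k V S f"
  by (simp add: Cinf_on_def)

lemma Cinf_dir_deriv: "Cinf_on V S f \<Longrightarrow> v \<in> V \<Longrightarrow> Cinf_on V S (\<lambda>x. dir_deriv f x v)"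
  unfolding Cinf_on_def by (metis Ck_on.simps(2))

lemma Cinf_subset: "Cinf_on V S f \<Longrightarrow> T \<subseteq> S \<Longrightarrow> Cinf_on V T f"
  unfolding Cinf_on_def using Ck_subset by blast

lemma has_vector_derivative_local:
  assumes "(f has_vector_derivative D) (at (a::real))" "d > 0" "\<And>t. \<bar>t - a\<bar> < d \<Longrightarrow> f t = g t"
  shows "(g has_vector_derivative D) (at a)"
  using assms(1) by (rule has_vector_derivative_transform_within_open[where S="ball a d"])
    (use assms in \<open>auto simp: dist_real_def abs_minus_commute\<close>)

lemma line_deriv_cong:
  fixes V :: "'a::real_normed_vector set"
  assumes "subspace V" "openin (top_of_set V) S" "x \<in> S" "v \<in> V" "\<And>x. x \<in> S \<Longrightarrow> f x = g x"
    "((\<lambda>t. f (x + t *\<^sub>R v)) has_vector_derivative D) (at 0)"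
  shows "((\<lambda>t. g (x + t *\<^sub>R v)) has_vector_derivative D) (at 0)"
proof -
  obtain d where d: "d > 0" "\<And>t. \<bar>t\<bar> < d \<Longrightarrow> x + t *\<^sub>R v \<in> S"
    using openin_sub_line[OF assms(1-4)] by blast
  show ?thesis
    using assms(6) by (rule has_vector_derivative_local[OF _ d(1)]) (use d assms in auto)
qed

text \<open>No differentiability is assumed: both curves have the same derivatives, if any, so the
  choice made by \<open>vector_derivative\<close> is the same.\<close>

lemma dir_deriv_cong:
  assumes "subspace V" "openin (top_of_set V) S" "x \<in> S" "v \<in> V" "\<And>x. x \<in> S \<Longrightarrow> f x = g x"
  shows "dir_deriv f x v = dir_deriv g x v"
proof -
  have "((\<lambda>t. f (x + t *\<^sub>R v)) has_vector_derivative D) (at 0) \<longleftrightarrow>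
        ((\<lambda>t. g (x + t *\<^sub>R v)) has_vector_derivative D) (at 0)" for D
    using line_deriv_cong[OF assms(1-4)] assms(5) by metis
  then show ?thesis unfolding dir_deriv_def vector_derivative_def by simp
qed

lemma Ck_cong:
  assumes V: "subspace V" "openin (top_of_set V) S"
  shows "Ck_on k V S f \<Longrightarrow> (\<And>x. x \<in> S \<Longrightarrow> f x = g x) \<Longrightarrow> Ck_on k V S g"
proof (induction k arbitrary: f g)
  case 0
  then show ?case using continuous_on_cong[of S S f g] by simp
next
  case (Suc k)
  have d: "((\<lambda>t. g (x + t *\<^sub>R v)) has_vector_derivative dir_deriv f x v) (at 0)" if "v \<in> V" "x \<in> S" for v x
    by (rule line_deriv_cong[OF V that(2,1) Suc.prems(2) Ck_deriv[OF Suc.prems(1) that(2,1)]])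
  have "Ck_on k V S (\<lambda>x. dir_deriv g x v)" if v: "v \<in> V" for v
  proof (rule Suc.IH)
    show "Ck_on k V S (\<lambda>x. dir_deriv f x v)" using Suc.prems(1) v by simp
    show "dir_deriv f x v = dir_deriv g x v" if "x \<in> S" for x
      using dir_derivI[OF d[OF v that]] by simp
  qed
  moreover have "(\<lambda>t. g (x + t *\<^sub>R v)) differentiable at 0" if "v \<in> V" "x \<in> S" for v x
    using d[OF that] by (rule differentiableI_vector)
  moreover have "continuous_on S g"
    using Ck_continuous[OF Suc.prems(1)] continuous_on_cong[of S S f g] Suc.prems(2) by simp
  ultimately show ?case by simp
qed

text \<open>The working introduction rule: the derivative may be given by any convenient formula
  \<open>f'\<close>, and the claim about the literal \<open>dir_deriv\<close> follows by congruence
  on the open set.\<close>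

lemma Ck_SucI:
  assumes V: "subspace V" "openin (top_of_set V) S"
    and c: "continuous_on S f"
    and d: "\<And>v x. v \<in> V \<Longrightarrow> x \<in> S \<Longrightarrow> ((\<lambda>t. f (x + t *\<^sub>R v)) has_vector_derivative f' v x) (at 0)"
    and k: "\<And>v. v \<in> V \<Longrightarrow> Ck_on k V S (f' v)"
  shows "Ck_on (Suc k) V S f"
proof -
  have "Ck_on k V S (\<lambda>x. dir_deriv f x v)" if v: "v \<in> V" for v
  proof (rule Ck_cong[OF V k[OF v]])
    show "f' v x = dir_deriv f x v" if "x \<in> S" for x
      using dir_derivI[OF d[OF v that]] by simp
  qed
  moreover have "(\<lambda>t. f (x + t *\<^sub>R v)) differentiable at 0" if "v \<in> V" "x \<in> S" for v x
    using d[OF that] by (rule differentiableI_vector)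
  ultimately show ?thesis using c by simp
qed

lemma Cinf_cong:
  assumes "subspace V" "openin (top_of_set V) S" "Cinf_on V S f" "\<And>x. x \<in> S \<Longrightarrow> f x = g x"
  shows "Cinf_on V S g"
  using assms Ck_cong unfolding Cinf_on_def by blast

lemma continuous_within_openin:
  fixes V :: "'a::real_normed_vector set"
  assumes "openin (top_of_set V) T" "x \<in> T" "continuous (at x within T) f"
  shows "continuous (at x within V) f"
proof -
  obtain U where U: "open U" "T = V \<inter> U" using assms(1) by (metis openin_open)
  have "at x within T = at x within V"
    using U assms(2) at_within_nhd[of x U T V] by auto
  then show ?thesis using assms(3) by simp
qed

text \<open>At order 0, continuity within a relatively open \<open>T\<close> at a point is
  continuity within \<open>V\<close>, so it passes to \<open>S\<close>; higher orders follow by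
  induction applied to each directional derivative.\<close>

lemma Ck_local:
  assumes V: "subspace V" and "openin (top_of_set V) S"
    and "\<And>x. x \<in> S \<Longrightarrow> \<exists>T. openin (top_of_set V) T \<and> x \<in> T \<and> Ck_on k V T f"
  shows "Ck_on k V S f"
  using assms(3)
proof (induction k arbitrary: f)
  case 0
  show ?case
    unfolding Ck_on.simps continuous_on_eq_continuous_within
  proof
    fix x assume x: "x \<in> S"
    then obtain T where T: "openin (top_of_set V) T" "x \<in> T" "continuous_on T f"
      using 0 by auto
    then have "continuous (at x within T) f" by (simp add: continuous_on_eq_continuous_within)
    then have "continuous (at x within V) f"
      using continuous_within_openin[OF T(1,2)] by blast
    then show "continuous (at x within S) f"
      using continuous_within_subset openin_imp_subset[OF assms(2)] by metis
  qed
next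
  case (Suc k)
  have c: "Ck_on k V S f"
  proof (rule Suc.IH)
    show "\<exists>T. openin (top_of_set V) T \<and> x \<in> T \<and> Ck_on k V T f" if "x \<in> S" for x
      using Suc.prems[OF that] Ck_pred by metis
  qed
  have "Ck_on k V S (\<lambda>x. dir_deriv f x v)" if v: "v \<in> V" for v
  proof (rule Suc.IH)
    show "\<exists>T. openin (top_of_set V) T \<and> x \<in> T \<and> Ck_on k V T (\<lambda>x. dir_deriv f x v)" if "x \<in> S" for x
      using Suc.prems[OF that] v unfolding Ck_on.simps by metis
  qed
  moreover have "(\<lambda>t. f (x + t *\<^sub>R v)) differentiable at 0" if "v \<in> V" "x \<in> S" for v x
    using Suc.prems[OF that(2)] that(1) unfolding Ck_on.simps by metis
  ultimately show ?case using Ck_continuous[OF c] by simp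
qed

lemma Cinf_local:
  assumes "subspace V" "openin (top_of_set V) S"
    and "\<And>x. x \<in> S \<Longrightarrow> \<exists>T. openin (top_of_set V) T \<and> x \<in> T \<and> Cinf_on V T f"
  shows "Cinf_on V S f"
  unfolding Cinf_on_def
proof (intro allI Ck_local[OF assms(1,2)])
  show "\<exists>T. openin (top_of_set V) T \<and> x \<in> T \<and> Ck_on k V T f" if "x \<in> S" for x k
    using assms(3)[OF that] Cinf_Ck by metis
qed

lemma Ck_const: "subspace V \<Longrightarrow> openin (top_of_set V) S \<Longrightarrow> Ck_on k V S (\<lambda>_. c)"
proof (induction k arbitrary: c)
  case (Suc k)
  show ?case
    by (rule Ck_SucI[where f' = "\<lambda>_ _. 0"]) (use Suc in \<open>auto intro!: derivative_eq_intros\<close>)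
qed simp

lemma Ck_add:
  assumes V: "subspace V" "openin (top_of_set V) S"
  shows "Ck_on k V S f \<Longrightarrow> Ck_on k V S g \<Longrightarrow> Ck_on k V S (\<lambda>x. f x + g x)"
proof (induction k arbitrary: f g)
  case (Suc k)
  show ?case
    by (rule Ck_SucI[OF V, where f' = "\<lambda>v x. dir_deriv f x v + dir_deriv g x v"])
      (use Suc in \<open>auto intro!: continuous_on_add has_vector_derivative_add Ck_deriv[OF Suc.prems(1)] Ck_deriv[OF Suc.prems(2)]\<close>)
qed (auto intro: continuous_on_add)

lemma Ck_scaleR:
  assumes V: "subspace V" "openin (top_of_set V) S"
  shows "Ck_on k V S f \<Longrightarrow> Ck_on k V S g \<Longrightarrow> Ck_on k V S (\<lambda>x. f x *\<^sub>R g x)"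
proof (induction k arbitrary: f g)
  case (Suc k)
  have fr: "((\<lambda>t. f (x + t *\<^sub>R v)) has_field_derivative dir_deriv f x v) (at 0)" if "v \<in> V" "x \<in> S" for x v
    using Ck_deriv[OF Suc.prems(1) that(2,1)] by (simp add: has_real_derivative_iff_has_vector_derivative)
  have "((\<lambda>t. f (x + t *\<^sub>R v) *\<^sub>R g (x + t *\<^sub>R v)) has_vector_derivative
      f x *\<^sub>R dir_deriv g x v + dir_deriv f x v *\<^sub>R g x) (at 0)" if "v \<in> V" "x \<in> S" for x v
    using has_vector_derivative_scaleR[OF fr[OF that] Ck_deriv[OF Suc.prems(2) that(2,1)]] by simp
  moreover have "Ck_on k V S (\<lambda>x. f x *\<^sub>R dir_deriv g x v + dir_deriv f x v *\<^sub>R g x)" if "v \<in> V" for v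
    by (intro Ck_add[OF V] Suc.IH) (use Suc.prems Ck_pred that in auto)
  moreover have "continuous_on S (\<lambda>x. f x *\<^sub>R g x)"
    using Suc.prems by (auto intro!: continuous_on_scaleR)
  ultimately show ?case
    by (intro Ck_SucI[OF V, where f' = "\<lambda>v x. f x *\<^sub>R dir_deriv g x v + dir_deriv f x v *\<^sub>R g x"])
qed (auto intro!: continuous_on_scaleR)

lemma Ck_sum:
  assumes V: "subspace V" "openin (top_of_set V) S" and "\<And>i. i \<in> I \<Longrightarrow> Ck_on k V S (f i)"
  shows "Ck_on k V S (\<lambda>x. \<Sum>i\<in>I. f i x)"
  using assms(3)
  by (induction I rule: infinite_finite_induct) (auto intro!: Ck_const[OF V] Ck_add[OF V])

lemma Cinf_const: "subspace V \<Longrightarrow> openin (top_of_set V) S \<Longrightarrow> Cinf_on V S (\<lambda>_. c)"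
  by (simp add: Cinf_on_def Ck_const)

lemma Cinf_add: "subspace V \<Longrightarrow> openin (top_of_set V) S \<Longrightarrow> Cinf_on V S f \<Longrightarrow> Cinf_on V S g
  \<Longrightarrow> Cinf_on V S (\<lambda>x. f x + g x)"
  by (simp add: Cinf_on_def Ck_add)

lemma Cinf_scaleR: "subspace V \<Longrightarrow> openin (top_of_set V) S \<Longrightarrow> Cinf_on V S f \<Longrightarrow> Cinf_on V S g
  \<Longrightarrow> Cinf_on V S (\<lambda>x. f x *\<^sub>R g x)"
  by (simp add: Cinf_on_def Ck_scaleR)

lemma Cinf_mult: "subspace V \<Longrightarrow> openin (top_of_set V) S \<Longrightarrow> Cinf_on V S f \<Longrightarrow> Cinf_on V S g
  \<Longrightarrow> Cinf_on V S (\<lambda>x. f x * g x :: real)"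
  using Cinf_scaleR[of V S f g] by simp

lemma Cinf_diff: "subspace V \<Longrightarrow> openin (top_of_set V) S \<Longrightarrow> Cinf_on V S f \<Longrightarrow> Cinf_on V S g
  \<Longrightarrow> Cinf_on V S (\<lambda>x. f x - g x)"
  using Cinf_add[of V S f "\<lambda>x. (-1) *\<^sub>R g x"] Cinf_scaleR[of V S "\<lambda>_. -1" g] Cinf_const[of V S "-1::real"] by simp

lemma Cinf_sum:
  assumes "subspace V" "openin (top_of_set V) S" "\<And>i. i \<in> I \<Longrightarrow> Cinf_on V S (f i)"
  shows "Cinf_on V S (\<lambda>x. \<Sum>i\<in>I. f i x)"
  using assms unfolding Cinf_on_def by (blast intro: Ck_sum)

lemma Cinf_prod:
  assumes V: "subspace V" "openin (top_of_set V) S" and "\<And>i. i \<in> I \<Longrightarrow> Cinf_on V S (f i)"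
  shows "Cinf_on V S (\<lambda>x. \<Prod>i\<in>I. f i x :: real)"
  using assms(3)
  by (induction I rule: infinite_finite_induct) (auto intro!: Cinf_const[OF V] Cinf_mult[OF V])

section \<open>Strict differentiability and the chain rule\<close>

lemma blin_on_continuous:
  assumes "blin_on V L" "subspace V" shows "continuous_on V L"
proof -
  obtain K where K: "K \<ge> 0" "\<And>x. x \<in> V \<Longrightarrow> norm (L x) \<le> K * norm x"
    using blin_on_bound[OF assms(1)] by blast
  have "K-lipschitz_on V L"
    by (rule lipschitz_onI)
      (use K blin_on_diff[OF assms] subspace_diff[OF assms(2)] in \<open>auto simp: dist_norm simp flip: blin_on_diff[OF assms]\<close>)
  then show ?thesis by (rule lipschitz_on_continuous_on)
qed

text \<open>In this form derivatives are computed with the rules for limits, and linear maps can be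
  pulled through the quotient.\<close>

lemma has_vector_derivative_quotient:
  "(c has_vector_derivative c') (at s) \<longleftrightarrow> ((\<lambda>h. (1 / h) *\<^sub>R (c (s + h) - c s)) \<longlongrightarrow> c') (at (0::real))"
proof -
  have eq: "norm (c (s + h) - c s - h *\<^sub>R c') / norm h = norm ((1 / h) *\<^sub>R (c (s + h) - c s) - c')" if "h \<noteq> 0" for h
  proof -
    have "(1 / h) *\<^sub>R (c (s + h) - c s) - c' = (1 / h) *\<^sub>R (c (s + h) - c s - h *\<^sub>R c')"
      using that by (simp add: scaleR_diff_right)
    then show ?thesis by simp
  qed
  have "(c has_vector_derivative c') (at s) \<longleftrightarrow>
      ((\<lambda>h. norm (c (s + h) - c s - h *\<^sub>R c') / norm h) \<longlongrightarrow> 0) (at 0)"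
    unfolding has_vector_derivative_def has_derivative_at by (simp add: bounded_linear_scaleR_left)
  also have "\<dots> \<longleftrightarrow> ((\<lambda>h. norm ((1 / h) *\<^sub>R (c (s + h) - c s) - c')) \<longlongrightarrow> 0) (at 0)"
    by (intro tendsto_cong) (use eq in \<open>auto simp: eventually_at_filter\<close>)
  also have "\<dots> \<longleftrightarrow> ((\<lambda>h. (1 / h) *\<^sub>R (c (s + h) - c s)) \<longlongrightarrow> c') (at 0)"
    by (simp only: tendsto_norm_zero_iff LIM_zero_iff)
  finally show ?thesis .
qed

text \<open>Closedness of \<open>V\<close> puts the limit \<open>c'\<close> of the difference
  quotients into \<open>V\<close>; continuity of \<open>L\<close> on \<open>V\<close> then carries
  the limit over.\<close>

lemma blin_on_has_vector_derivative:
  assumes L: "blin_on V L" and V: "subspace V" "closed V" and c: "(c has_vector_derivative c') (at s)"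
    and "d > 0" "\<And>t. \<bar>t - s\<bar> < d \<Longrightarrow> c t \<in> V"
  shows "c' \<in> V \<and> ((\<lambda>t. L (c t)) has_vector_derivative L c') (at s)"
proof -
  have lim: "((\<lambda>h. (1 / h) *\<^sub>R (c (s + h) - c s)) \<longlongrightarrow> c') (at 0)"
    using c by (simp add: has_vector_derivative_quotient)
  have inV: "c s \<in> V" "\<And>h. \<bar>h\<bar> < d \<Longrightarrow> c (s + h) \<in> V" using assms(5,6) by auto
  have ev: "\<forall>\<^sub>F h in at (0::real). \<bar>h\<bar> < d"
    using assms(5) by (auto simp: eventually_at intro!: exI[of _ d])
  have ev2: "\<forall>\<^sub>F h in at (0::real). (1 / h) *\<^sub>R (c (s + h) - c s) \<in> V"
    using ev by eventually_elim (auto intro!: subspace_scale[OF V(1)] subspace_diff[OF V(1)] inV)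
  have c'V: "c' \<in> V"
    using Lim_in_closed_set[OF V(2) ev2 _ lim] by simp
  have "continuous (at c' within V) L"
    using blin_on_continuous[OF L V(1)] c'V by (simp add: continuous_on_eq_continuous_within)
  then have "((\<lambda>h. L ((1 / h) *\<^sub>R (c (s + h) - c s))) \<longlongrightarrow> L c') (at 0)"
    using continuous_within_tendsto_compose[OF _ ev2 lim] by blast
  moreover have "\<forall>\<^sub>F h in at (0::real). L ((1 / h) *\<^sub>R (c (s + h) - c s)) = (1 / h) *\<^sub>R (L (c (s + h)) - L (c s))"
    using ev by eventually_elim
      (use inV in \<open>simp add: blin_onD(2)[OF L] blin_on_diff[OF L V(1)] subspace_diff[OF V(1)]\<close>)
  ultimately have lim2: "((\<lambda>h. (1 / h) *\<^sub>R (L (c (s + h)) - L (c s))) \<longlongrightarrow> L c') (at 0)"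
    by (rule Lim_transform_eventually)
  then have "((\<lambda>t. L (c t)) has_vector_derivative L c') (at s)"
    by (simp add: has_vector_derivative_quotient)
  then show ?thesis using c'V by blast
qed

lemma Ck_line_derivative:
  assumes "Ck_on (Suc k) V S f" "y + s *\<^sub>R a \<in> S" "a \<in> V"
  shows "((\<lambda>t. f (y + t *\<^sub>R a)) has_vector_derivative dir_deriv f (y + s *\<^sub>R a) a) (at s)"
  using Ck_deriv[OF assms] unfolding has_vector_derivative_quotient
  by (simp add: scaleR_add_left add.assoc)

text \<open>The mean value inequality for \<open>g s - s *\<^sub>R D\<close>. The closed segment
  allows \<open>c\<close> to have either sign.\<close>

lemma mean_value_segment:
  fixes g :: "real \<Rightarrow> 'a::real_normed_vector"
  assumes d: "\<And>s. s \<in> closed_segment 0 c \<Longrightarrow> (g has_vector_derivative g' s) (at s)"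
    and e: "\<And>s. s \<in> closed_segment 0 c \<Longrightarrow> norm (g' s - D) \<le> e"
  shows "norm (g c - g 0 - c *\<^sub>R D) \<le> e * \<bar>c\<bar>"
proof -
  have e0: "0 \<le> e" using e[of 0] norm_ge_zero order_trans by (metis ends_in_segment(1))
  have "norm ((g c - c *\<^sub>R D) - (g 0 - 0 *\<^sub>R D)) \<le> e * norm (c - 0)"
  proof (rule differentiable_bound[of "closed_segment 0 c" "\<lambda>s. g s - s *\<^sub>R D" "\<lambda>s h. h *\<^sub>R (g' s - D)"])
    fix s assume s: "s \<in> closed_segment 0 c"
    have "((\<lambda>s. g s - s *\<^sub>R D) has_vector_derivative g' s - D) (at s)"
      using d[OF s] by (auto intro!: derivative_eq_intros)
    then show "((\<lambda>s. g s - s *\<^sub>R D) has_derivative (\<lambda>h. h *\<^sub>R (g' s - D))) (at s within closed_segment 0 c)"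
      unfolding has_vector_derivative_def by (rule has_derivative_at_withinI)
    show "onorm (\<lambda>h. h *\<^sub>R (g' s - D)) \<le> e"
      by (rule onorm_bound) (use e[OF s] e0 in \<open>auto simp: mult.commute[of e] intro!: mult_left_mono\<close>)
  qed auto
  then show ?thesis by (simp add: algebra_simps)
qed

text \<open>Moving from \<open>y\<close> to \<open>x\<close> along one basis vector at a time turns
  continuity of the partial derivatives at \<open>x0\<close> into an estimate for all pairs near
  \<open>x0\<close>. The linear term is written in coordinates because linearity of
  \<open>dir_deriv f x0\<close> is itself deduced from this lemma.\<close>

lemma strict_differentiability:
  assumes fd: "fd_subspace V" and S: "openin (top_of_set V) S" and f: "Ck_on (Suc k) V S f"
    and x0: "x0 \<in> S" and "e > 0"
  shows "\<exists>d>0. V \<inter> ball x0 d \<subseteq> S \<and> (\<forall>x\<in>V \<inter> ball x0 d. \<forall>y\<in>V \<inter> ball x0 d.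
    norm (f x - f y - (\<Sum>b\<in>fbasis V. coord V b (x - y) *\<^sub>R dir_deriv f x0 b)) \<le> e * norm (x - y))"
proof -
  note B = fbasis[OF fd]
  have V: "subspace V" using fd fd_subspaceD by blast
  let ?B = "fbasis V"
  have "\<exists>K. \<forall>b. 0 \<le> K b \<and> (\<forall>x\<in>V. \<bar>coord V b x\<bar> \<le> K b * norm x)"
    using blin_on_coord[OF fd] unfolding blin_on_def real_norm_def by metis
  then obtain K where K: "\<And>b. 0 \<le> K b" "\<And>b x. x \<in> V \<Longrightarrow> \<bar>coord V b x\<bar> \<le> K b * norm x" by blast
  define KK where "KK = (\<Sum>b\<in>?B. K b)"
  have KK0: "0 \<le> KK" unfolding KK_def using K(1) by (auto intro: sum_nonneg)
  \<comment> \<open>The tolerance per unit of coordinate: the absolute coordinates of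
    \<open>x - y\<close> add up to at most \<open>KK\<close> times its norm.\<close>
  define e' where "e' = e / (KK + 1)"
  have e': "e' > 0" using assms(5) KK0 by (simp add: e'_def)
  obtain d0 where d0: "d0 > 0" "\<And>y. y \<in> V \<Longrightarrow> dist y x0 < d0 \<Longrightarrow> y \<in> S"
    using S x0 unfolding openin_sub_iff by blast
  have x0V: "x0 \<in> V" using S x0 openin_imp_subset by blast
  have "\<exists>d>0. \<forall>x\<in>S. dist x x0 < d \<longrightarrow> dist (dir_deriv f x b) (dir_deriv f x0 b) < e'" if "b \<in> ?B" for b
  proof -
    have "continuous_on S (\<lambda>x. dir_deriv f x b)"
      using f B(4) that Ck_continuous by (metis Ck_on.simps(2) subsetD)
    then show ?thesis using x0 e' unfolding continuous_on_iff by blast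
  qed
  then obtain dd where dd: "\<And>b. b \<in> ?B \<Longrightarrow> dd b > 0"
    "\<And>b x. b \<in> ?B \<Longrightarrow> x \<in> S \<Longrightarrow> dist x x0 < dd b \<Longrightarrow> dist (dir_deriv f x b) (dir_deriv f x0 b) < e'"
    by metis
  define d where "d = Min (insert d0 (dd ` ?B))"
  have d: "d > 0" "d \<le> d0" "\<And>b. b \<in> ?B \<Longrightarrow> d \<le> dd b"
    unfolding d_def using B(1) d0(1) dd(1) by auto
  \<comment> \<open>Every point of the broken path is within \<open>d\<close> of \<open>x0\<close>
    as soon as the distance of \<open>y\<close> plus the total length of the legs is.\<close>
  have tele: "norm (f (y + (\<Sum>b\<in>A. c b *\<^sub>R b)) - f y - (\<Sum>b\<in>A. c b *\<^sub>R dir_deriv f x0 b)) \<le> e' * (\<Sum>b\<in>A. \<bar>c b\<bar>)"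
    if "finite A" "A \<subseteq> ?B" "y \<in> V" "dist y x0 + (\<Sum>b\<in>A. \<bar>c b\<bar> * norm b) < d" for A y and c :: "'a \<Rightarrow> real"
    using that
  proof (induction A rule: finite_induct)
    case (insert a A)
    define z where "z = y + (\<Sum>b\<in>A. c b *\<^sub>R b)"
    have aB: "a \<in> ?B" and aV: "a \<in> V" using insert.prems B(4) by auto
    have zV: "z \<in> V" unfolding z_def using insert.prems B(4)
      by (intro subspace_add[OF V] subspace_sum[OF V] subspace_scale[OF V]) auto
    have "norm (\<Sum>b\<in>A. c b *\<^sub>R b) \<le> (\<Sum>b\<in>A. \<bar>c b\<bar> * norm b)"
      by (rule sum_norm_le) simp
    then have zd: "dist z x0 \<le> dist y x0 + (\<Sum>b\<in>A. \<bar>c b\<bar> * norm b)"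
      unfolding z_def dist_norm using norm_triangle_ineq[of "y - x0" "\<Sum>b\<in>A. c b *\<^sub>R b"] by (simp add: algebra_simps)
    have step: "norm (f (z + c a *\<^sub>R a) - f (z + 0 *\<^sub>R a) - c a *\<^sub>R dir_deriv f x0 a) \<le> e' * \<bar>c a\<bar>"
    proof (rule mean_value_segment)
      fix s assume "s \<in> closed_segment 0 (c a)"
      then have s: "\<bar>s\<bar> \<le> \<bar>c a\<bar>" by (auto simp: closed_segment_eq_real_ivl split: if_splits)
      have "dist (z + s *\<^sub>R a) x0 \<le> dist z x0 + \<bar>s\<bar> * norm a"
        unfolding dist_norm using norm_triangle_ineq[of "z - x0" "s *\<^sub>R a"] by (simp add: algebra_simps)
      also have "\<dots> \<le> dist z x0 + \<bar>c a\<bar> * norm a" using s by (simp add: mult_right_mono)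
      also have "\<dots> < d" using zd insert by (simp add: algebra_simps)
      finally have dz: "dist (z + s *\<^sub>R a) x0 < d" .
      then have zS: "z + s *\<^sub>R a \<in> S"
        using d0(2)[of "z + s *\<^sub>R a"] d(2) zV aV V by (simp add: subspace_add subspace_scale)
      show "((\<lambda>s. f (z + s *\<^sub>R a)) has_vector_derivative dir_deriv f (z + s *\<^sub>R a) a) (at s)"
        by (rule Ck_line_derivative[OF f zS aV])
      show "norm (dir_deriv f (z + s *\<^sub>R a) a - dir_deriv f x0 a) \<le> e'"
        using dd(2)[OF aB zS] dz d(3)[OF aB] by (simp add: dist_norm)
    qed
    have s0: "0 \<le> \<bar>c a\<bar> * norm a" by simp
    have IH: "norm (f z - f y - (\<Sum>b\<in>A. c b *\<^sub>R dir_deriv f x0 b)) \<le> e' * (\<Sum>b\<in>A. \<bar>c b\<bar>)"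
    proof -
      have "dist y x0 + (\<Sum>b\<in>A. \<bar>c b\<bar> * norm b) < d"
        using insert.prems(3) s0 unfolding sum.insert[OF insert.hyps] by linarith
      then show ?thesis unfolding z_def using insert.prems by (intro insert.IH) auto
    qed
    have "norm ((f (z + c a *\<^sub>R a) - f (z + 0 *\<^sub>R a) - c a *\<^sub>R dir_deriv f x0 a)
        + (f z - f y - (\<Sum>b\<in>A. c b *\<^sub>R dir_deriv f x0 b))) \<le> e' * \<bar>c a\<bar> + e' * (\<Sum>b\<in>A. \<bar>c b\<bar>)"
      by (rule norm_triangle_mono[OF step IH])
    moreover have "y + (\<Sum>b\<in>insert a A. c b *\<^sub>R b) = z + c a *\<^sub>R a"
      using insert.hyps by (simp add: z_def)
    moreover have "(f (z + c a *\<^sub>R a) - f (z + 0 *\<^sub>R a) - c a *\<^sub>R dir_deriv f x0 a)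
        + (f z - f y - (\<Sum>b\<in>A. c b *\<^sub>R dir_deriv f x0 b))
      = f (z + c a *\<^sub>R a) - f y - (\<Sum>b\<in>insert a A. c b *\<^sub>R dir_deriv f x0 b)"
      using insert.hyps by (simp add: algebra_simps)
    moreover have "e' * \<bar>c a\<bar> + e' * (\<Sum>b\<in>A. \<bar>c b\<bar>) = e' * (\<Sum>b\<in>insert a A. \<bar>c b\<bar>)"
      using insert.hyps by (simp add: distrib_left)
    ultimately show ?case by (simp only:)
  qed simp
  define N where "N = (\<Sum>b\<in>?B. K b * norm b)"
  have N0: "0 \<le> N" unfolding N_def using K(1) by (auto intro: sum_nonneg)
  \<comment> \<open>Chosen so that \<open>d1 + 2 * d1 * N = d\<close>: the start is within
    \<open>d1\<close> of \<open>x0\<close>, the two points are at most \<open>2 * d1\<close> apart,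
    and \<open>N\<close> bounds the total length of the legs relative to their distance.\<close>
  define d1 where "d1 = d / (1 + 2 * N)"
  have d1: "d1 > 0" "d1 \<le> d" "d1 + 2 * d1 * N = d"
  proof -
    show "d1 > 0" using d N0 by (simp add: d1_def)
    have "1 + 2 * N \<noteq> 0" using N0 by linarith
    then have "d1 * (1 + 2 * N) = d" unfolding d1_def times_divide_eq_left by (rule nonzero_mult_div_cancel_right)
    then show "d1 + 2 * d1 * N = d" by (simp add: algebra_simps)
    then show "d1 \<le> d" using \<open>d1 > 0\<close> N0 by (smt (verit) mult_nonneg_nonneg)
  qed
  have main: "norm (f x - f y - (\<Sum>b\<in>?B. coord V b (x - y) *\<^sub>R dir_deriv f x0 b)) \<le> e * norm (x - y)"
    if x: "x \<in> V \<inter> ball x0 d1" and y: "y \<in> V \<inter> ball x0 d1" for x y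
  proof -
    have xy: "x - y \<in> V" using x y V by (simp add: subspace_diff)
    have nxy: "norm (x - y) \<le> 2 * d1"
      using x y dist_triangle2[of x y x0] by (simp add: dist_norm norm_minus_commute)
    have "(\<Sum>b\<in>?B. \<bar>coord V b (x - y)\<bar> * norm b) \<le> (\<Sum>b\<in>?B. (K b * norm (x - y)) * norm b)"
      by (intro sum_mono mult_right_mono K(2)[OF xy]) auto
    also have "\<dots> = N * norm (x - y)" by (simp add: N_def sum_distrib_left algebra_simps)
    also have "\<dots> \<le> N * (2 * d1)" by (rule mult_left_mono[OF nxy N0])
    finally have bd: "dist y x0 + (\<Sum>b\<in>?B. \<bar>coord V b (x - y)\<bar> * norm b) < d"
      using y d1(3) by (simp add: dist_commute mult.commute mult.left_commute)
    have "norm (f (y + (x - y)) - f y - (\<Sum>b\<in>?B. coord V b (x - y) *\<^sub>R dir_deriv f x0 b))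
        \<le> e' * (\<Sum>b\<in>?B. \<bar>coord V b (x - y)\<bar>)"
      using tele[OF B(1) subset_refl _ bd] y coord_sum[OF fd xy] by auto
    also have "\<dots> \<le> e' * (\<Sum>b\<in>?B. K b * norm (x - y))"
      using e' by (intro mult_left_mono sum_mono K(2)[OF xy]) auto
    also have "\<dots> = e' * KK * norm (x - y)" by (simp add: KK_def sum_distrib_right)
    also have "\<dots> \<le> e * norm (x - y)"
    proof (rule mult_right_mono)
      have "e' * KK \<le> e' * (KK + 1)" using e' by simp
      also have "\<dots> = e" using KK0 by (simp add: e'_def)
      finally show "e' * KK \<le> e" .
    qed simp
    finally show ?thesis by simp
  qed
  have "V \<inter> ball x0 d1 \<subseteq> S" using d0(2) d1(2) d(2) by (auto simp: dist_commute)
  then show ?thesis using d1(1) main by blast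
qed

text \<open>Strict differentiability on the line through \<open>x0\<close> in direction
  \<open>v\<close>. This is the source of the linearity of the directional derivative in its
  direction.\<close>

lemma dir_deriv_expand:
  assumes fd: "fd_subspace V" and S: "openin (top_of_set V) S" and f: "Ck_on (Suc k) V S f"
    and x0: "x0 \<in> S" and v: "v \<in> V"
  shows "dir_deriv f x0 v = (\<Sum>b\<in>fbasis V. coord V b v *\<^sub>R dir_deriv f x0 b)"
proof -
  have V: "subspace V" using fd fd_subspaceD by blast
  have x0V: "x0 \<in> V" using S x0 openin_imp_subset by blast
  let ?L = "\<lambda>v. (\<Sum>b\<in>fbasis V. coord V b v *\<^sub>R dir_deriv f x0 b)"
  have "((\<lambda>h. (1 / h) *\<^sub>R (f (x0 + (0 + h) *\<^sub>R v) - f (x0 + 0 *\<^sub>R v))) \<longlongrightarrow> ?L v) (at 0)"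
    unfolding tendsto_iff
  proof (intro allI impI)
    fix e :: real assume e: "e > 0"
    define e1 where "e1 = e / (norm v + 1)"
    have nv: "norm v + 1 > 0" by (simp add: add_nonneg_pos)
    have e1: "e1 > 0" "e1 * norm v < e"
      using e nv by (auto simp: e1_def field_simps)
    obtain d where d: "d > 0" "\<And>x y. x \<in> V \<inter> ball x0 d \<Longrightarrow> y \<in> V \<inter> ball x0 d \<Longrightarrow>
        norm (f x - f y - ?L (x - y)) \<le> e1 * norm (x - y)"
      using strict_differentiability[OF fd S f x0 e1(1)] by blast
    show "\<forall>\<^sub>F h in at 0. dist ((1 / h) *\<^sub>R (f (x0 + (0 + h) *\<^sub>R v) - f (x0 + 0 *\<^sub>R v))) (?L v) < e"
      unfolding eventually_at
    proof (intro exI[of _ "d / (norm v + 1)"] conjI ballI impI)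
      show "0 < d / (norm v + 1)" using d nv by simp
      fix h :: real assume h: "h \<noteq> 0 \<and> dist h 0 < d / (norm v + 1)"
      then have "\<bar>h\<bar> * (norm v + 1) < d" using nv by (simp add: pos_less_divide_eq)
      then have "\<bar>h\<bar> * norm v < d" by (smt (verit) mult_left_mono)
      then have x: "x0 + h *\<^sub>R v \<in> V \<inter> ball x0 d"
        using x0V v V by (simp add: dist_norm subspace_add subspace_scale)
      have "norm (f (x0 + h *\<^sub>R v) - f x0 - ?L (h *\<^sub>R v)) \<le> e1 * norm (h *\<^sub>R v)"
        using d(2)[OF x, of x0] x0V d(1) by simp
      moreover have "?L (h *\<^sub>R v) = h *\<^sub>R ?L v"
        using blin_onD(2)[OF blin_on_coord[OF fd] v] by (simp add: scaleR_sum_right)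
      ultimately have "norm (f (x0 + h *\<^sub>R v) - f x0 - h *\<^sub>R ?L v) \<le> e1 * \<bar>h\<bar> * norm v"
        by (simp only: norm_scaleR mult.assoc)
      define X where "X = f (x0 + h *\<^sub>R v) - f x0 - h *\<^sub>R ?L v"
      have "norm X \<le> (e1 * norm v) * \<bar>h\<bar>"
        using \<open>norm (f (x0 + h *\<^sub>R v) - f x0 - h *\<^sub>R ?L v) \<le> e1 * \<bar>h\<bar> * norm v\<close> unfolding X_def by (simp only: mult_ac)
      then have "norm X / \<bar>h\<bar> \<le> e1 * norm v" using h by (subst pos_divide_le_eq) auto
      moreover have "(1 / h) *\<^sub>R (f (x0 + h *\<^sub>R v) - f x0) - ?L v = (1 / h) *\<^sub>R X"
        using h by (simp add: scaleR_diff_right X_def)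
      moreover have "norm ((1 / h) *\<^sub>R X) = norm X / \<bar>h\<bar>" by simp
      ultimately have "norm ((1 / h) *\<^sub>R (f (x0 + h *\<^sub>R v) - f x0) - ?L v) \<le> e1 * norm v" by (simp only:)
      then show "dist ((1 / h) *\<^sub>R (f (x0 + (0 + h) *\<^sub>R v) - f (x0 + 0 *\<^sub>R v))) (?L v) < e"
        using e1(2) by (simp add: dist_norm)
    qed
  qed
  then show ?thesis by (intro dir_derivI) (simp add: has_vector_derivative_quotient)
qed

lemma blin_on_dir_deriv:
  assumes "fd_subspace V" "openin (top_of_set V) S" "Ck_on (Suc k) V S f" "x \<in> S"
  shows "blin_on V (dir_deriv f x)"
proof (rule blin_onI[OF assms(1)])
  have V: "subspace V" using assms fd_subspaceD by blast
  note c = blin_onD[OF blin_on_coord[OF assms(1)]]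
  note e = dir_deriv_expand[OF assms]
  show "dir_deriv f x (u + v) = dir_deriv f x u + dir_deriv f x v" if "u \<in> V" "v \<in> V" for u v
    using that c(1)[OF that] by (simp add: e[of "u + v"] e[of u] e[of v] subspace_add[OF V] scaleR_add_left sum.distrib)
  show "dir_deriv f x (a *\<^sub>R v) = a *\<^sub>R dir_deriv f x v" if "v \<in> V" for a v
    using that c(2)[OF that] by (simp add: e[of "a *\<^sub>R v"] e[of v] subspace_scale[OF V] scaleR_sum_right)
qed

lemma strict_differentiability':
  assumes fd: "fd_subspace V" and S: "openin (top_of_set V) S" and f: "Ck_on (Suc k) V S f"
    and x0: "x0 \<in> S" and "e > 0"
  obtains d where "d > 0" "V \<inter> ball x0 d \<subseteq> S"
    "\<And>x y. x \<in> V \<inter> ball x0 d \<Longrightarrow> y \<in> V \<inter> ball x0 d \<Longrightarrow>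
      norm (f x - f y - dir_deriv f x0 (x - y)) \<le> e * norm (x - y)"
proof -
  obtain d where d: "d > 0" "V \<inter> ball x0 d \<subseteq> S"
    "\<And>x y. x \<in> V \<inter> ball x0 d \<Longrightarrow> y \<in> V \<inter> ball x0 d \<Longrightarrow>
      norm (f x - f y - (\<Sum>b\<in>fbasis V. coord V b (x - y) *\<^sub>R dir_deriv f x0 b)) \<le> e * norm (x - y)"
    using strict_differentiability[OF assms] by blast
  have V: "subspace V" using assms fd_subspaceD by blast
  show ?thesis
  proof (rule that[OF d(1,2)])
    fix x y assume xy: "x \<in> V \<inter> ball x0 d" "y \<in> V \<inter> ball x0 d"
    then have "x - y \<in> V" using V by (simp add: subspace_diff)
    then show "norm (f x - f y - dir_deriv f x0 (x - y)) \<le> e * norm (x - y)"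
      using d(3)[OF xy] dir_deriv_expand[OF fd S f x0] by metis
  qed
qed

text \<open>The curve need only be differentiable at the single time \<open>s\<close>. After
  subtraction of its linear part, \<open>f\<close> has arbitrarily small Lipschitz constants near
  \<open>c s\<close>, so the difference quotients along \<open>c\<close> tend to 0; the linear part
  is differentiated directly.\<close>

lemma Ck_curve:
  assumes fd: "fd_subspace V" and S: "openin (top_of_set V) S" and f: "Ck_on (Suc k) V S f"
    and c: "(c has_vector_derivative c') (at s)" and cs: "c s \<in> S" and d: "d > 0" "\<And>t. \<bar>t - s\<bar> < d \<Longrightarrow> c t \<in> V"
  shows "c' \<in> V \<and> ((\<lambda>t. f (c t)) has_vector_derivative dir_deriv f (c s) c') (at s)"
proof -
  have V: "subspace V" "closed V" using fd fd_subspaceD fd_subspace_closed by auto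
  let ?L = "dir_deriv f (c s)"
  have L: "blin_on V ?L" by (rule blin_on_dir_deriv[OF fd S f cs])
  have Lc: "c' \<in> V" "((\<lambda>t. ?L (c t)) has_vector_derivative ?L c') (at s)"
    using blin_on_has_vector_derivative[OF L V c d] by auto
  have cV: "c s \<in> V" using d by simp
  have limc: "((\<lambda>h. (1 / h) *\<^sub>R (c (s + h) - c s)) \<longlongrightarrow> c') (at 0)"
    using c by (simp add: has_vector_derivative_quotient)
  have contc: "((\<lambda>h. c (s + h)) \<longlongrightarrow> c s) (at 0)"
    using has_vector_derivative_continuous[OF c] by (simp add: continuous_at LIM_offset_zero_iff add.commute)
  have "((\<lambda>h. (1 / h) *\<^sub>R ((f (c (s + h)) - ?L (c (s + h))) - (f (c s) - ?L (c s)))) \<longlongrightarrow> 0) (at 0)"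
    unfolding tendsto_iff
  proof (intro allI impI)
    fix e :: real assume e: "e > 0"
    \<comment> \<open>The quotients of \<open>c\<close> are eventually bounded by
      \<open>norm c' + 1\<close>; the larger denominator makes the resulting bound strictly smaller
      than \<open>e\<close>.\<close>
    define e1 where "e1 = e / (norm c' + 2)"
    have nv: "norm c' + 2 > 0" by (simp add: add_nonneg_pos)
    have e1: "e1 > 0" "e1 * (norm c' + 1) < e" using e nv by (auto simp: e1_def field_simps)
    obtain \<delta> where \<delta>: "\<delta> > 0" "\<And>x y. x \<in> V \<inter> ball (c s) \<delta> \<Longrightarrow> y \<in> V \<inter> ball (c s) \<delta> \<Longrightarrow>
      norm (f x - f y - ?L (x - y)) \<le> e1 * norm (x - y)"
      using strict_differentiability'[OF fd S f cs e1(1)] by metis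
    have "\<forall>\<^sub>F h in at 0. dist (c (s + h)) (c s) < \<delta>" using contc \<delta>(1) by (simp add: tendsto_iff)
    moreover have "\<forall>\<^sub>F h in at 0. dist ((1 / h) *\<^sub>R (c (s + h) - c s)) c' < 1" using limc by (simp add: tendsto_iff)
    moreover have "\<forall>\<^sub>F h in at (0::real). \<bar>h\<bar> < d" using d(1) by (auto simp: eventually_at intro!: exI[of _ d])
    moreover have "\<forall>\<^sub>F h in at (0::real). h \<noteq> 0" by (simp add: eventually_at_filter)
    ultimately show "\<forall>\<^sub>F h in at 0. dist ((1 / h) *\<^sub>R ((f (c (s + h)) - ?L (c (s + h))) - (f (c s) - ?L (c s)))) 0 < e"
    proof eventually_elim
      case (elim h)
      have inV: "c (s + h) \<in> V" using elim d by simp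
      then have "norm (f (c (s + h)) - f (c s) - ?L (c (s + h) - c s)) \<le> e1 * norm (c (s + h) - c s)"
        using \<delta> cV elim by (intro \<delta>(2)) (auto simp: dist_commute)
      then have "norm ((f (c (s + h)) - ?L (c (s + h))) - (f (c s) - ?L (c s))) \<le> e1 * norm (c (s + h) - c s)"
        by (simp only: blin_on_diff[OF L V(1) inV cV]) (simp add: algebra_simps)
      then have "norm ((1 / h) *\<^sub>R ((f (c (s + h)) - ?L (c (s + h))) - (f (c s) - ?L (c s)))) \<le> e1 * norm ((1 / h) *\<^sub>R (c (s + h) - c s))"
        using elim by (simp add: divide_simps)
      also have "\<dots> \<le> e1 * (norm c' + 1)"
      proof (rule mult_left_mono)
        have "norm ((1 / h) *\<^sub>R (c (s + h) - c s)) \<le> norm c' + norm ((1 / h) *\<^sub>R (c (s + h) - c s) - c')"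
          by (rule norm_triangle_sub)
        then show "norm ((1 / h) *\<^sub>R (c (s + h) - c s)) \<le> norm c' + 1"
          using elim(2) by (simp add: dist_norm)
      qed (use e1 in simp)
      finally show ?case using e1(2) by simp
    qed
  qed
  then have "((\<lambda>t. f (c t) - ?L (c t)) has_vector_derivative 0) (at s)"
    by (simp add: has_vector_derivative_quotient)
  from has_vector_derivative_add[OF this Lc(2)] show ?thesis using Lc(1) by simp
qed

lemma Ck_blin:
  assumes V: "subspace V" "openin (top_of_set V) S" and W: "subspace W" "closed W" and L: "blin_on W L"
  shows "Ck_on k V S h \<Longrightarrow> (\<And>x. x \<in> S \<Longrightarrow> h x \<in> W) \<Longrightarrow> Ck_on k V S (\<lambda>x. L (h x))"
proof (induction k arbitrary: h)
  case 0
  then show ?case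
    using continuous_on_compose2[OF blin_on_continuous[OF L W(1)]] by (auto simp: image_subset_iff)
next
  case (Suc k)
  have d: "dir_deriv h x v \<in> W \<and> ((\<lambda>t. L (h (x + t *\<^sub>R v))) has_vector_derivative L (dir_deriv h x v)) (at 0)"
    if v: "v \<in> V" and x: "x \<in> S" for v x
  proof -
    obtain d where d: "d > 0" "\<And>t. \<bar>t\<bar> < d \<Longrightarrow> x + t *\<^sub>R v \<in> S" using openin_sub_line[OF V x v] by blast
    show ?thesis
      by (rule blin_on_has_vector_derivative[OF L W Ck_deriv[OF Suc.prems(1) x v] d(1)])
        (use d(2) Suc.prems(2) in auto)
  qed
  show ?case
  proof (rule Ck_SucI[OF V, where f' = "\<lambda>v x. L (dir_deriv h x v)"])
    show "continuous_on S (\<lambda>x. L (h x))"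
      using continuous_on_compose2[OF blin_on_continuous[OF L W(1)] Ck_continuous[OF Suc.prems(1)]] Suc.prems(2) by (auto simp: image_subset_iff)
    show "Ck_on k V S (\<lambda>x. L (dir_deriv h x v))" if "v \<in> V" for v
      by (rule Suc.IH) (use Suc.prems(1) d that in auto)
  qed (use d in blast)
qed

lemma dir_deriv_in_subspace:
  assumes V: "subspace V" "openin (top_of_set V) S" and W: "fd_subspace W"
    and h: "Ck_on (Suc k) V S h" "\<And>x. x \<in> S \<Longrightarrow> h x \<in> W" and "x \<in> S" "v \<in> V"
  shows "dir_deriv h x v \<in> W"
proof -
  obtain d where d: "d > 0" "\<And>t. \<bar>t\<bar> < d \<Longrightarrow> x + t *\<^sub>R v \<in> S" using openin_sub_line[OF V assms(6,7)] by blast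
  show ?thesis
    using blin_on_has_vector_derivative[OF blin_on_coord[OF W] fd_subspaceD[OF W] fd_subspace_closed[OF W]
        Ck_deriv[OF h(1) assms(6,7)] d(1)] d(2) h(2) by simp
qed

lemma Ck_compose_deriv:
  assumes V: "subspace V" "openin (top_of_set V) S" and W: "fd_subspace W" "openin (top_of_set W) T"
    and f: "Ck_on (Suc k) V S f" "\<And>x. x \<in> S \<Longrightarrow> f x \<in> T" and g: "Ck_on (Suc k) W T g" and x: "x \<in> S" and v: "v \<in> V"
  shows "((\<lambda>t. g (f (x + t *\<^sub>R v))) has_vector_derivative dir_deriv g (f x) (dir_deriv f x v)) (at 0)"
proof -
  obtain d where d: "d > 0" "\<And>t. \<bar>t\<bar> < d \<Longrightarrow> x + t *\<^sub>R v \<in> S" using openin_sub_line[OF V x v] by blast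
  have TW: "T \<subseteq> W" using W(2) openin_imp_subset by blast
  show ?thesis
    using Ck_curve[OF W g Ck_deriv[OF f(1) x v] _ d(1)] d(2) f(2) x TW by auto
qed

lemma dir_deriv_compose:
  assumes V: "subspace V" "openin (top_of_set V) S" and W: "fd_subspace W" "openin (top_of_set W) T"
    and f: "Ck_on (Suc k) V S f" "\<And>x. x \<in> S \<Longrightarrow> f x \<in> T" and g: "Ck_on (Suc k) W T g" and x: "x \<in> S" and v: "v \<in> V"
  shows "dir_deriv (\<lambda>x. g (f x)) x v = dir_deriv g (f x) (dir_deriv f x v)"
  by (rule dir_derivI) (rule Ck_compose_deriv[OF assms])

text \<open>The derivative of the composite is a sum over the basis of \<open>W\<close> of products
  of coordinates of the derivative of \<open>f\<close> with directional derivatives of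
  \<open>g\<close> along \<open>f\<close>. The latter are composites of lower order.\<close>

lemma Ck_compose:
  assumes V: "subspace V" "openin (top_of_set V) S" and W: "fd_subspace W" "openin (top_of_set W) T"
  shows "Ck_on k V S f \<Longrightarrow> (\<And>x. x \<in> S \<Longrightarrow> f x \<in> T) \<Longrightarrow> Ck_on k W T g \<Longrightarrow> Ck_on k V S (\<lambda>x. g (f x))"
proof (induction k arbitrary: f g)
  case 0
  then show ?case using continuous_on_compose2[of T g S f] by (auto simp: image_subset_iff)
next
  case (Suc k)
  have TW: "T \<subseteq> W" using W(2) openin_imp_subset by blast
  have fW: "f x \<in> W" if "x \<in> S" for x using Suc.prems(2) TW that by blast
  show ?case
  proof (rule Ck_SucI[OF V, where f' = "\<lambda>v x. \<Sum>b\<in>fbasis W. coord W b (dir_deriv f x v) *\<^sub>R dir_deriv g (f x) b"])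
    show "continuous_on S (\<lambda>x. g (f x))"
      using continuous_on_compose2[OF Ck_continuous[OF Suc.prems(3)] Ck_continuous[OF Suc.prems(1)]] Suc.prems(2)
      by (auto simp: image_subset_iff)
    fix v assume v: "v \<in> V"
    have dW: "dir_deriv f x v \<in> W" if "x \<in> S" for x
      by (rule dir_deriv_in_subspace[OF V W(1) Suc.prems(1) fW that v])
    show "((\<lambda>t. g (f (x + t *\<^sub>R v))) has_vector_derivative
        (\<Sum>b\<in>fbasis W. coord W b (dir_deriv f x v) *\<^sub>R dir_deriv g (f x) b)) (at 0)" if "x \<in> S" for x
      using Ck_compose_deriv[OF V W Suc.prems that v]
        dir_deriv_expand[OF W Suc.prems(3) Suc.prems(2)[OF that] dW[OF that]] by simp
    show "Ck_on k V S (\<lambda>x. \<Sum>b\<in>fbasis W. coord W b (dir_deriv f x v) *\<^sub>R dir_deriv g (f x) b)"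
    proof (intro Ck_sum[OF V] Ck_scaleR[OF V])
      fix b assume b: "b \<in> fbasis W"
      show "Ck_on k V S (\<lambda>x. coord W b (dir_deriv f x v))"
        by (rule Ck_blin[OF V fd_subspaceD[OF W(1)] fd_subspace_closed[OF W(1)] blin_on_coord[OF W(1)]])
          (use Suc.prems(1) v dW in auto)
      show "Ck_on k V S (\<lambda>x. dir_deriv g (f x) b)"
      proof (rule Suc.IH[of f "\<lambda>y. dir_deriv g y b"])
        show "Ck_on k V S f" using Ck_pred[OF Suc.prems(1)] .
        show "Ck_on k W T (\<lambda>y. dir_deriv g y b)" using Suc.prems(3) fbasis(4)[OF W(1)] b by auto
      qed (use Suc.prems(2) in auto)
    qed
  qed
qed

lemma Cinf_compose:
  assumes "subspace V" "openin (top_of_set V) S" "fd_subspace W" "openin (top_of_set W) T"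
    "Cinf_on V S f" "\<And>x. x \<in> S \<Longrightarrow> f x \<in> T" "Cinf_on W T g"
  shows "Cinf_on V S (\<lambda>x. g (f x))"
  unfolding Cinf_on_def
  by (rule allI) (rule Ck_compose[OF assms(1-4) Cinf_Ck[OF assms(5)] assms(6) Cinf_Ck[OF assms(7)]])

lemma Ck_id: "subspace V \<Longrightarrow> openin (top_of_set V) S \<Longrightarrow> Ck_on k V S (\<lambda>x. x)"
proof (cases k)
  case (Suc n)
  assume V: "subspace V" "openin (top_of_set V) S"
  show ?thesis unfolding Suc
    by (rule Ck_SucI[OF V, where f' = "\<lambda>v _. v"]) (auto intro!: derivative_eq_intros Ck_const[OF V] continuous_intros)
qed (simp add: continuous_on_id)

lemma Cinf_id: "subspace V \<Longrightarrow> openin (top_of_set V) S \<Longrightarrow> Cinf_on V S (\<lambda>x. x)"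
  by (simp add: Cinf_on_def Ck_id)

lemma Cinf_blin:
  assumes "subspace V" "openin (top_of_set V) S" "fd_subspace W" "blin_on W L"
    "Cinf_on V S h" "\<And>x. x \<in> S \<Longrightarrow> h x \<in> W"
  shows "Cinf_on V S (\<lambda>x. L (h x))"
  unfolding Cinf_on_def
  by (rule allI) (rule Ck_blin[OF assms(1,2) fd_subspaceD[OF assms(3)] fd_subspace_closed[OF assms(3)]
        assms(4) Cinf_Ck[OF assms(5)] assms(6)])

lemma Cinf_blin_id:
  assumes "fd_subspace V" "openin (top_of_set V) S" "blin_on V L"
  shows "Cinf_on V S L"
proof -
  have V: "subspace V" using assms fd_subspaceD by blast
  show ?thesis
    by (rule Cinf_blin[OF V assms(2,1,3) Cinf_id[OF V assms(2)]]) (use assms(2) openin_imp_subset in blast)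
qed

lemma dir_deriv_blin:
  assumes "fd_subspace V" "blin_on V L" "x \<in> V" "v \<in> V"
  shows "dir_deriv L x v = L v"
proof (rule dir_derivI)
  have V: "subspace V" using assms fd_subspaceD by blast
  have c: "((\<lambda>t. x + t *\<^sub>R v) has_vector_derivative v) (at 0)" by (auto intro!: derivative_eq_intros)
  show "((\<lambda>t. L (x + t *\<^sub>R v)) has_vector_derivative L v) (at 0)"
    using blin_on_has_vector_derivative[OF assms(2) V fd_subspace_closed[OF assms(1)] c, of 1] assms(3,4) V
    by (simp add: subspace_add subspace_scale)
qed

text \<open>Two nested mean value inequalities, the outer one in direction \<open>u\<close> and the
  inner one in direction \<open>v\<close>, compare the second difference with the mixed
  derivative.\<close>

lemma second_difference:
  assumes V: "subspace V" "openin (top_of_set V) S" and f: "Ck_on (Suc (Suc k)) V S f"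
    and x: "x \<in> S" and u: "u \<in> V" and v: "v \<in> V" and e: "e > 0"
  shows "\<exists>d>0. \<forall>h. 0 < h \<and> h < d \<longrightarrow> norm (f (x + h *\<^sub>R u + h *\<^sub>R v) - f (x + h *\<^sub>R u) - f (x + h *\<^sub>R v) + f x
    - (h * h) *\<^sub>R dir_deriv (\<lambda>x. dir_deriv f x u) x v) \<le> e * (h * h)"
proof -
  let ?fu = "\<lambda>x. dir_deriv f x u" and ?A = "dir_deriv (\<lambda>x. dir_deriv f x u) x v"
  have fu: "Ck_on (Suc k) V S ?fu" using f u by simp
  have "continuous_on S (\<lambda>x. dir_deriv ?fu x v)" using fu v Ck_continuous by (metis Ck_on.simps(2))
  then obtain d1 where d1: "d1 > 0" "\<And>y. y \<in> S \<Longrightarrow> dist y x < d1 \<Longrightarrow> dist (dir_deriv ?fu y v) ?A < e"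
    using x e unfolding continuous_on_iff by blast
  obtain d2 where d2: "d2 > 0" "\<And>y. y \<in> V \<Longrightarrow> dist y x < d2 \<Longrightarrow> y \<in> S"
    using V(2) x unfolding openin_sub_iff by blast
  have xV: "x \<in> V" using V(2) x openin_imp_subset by blast
  define N where "N = norm u + norm v + 1"
  have N: "N > 0" unfolding N_def by (simp add: add_nonneg_pos)
  define d where "d = min d1 d2 / N"
  have d: "d > 0" using d1 d2 N by (simp add: d_def)
  have near: "x + s *\<^sub>R u + t *\<^sub>R v \<in> S \<and> dist (x + s *\<^sub>R u + t *\<^sub>R v) x < d1" if "\<bar>s\<bar> \<le> h" "\<bar>t\<bar> \<le> h" "h < d" for s t h
  proof -
    have "norm (s *\<^sub>R u + t *\<^sub>R v) \<le> \<bar>s\<bar> * norm u + \<bar>t\<bar> * norm v" by (metis norm_scaleR norm_triangle_ineq)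
    also have "\<dots> \<le> h * norm u + h * norm v" using that by (intro add_mono mult_right_mono) auto
    also have "\<dots> \<le> h * N" using that by (simp add: N_def algebra_simps)
    also have "\<dots> < d * N" using that N by simp
    also have "\<dots> = min d1 d2" using N by (simp add: d_def)
    finally have "dist (x + s *\<^sub>R u + t *\<^sub>R v) x < min d1 d2" by (simp add: dist_norm add.assoc)
    then show ?thesis using d2(2) xV u v V by (simp add: subspace_add subspace_scale)
  qed
  show ?thesis
  proof (intro exI conjI allI impI)
    show "d > 0" by fact
    fix h :: real assume h: "0 < h \<and> h < d"
    let ?F = "\<lambda>s. f ((x + h *\<^sub>R v) + s *\<^sub>R u) - f (x + s *\<^sub>R u)"
    have "norm (?F h - ?F 0 - h *\<^sub>R (h *\<^sub>R ?A)) \<le> (e * h) * \<bar>h\<bar>"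
    proof (rule mean_value_segment)
      fix s assume s: "s \<in> closed_segment 0 h"
      then have sh: "\<bar>s\<bar> \<le> h" using h by (auto simp: closed_segment_eq_real_ivl)
      have in1: "x + h *\<^sub>R v + s *\<^sub>R u \<in> S" "x + s *\<^sub>R u \<in> S"
        using near[of s h h] near[of s h 0] sh h by (auto simp: algebra_simps)
      show "(?F has_vector_derivative ?fu ((x + h *\<^sub>R v) + s *\<^sub>R u) - ?fu (x + s *\<^sub>R u)) (at s)"
        by (intro has_vector_derivative_diff Ck_line_derivative[OF f _ u] in1)
      have "norm (?fu ((x + s *\<^sub>R u) + h *\<^sub>R v) - ?fu ((x + s *\<^sub>R u) + 0 *\<^sub>R v) - h *\<^sub>R ?A) \<le> e * \<bar>h\<bar>"
      proof (rule mean_value_segment)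
        fix t assume "t \<in> closed_segment 0 h"
        then have th: "\<bar>t\<bar> \<le> h" using h by (auto simp: closed_segment_eq_real_ivl)
        have n: "x + s *\<^sub>R u + t *\<^sub>R v \<in> S" "dist (x + s *\<^sub>R u + t *\<^sub>R v) x < d1" using near[OF sh th] h by auto
        show "((\<lambda>t. ?fu ((x + s *\<^sub>R u) + t *\<^sub>R v)) has_vector_derivative dir_deriv ?fu ((x + s *\<^sub>R u) + t *\<^sub>R v) v) (at t)"
          by (rule Ck_line_derivative[OF fu n(1) v])
        show "norm (dir_deriv ?fu ((x + s *\<^sub>R u) + t *\<^sub>R v) v - ?A) \<le> e"
          using d1(2)[OF n] by (simp add: dist_norm)
      qed
      then show "norm (?fu ((x + h *\<^sub>R v) + s *\<^sub>R u) - ?fu (x + s *\<^sub>R u) - h *\<^sub>R ?A) \<le> e * h"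
        using h by (simp add: algebra_simps)
    qed
    then show "norm (f (x + h *\<^sub>R u + h *\<^sub>R v) - f (x + h *\<^sub>R u) - f (x + h *\<^sub>R v) + f x - (h * h) *\<^sub>R ?A) \<le> e * (h * h)"
      using h by (simp add: algebra_simps)
  qed
qed

text \<open>The second difference is symmetric in \<open>u\<close> and \<open>v\<close>, so it
  approximates both mixed derivatives. Errors of a quarter of their distance on either side would
  bound the distance by half of itself.\<close>

lemma dir_deriv_symmetric:
  assumes V: "subspace V" "openin (top_of_set V) S" and f: "Ck_on (Suc (Suc k)) V S f"
    and x: "x \<in> S" and u: "u \<in> V" and v: "v \<in> V"
  shows "dir_deriv (\<lambda>x. dir_deriv f x u) x v = dir_deriv (\<lambda>x. dir_deriv f x v) x u"
proof (rule ccontr)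
  let ?A = "dir_deriv (\<lambda>x. dir_deriv f x u) x v" and ?B = "dir_deriv (\<lambda>x. dir_deriv f x v) x u"
  assume "?A \<noteq> ?B"
  then have e: "norm (?A - ?B) / 4 > 0" by simp
  obtain d1 where d1: "d1 > 0" "\<And>h. 0 < h \<Longrightarrow> h < d1 \<Longrightarrow> norm (f (x + h *\<^sub>R u + h *\<^sub>R v) - f (x + h *\<^sub>R u) - f (x + h *\<^sub>R v) + f x
    - (h * h) *\<^sub>R ?A) \<le> norm (?A - ?B) / 4 * (h * h)"
    using second_difference[OF V f x u v e] by blast
  obtain d2 where d2: "d2 > 0" "\<And>h. 0 < h \<Longrightarrow> h < d2 \<Longrightarrow> norm (f (x + h *\<^sub>R v + h *\<^sub>R u) - f (x + h *\<^sub>R v) - f (x + h *\<^sub>R u) + f x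
    - (h * h) *\<^sub>R ?B) \<le> norm (?A - ?B) / 4 * (h * h)"
    using second_difference[OF V f x v u e] by blast
  define h where "h = min d1 d2 / 2"
  have h: "0 < h" "h < d1" "h < d2" using d1(1) d2(1) by (auto simp: h_def)
  have "norm ((f (x + h *\<^sub>R v + h *\<^sub>R u) - f (x + h *\<^sub>R v) - f (x + h *\<^sub>R u) + f x - (h * h) *\<^sub>R ?B)
     - (f (x + h *\<^sub>R u + h *\<^sub>R v) - f (x + h *\<^sub>R u) - f (x + h *\<^sub>R v) + f x - (h * h) *\<^sub>R ?A))
     \<le> norm (?A - ?B) / 4 * (h * h) + norm (?A - ?B) / 4 * (h * h)"
    by (rule order_trans[OF norm_triangle_ineq4 add_mono[OF d2(2)[OF h(1,3)] d1(2)[OF h(1,2)]]])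
  moreover have "(f (x + h *\<^sub>R v + h *\<^sub>R u) - f (x + h *\<^sub>R v) - f (x + h *\<^sub>R u) + f x - (h * h) *\<^sub>R ?B)
     - (f (x + h *\<^sub>R u + h *\<^sub>R v) - f (x + h *\<^sub>R u) - f (x + h *\<^sub>R v) + f x - (h * h) *\<^sub>R ?A) = (h * h) *\<^sub>R (?A - ?B)"
    by (simp add: algebra_simps)
  ultimately have "norm ((h * h) *\<^sub>R (?A - ?B)) \<le> norm (?A - ?B) / 4 * (h * h) + norm (?A - ?B) / 4 * (h * h)"
    by (simp only:)
  then have "(h * h) * norm (?A - ?B) \<le> (h * h) * (norm (?A - ?B) / 2)" by (simp del: scaleR_diff_right)
  then have "norm (?A - ?B) \<le> norm (?A - ?B) / 2" using h by (simp only: mult_le_cancel_left_pos mult_pos_pos)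
  then show False using e by simp
qed

section \<open>The inverse function theorem\<close>

text \<open>Solving \<open>L z = w\<close> is a fixed point problem for \<open>z - L z + w\<close>,
  a contraction with factor 1/2 of the complete space \<open>V\<close>.\<close>

lemma near_identity_bij:
  assumes fd: "fd_subspace V" and L: "blin_on V L" "\<And>v. v \<in> V \<Longrightarrow> L v \<in> V"
    and near: "\<And>v. v \<in> V \<Longrightarrow> norm (L v - v) \<le> norm v / 2"
  shows "\<And>v. v \<in> V \<Longrightarrow> norm v \<le> 2 * norm (L v)" and "bij_betw L V V"
proof -
  have V: "subspace V" using fd fd_subspaceD by blast
  show lb: "norm v \<le> 2 * norm (L v)" if "v \<in> V" for v
    using near[OF that] norm_triangle_sub[of v "L v"] by (simp add: norm_minus_commute)
  have "inj_on L V"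
  proof (rule inj_onI)
    fix x y assume xy: "x \<in> V" "y \<in> V" "L x = L y"
    then have "norm (x - y) \<le> 2 * norm (L x - L y)"
      using lb[of "x - y"] blin_on_diff[OF L(1) V] subspace_diff[OF V] by simp
    then show "x = y" using xy by simp
  qed
  moreover have "w \<in> L ` V" if w: "w \<in> V" for w
  proof -
    have "\<exists>!z. z \<in> V \<and> z - L z + w = z"
    proof (rule Banach_fix[of V "1/2" "\<lambda>z. z - L z + w"])
      show "complete V" by (rule fd_subspace_complete[OF fd])
      show "V \<noteq> {}" using w by blast
      show "(\<lambda>z. z - L z + w) ` V \<subseteq> V" using L(2) w V by (auto intro!: subspace_add subspace_diff)
      fix x y assume xy: "x \<in> V" "y \<in> V"
      then have "norm (L (x - y) - (x - y)) \<le> norm (x - y) / 2" by (intro near subspace_diff[OF V])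
      moreover have "(x - L x + w) - (y - L y + w) = - (L (x - y) - (x - y))"
        using blin_on_diff[OF L(1) V xy] by simp
      ultimately show "dist (x - L x + w) (y - L y + w) \<le> 1/2 * dist x y"
        unfolding dist_norm by (metis norm_minus_cancel mult.commute times_divide_eq_left mult_1)
    qed auto
    then obtain z where "z \<in> V" "L z = w" by auto
    then show ?thesis by blast
  qed
  ultimately show "bij_betw L V V" using L(2) by (auto simp: bij_betw_def)
qed

text \<open>The inverse of a smooth family of operators close to the identity is smooth: its derivative
  in direction u is minus B (D_u A) B, which is polynomial in B, so that induction on the order of
  differentiability applies.\<close>

lemma smooth_inverse_family:
  fixes A B :: "'e::real_normed_vector \<Rightarrow> 'e \<Rightarrow> 'e"
  assumes fd: "fd_subspace V" and S: "openin (top_of_set V) S"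
    and L: "\<And>x. x \<in> S \<Longrightarrow> blin_on V (A x)" "\<And>x v. x \<in> S \<Longrightarrow> v \<in> V \<Longrightarrow> A x v \<in> V"
    and near: "\<And>x v. x \<in> S \<Longrightarrow> v \<in> V \<Longrightarrow> norm (A x v - v) \<le> norm v / 2"
    and smooth: "\<And>v. v \<in> V \<Longrightarrow> Cinf_on V S (\<lambda>x. A x v)"
    and B: "\<And>x. B x = inv_into V (A x)"
  shows "w \<in> V \<Longrightarrow> Cinf_on V S (\<lambda>x. B x w)"
proof -
  have V: "subspace V" using fd fd_subspaceD by blast
  have lb: "norm v \<le> 2 * norm (A x v)" if "x \<in> S" "v \<in> V" for x v
    using near_identity_bij(1)[OF fd L(1)[OF that(1)] L(2)[OF that(1)] near[OF that(1)] that(2)] .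
  have bij: "bij_betw (A x) V V" if "x \<in> S" for x
    using near_identity_bij(2)[OF fd L(1)[OF that] L(2)[OF that] near[OF that]] .
  have AB: "A x (B x w) = w" "B x w \<in> V" "B x (A x w) = w" if "x \<in> S" "w \<in> V" for x w
    using bij[OF that(1)] that(2) unfolding B bij_betw_def
    by (auto intro: f_inv_into_f inv_into_into inv_into_f_f)
  have Bn: "norm (B x w) \<le> 2 * norm w" if "x \<in> S" "w \<in> V" for x w
    using lb[OF that(1) AB(2)[OF that]] AB(1)[OF that] by simp
  have Bdiff: "B x w - B x w' = B x (w - w')" if "x \<in> S" "w \<in> V" "w' \<in> V" for x w w'
  proof -
    have "A x (B x w - B x w') = w - w'"
      using blin_on_diff[OF L(1)[OF that(1)] V] AB that by simp
    then show ?thesis using AB(3)[of x "B x w - B x w'"] AB(2) that V by (simp add: subspace_diff)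
  qed
  have Bblin: "blin_on V (B x)" if x: "x \<in> S" for x
  proof (rule blin_onI[OF fd])
    show "B x (u + v) = B x u + B x v" if "u \<in> V" "v \<in> V" for u v
    proof -
      have "A x (B x u + B x v) = u + v"
        using blin_onD(1)[OF L(1)[OF x]] AB x that by simp
      then show ?thesis using AB(3)[of x "B x u + B x v"] AB(2) x that V by (simp add: subspace_add)
    qed
    show "B x (a *\<^sub>R v) = a *\<^sub>R B x v" if "v \<in> V" for a v
    proof -
      have "A x (a *\<^sub>R B x v) = a *\<^sub>R v"
        using blin_onD(2)[OF L(1)[OF x]] AB x that by simp
      then show ?thesis using AB(3)[of x "a *\<^sub>R B x v"] AB(2) x that V by (simp add: subspace_scale)
    qed
  qed
  \<comment> \<open>With \<open>v = B x w\<close> the difference of the inverses is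
    \<open>B x' w - v = B x' (w - A x' v)\<close>, and the operators \<open>B x'\<close> are bounded
    by 2.\<close>
  have cont: "continuous_on S (\<lambda>x. B x w)" if w: "w \<in> V" for w
    unfolding continuous_on_eq_continuous_within continuous_within
  proof
    fix x assume x: "x \<in> S"
    let ?v = "B x w"
    have v: "?v \<in> V" using AB x w by blast
    have "((\<lambda>x'. A x' ?v) \<longlongrightarrow> A x ?v) (at x within S)"
      using Ck_continuous[OF Cinf_Ck[OF smooth[OF v], of 0]] x
      by (simp add: continuous_on_eq_continuous_within continuous_within)
    then have "((\<lambda>x'. 2 * norm (A x ?v - A x' ?v)) \<longlongrightarrow> 2 * norm (A x ?v - A x ?v)) (at x within S)"
      by (intro tendsto_intros)
    then have z: "((\<lambda>x'. 2 * norm (A x ?v - A x' ?v)) \<longlongrightarrow> 0) (at x within S)" by simp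
    have "\<forall>\<^sub>F x' in at x within S. norm (B x' w - ?v) \<le> 2 * norm (A x ?v - A x' ?v)"
      unfolding eventually_at_filter
    proof (intro always_eventually allI impI)
      fix x' assume x': "x' \<in> S"
      have "B x' w - ?v = B x' (w - A x' ?v)"
        using AB(3)[OF x' v] Bdiff[OF x' w, of "A x' ?v"] L(2)[OF x' v] by simp
      then show "norm (B x' w - ?v) \<le> 2 * norm (A x ?v - A x' ?v)"
        using Bn[OF x', of "w - A x' ?v"] L(2)[OF x' v] w AB(1)[OF x w] V by (simp add: subspace_diff)
    qed
    then have "((\<lambda>x'. B x' w - ?v) \<longlongrightarrow> 0) (at x within S)"
      by (rule Lim_null_comparison[OF _ z])
    then show "((\<lambda>x'. B x' w) \<longlongrightarrow> ?v) (at x within S)" by (simp add: LIM_zero_iff)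
  qed
  have deriv: "((\<lambda>t. B (x + t *\<^sub>R u) w) has_vector_derivative - B x (dir_deriv (\<lambda>x'. A x' (B x w)) x u)) (at 0)"
    if w: "w \<in> V" and u: "u \<in> V" and x: "x \<in> S" for w u x
  proof -
    let ?v = "B x w" and ?z = "dir_deriv (\<lambda>x'. A x' (B x w)) x u"
    have v: "?v \<in> V" using AB x w by blast
    obtain d where d: "d > 0" "\<And>t. \<bar>t\<bar> < d \<Longrightarrow> x + t *\<^sub>R u \<in> S" using openin_sub_line[OF V S x u] by blast
    have ev: "\<forall>\<^sub>F h in at (0::real). \<bar>h\<bar> < d \<and> h \<noteq> 0" using d(1) by (auto simp: eventually_at intro!: exI[of _ d])
    have lim1: "((\<lambda>h. (1 / h) *\<^sub>R (A (x + h *\<^sub>R u) ?v - A x ?v)) \<longlongrightarrow> ?z) (at 0)"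
      using Ck_deriv[OF Cinf_Ck[OF smooth[OF v], of "Suc 0"] x u] by (simp add: has_vector_derivative_quotient)
    have zV: "?z \<in> V"
      by (rule dir_deriv_in_subspace[OF V S fd Cinf_Ck[OF smooth[OF v], of "Suc 0"] _ x u]) (use L v in blast)
    have "((\<lambda>h. x + h *\<^sub>R u) \<longlongrightarrow> x + 0 *\<^sub>R u) (at (0::real))" by (intro tendsto_intros)
    then have "((\<lambda>h. x + h *\<^sub>R u) \<longlongrightarrow> x) (at (0::real))" by simp
    then have limB: "((\<lambda>h. B (x + h *\<^sub>R u) ?z) \<longlongrightarrow> B x ?z) (at 0)"
      using continuous_on_tendsto_compose[OF cont[OF zV] _ x, of "\<lambda>h. x + h *\<^sub>R u" "at (0::real)"]
        eventually_mono[OF ev] d(2) by fastforce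
    let ?q = "\<lambda>h. (1 / h) *\<^sub>R (A (x + h *\<^sub>R u) ?v - A x ?v)"
    have "((\<lambda>h. 2 * norm (?q h - ?z)) \<longlongrightarrow> 2 * norm (?z - ?z)) (at 0)"
      by (intro tendsto_intros lim1)
    then have z0: "((\<lambda>h. 2 * norm (?q h - ?z)) \<longlongrightarrow> 0) (at 0)" by simp
    have "\<forall>\<^sub>F h in at 0. norm ((1 / h) *\<^sub>R (B (x + h *\<^sub>R u) w - B x w) + B (x + h *\<^sub>R u) ?z) \<le> 2 * norm (?q h - ?z)"
      using ev
    proof eventually_elim
      case (elim h)
      let ?x = "x + h *\<^sub>R u"
      have xS: "?x \<in> S" using d(2) elim by blast
      have AV: "A ?x ?v \<in> V" "A x ?v \<in> V" using L(2) xS x v by auto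
      have qV: "?q h \<in> V" using AV V by (simp add: subspace_diff subspace_scale)
      have "(1 / h) *\<^sub>R (B ?x w - B x w) = (1 / h) *\<^sub>R (B ?x (A x ?v) - B ?x (A ?x ?v))"
        using AB(3)[OF xS v] AB(1)[OF x w] by simp
      also have "\<dots> = (1 / h) *\<^sub>R B ?x (A x ?v - A ?x ?v)" using Bdiff[OF xS AV(2,1)] by simp
      also have "\<dots> = (1 / h) *\<^sub>R B ?x ((-1) *\<^sub>R (A ?x ?v - A x ?v))" by simp
      also have "\<dots> = - ((1 / h) *\<^sub>R B ?x (A ?x ?v - A x ?v))"
        using blin_onD(2)[OF Bblin[OF xS] subspace_diff[OF V AV], of "-1"] by simp
      also have "\<dots> = - B ?x (?q h)"
        using blin_onD(2)[OF Bblin[OF xS] subspace_diff[OF V AV], of "1 / h"] by simp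
      finally have "(1 / h) *\<^sub>R (B ?x w - B x w) + B ?x ?z = - B ?x (?q h - ?z)"
        by (simp flip: Bdiff[OF xS qV zV])
      then show ?case using Bn[OF xS subspace_diff[OF V qV zV]] by simp
    qed
    then have "((\<lambda>h. (1 / h) *\<^sub>R (B (x + h *\<^sub>R u) w - B x w) + B (x + h *\<^sub>R u) ?z) \<longlongrightarrow> 0) (at 0)"
      by (rule Lim_null_comparison[OF _ z0])
    from tendsto_diff[OF this limB]
    have "((\<lambda>h. (1 / h) *\<^sub>R (B (x + h *\<^sub>R u) w - B x w)) \<longlongrightarrow> - B x ?z) (at 0)" by simp
    then show ?thesis by (simp add: has_vector_derivative_quotient)
  qed
  have "\<forall>w\<in>V. Ck_on k V S (\<lambda>x. B x w)" for k
  proof (induction k)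
    case 0
    then show ?case using cont by simp
  next
    case (Suc k)
    show ?case
    proof
      fix w assume w: "w \<in> V"
      \<comment> \<open>The derivative formula expanded in the basis. It involves \<open>B\<close>
        only at vectors that do not vary with the point, which is what the induction hypothesis
        covers.\<close>
      let ?f' = "\<lambda>u x. (-1) *\<^sub>R (\<Sum>b\<in>fbasis V. coord V b (B x w) *\<^sub>R
          (\<Sum>b'\<in>fbasis V. coord V b' (dir_deriv (\<lambda>x'. A x' b) x u) *\<^sub>R B x b'))"
      note BV = fbasis(4)[OF fd]
      have zV: "dir_deriv (\<lambda>x'. A x' b) x u \<in> V" if "x \<in> S" "u \<in> V" "b \<in> V" for x u b
        by (rule dir_deriv_in_subspace[OF V S fd Cinf_Ck[OF smooth[OF that(3)], of "Suc 0"] _ that(1,2)])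
           (use L that in blast)
      show "Ck_on (Suc k) V S (\<lambda>x. B x w)"
      proof (rule Ck_SucI[OF V S cont[OF w], where f' = ?f'])
        fix u x assume u: "u \<in> V" and x: "x \<in> S"
        let ?v = "B x w"
        have v: "?v \<in> V" using AB x w by blast
        have "dir_deriv (\<lambda>x'. A x' ?v) x u = (\<Sum>b\<in>fbasis V. coord V b ?v *\<^sub>R dir_deriv (\<lambda>x'. A x' b) x u)"
        proof (rule dir_derivI)
          have "((\<lambda>t. \<Sum>b\<in>fbasis V. coord V b ?v *\<^sub>R A (x + t *\<^sub>R u) b) has_vector_derivative
              (\<Sum>b\<in>fbasis V. coord V b ?v *\<^sub>R dir_deriv (\<lambda>x'. A x' b) x u)) (at 0)"
          proof (rule has_vector_derivative_sum)
            fix b assume "b \<in> fbasis V"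
            then have "b \<in> V" using BV by blast
            from Ck_deriv[OF Cinf_Ck[OF smooth[OF this], of "Suc 0"] x u]
            show "((\<lambda>t. coord V b ?v *\<^sub>R A (x + t *\<^sub>R u) b) has_vector_derivative coord V b ?v *\<^sub>R dir_deriv (\<lambda>x'. A x' b) x u) (at 0)"
              by (auto intro!: derivative_eq_intros)
          qed
          then show "((\<lambda>t. A (x + t *\<^sub>R u) ?v) has_vector_derivative
              (\<Sum>b\<in>fbasis V. coord V b ?v *\<^sub>R dir_deriv (\<lambda>x'. A x' b) x u)) (at 0)"
            by (rule line_deriv_cong[OF V S x u, rotated]) (use blin_on_expand[OF fd L(1) v] in simp)
        qed
        then have "B x (dir_deriv (\<lambda>x'. A x' ?v) x u) = B x (\<Sum>b\<in>fbasis V. coord V b ?v *\<^sub>R dir_deriv (\<lambda>x'. A x' b) x u)"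
          by simp
        also have "\<dots> = (\<Sum>b\<in>fbasis V. B x (coord V b ?v *\<^sub>R dir_deriv (\<lambda>x'. A x' b) x u))"
          by (rule blin_on_sum[OF Bblin[OF x] V]) (use zV[OF x u] BV V in \<open>auto intro: subspace_scale\<close>)
        also have "\<dots> = (\<Sum>b\<in>fbasis V. coord V b ?v *\<^sub>R B x (dir_deriv (\<lambda>x'. A x' b) x u))"
          using zV[OF x u] BV by (intro sum.cong refl blin_onD(2)[OF Bblin[OF x]]) auto
        also have "\<dots> = (\<Sum>b\<in>fbasis V. coord V b ?v *\<^sub>R
            (\<Sum>b'\<in>fbasis V. coord V b' (dir_deriv (\<lambda>x'. A x' b) x u) *\<^sub>R B x b'))"
          using zV[OF x u] BV by (intro sum.cong refl arg_cong2[where f = scaleR] blin_on_expand[OF fd Bblin[OF x]]) auto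
        finally show "((\<lambda>t. B (x + t *\<^sub>R u) w) has_vector_derivative ?f' u x) (at 0)"
          using deriv[OF w u x] by simp
      next
        fix u assume u: "u \<in> V"
        show "Ck_on k V S (?f' u)"
        proof (intro Ck_scaleR[OF V S] Ck_const[OF V S] Ck_sum[OF V S])
          fix b assume b: "b \<in> fbasis V"
          show "Ck_on k V S (\<lambda>x. coord V b (B x w))"
            by (rule Ck_blin[OF V S V fd_subspace_closed[OF fd] blin_on_coord[OF fd]]) (use Suc w AB in auto)
          fix b' assume b': "b' \<in> fbasis V"
          show "Ck_on k V S (\<lambda>x. B x b')" using Suc b' BV by blast
          show "Ck_on k V S (\<lambda>x. coord V b' (dir_deriv (\<lambda>x'. A x' b) x u))"
            by (rule Ck_blin[OF V S V fd_subspace_closed[OF fd] blin_on_coord[OF fd] Cinf_Ck[OF Cinf_dir_deriv[OF smooth u]]])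
              (use zV b BV u in auto)
        qed
      qed
    qed
  qed
  then show "w \<in> V \<Longrightarrow> Cinf_on V S (\<lambda>x. B x w)" unfolding Cinf_on_def by blast
qed

text \<open>A derivative equal to the identity at \<open>x0\<close> is the case that occurs, both
  for the coordinates that straighten a submersion and for the composite of slice and retraction.
  Points near \<open>f x0\<close> are reached as fixed points of \<open>x - f x + y\<close>.\<close>

lemma inverse_function:
  fixes f :: "'e::real_normed_vector \<Rightarrow> 'e"
  assumes fd: "fd_subspace V" and S: "openin (top_of_set V) S" and f: "Cinf_on V S f" "\<And>x. x \<in> S \<Longrightarrow> f x \<in> V"
    and x0: "x0 \<in> S" and id: "\<And>v. v \<in> V \<Longrightarrow> dir_deriv f x0 v = v"
  obtains S' T' g where "openin (top_of_set V) S'" "S' \<subseteq> S" "x0 \<in> S'" "openin (top_of_set V) T'" "f x0 \<in> T'"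
    "Cinf_on V T' g" "\<And>y. y \<in> T' \<Longrightarrow> g y \<in> S'" "\<And>y. y \<in> T' \<Longrightarrow> f (g y) = y"
    "\<And>x. x \<in> S' \<Longrightarrow> f x \<in> T'" "\<And>x. x \<in> S' \<Longrightarrow> g (f x) = x"
proof -
  have V: "subspace V" using fd fd_subspaceD by blast
  have x0V: "x0 \<in> V" using x0 S openin_imp_subset by blast
  obtain d where d: "d > 0" "V \<inter> ball x0 d \<subseteq> S"
    "\<And>x y. x \<in> V \<inter> ball x0 d \<Longrightarrow> y \<in> V \<inter> ball x0 d \<Longrightarrow> norm (f x - f y - dir_deriv f x0 (x - y)) \<le> 1/2 * norm (x - y)"
    using strict_differentiability'[OF fd S Cinf_Ck[OF f(1), of "Suc 0"] x0, of "1/2"] by auto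
  define U where "U = V \<inter> ball x0 d"
  have UV: "U \<subseteq> V" "U \<subseteq> S" and Uo: "openin (top_of_set V) U" and x0U: "x0 \<in> U"
    using d x0V by (auto simp: U_def openin_open)
  have est: "norm (f x - f y - (x - y)) \<le> norm (x - y) / 2" if "x \<in> U" "y \<in> U" for x y
    using d(3)[of x y] that id[of "x - y"] V unfolding U_def by (simp add: subspace_diff)
  have lip: "norm (x - y) \<le> 2 * norm (f x - f y)" if "x \<in> U" "y \<in> U" for x y
    using est[OF that] norm_triangle_sub[of "x - y" "f x - f y"] by (simp add: norm_minus_commute)
  have inj: "inj_on f U" using lip by (intro inj_onI) fastforce
  \<comment> \<open>On the ball of radius \<open>d / 2\<close> the deviation of \<open>f\<close>
    from a translation is at most \<open>d / 4\<close>; another \<open>d / 4\<close> for the target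
    makes the contraction map that ball to itself.\<close>
  define T' where "T' = V \<inter> ball (f x0) (d / 4)"
  define S' where "S' = U \<inter> f -` T'"
  have T'o: "openin (top_of_set V) T'" by (auto simp: T'_def openin_open)
  have fx0: "f x0 \<in> T'" using d(1) f(2)[OF x0] by (simp add: T'_def)
  have "openin (top_of_set U) (U \<inter> f -` T')"
  proof (rule continuous_openin_preimage[of U f V])
    show "continuous_on U f" using continuous_on_subset[OF Ck_continuous[OF Cinf_Ck[OF f(1), of 0]] UV(2)] .
    show "f \<in> U \<rightarrow> V" using f(2) UV by auto
  qed (rule T'o)
  then have S'o: "openin (top_of_set V) S'" unfolding S'_def using Uo openin_trans by blast
  have surj: "\<exists>x\<in>U. f x = y" if y: "y \<in> T'" for y
  proof -
    let ?C = "V \<inter> cball x0 (d / 2)"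
    have CU: "?C \<subseteq> U" using d(1) by (auto simp: U_def)
    have "\<exists>!x. x \<in> ?C \<and> x - f x + y = x"
    proof (rule Banach_fix[of ?C "1/2" "\<lambda>x. x - f x + y"])
      show "complete ?C" using fd_subspace_compact_cball[OF fd] compact_imp_complete by blast
      show "?C \<noteq> {}" using x0V d(1) by (auto intro!: exI[of _ x0])
      show "(\<lambda>x. x - f x + y) ` ?C \<subseteq> ?C"
      proof (intro image_subsetI IntI)
        fix x assume x: "x \<in> ?C"
        then have xU: "x \<in> U" using CU by blast
        show "x - f x + y \<in> V" using x xU UV f(2) y V by (auto simp: T'_def intro!: subspace_add subspace_diff)
        have "norm (f x - f x0 - (x - x0)) \<le> d / 4"
          using est[OF xU x0U] x by (simp add: dist_norm norm_minus_commute)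
        moreover have "norm (y - f x0) < d / 4" using y by (simp add: T'_def dist_norm norm_minus_commute)
        ultimately have "norm ((y - f x0) - (f x - f x0 - (x - x0))) \<le> d / 2"
          using norm_triangle_ineq4[of "y - f x0" "f x - f x0 - (x - x0)"] by simp
        then show "x - f x + y \<in> cball x0 (d / 2)" by (simp add: dist_norm norm_minus_commute algebra_simps)
      qed
      fix x x' assume xx: "x \<in> ?C" "x' \<in> ?C"
      have "(x - f x + y) - (x' - f x' + y) = - (f x - f x' - (x - x'))" by simp
      then show "dist (x - f x + y) (x' - f x' + y) \<le> 1/2 * dist x x'"
        unfolding dist_norm using est[of x x'] xx CU by (metis norm_minus_cancel subsetD mult.commute times_divide_eq_left mult_1)
    qed auto
    then obtain x where "x \<in> ?C" "f x = y" by auto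
    then show ?thesis using CU by blast
  qed
  define g where "g = inv_into U f"
  have gU: "g y \<in> U" "f (g y) = y" if "y \<in> T'" for y
    using surj[OF that] unfolding g_def by (auto intro: inv_into_into f_inv_into_f)
  have gS: "g y \<in> S'" if "y \<in> T'" for y using gU[OF that] that by (simp add: S'_def)
  have gf: "g (f x) = x" if "x \<in> S'" for x using that inj by (simp add: S'_def g_def inv_into_f_f)
  have S'S: "S' \<subseteq> S" "S' \<subseteq> U" using UV by (auto simp: S'_def)
  define A where "A = dir_deriv f"
  define B where "B = (\<lambda>x. inv_into V (A x))"
  have L: "blin_on V (A x)" "v \<in> V \<Longrightarrow> A x v \<in> V" if "x \<in> S'" for x v
    unfolding A_def using that S'S f
    by (auto intro!: blin_on_dir_deriv[OF fd S Cinf_Ck[OF f(1), of "Suc 0"]] dir_deriv_in_subspace[OF V S fd Cinf_Ck[OF f(1), of "Suc 0"]])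
  \<comment> \<open>The estimate \<open>est\<close> holds for all pairs in \<open>U\<close>, so
    passing to the limit of difference quotients bounds the derivative at every point of
    \<open>S'\<close> and not only at \<open>x0\<close>.\<close>
  have near: "norm (A x v - v) \<le> norm v / 2" if x: "x \<in> S'" and v: "v \<in> V" for x v
  proof -
    have xU: "x \<in> U" using x S'S by blast
    obtain \<delta> where \<delta>: "\<delta> > 0" "\<And>t. \<bar>t\<bar> < \<delta> \<Longrightarrow> x + t *\<^sub>R v \<in> U" using openin_sub_line[OF V Uo xU v] by blast
    have "((\<lambda>h. (1 / h) *\<^sub>R (f (x + h *\<^sub>R v) - f x)) \<longlongrightarrow> A x v) (at 0)"
      using Ck_deriv[OF Cinf_Ck[OF f(1), of "Suc 0"] _ v, of x] xU UV by (auto simp: has_vector_derivative_quotient A_def)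
    then have "((\<lambda>h. norm ((1 / h) *\<^sub>R (f (x + h *\<^sub>R v) - f x) - v)) \<longlongrightarrow> norm (A x v - v)) (at 0)"
      by (intro tendsto_intros)
    moreover have "\<forall>\<^sub>F h in at (0::real). norm ((1 / h) *\<^sub>R (f (x + h *\<^sub>R v) - f x) - v) \<le> norm v / 2"
      unfolding eventually_at
    proof (intro exI[of _ \<delta>] conjI ballI impI)
      fix h :: real assume h: "h \<noteq> 0 \<and> dist h 0 < \<delta>"
      have e: "norm (f (x + h *\<^sub>R v) - f x - h *\<^sub>R v) \<le> norm v / 2 * \<bar>h\<bar>"
        using est[OF \<delta>(2) xU, of h] h by (simp add: mult.commute)
      have "(1 / h) *\<^sub>R (f (x + h *\<^sub>R v) - f x) - v = (1 / h) *\<^sub>R (f (x + h *\<^sub>R v) - f x - h *\<^sub>R v)"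
        using h by (simp add: scaleR_diff_right)
      then have "norm ((1 / h) *\<^sub>R (f (x + h *\<^sub>R v) - f x) - v) = norm (f (x + h *\<^sub>R v) - f x - h *\<^sub>R v) / \<bar>h\<bar>"
        by (simp only:) simp
      then show "norm ((1 / h) *\<^sub>R (f (x + h *\<^sub>R v) - f x) - v) \<le> norm v / 2"
        using e h by (simp only:) (subst pos_divide_le_eq, auto)
    qed (rule \<delta>)
    ultimately show ?thesis by (rule tendsto_upperbound) simp
  qed
  have smA: "Cinf_on V S' (\<lambda>x. A x v)" if "v \<in> V" for v
    unfolding A_def by (rule Cinf_subset[OF Cinf_dir_deriv[OF f(1) that] S'S(1)])
  have smB: "Cinf_on V S' (\<lambda>x. B x w)" if "w \<in> V" for w
    by (rule smooth_inverse_family[OF fd S'o L near smA, of B w]) (use that in \<open>simp_all add: B_def\<close>)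
  have AB: "A x (B x w) = w" "B x w \<in> V" if "x \<in> S'" "w \<in> V" for x w
    using near_identity_bij(2)[OF fd L(1)[OF that(1)] L(2)[OF that(1)] near[OF that(1)]] that(2)
    unfolding B_def bij_betw_def by (auto intro: f_inv_into_f inv_into_into)
  have lb: "norm v \<le> 2 * norm (A x v)" if "x \<in> S'" "v \<in> V" for x v
    using near_identity_bij(1)[OF fd L(1)[OF that(1)] L(2)[OF that(1)] near[OF that(1)] that(2)] .
  have glip: "norm (g y - g y') \<le> 2 * norm (y - y')" if "y \<in> T'" "y' \<in> T'" for y y'
    using lip[of "g y" "g y'"] gU that by simp
  have gcont: "continuous_on T' g"
  proof (rule lipschitz_on_continuous_on[of 2])
    show "2-lipschitz_on T' g" by (rule lipschitz_onI) (use glip in \<open>auto simp: dist_norm\<close>)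
  qed
  have gderiv: "((\<lambda>t. g (y + t *\<^sub>R w)) has_vector_derivative B (g y) w) (at 0)"
    if w: "w \<in> V" and y: "y \<in> T'" for w y
  proof -
    let ?x = "g y" and ?b = "B (g y) w"
    have xS: "?x \<in> S'" using gS y by blast
    have b: "?b \<in> V" "A ?x ?b = w" using AB xS w by auto
    obtain \<delta> where \<delta>: "\<delta> > 0" "\<And>t. \<bar>t\<bar> < \<delta> \<Longrightarrow> y + t *\<^sub>R w \<in> T'" using openin_sub_line[OF V T'o y w] by blast
    have "((\<lambda>h. (1 / h) *\<^sub>R (g (y + h *\<^sub>R w) - g y) - ?b) \<longlongrightarrow> 0) (at 0)"
      unfolding tendsto_iff
    proof (intro allI impI)
      fix e :: real assume e: "e > 0"
      \<comment> \<open>The factor 4 is the Lipschitz constant 2 of \<open>g\<close> times the bound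
        2 for the inverse operator.\<close>
      define e1 where "e1 = e / (4 * (norm w + 1))"
      have nw: "norm w + 1 > 0" by (simp add: add_nonneg_pos)
      have e1: "e1 > 0" using e nw by (simp add: e1_def)
      have e1w: "4 * (e1 * norm w) < e"
      proof -
        have "4 * (e1 * norm w) < 4 * (e1 * (norm w + 1))" using e1 by simp
        also have "\<dots> = e" using nw unfolding e1_def by (simp add: divide_simps)
        finally show ?thesis .
      qed
      obtain r where r: "r > 0" "\<And>a b. a \<in> V \<inter> ball ?x r \<Longrightarrow> b \<in> V \<inter> ball ?x r \<Longrightarrow>
          norm (f a - f b - A ?x (a - b)) \<le> e1 * norm (a - b)"
      proof (rule strict_differentiability'[OF fd S Cinf_Ck[OF f(1), of "Suc 0"] _ e1, of ?x])
        show "?x \<in> S" using xS S'S by blast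
      qed (use that in \<open>simp add: A_def\<close>)
      have "\<forall>\<^sub>F h in at (0::real). \<bar>h\<bar> < \<delta> \<and> h \<noteq> 0 \<and> \<bar>h\<bar> < r / (2 * (norm w + 1))"
        using \<delta>(1) r(1) nw by (auto simp: eventually_at intro!: exI[of _ "min \<delta> (r / (2 * (norm w + 1)))"])
      then show "\<forall>\<^sub>F h in at 0. dist ((1 / h) *\<^sub>R (g (y + h *\<^sub>R w) - g y) - ?b) 0 < e"
      proof eventually_elim
        case (elim h)
        let ?xh = "g (y + h *\<^sub>R w)"
        have yh: "y + h *\<^sub>R w \<in> T'" using \<delta> elim by blast
        have l: "norm (?xh - ?x) \<le> 2 * (\<bar>h\<bar> * norm w)" using glip[OF yh y] by simp
        have "\<bar>h\<bar> * norm w \<le> \<bar>h\<bar> * (norm w + 1)" by (simp add: mult_left_mono)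
        also have "\<dots> < r / 2" using elim nw by (simp add: field_simps)
        finally have lr: "norm (?xh - ?x) < r" using l by simp
        have xhV: "?xh \<in> V" "?x \<in> V" using gS[OF yh] xS S'S UV by auto
        have "norm (f ?xh - f ?x - A ?x (?xh - ?x)) \<le> e1 * norm (?xh - ?x)"
          by (rule r(2)) (use xhV lr r(1) in \<open>auto simp: dist_norm norm_minus_commute\<close>)
        then have 1: "norm (h *\<^sub>R w - A ?x (?xh - ?x)) \<le> e1 * (2 * (\<bar>h\<bar> * norm w))"
          using gU(2)[OF yh] gU(2)[OF y] order_trans[OF _ mult_left_mono[OF l, of e1]] e1 by simp
        have "A ?x (h *\<^sub>R ?b - (?xh - ?x)) = h *\<^sub>R w - A ?x (?xh - ?x)"
          using blin_on_diff[OF L(1)[OF xS] V, of "h *\<^sub>R ?b" "?xh - ?x"] blin_onD(2)[OF L(1)[OF xS] b(1)] b V xhV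
          by (simp add: subspace_diff subspace_scale)
        then have "norm (h *\<^sub>R ?b - (?xh - ?x)) \<le> 2 * (e1 * (2 * (\<bar>h\<bar> * norm w)))"
          using lb[OF xS, of "h *\<^sub>R ?b - (?xh - ?x)"] 1 b V xhV by (simp add: subspace_diff subspace_scale)
        then have 2: "norm (h *\<^sub>R ?b - (?xh - ?x)) \<le> (4 * (e1 * norm w)) * \<bar>h\<bar>" by (simp add: mult_ac)
        have "(1 / h) *\<^sub>R (?xh - ?x) - ?b = - ((1 / h) *\<^sub>R (h *\<^sub>R ?b - (?xh - ?x)))"
          using elim by (simp add: scaleR_diff_right)
        then have "norm ((1 / h) *\<^sub>R (?xh - ?x) - ?b) = norm (h *\<^sub>R ?b - (?xh - ?x)) / \<bar>h\<bar>"
          by (simp only:) simp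
        also have "\<dots> \<le> 4 * (e1 * norm w)"
          using 2 elim by (subst pos_divide_le_eq) auto
        finally show ?case using e1w by simp
      qed
    qed
    then show ?thesis by (simp add: has_vector_derivative_quotient LIM_zero_iff)
  qed
  \<comment> \<open>Bootstrapping: the derivative of \<open>g\<close> is the smooth operator family
    \<open>B\<close> composed with \<open>g\<close>, so it has the order of \<open>g\<close> and
    raises that order by one.\<close>
  have "Ck_on k V T' g" for k
  proof (induction k)
    case 0
    then show ?case using gcont by simp
  next
    case (Suc k)
    show ?case
      by (rule Ck_SucI[OF V T'o gcont gderiv]) (auto intro!: Ck_compose[OF V T'o fd S'o Suc gS Cinf_Ck[OF smB]])
  qed
  then have "Cinf_on V T' g" by (simp add: Cinf_on_def)
  moreover have "x0 \<in> S'" using x0U fx0 by (simp add: S'_def)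
  ultimately show ?thesis
    using that[OF S'o S'S(1) _ T'o fx0] gS gU gf by (auto simp: S'_def)
qed

section \<open>Bump functions\<close>

lemma fd_subspace_UNIV: "fd_subspace (UNIV :: 'a::euclidean_space set)"
  unfolding fd_subspace_def using span_Basis by (auto intro!: exI[of _ Basis])

lemma Ck_real_SucI:
  fixes f :: "real \<Rightarrow> real"
  assumes "open S" and f: "\<And>x. x \<in> S \<Longrightarrow> (f has_real_derivative f' x) (at x)" and f': "Ck_on k UNIV S f'"
  shows "Ck_on (Suc k) UNIV S f"
proof (rule Ck_SucI[where f' = "\<lambda>v x. v *\<^sub>R f' x"])
  show o: "openin (top_of_set UNIV) S" using assms(1) by simp
  show "continuous_on S f"
    using f by (intro continuous_at_imp_continuous_on) (auto intro: DERIV_isCont)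
  show "((\<lambda>t. f (x + t *\<^sub>R v)) has_vector_derivative v *\<^sub>R f' x) (at 0)" if "x \<in> S" for x v
  proof -
    have "((\<lambda>t. f (x + t * v)) has_real_derivative f' x * v) (at 0)"
      by (rule DERIV_chain'[of "\<lambda>t. x + t * v" v 0 _ f "f' x", simplified])
         (use f[OF that] in \<open>auto intro!: derivative_eq_intros\<close>)
    then show ?thesis by (simp add: has_real_derivative_iff_has_vector_derivative mult.commute)
  qed
  show "Ck_on k UNIV S (\<lambda>x. v *\<^sub>R f' x)" for v
    by (intro Ck_scaleR Ck_const f') (use o in auto)
qed simp

text \<open>The case \<open>n = 0\<close> is the classical flat function. The powers of
  \<open>inverse x\<close> make the family closed under differentiation up to linear combinations,
  so all orders are treated by one induction.\<close>

definition flat_exp :: "nat \<Rightarrow> real \<Rightarrow> real" where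
  "flat_exp n x = (if x > 0 then exp (- inverse x) * inverse x ^ n else 0)"

lemma flat_exp_tendsto: "(flat_exp n \<longlongrightarrow> 0) (at 0)"
proof -
  have "((\<lambda>y::real. y ^ n / exp y) \<longlongrightarrow> 0) at_top" by (rule tendsto_power_div_exp_0)
  then have "((\<lambda>x::real. inverse x ^ n / exp (inverse x)) \<longlongrightarrow> 0) (at_right 0)"
    by (rule filterlim_compose[OF _ filterlim_inverse_at_top_right])
  then have r: "(flat_exp n \<longlongrightarrow> 0) (at_right 0)"
    by (rule Lim_transform_eventually)
      (auto simp: eventually_at_filter flat_exp_def exp_minus divide_inverse mult.commute)
  have l: "(flat_exp n \<longlongrightarrow> 0) (at_left 0)"
    by (rule Lim_transform_eventually[OF tendsto_const]) (auto simp: eventually_at_filter flat_exp_def)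
  show ?thesis using l r by (simp add: filterlim_split_at)
qed

lemma flat_exp_deriv:
  "(flat_exp n has_real_derivative flat_exp (n + 2) x - of_nat n * flat_exp (n + 1) x) (at x)"
proof -
  consider "x > 0" | "x < 0" | "x = 0" by linarith
  then show ?thesis
  proof cases
    case 1
    have "((\<lambda>x. exp (- inverse x) * inverse x ^ n) has_real_derivative
        flat_exp (n + 2) x - of_nat n * flat_exp (n + 1) x) (at x)"
    proof (cases n)
      case 0
      show ?thesis using 1 unfolding 0 flat_exp_def
        by (auto intro!: derivative_eq_intros simp: power2_eq_square)
    next
      case (Suc m)
      show ?thesis using 1 unfolding Suc flat_exp_def
        by (auto intro!: derivative_eq_intros simp: algebra_simps power2_eq_square power_eq_if[of "inverse x" m])
    qed
    then show ?thesis
      by (rule has_field_derivative_transform_within_open[of _ _ _ "{0<..}"]) (use 1 in \<open>auto simp: flat_exp_def\<close>)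
  next
    case 2
    have "((\<lambda>x. 0) has_real_derivative flat_exp (n + 2) x - of_nat n * flat_exp (n + 1) x) (at x)"
      using 2 by (simp add: flat_exp_def)
    then show ?thesis
      by (rule has_field_derivative_transform_within_open[of _ _ _ "{..<0}"]) (use 2 in \<open>auto simp: flat_exp_def\<close>)
  next
    case 3
    have "((\<lambda>h. (flat_exp n (0 + h) - flat_exp n 0) / h) \<longlongrightarrow> 0) (at 0)"
      by (rule Lim_transform_eventually[OF flat_exp_tendsto[of "Suc n"]])
        (auto simp: eventually_at_filter flat_exp_def field_simps)
    then show ?thesis using 3 by (simp add: DERIV_def flat_exp_def)
  qed
qed

lemma Ck_flat_exp: "Ck_on k UNIV UNIV (flat_exp n)"
proof (induction k arbitrary: n)
  case 0
  show ?case using flat_exp_deriv[of n] by (auto intro!: continuous_at_imp_continuous_on DERIV_isCont)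
next
  case (Suc k)
  have "Ck_on k UNIV UNIV (\<lambda>x. flat_exp (n + 2) x + (- of_nat n) *\<^sub>R flat_exp (n + 1) x)"
    by (intro Ck_add Ck_scaleR Ck_const Suc) auto
  then show ?case
    by (intro Ck_real_SucI[OF _ flat_exp_deriv]) auto
qed

lemma Cinf_inverse: "Cinf_on UNIV (- {0}) (inverse :: real \<Rightarrow> real)"
proof -
  have o: "openin (top_of_set UNIV) (- {0::real})" by (simp add: open_Compl)
  have "Ck_on k UNIV (- {0}) (inverse :: real \<Rightarrow> real)" for k
  proof (induction k)
    case 0
    show ?case by (auto intro!: continuous_intros)
  next
    case (Suc k)
    have "Ck_on k UNIV (- {0::real}) (\<lambda>x. (-1) *\<^sub>R (inverse x *\<^sub>R inverse x))"
      by (rule Ck_scaleR[OF subspace_UNIV o Ck_const[OF subspace_UNIV o]])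
        (rule Ck_scaleR[OF subspace_UNIV o Suc Suc])
    then show ?case
      by (intro Ck_real_SucI[of _ _ "\<lambda>x. (-1) *\<^sub>R (inverse x *\<^sub>R inverse x)"])
        (auto intro!: derivative_eq_intros simp: power2_eq_square)
  qed
  then show ?thesis by (simp add: Cinf_on_def)
qed

text \<open>The usual quotient that makes a step out of flat functions; the denominator is positive
  because \<open>x\<close> and \<open>1 - x\<close> are never both nonpositive.\<close>

definition smooth_step :: "real \<Rightarrow> real" where
  "smooth_step x = flat_exp 0 x * inverse (flat_exp 0 x + flat_exp 0 (1 - x))"

lemma smooth_step: "x \<le> 0 \<Longrightarrow> smooth_step x = 0" "x \<ge> 1 \<Longrightarrow> smooth_step x = 1"
  by (auto simp: smooth_step_def flat_exp_def)

lemma Cinf_affine_real: "Cinf_on UNIV UNIV (\<lambda>x::real. a + b * x)"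
  by (intro Cinf_add Cinf_mult Cinf_const Cinf_id) auto

lemma Cinf_smooth_step: "Cinf_on UNIV UNIV smooth_step"
proof -
  have U: "subspace (UNIV::real set)" "openin (top_of_set UNIV) (UNIV::real set)"
    "fd_subspace (UNIV::real set)" "openin (top_of_set UNIV) (- {0::real})"
    by (auto simp: fd_subspace_UNIV open_Compl)
  have e: "Cinf_on UNIV UNIV (flat_exp 0)" by (simp add: Cinf_on_def Ck_flat_exp)
  have e1: "Cinf_on UNIV UNIV (\<lambda>x. flat_exp 0 (1 - x))"
    using Cinf_compose[OF U(1,2,3,2) Cinf_affine_real[of 1 "-1"] _ e] by simp
  have "flat_exp 0 x + flat_exp 0 (1 - x) \<noteq> 0" for x
    by (auto simp: flat_exp_def) (smt (verit) exp_gt_zero)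
  then have "Cinf_on UNIV UNIV (\<lambda>x. inverse (flat_exp 0 x + flat_exp 0 (1 - x)))"
    by (intro Cinf_compose[OF U(1,2,3,4) Cinf_add[OF U(1,2) e e1] _ Cinf_inverse]) auto
  from Cinf_mult[OF U(1,2) e this] show ?thesis unfolding smooth_step_def .
qed

definition cutoff :: "real \<Rightarrow> real" where
  "cutoff x = smooth_step (2 + 1 * x) * smooth_step (2 + (-1) * x)"

lemma cutoff: "\<bar>x\<bar> \<le> 1 \<Longrightarrow> cutoff x = 1" "2 \<le> \<bar>x\<bar> \<Longrightarrow> cutoff x = 0"
proof -
  show "cutoff x = 1" if "\<bar>x\<bar> \<le> 1"
    using that smooth_step(2)[of "2 + x"] smooth_step(2)[of "2 - x"] by (simp add: cutoff_def abs_le_iff)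
  show "cutoff x = 0" if "2 \<le> \<bar>x\<bar>"
    using that smooth_step(1)[of "2 + x"] smooth_step(1)[of "2 - x"] by (auto simp: cutoff_def abs_if split: if_splits)
qed

lemma Cinf_cutoff: "Cinf_on UNIV UNIV cutoff"
proof -
  have U: "subspace (UNIV::real set)" "openin (top_of_set UNIV) (UNIV::real set)" "fd_subspace (UNIV::real set)"
    by (auto simp: fd_subspace_UNIV)
  show ?thesis unfolding cutoff_def
    by (intro Cinf_mult[OF U(1,2)] Cinf_compose[OF U(1,2,3,2) Cinf_affine_real _ Cinf_smooth_step]) auto
qed

text \<open>A product of cutoffs in the coordinates, since a general norm is not smooth. The scale
  \<open>\<eta>\<close> is so small that the coordinate box outside which the product vanishes lies
  in the ball of radius \<open>r\<close>.\<close>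

lemma bump_function:
  fixes V :: "'a::real_normed_vector set"
  assumes fd: "fd_subspace V" and x0: "x0 \<in> V" and r: "r > 0"
  obtains \<beta> :: "'a \<Rightarrow> real" and \<delta> where "Cinf_on V V \<beta>" "\<delta> > 0" "\<And>x. x \<in> V \<Longrightarrow> dist x x0 < \<delta> \<Longrightarrow> \<beta> x = 1"
    "\<And>x. x \<in> V \<Longrightarrow> r \<le> dist x x0 \<Longrightarrow> \<beta> x = 0"
proof -
  note B = fbasis[OF fd]
  have V: "subspace V" using fd fd_subspaceD by blast
  have Vo: "openin (top_of_set V) V" by simp
  have U: "subspace (UNIV::real set)" "openin (top_of_set UNIV) (UNIV::real set)" "fd_subspace (UNIV::real set)"
    by (auto simp: fd_subspace_UNIV)
  have "\<exists>K. \<forall>b. 0 \<le> K b \<and> (\<forall>x\<in>V. \<bar>coord V b x\<bar> \<le> K b * norm x)"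
    using blin_on_coord[OF fd] unfolding blin_on_def real_norm_def by metis
  then obtain K where K: "\<And>b. 0 \<le> K b" "\<And>b x. x \<in> V \<Longrightarrow> \<bar>coord V b x\<bar> \<le> K b * norm x" by blast
  define \<eta> where "\<eta> = r / (2 * ((\<Sum>b\<in>fbasis V. norm b) + 1))"
  have N: "(\<Sum>b\<in>fbasis V. norm b) \<ge> 0" by (simp add: sum_nonneg)
  have \<eta>: "\<eta> > 0" using r N by (simp add: \<eta>_def)
  have \<eta>r: "2 * \<eta> * (\<Sum>b\<in>fbasis V. norm b) < r"
  proof -
    have "2 * \<eta> * (\<Sum>b\<in>fbasis V. norm b) < 2 * \<eta> * ((\<Sum>b\<in>fbasis V. norm b) + 1)" using \<eta> by simp
    also have "\<dots> = r" unfolding \<eta>_def using N by (simp add: divide_simps)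
    finally show ?thesis .
  qed
  define KK where "KK = (\<Sum>b\<in>fbasis V. K b) + 1"
  have KK: "KK > 0" "\<And>b. b \<in> fbasis V \<Longrightarrow> K b \<le> KK"
    unfolding KK_def
  proof -
    have "0 \<le> (\<Sum>b\<in>fbasis V. K b)" using K(1) by (simp add: sum_nonneg)
    then show "(\<Sum>b\<in>fbasis V. K b) + 1 > 0" by linarith
    show "K b \<le> (\<Sum>b\<in>fbasis V. K b) + 1" if "b \<in> fbasis V" for b
      using member_le_sum[OF that, of K] K(1) B(1) by simp
  qed
  define \<beta> where "\<beta> x = (\<Prod>b\<in>fbasis V. cutoff (coord V b (x - x0) * inverse \<eta>))" for x
  show ?thesis
  proof
    show "\<eta> / KK > 0" using \<eta> KK by simp
    show "Cinf_on V V \<beta>" unfolding \<beta>_def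
    proof (rule Cinf_prod[OF V Vo])
      fix b
      have "Cinf_on V V (\<lambda>x. coord V b (x - x0))"
        by (rule Cinf_blin[OF V Vo fd blin_on_coord[OF fd]])
          (auto intro!: Cinf_diff[OF V Vo] Cinf_id[OF V Vo] Cinf_const[OF V Vo] subspace_diff[OF V] x0)
      then have "Cinf_on V V (\<lambda>x. coord V b (x - x0) * inverse \<eta>)"
        by (rule Cinf_mult[OF V Vo _ Cinf_const[OF V Vo]])
      then show "Cinf_on V V (\<lambda>x. cutoff (coord V b (x - x0) * inverse \<eta>))"
        by (rule Cinf_compose[OF V Vo U(3,2) _ _ Cinf_cutoff]) simp
    qed
    fix x assume x: "x \<in> V"
    then have xx: "x - x0 \<in> V" using x0 V by (simp add: subspace_diff)
    show "\<beta> x = 1" if d: "dist x x0 < \<eta> / KK"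
      unfolding \<beta>_def
    proof (rule prod.neutral, intro ballI cutoff(1))
      fix b assume b: "b \<in> fbasis V"
      have "\<bar>coord V b (x - x0)\<bar> \<le> KK * norm (x - x0)"
        using K(2)[OF xx, of b] KK(2)[OF b] mult_right_mono[of "K b" KK "norm (x - x0)"] by simp
      also have "\<dots> \<le> \<eta>" using d KK(1) by (simp add: dist_norm pos_less_divide_eq mult.commute)
      finally show "\<bar>coord V b (x - x0) * inverse \<eta>\<bar> \<le> 1"
        using \<eta> by (simp add: abs_mult field_simps)
    qed
    show "\<beta> x = 0" if d: "r \<le> dist x x0"
    proof -
      have "\<exists>b\<in>fbasis V. 2 * \<eta> \<le> \<bar>coord V b (x - x0)\<bar>"
      proof (rule ccontr)
        assume "\<not> ?thesis"
        then have l: "\<bar>coord V b (x - x0)\<bar> \<le> 2 * \<eta>" if "b \<in> fbasis V" for b using that by force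
        have "norm (x - x0) = norm (\<Sum>b\<in>fbasis V. coord V b (x - x0) *\<^sub>R b)" using coord_sum[OF fd xx] by simp
        also have "\<dots> \<le> (\<Sum>b\<in>fbasis V. (2 * \<eta>) * norm b)"
          by (rule sum_norm_le) (auto intro!: mult_right_mono l)
        also have "\<dots> = 2 * \<eta> * (\<Sum>b\<in>fbasis V. norm b)" by (simp add: sum_distrib_left)
        finally show False using \<eta>r d by (simp add: dist_norm)
      qed
      then obtain b where b: "b \<in> fbasis V" "2 * \<eta> \<le> \<bar>coord V b (x - x0)\<bar>" by blast
      have "cutoff (coord V b (x - x0) * inverse \<eta>) = 0"
        by (rule cutoff(2)) (use b \<eta> in \<open>simp add: abs_mult field_simps\<close>)
      then show ?thesis unfolding \<beta>_def using b B(1) by (auto simp: prod_zero_iff)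
    qed
  qed
qed

text \<open>A dimension count: the images of the basis vectors together with a missed vector would
  be independent, but too many. It is applied to the derivative of an isometry.\<close>

lemma blin_on_inj_surj:
  assumes fd: "fd_subspace V" and L: "blin_on V L" "\<And>v. v \<in> V \<Longrightarrow> L v \<in> V"
    and inj: "\<And>v. v \<in> V \<Longrightarrow> L v = 0 \<Longrightarrow> v = 0"
  shows "L ` V = V"
proof (rule ccontr)
  note B = fbasis[OF fd]
  have V: "subspace V" using fd fd_subspaceD by blast
  assume "L ` V \<noteq> V"
  then obtain z where z: "z \<in> V" "z \<notin> L ` V" using L(2) by blast
  have subL: "subspace (L ` V)"
    unfolding subspace_def
  proof (intro conjI ballI allI)
    show "0 \<in> L ` V" using blin_on_zero[OF L(1) V] subspace_0[OF V] by (metis imageI)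
    show "x + y \<in> L ` V" if "x \<in> L ` V" "y \<in> L ` V" for x y
      using that blin_onD(1)[OF L(1)] subspace_add[OF V] by (metis (no_types, lifting) imageE imageI)
    show "c *\<^sub>R x \<in> L ` V" if "x \<in> L ` V" for c x
      using that blin_onD(2)[OF L(1)] subspace_scale[OF V] by (metis (no_types, lifting) imageE imageI)
  qed
  have injB: "inj_on L V"
  proof (rule inj_onI)
    fix x y assume "x \<in> V" "y \<in> V" "L x = L y"
    then show "x = y" using inj[of "x - y"] blin_on_diff[OF L(1) V] subspace_diff[OF V] by simp
  qed
  then have injB': "inj_on L (fbasis V)" using B(4) inj_on_subset by blast
  have "independent (L ` fbasis V)"
    unfolding dependent_finite[OF finite_imageI[OF B(1)]]
  proof clarify
    fix u b assume b: "b \<in> fbasis V" "u (L b) \<noteq> 0" and s: "(\<Sum>v\<in>L ` fbasis V. u v *\<^sub>R v) = 0"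
    have "0 = (\<Sum>b\<in>fbasis V. u (L b) *\<^sub>R L b)" using s by (simp add: sum.reindex[OF injB'])
    also have "\<dots> = (\<Sum>b\<in>fbasis V. L (u (L b) *\<^sub>R b))"
      using B(4) by (intro sum.cong refl blin_onD(2)[OF L(1), symmetric]) auto
    also have "\<dots> = L (\<Sum>b\<in>fbasis V. u (L b) *\<^sub>R b)"
      using B(4) V by (intro blin_on_sum[OF L(1) V, symmetric]) (auto intro: subspace_scale)
    finally have L0: "L (\<Sum>b\<in>fbasis V. u (L b) *\<^sub>R b) = 0" by simp
    have "(\<Sum>b\<in>fbasis V. u (L b) *\<^sub>R b) \<in> V"
      using B(4) by (intro subspace_sum[OF V] subspace_scale[OF V]) auto
    then have "(\<Sum>b\<in>fbasis V. u (L b) *\<^sub>R b) = 0" using L0 inj by simp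
    moreover have "\<not> (\<exists>u. (\<exists>v\<in>fbasis V. u v \<noteq> 0) \<and> (\<Sum>v\<in>fbasis V. u v *\<^sub>R v) = 0)"
      using B(2) dependent_finite[OF B(1)] by simp
    moreover have "\<exists>u. (\<exists>v\<in>fbasis V. u v \<noteq> 0) \<and> (\<Sum>v\<in>fbasis V. u v *\<^sub>R v) = 0"
      by (rule exI[of _ "\<lambda>b. u (L b)"]) (use calculation(1) b in blast)
    ultimately show False by simp
  qed
  moreover have sp: "span (L ` fbasis V) \<subseteq> L ` V" by (rule span_minimal[OF _ subL]) (use B(4) in blast)
  ultimately have ind: "independent (insert z (L ` fbasis V))"
    using z(2) by (intro independent_insertI) auto
  have "insert z (L ` fbasis V) \<subseteq> span (fbasis V)" using z(1) L(2) B by auto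
  from independent_span_bound[OF B(1) ind this]
  have "card (insert z (L ` fbasis V)) \<le> card (fbasis V)" by simp
  moreover have "z \<notin> L ` fbasis V" using z(2) B(4) by blast
  ultimately show False using B(1) card_image[OF injB'] by simp
qed

section \<open>Second derivatives of isometries\<close>

lemma unit_bound:
  assumes "blin_on V L" "subspace V" "\<And>u. u \<in> V \<Longrightarrow> norm u = 1 \<Longrightarrow> norm (L u) \<le> C" "u \<in> V"
  shows "norm (L u) \<le> C * norm u"
proof (cases "u = 0")
  case True
  then show ?thesis using blin_on_zero[OF assms(1,2)] by simp
next
  case False
  have "norm (L ((1 / norm u) *\<^sub>R u)) \<le> C"
    using assms False by (intro assms(3) subspace_scale) auto
  then have "norm (L u) / norm u \<le> C"
    using blin_onD(2)[OF assms(1,4), of "1 / norm u"] by simp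
  then show ?thesis using False by (simp add: pos_divide_le_eq)
qed

lemma continuous_compact_bounded:
  assumes "compact S" "continuous_on S (f :: _ \<Rightarrow> real)"
  obtains C where "C \<ge> 0" "\<And>x. x \<in> S \<Longrightarrow> \<bar>f x\<bar> \<le> C"
proof -
  obtain C where "C > 0" "\<And>y. y \<in> f ` S \<Longrightarrow> norm y \<le> C"
    using compact_imp_bounded[OF compact_continuous_image[OF assms(2,1)]] by (meson bounded_pos)
  then show ?thesis using that[of C] by fastforce
qed

text \<open>A Riemannian metric read in a chart: \<open>S\<close> is an open set of coordinates and
  \<open>G x\<close> the inner product at \<open>x\<close>.\<close>

locale local_metric =
  fixes V :: "'e::real_normed_vector set" and S :: "'e set" and G :: "'e \<Rightarrow> 'e \<Rightarrow> 'e \<Rightarrow> real"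
  assumes fd: "fd_subspace V" and S: "openin (top_of_set V) S"
    and sym: "\<And>x u v. x \<in> S \<Longrightarrow> u \<in> V \<Longrightarrow> v \<in> V \<Longrightarrow> G x u v = G x v u"
    and lin: "\<And>x u. x \<in> S \<Longrightarrow> u \<in> V \<Longrightarrow> blin_on V (G x u)"
    and pos: "\<And>x u. x \<in> S \<Longrightarrow> u \<in> V \<Longrightarrow> u \<noteq> 0 \<Longrightarrow> 0 < G x u u"
    and smooth: "\<And>u v. u \<in> V \<Longrightarrow> v \<in> V \<Longrightarrow> Cinf_on V S (\<lambda>x. G x u v)"
begin

lemma V: "subspace V" and VB: "b \<in> fbasis V \<Longrightarrow> b \<in> V" and SV: "S \<subseteq> V"
  using fd fd_subspaceD fbasis(4)[OF fd] openin_imp_subset[OF S] by auto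

lemma lin': "x \<in> S \<Longrightarrow> v \<in> V \<Longrightarrow> blin_on V (\<lambda>u. G x u v)"
  using lin[of x v] sym[of x _ v] V unfolding blin_on_def by (auto simp: subspace_add subspace_scale)

text \<open>Reduces \<open>G\<close> to finitely many smooth coefficient functions, through which
  continuity and derivatives with varying vectors are obtained.\<close>

lemma expand:
  assumes "x \<in> S" "u \<in> V" "v \<in> V"
  shows "G x u v = (\<Sum>b\<in>fbasis V. \<Sum>b'\<in>fbasis V. coord V b u * coord V b' v * G x b b')"
proof -
  have "G x u v = (\<Sum>b\<in>fbasis V. coord V b u *\<^sub>R G x b v)"
    by (rule blin_on_expand[OF fd lin'[OF assms(1,3)] assms(2)])
  also have "\<dots> = (\<Sum>b\<in>fbasis V. coord V b u *\<^sub>R (\<Sum>b'\<in>fbasis V. coord V b' v *\<^sub>R G x b b'))"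
    by (intro sum.cong refl arg_cong2[where f = scaleR] blin_on_expand[OF fd lin]) (use assms VB in auto)
  finally show ?thesis by (simp add: sum_distrib_left mult.assoc)
qed

definition DG :: "'e \<Rightarrow> 'e \<Rightarrow> 'e \<Rightarrow> 'e \<Rightarrow> real" where
  "DG x w u v = dir_deriv (\<lambda>x. G x u v) x w"

lemma G_line_deriv:
  assumes "x \<in> S" "w \<in> V" "u \<in> V" "v \<in> V"
  shows "((\<lambda>t. G (x + t *\<^sub>R w) u v) has_vector_derivative DG x w u v) (at 0)"
  unfolding DG_def by (rule Ck_deriv[OF Cinf_Ck[OF smooth[OF assms(3,4)]] assms(1,2)])

lemma DG_expand:
  assumes "x \<in> S" "w \<in> V" "u \<in> V" "v \<in> V"
  shows "DG x w u v = (\<Sum>b\<in>fbasis V. \<Sum>b'\<in>fbasis V. coord V b u * coord V b' v * DG x w b b')"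
  unfolding DG_def[of x w u v]
proof (rule dir_derivI)
  have "((\<lambda>t. \<Sum>b\<in>fbasis V. \<Sum>b'\<in>fbasis V. coord V b u * coord V b' v * G (x + t *\<^sub>R w) b b') has_vector_derivative
     (\<Sum>b\<in>fbasis V. \<Sum>b'\<in>fbasis V. coord V b u * coord V b' v * DG x w b b')) (at 0)"
    by (intro has_vector_derivative_sum has_vector_derivative_mult_right G_line_deriv assms VB)
  then show "((\<lambda>t. G (x + t *\<^sub>R w) u v) has_vector_derivative
     (\<Sum>b\<in>fbasis V. \<Sum>b'\<in>fbasis V. coord V b u * coord V b' v * DG x w b b')) (at 0)"
    by (rule line_deriv_cong[OF V S assms(1,2), rotated]) (use expand assms in simp)
qed

lemma DG_lin: 
  assumes "x \<in> S"
  shows "u \<in> V \<Longrightarrow> v \<in> V \<Longrightarrow> blin_on V (\<lambda>w. DG x w u v)"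
    and "w \<in> V \<Longrightarrow> v \<in> V \<Longrightarrow> blin_on V (\<lambda>u. DG x w u v)"
    and "w \<in> V \<Longrightarrow> u \<in> V \<Longrightarrow> blin_on V (\<lambda>v. DG x w u v)"
proof -
  note c = blin_onD[OF blin_on_coord[OF fd]]
  show "u \<in> V \<Longrightarrow> v \<in> V \<Longrightarrow> blin_on V (\<lambda>w. DG x w u v)"
    unfolding DG_def using blin_on_dir_deriv[OF fd S Cinf_Ck[OF smooth, of _ _ "Suc 0"] assms] .
  show "w \<in> V \<Longrightarrow> v \<in> V \<Longrightarrow> blin_on V (\<lambda>u. DG x w u v)"
  proof (rule blin_onI[OF fd])
    fix u u' a assume uv: "w \<in> V" "v \<in> V" "u \<in> V"
    show "DG x w (u + u') v = DG x w u v + DG x w u' v" if "u' \<in> V"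
      using uv that by (simp add: DG_expand[OF assms, of w] subspace_add[OF V] c(1) distrib_right sum.distrib)
    show "DG x w (a *\<^sub>R u) v = a *\<^sub>R DG x w u v"
      using uv by (simp add: DG_expand[OF assms, of w] subspace_scale[OF V] c(2) sum_distrib_left mult.assoc)
  qed
  show "w \<in> V \<Longrightarrow> u \<in> V \<Longrightarrow> blin_on V (\<lambda>v. DG x w u v)"
  proof (rule blin_onI[OF fd])
    fix v v' a assume uv: "w \<in> V" "u \<in> V" "v \<in> V"
    show "DG x w u (v + v') = DG x w u v + DG x w u v'" if "v' \<in> V"
      using uv that by (simp add: DG_expand[OF assms, of w] subspace_add[OF V] c(1) distrib_right distrib_left sum.distrib)
    show "DG x w u (a *\<^sub>R v) = a *\<^sub>R DG x w u v"
      using uv by (simp add: DG_expand[OF assms, of w] subspace_scale[OF V] c(2) sum_distrib_left mult.left_commute mult.assoc)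
  qed
qed

text \<open>The constants exist on a compact ball times unit spheres, by continuity and positivity;
  homogeneity extends them to all vectors.\<close>

lemma bounds:
  assumes x0: "x0 \<in> S"
  obtains \<rho> c C where "\<rho> > 0" "V \<inter> ball x0 \<rho> \<subseteq> S" "c > 0" "C \<ge> 0"
    "\<And>x u. x \<in> V \<inter> ball x0 \<rho> \<Longrightarrow> u \<in> V \<Longrightarrow> c * (norm u)\<^sup>2 \<le> G x u u"
    "\<And>x u. x \<in> V \<inter> ball x0 \<rho> \<Longrightarrow> u \<in> V \<Longrightarrow> G x u u \<le> C * (norm u)\<^sup>2"
    "\<And>x w u v. x \<in> V \<inter> ball x0 \<rho> \<Longrightarrow> w \<in> V \<Longrightarrow> u \<in> V \<Longrightarrow> v \<in> V \<Longrightarrow> \<bar>DG x w u v\<bar> \<le> C * (norm w * norm u * norm v)"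
proof -
  obtain e where e: "e > 0" "\<And>y. y \<in> V \<Longrightarrow> dist y x0 < e \<Longrightarrow> y \<in> S"
    using S x0 unfolding openin_sub_iff by blast
  define \<rho> where "\<rho> = e / 2"
  let ?K = "V \<inter> cball x0 \<rho>" and ?U = "V \<inter> sphere 0 1"
  have KS: "?K \<subseteq> S" using e by (auto simp: \<rho>_def dist_commute)
  have cK: "compact ?K" by (rule fd_subspace_compact_cball[OF fd])
  have "?U = (V \<inter> cball 0 1) \<inter> sphere 0 1" by auto
  moreover have "closed (sphere 0 1 :: 'e set)"
    unfolding sphere_def dist_norm by (intro closed_Collect_eq continuous_intros)
  ultimately have cU: "compact ?U"
    using compact_Int_closed[OF fd_subspace_compact[OF fd, of 1]] by simp
  have cc: "continuous_on V (coord V b)" for b by (rule blin_on_continuous[OF blin_on_coord[OF fd] V])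
  have cf: "continuous_on ?U (coord V b)" for b by (rule continuous_on_subset[OF cc]) auto
  have cG: "continuous_on ?K (\<lambda>x. G x b b')" if "b \<in> fbasis V" "b' \<in> fbasis V" for b b'
    by (rule continuous_on_subset[OF Ck_continuous[OF Cinf_Ck[OF smooth, of _ _ 0]] KS]) (use that VB in auto)
  have cDG: "continuous_on ?K (\<lambda>x. DG x d b b')" if "d \<in> fbasis V" "b \<in> fbasis V" "b' \<in> fbasis V" for d b b'
    unfolding DG_def
    by (rule continuous_on_subset[OF Ck_continuous[OF Cinf_Ck[OF Cinf_dir_deriv[OF smooth], of _ _ _ 0]] KS]) (use that VB in auto)
  have cGu: "continuous_on (?K \<times> ?U) (\<lambda>p. G (fst p) (snd p) (snd p))"
  proof -
    have "continuous_on (?K \<times> ?U) (\<lambda>p. \<Sum>b\<in>fbasis V. \<Sum>b'\<in>fbasis V. coord V b (snd p) * coord V b' (snd p) * G (fst p) b b')"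
      by (intro continuous_intros continuous_on_compose2[OF cf continuous_on_snd[OF continuous_on_id]]
          continuous_on_compose2[OF cG continuous_on_fst[OF continuous_on_id]]) auto
    then show ?thesis
      by (rule continuous_on_eq) (use KS expand in \<open>auto\<close>)
  qed
  have c3: "compact (?K \<times> ?U \<times> ?U \<times> ?U)" and c1: "compact (?K \<times> ?U)" using cK cU by (auto intro!: compact_Times)
  have cDGu: "continuous_on (?K \<times> ?U \<times> ?U \<times> ?U) (\<lambda>p. DG (fst p) (fst (snd p)) (fst (snd (snd p))) (snd (snd (snd p))))"
  proof -
    have "continuous_on (?K \<times> ?U \<times> ?U \<times> ?U) (\<lambda>p. \<Sum>b\<in>fbasis V. \<Sum>b'\<in>fbasis V. coord V b (fst (snd (snd p))) * coord V b' (snd (snd (snd p))) *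
        (\<Sum>d\<in>fbasis V. coord V d (fst (snd p)) * DG (fst p) d b b'))"
      by (intro continuous_intros continuous_on_compose2[OF cDG continuous_on_fst[OF continuous_on_id]]
          continuous_on_compose2[OF cf, of _ "\<lambda>p. fst (snd (snd p))"] continuous_on_compose2[OF cf, of _ "\<lambda>p. snd (snd (snd p))"]
          continuous_on_compose2[OF cf, of _ "\<lambda>p. fst (snd p)"]) auto
    then show ?thesis
    proof (rule continuous_on_eq)
      fix p assume "p \<in> ?K \<times> ?U \<times> ?U \<times> ?U"
      then obtain x w u v where p: "p = (x, w, u, v)" "x \<in> S" "w \<in> V" "u \<in> V" "v \<in> V" using KS by auto
      have "DG x w b b' = (\<Sum>d\<in>fbasis V. coord V d w * DG x d b b')" if "b \<in> fbasis V" "b' \<in> fbasis V" for b b'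
        using blin_on_expand[OF fd DG_lin(1)[OF p(2)] p(3)] that VB by simp
      then show "(\<Sum>b\<in>fbasis V. \<Sum>b'\<in>fbasis V. coord V b (fst (snd (snd p))) * coord V b' (snd (snd (snd p))) *
        (\<Sum>d\<in>fbasis V. coord V d (fst (snd p)) * DG (fst p) d b b')) = DG (fst p) (fst (snd p)) (fst (snd (snd p))) (snd (snd (snd p)))"
        using DG_expand[OF p(2-5)] p(1) by simp
    qed
  qed
  obtain C1 where C1: "C1 \<ge> 0" "\<And>p. p \<in> ?K \<times> ?U \<Longrightarrow> \<bar>G (fst p) (snd p) (snd p)\<bar> \<le> C1"
    using continuous_compact_bounded[OF c1 cGu] by blast
  obtain C2 where C2: "C2 \<ge> 0" "\<And>p. p \<in> ?K \<times> ?U \<times> ?U \<times> ?U \<Longrightarrow> \<bar>DG (fst p) (fst (snd p)) (fst (snd (snd p))) (snd (snd (snd p)))\<bar> \<le> C2"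
    using continuous_compact_bounded[OF c3 cDGu] by blast
  have "\<exists>c>0. \<forall>p\<in>?K \<times> ?U. c \<le> G (fst p) (snd p) (snd p)"
  proof (cases "?K \<times> ?U = {}")
    \<comment> \<open>This happens only in dimension 0, where there are no unit vectors and every
      constant serves.\<close>
    case True
    show ?thesis unfolding True by (intro exI[of _ 1]) simp
  next
    case False
    obtain p where p: "p \<in> ?K \<times> ?U" "\<forall>q\<in>?K \<times> ?U. G (fst p) (snd p) (snd p) \<le> G (fst q) (snd q) (snd q)"
      using continuous_attains_inf[OF c1 False cGu] by blast
    have "0 < G (fst p) (snd p) (snd p)" using p(1) KS by (intro pos) auto
    then show ?thesis using p(2) by blast
  qed
  then obtain c where c: "c > 0" "\<And>p. p \<in> ?K \<times> ?U \<Longrightarrow> c \<le> G (fst p) (snd p) (snd p)" by blast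
  have GS: "G x u u = (norm u)\<^sup>2 * G x ((1 / norm u) *\<^sub>R u) ((1 / norm u) *\<^sub>R u)" if "x \<in> S" "u \<in> V" "u \<noteq> 0" for x u
    using that V blin_onD(2)[OF lin] blin_onD(2)[OF lin'] by (simp add: subspace_scale power2_eq_square)
  show ?thesis
  proof
    show "\<rho> > 0" using e by (simp add: \<rho>_def)
    show "V \<inter> ball x0 \<rho> \<subseteq> S" using KS by auto
    show "c > 0" by fact
    show "max C1 C2 \<ge> 0" using C1 by simp
    fix x assume x: "x \<in> V \<inter> ball x0 \<rho>"
    then have xK: "x \<in> ?K" and xS: "x \<in> S" using KS by auto
    show "c * (norm u)\<^sup>2 \<le> G x u u" if u: "u \<in> V" for u
    proof (cases "u = 0")
      case True
      then show ?thesis using blin_on_zero[OF lin[OF xS u] V] by simp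
    next
      case False
      have "(norm u)\<^sup>2 * c \<le> (norm u)\<^sup>2 * G x ((1 / norm u) *\<^sub>R u) ((1 / norm u) *\<^sub>R u)"
        using c(2)[of "(x, (1 / norm u) *\<^sub>R u)"] xK u False V by (intro mult_left_mono) (auto simp: subspace_scale)
      then show ?thesis using GS[OF xS u False] by (simp add: mult.commute)
    qed
    show "G x u u \<le> max C1 C2 * (norm u)\<^sup>2" if u: "u \<in> V" for u
    proof (cases "u = 0")
      case True
      then show ?thesis using blin_on_zero[OF lin[OF xS u] V] by simp
    next
      case False
      have "(norm u)\<^sup>2 * G x ((1 / norm u) *\<^sub>R u) ((1 / norm u) *\<^sub>R u) \<le> (norm u)\<^sup>2 * max C1 C2"
        using C1(2)[of "(x, (1 / norm u) *\<^sub>R u)"] xK u False V by (intro mult_left_mono) (auto simp: subspace_scale)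
      then show ?thesis using GS[OF xS u False] by (simp add: mult.commute)
    qed
    fix w u v assume wuv: "w \<in> V" "u \<in> V" "v \<in> V"
    \<comment> \<open>Homogeneity is used one argument at a time; each of the following bounds frees
      one more vector from the unit sphere.\<close>
    have 1: "norm (DG x w u v) \<le> C2" if "w \<in> V" "norm w = 1" "u \<in> V" "norm u = 1" "v \<in> V" "norm v = 1" for w u v
      using C2(2)[of "(x, w, u, v)"] xK that by simp
    have 2: "norm (DG x w u v) \<le> C2 * norm v" if "w \<in> V" "norm w = 1" "u \<in> V" "norm u = 1" "v \<in> V" for w u v
      by (rule unit_bound[OF DG_lin(3)[OF xS that(1,3)] V 1 that(5)]) (use that in auto)
    have 3: "norm (DG x w u v) \<le> C2 * norm v * norm u" if "w \<in> V" "norm w = 1" "u \<in> V" "v \<in> V" for w u v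
      by (rule unit_bound[OF DG_lin(2)[OF xS that(1,4)] V 2 that(3)]) (use that in auto)
    have "norm (DG x w u v) \<le> C2 * norm v * norm u * norm w"
      by (rule unit_bound[OF DG_lin(1)[OF xS wuv(2,3)] V 3 wuv(1)]) (use wuv in auto)
    also have "\<dots> = C2 * (norm w * norm u * norm v)" by simp
    also have "\<dots> \<le> max C1 C2 * (norm w * norm u * norm v)" by (intro mult_right_mono) auto
    finally show "\<bar>DG x w u v\<bar> \<le> max C1 C2 * (norm w * norm u * norm v)" by simp
  qed
qed

text \<open>Differentiating the isometry equation expresses the symmetrisation of
  T(w, u, v) = G(D_w D_u f, D_v f) in its last two arguments by first-order terms; since T is
  symmetric in the first two arguments, T itself is of first order (as for Christoffel symbols).\<close>

lemma isometry_bounds: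
  assumes x0: "x0 \<in> S"
  obtains \<rho> C where "\<rho> > 0" "V \<inter> ball x0 \<rho> \<subseteq> S" "C \<ge> 0"
    "\<And>A f x u w. openin (top_of_set V) A \<Longrightarrow> Cinf_on V A f \<Longrightarrow> A \<subseteq> V \<inter> ball x0 \<rho> \<Longrightarrow>
      (\<And>x. x \<in> A \<Longrightarrow> f x \<in> V \<inter> ball x0 \<rho>) \<Longrightarrow>
      (\<And>x u v. x \<in> A \<Longrightarrow> u \<in> V \<Longrightarrow> v \<in> V \<Longrightarrow> G (f x) (dir_deriv f x u) (dir_deriv f x v) = G x u v) \<Longrightarrow>
      x \<in> A \<Longrightarrow> u \<in> V \<Longrightarrow> w \<in> V \<Longrightarrow>
      norm (dir_deriv f x u) \<le> C * norm u \<and> norm (dir_deriv (\<lambda>x. dir_deriv f x u) x w) \<le> C * (norm u * norm w)"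
proof -
  obtain \<rho> c C where \<rho>: "\<rho> > 0" "V \<inter> ball x0 \<rho> \<subseteq> S" and c: "c > 0" and C: "C \<ge> 0"
    and lo: "\<And>x u. x \<in> V \<inter> ball x0 \<rho> \<Longrightarrow> u \<in> V \<Longrightarrow> c * (norm u)\<^sup>2 \<le> G x u u"
    and up: "\<And>x u. x \<in> V \<inter> ball x0 \<rho> \<Longrightarrow> u \<in> V \<Longrightarrow> G x u u \<le> C * (norm u)\<^sup>2"
    and DGb: "\<And>x w u v. x \<in> V \<inter> ball x0 \<rho> \<Longrightarrow> w \<in> V \<Longrightarrow> u \<in> V \<Longrightarrow> v \<in> V \<Longrightarrow> \<bar>DG x w u v\<bar> \<le> C * (norm w * norm u * norm v)"
    using bounds[OF x0] by metis
  define K where "K = sqrt (C / c)"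
  have K: "K \<ge> 0" "K\<^sup>2 = C / c" using C c by (auto simp: K_def)
  define M where "M = C + C * (K * K * K)"
  have M: "M \<ge> 0" using C K by (simp add: M_def)
  \<comment> \<open>\<open>3/2 * M\<close> bounds \<open>T\<close> as half the sum of three terms;
    testing against a vector of norm at most \<open>K\<close> times that of the second derivative,
    and dividing by \<open>c\<close>, gives the other entry.\<close>
  define C' where "C' = max K (3/2 * M * K / c)"
  show ?thesis
  proof (rule that[OF \<rho>])
    show "C' \<ge> 0" using K by (simp add: C'_def)
    fix A f x u w
    assume A: "openin (top_of_set V) A" and f: "Cinf_on V A f" and AB: "A \<subseteq> V \<inter> ball x0 \<rho>"
      and fB: "\<And>x. x \<in> A \<Longrightarrow> f x \<in> V \<inter> ball x0 \<rho>"
      and iso: "\<And>x u v. x \<in> A \<Longrightarrow> u \<in> V \<Longrightarrow> v \<in> V \<Longrightarrow> G (f x) (dir_deriv f x u) (dir_deriv f x v) = G x u v"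
      and x: "x \<in> A" and u0: "u \<in> V" and w0: "w \<in> V"
    let ?D = "\<lambda>u x. dir_deriv f x u"
    let ?DD = "\<lambda>w u x. dir_deriv (?D u) x w"
    have fS: "f x \<in> S" if "x \<in> A" for x using fB[OF that] \<rho> by blast
    have xS: "x \<in> S" using x AB \<rho> by blast
    have DV: "?D u x \<in> V" if "x \<in> A" "u \<in> V" for x u
      by (rule dir_deriv_in_subspace[OF V A fd Cinf_Ck[OF f, of "Suc 0"] _ that]) (use fB in blast)
    have DDV: "?DD w u x \<in> V" if "u \<in> V" "w \<in> V" for u w
      by (rule dir_deriv_in_subspace[OF V A fd Cinf_Ck[OF Cinf_dir_deriv[OF f that(1)], of "Suc 0"] _ x that(2)])
        (use DV that in blast)
    \<comment> \<open>Vectors of equal \<open>G\<close>-length at two points of the ball have norms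
      comparable up to the factor \<open>sqrt (C / c)\<close>.\<close>
    have lower: "norm v \<le> K * norm v'" if "v \<in> V" "v' \<in> V" "y \<in> V \<inter> ball x0 \<rho>" "y' \<in> V \<inter> ball x0 \<rho>" "G y v v = G y' v' v'" for v v' y y'
    proof -
      have "c * (norm v)\<^sup>2 \<le> C * (norm v')\<^sup>2" using lo[OF that(3,1)] up[OF that(4,2)] that(5) by simp
      then have "(norm v)\<^sup>2 \<le> (K * norm v')\<^sup>2"
      proof -
        have "C = c * K\<^sup>2" using c K(2) by simp
        then have "c * (norm v)\<^sup>2 \<le> c * (K * norm v')\<^sup>2"
          using \<open>c * (norm v)\<^sup>2 \<le> C * (norm v')\<^sup>2\<close> by (simp add: power_mult_distrib mult.assoc)
        then show ?thesis using c by (simp only: mult_le_cancel_left_pos)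
      qed
      then show ?thesis by (rule power2_le_imp_le) (simp add: K(1))
    qed
    have fx: "f x \<in> V \<inter> ball x0 \<rho>" and xB: "x \<in> V \<inter> ball x0 \<rho>" using fB x AB by auto
    have D1: "norm (?D u x) \<le> K * norm u" if "u \<in> V" for u
      by (rule lower[OF DV[OF x that] that fx xB iso[OF x that that]])
    define T where "T w u v = G (f x) (?DD w u x) (?D v x)" for w u v
    define R where "R w u v = DG x w u v - DG (f x) (?D w x) (?D u x) (?D v x)" for w u v
    \<comment> \<open>The isometry equation is expanded in the basis and differentiated by the
      product rule. The two coordinate factors produce the two \<open>T\<close> terms, and the
      coefficients at the moving point \<open>f x\<close> produce the derivative of the
      metric.\<close>
    have deriv: "T w u v + T w v u = R w u v" if wuv: "w \<in> V" "u \<in> V" "v \<in> V" for w u v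
    proof -
      let ?B = "fbasis V"
      have rd: "((\<lambda>t. coord V b (?D u (x + t *\<^sub>R w))) has_real_derivative coord V b (?DD w u x)) (at 0)" if "u \<in> V" for b u
      proof -
        obtain d where d: "d > 0" "\<And>t. \<bar>t\<bar> < d \<Longrightarrow> x + t *\<^sub>R w \<in> A" using openin_sub_line[OF V A x wuv(1)] by blast
        show ?thesis
          using blin_on_has_vector_derivative[OF blin_on_coord[OF fd] V fd_subspace_closed[OF fd]
              Ck_deriv[OF Cinf_Ck[OF Cinf_dir_deriv[OF f that], of "Suc 0"] x wuv(1)] d(1)] d(2) DV that
          by (simp add: has_real_derivative_iff_has_vector_derivative)
      qed
      have rG: "((\<lambda>t. G (f (x + t *\<^sub>R w)) b b') has_real_derivative DG (f x) (?D w x) b b') (at 0)"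
        if "b \<in> ?B" "b' \<in> ?B" for b b'
        using Ck_compose_deriv[OF V A fd S Cinf_Ck[OF f, of "Suc 0"] fS Cinf_Ck[OF smooth, of _ _ "Suc 0"] x wuv(1)] that VB
        unfolding DG_def by (simp add: has_real_derivative_iff_has_vector_derivative)
      have "((\<lambda>t. \<Sum>b\<in>?B. \<Sum>b'\<in>?B. coord V b (?D u (x + t *\<^sub>R w)) * coord V b' (?D v (x + t *\<^sub>R w)) * G (f (x + t *\<^sub>R w)) b b')
        has_real_derivative (\<Sum>b\<in>?B. \<Sum>b'\<in>?B. coord V b (?D u x) * coord V b' (?D v x) * DG (f x) (?D w x) b b'
          + coord V b (?DD w u x) * coord V b' (?D v x) * G (f x) b b' + coord V b (?D u x) * coord V b' (?DD w v x) * G (f x) b b')) (at 0)"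
      proof (intro DERIV_sum)
        fix b b' assume b: "b \<in> ?B" "b' \<in> ?B"
        show "((\<lambda>t. coord V b (?D u (x + t *\<^sub>R w)) * coord V b' (?D v (x + t *\<^sub>R w)) * G (f (x + t *\<^sub>R w)) b b')
          has_real_derivative coord V b (?D u x) * coord V b' (?D v x) * DG (f x) (?D w x) b b'
          + coord V b (?DD w u x) * coord V b' (?D v x) * G (f x) b b' + coord V b (?D u x) * coord V b' (?DD w v x) * G (f x) b b') (at 0)"
          using DERIV_mult[OF DERIV_mult[OF rd[OF wuv(2), of b] rd[OF wuv(3), of b']] rG[OF b]] by (simp add: algebra_simps)
      qed
      also have "(\<Sum>b\<in>?B. \<Sum>b'\<in>?B. coord V b (?D u x) * coord V b' (?D v x) * DG (f x) (?D w x) b b'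
          + coord V b (?DD w u x) * coord V b' (?D v x) * G (f x) b b' + coord V b (?D u x) * coord V b' (?DD w v x) * G (f x) b b')
        = DG (f x) (?D w x) (?D u x) (?D v x) + G (f x) (?DD w u x) (?D v x) + G (f x) (?D u x) (?DD w v x)"
        using wuv x by (simp add: DG_expand[OF fS[OF x] DV DV DV] expand[OF fS[OF x]] DV DDV sum.distrib)
      finally have 1: "((\<lambda>t. \<Sum>b\<in>?B. \<Sum>b'\<in>?B. coord V b (?D u (x + t *\<^sub>R w)) * coord V b' (?D v (x + t *\<^sub>R w)) * G (f (x + t *\<^sub>R w)) b b')
        has_vector_derivative DG (f x) (?D w x) (?D u x) (?D v x) + G (f x) (?DD w u x) (?D v x) + G (f x) (?D u x) (?DD w v x)) (at 0)"
        by (simp add: has_real_derivative_iff_has_vector_derivative)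
      have "((\<lambda>t. G (x + t *\<^sub>R w) u v)
        has_vector_derivative DG (f x) (?D w x) (?D u x) (?D v x) + G (f x) (?DD w u x) (?D v x) + G (f x) (?D u x) (?DD w v x)) (at 0)"
      proof (rule line_deriv_cong[OF V A x wuv(1) _ 1])
        fix y assume y: "y \<in> A"
        show "(\<Sum>b\<in>?B. \<Sum>b'\<in>?B. coord V b (?D u y) * coord V b' (?D v y) * G (f y) b b') = G y u v"
          using expand[OF fS[OF y] DV[OF y wuv(2)] DV[OF y wuv(3)]] iso[OF y wuv(2,3)] by simp
      qed
      from vector_derivative_unique_at[OF this G_line_deriv[OF xS wuv]]
      show ?thesis unfolding T_def R_def using sym[OF fS[OF x] DV[OF x wuv(2)] DDV[OF wuv(3,1)]] by simp
    qed
    have Tsym: "T w u v = T u w v" if "w \<in> V" "u \<in> V" for w u v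
      unfolding T_def using dir_deriv_symmetric[OF V A Cinf_Ck[OF f, of "Suc (Suc 0)"] x that(2,1)] by simp
    have Rb: "\<bar>R w u v\<bar> \<le> M * (norm w * norm u * norm v)" if wuv: "w \<in> V" "u \<in> V" "v \<in> V" for w u v
    proof -
      have "\<bar>DG (f x) (?D w x) (?D u x) (?D v x)\<bar> \<le> C * (norm (?D w x) * norm (?D u x) * norm (?D v x))"
        by (rule DGb[OF fx DV[OF x wuv(1)] DV[OF x wuv(2)] DV[OF x wuv(3)]])
      also have "\<dots> \<le> C * ((K * norm w) * (K * norm u) * (K * norm v))"
        using C K by (intro mult_left_mono mult_mono D1 wuv mult_nonneg_nonneg) auto
      finally have 1: "\<bar>DG (f x) (?D w x) (?D u x) (?D v x)\<bar> \<le> C * (K * K * K) * (norm w * norm u * norm v)"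
        by (simp add: mult_ac)
      have "\<bar>R w u v\<bar> \<le> \<bar>DG x w u v\<bar> + \<bar>DG (f x) (?D w x) (?D u x) (?D v x)\<bar>" unfolding R_def by (rule abs_triangle_ineq4)
      also have "\<dots> \<le> M * (norm w * norm u * norm v)"
        using 1 DGb[OF xB wuv] unfolding M_def by (simp add: distrib_right)
      finally show ?thesis .
    qed
    have Tb: "\<bar>T w u v\<bar> \<le> 3/2 * M * (norm w * norm u * norm v)" if wuv: "w \<in> V" "u \<in> V" "v \<in> V" for w u v
    proof -
      \<comment> \<open>Symmetry of \<open>T\<close> in its first two arguments cancels all other
        terms of this alternating cyclic sum.\<close>
      have "2 * T w u v = R w u v + R u v w - R v w u"
        using deriv[OF wuv] deriv[OF wuv(2,3,1)] deriv[OF wuv(3,1,2)]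
          Tsym[OF wuv(1,2), of v] Tsym[OF wuv(2,3), of w] Tsym[OF wuv(3,1), of u] by simp
      moreover have "\<bar>R u v w\<bar> \<le> M * (norm w * norm u * norm v)" "\<bar>R v w u\<bar> \<le> M * (norm w * norm u * norm v)"
        using Rb[OF wuv(2,3,1)] Rb[OF wuv(3,1,2)] by (simp_all add: mult_ac)
      ultimately have "\<bar>T w u v\<bar> \<le> 3/2 * (M * (norm w * norm u * norm v))" using Rb[OF wuv] by linarith
      then show ?thesis by (simp only: mult.assoc)
    qed
    have "norm (?DD w u x) \<le> (3/2 * M * K / c) * (norm u * norm w)"
    proof (cases "?DD w u x = 0")
      case True
      then show ?thesis using M K c by simp
    next
      case False
      let ?z = "?DD w u x"
      have zV: "?z \<in> V" by (rule DDV[OF u0 w0])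
      have "dir_deriv f x ` V = V"
      proof (rule blin_on_inj_surj[OF fd blin_on_dir_deriv[OF fd A Cinf_Ck[OF f, of "Suc 0"] x]])
        show "?D v x \<in> V" if "v \<in> V" for v by (rule DV[OF x that])
        show "v = 0" if "v \<in> V" "?D v x = 0" for v
        proof (rule ccontr)
          assume "v \<noteq> 0"
          then have "0 < G (f x) (?D v x) (?D v x)" using pos[OF xS that(1)] iso[OF x that(1) that(1)] by simp
          then show False using that(2) blin_on_zero[OF lin[OF fS[OF x] subspace_0[OF V]] V] by simp
        qed
      qed
      \<comment> \<open>To pair the second derivative with itself through \<open>T\<close>, it has
        to be written as a first derivative in some direction \<open>v\<close>; this is where
        surjectivity of the derivative enters.\<close>
      then obtain v where v: "v \<in> V" "?D v x = ?z" using zV by (metis imageE)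
      have vz: "norm v \<le> K * norm ?z" by (rule lower[OF v(1) zV xB fx]) (use iso[OF x v(1) v(1)] v(2) in simp)
      have "c * (norm ?z)\<^sup>2 \<le> T w u v" unfolding T_def v(2) by (rule lo[OF fx zV])
      also have "\<dots> \<le> 3/2 * M * (norm w * norm u * norm v)" using Tb[OF w0 u0 v(1)] by simp
      also have "\<dots> \<le> 3/2 * M * (norm w * norm u * (K * norm ?z))" using M vz by (intro mult_left_mono) auto
      finally have "norm ?z * (c * norm ?z) \<le> norm ?z * (3/2 * M * K * (norm u * norm w))"
        by (simp add: power2_eq_square mult_ac)
      then have "c * norm ?z \<le> 3/2 * M * K * (norm u * norm w)" using False by simp
      then show ?thesis using c by (simp add: field_simps)
    qed
    also have "\<dots> \<le> C' * (norm u * norm w)" by (intro mult_right_mono) (auto simp: C'_def)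
    finally have "norm (?DD w u x) \<le> C' * (norm u * norm w)" .
    moreover have "norm (?D u x) \<le> C' * norm u"
      using D1[OF u0] mult_right_mono[of K C' "norm u"] by (simp add: C'_def)
    ultimately show "norm (?D u x) \<le> C' * norm u \<and> norm (?DD w u x) \<le> C' * (norm u * norm w)" by blast
  qed
qed

end

section \<open>Straightening a submersion\<close>

lemma dir_deriv_const_add:
  "((\<lambda>t. f (x + t *\<^sub>R v)) has_vector_derivative D) (at 0) \<Longrightarrow> dir_deriv (\<lambda>x. c + f x) x v = D"
  by (rule dir_derivI) (auto intro!: derivative_eq_intros)

lemma linear_right_inverse:
  assumes V: "fd_subspace V" and W: "fd_subspace W" and A: "blin_on V A" "A ` V = W"
  obtains R where "blin_on W R" "\<And>w. w \<in> W \<Longrightarrow> R w \<in> V" "\<And>w. w \<in> W \<Longrightarrow> A (R w) = w"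
proof -
  have sV: "subspace V" using V fd_subspaceD by blast
  have "\<forall>b\<in>fbasis W. \<exists>r\<in>V. A r = b" using A(2) fbasis(4)[OF W] by blast
  then obtain r where r: "\<And>b. b \<in> fbasis W \<Longrightarrow> r b \<in> V" "\<And>b. b \<in> fbasis W \<Longrightarrow> A (r b) = b" by metis
  define R where "R w = (\<Sum>b\<in>fbasis W. coord W b w *\<^sub>R r b)" for w
  note c = blin_onD[OF blin_on_coord[OF W]]
  show ?thesis
  proof
    show "blin_on W R" unfolding R_def
      by (rule blin_onI[OF W]) (simp_all add: c scaleR_add_left sum.distrib scaleR_sum_right)
    show "R w \<in> V" for w
      unfolding R_def by (intro subspace_sum[OF sV] subspace_scale[OF sV] r)
    show "A (R w) = w" if "w \<in> W" for w
    proof -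
      have "A (R w) = (\<Sum>b\<in>fbasis W. A (coord W b w *\<^sub>R r b))"
        unfolding R_def by (rule blin_on_sum[OF A(1) sV]) (intro subspace_scale[OF sV] r)
      also have "\<dots> = (\<Sum>b\<in>fbasis W. coord W b w *\<^sub>R b)"
        using r by (intro sum.cong refl) (simp add: blin_onD(2)[OF A(1)])
      finally show ?thesis using coord_sum[OF W that] by simp
    qed
  qed
qed

text \<open>A submersion p becomes the linear map A = Dp(x0) in the coordinates
  z - R A z + R (p z), where R is a linear right inverse of A.\<close>

lemma submersion_local_structure:
  fixes p :: "'a::real_normed_vector \<Rightarrow> 'b::real_normed_vector"
  assumes fdV: "fd_subspace V" and fdW: "fd_subspace W" and S: "openin (top_of_set V) S"
    and p: "Cinf_on V S p" "\<And>x. x \<in> S \<Longrightarrow> p x \<in> W" and x0: "x0 \<in> S" and surj: "dir_deriv p x0 ` V = W"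
  obtains T L T2 s where "openin (top_of_set V) T" "T \<subseteq> S" "x0 \<in> T"
    "\<And>w. w \<in> W \<Longrightarrow> Cinf_on V T (\<lambda>x. L x w)"
    "\<And>x. x \<in> T \<Longrightarrow> blin_on W (L x)"
    "\<And>x w. x \<in> T \<Longrightarrow> w \<in> W \<Longrightarrow> L x w \<in> V"
    "\<And>x w. x \<in> T \<Longrightarrow> w \<in> W \<Longrightarrow> dir_deriv p x (L x w) = w"
    "openin (top_of_set W) T2" "p x0 \<in> T2" "Cinf_on W T2 s" "s (p x0) = x0"
    "\<And>y. y \<in> T2 \<Longrightarrow> s y \<in> T" "\<And>y. y \<in> T2 \<Longrightarrow> p (s y) = y"
    "\<And>y w. y \<in> T2 \<Longrightarrow> w \<in> W \<Longrightarrow> dir_deriv s y w = L (s y) w"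
    "\<And>k. k \<in> V \<Longrightarrow> dir_deriv p x0 k = 0 \<Longrightarrow>
       \<exists>\<kappa>. Cinf_on V T \<kappa> \<and> (\<forall>x\<in>T. \<kappa> x \<in> V \<and> dir_deriv p x (\<kappa> x) = 0) \<and> \<kappa> x0 = k"
    "\<And>x x'. x \<in> T \<Longrightarrow> x' \<in> T \<Longrightarrow> p x = p x' \<Longrightarrow> \<exists>c. c 0 = x \<and> c 1 = x' \<and>
       (\<forall>t\<in>{0..1::real}. c t \<in> T \<and> p (c t) = p x \<and>
          (\<exists>d>0. \<forall>s. \<bar>s - t\<bar> < d \<longrightarrow> c s \<in> T) \<and>
          (\<exists>c'\<in>V. (c has_vector_derivative c') (at t) \<and> dir_deriv p (c t) c' = 0))"
proof -
  have V: "subspace V" and W: "subspace W" using fdV fdW fd_subspaceD by auto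
  have SV: "S \<subseteq> V" using S openin_imp_subset by blast
  define A where "A = dir_deriv p x0"
  have A: "blin_on V A" unfolding A_def by (rule blin_on_dir_deriv[OF fdV S Cinf_Ck[OF p(1), of "Suc 0"] x0])
  have AW: "A v \<in> W" if "v \<in> V" for v using surj that by (auto simp: A_def)
  obtain R where R: "blin_on W R" "\<And>w. w \<in> W \<Longrightarrow> R w \<in> V" "\<And>w. w \<in> W \<Longrightarrow> A (R w) = w"
    using linear_right_inverse[OF fdV fdW A surj[folded A_def]] by blast
  define f where "f z = z - R (A z) + R (p z)" for z
  have RA: "blin_on V (\<lambda>z. R (A z))"
    by (rule blin_onI[OF fdV]) (simp_all add: blin_onD[OF A] blin_onD[OF R(1)] AW)
  have sRA: "Cinf_on V S (\<lambda>z. R (A z))" by (rule Cinf_blin_id[OF fdV S RA])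
  have sRp: "Cinf_on V S (\<lambda>z. R (p z))" by (rule Cinf_blin[OF V S fdW R(1) p])
  have sf: "Cinf_on V S f" unfolding f_def
    by (intro Cinf_add[OF V S] Cinf_diff[OF V S] Cinf_id[OF V S] sRA sRp)
  have fV: "f z \<in> V" if "z \<in> S" for z
    unfolding f_def using that SV AW R(2) p(2) by (intro subspace_add[OF V] subspace_diff[OF V]) auto
  have Af: "A (f z) = p z" if "z \<in> S" for z
  proof -
    have zV: "z \<in> V" using that SV by blast
    have in1: "R (A z) \<in> V" "R (p z) \<in> V" using zV AW R(2) p(2) that by auto
    have "A (f z) = A z - A (R (A z)) + A (R (p z))"
      unfolding f_def using blin_onD(1)[OF A subspace_diff[OF V zV in1(1)] in1(2)] blin_on_diff[OF A V zV in1(1)] by simp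
    then show ?thesis using R(3) AW zV p(2) that by simp
  qed
  have Df: "dir_deriv f x0 v = v" if v: "v \<in> V" for v
  proof (rule dir_derivI)
    have "((\<lambda>t. R (A (x0 + t *\<^sub>R v))) has_vector_derivative R (A v)) (at 0)"
      using Ck_deriv[OF Cinf_Ck[OF sRA, of "Suc 0"] x0 v] dir_deriv_blin[OF fdV RA _ v, of x0] x0 SV by auto
    moreover have "((\<lambda>t. R (p (x0 + t *\<^sub>R v))) has_vector_derivative R (A v)) (at 0)"
    proof -
      obtain d where d: "d > 0" "\<And>t. \<bar>t\<bar> < d \<Longrightarrow> x0 + t *\<^sub>R v \<in> S" using openin_sub_line[OF V S x0 v] by blast
      show ?thesis
        using blin_on_has_vector_derivative[OF R(1) W fd_subspace_closed[OF fdW] Ck_deriv[OF Cinf_Ck[OF p(1), of "Suc 0"] x0 v] d(1)] d(2) p(2)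
        unfolding A_def by simp
    qed
    ultimately have "((\<lambda>t. (x0 + t *\<^sub>R v) - R (A (x0 + t *\<^sub>R v)) + R (p (x0 + t *\<^sub>R v))) has_vector_derivative v - R (A v) + R (A v)) (at 0)"
      by (intro has_vector_derivative_add has_vector_derivative_diff) (auto intro!: derivative_eq_intros)
    then show "((\<lambda>t. f (x0 + t *\<^sub>R v)) has_vector_derivative v) (at 0)" unfolding f_def by simp
  qed
  obtain S' T' g where ift: "openin (top_of_set V) S'" "S' \<subseteq> S" "x0 \<in> S'" "openin (top_of_set V) T'" "f x0 \<in> T'"
    "Cinf_on V T' g" "\<And>y. y \<in> T' \<Longrightarrow> g y \<in> S'" "\<And>y. y \<in> T' \<Longrightarrow> f (g y) = y"
    "\<And>x. x \<in> S' \<Longrightarrow> f x \<in> T'" "\<And>x. x \<in> S' \<Longrightarrow> g (f x) = x"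
    using inverse_function[OF fdV S sf fV x0 Df] by blast
  obtain \<delta> where \<delta>: "\<delta> > 0" "\<And>y. y \<in> V \<Longrightarrow> dist y (f x0) < \<delta> \<Longrightarrow> y \<in> T'"
    using ift(4,5) unfolding openin_sub_iff by blast
  \<comment> \<open>A ball is taken for its convexity: the segments that join two points of a fibre
    have to stay inside.\<close>
  define U where "U = V \<inter> ball (f x0) \<delta>"
  have U: "openin (top_of_set V) U" "U \<subseteq> T'" "U \<subseteq> V" "f x0 \<in> U"
    using \<delta> fV[OF x0] by (auto simp: U_def openin_open dist_commute)
  define T where "T = S' \<inter> f -` U"
  have "openin (top_of_set S') (S' \<inter> f -` U)"
    by (rule continuous_openin_preimage[of S' f V])
      (use Ck_continuous[OF Cinf_Ck[OF Cinf_subset[OF sf ift(2)], of 0]] fV ift(2) U(1) in auto)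
  then have T: "openin (top_of_set V) T" "T \<subseteq> S" "x0 \<in> T" "T \<subseteq> S'"
    unfolding T_def using ift(1,2,3) U(4) openin_trans by auto
  have fU: "f x \<in> U" if "x \<in> T" for x using that by (simp add: T_def)
  have gT: "g y \<in> T" "f (g y) = y" if "y \<in> U" for y
    using that ift(7,8)[of y] U(2) by (auto simp: T_def)
  have gf: "g (f x) = x" if "x \<in> T" for x using that ift(10) T(4) by blast
  have sg: "Cinf_on V U g" by (rule Cinf_subset[OF ift(6) U(2)])
  have sfT: "Cinf_on V T f" by (rule Cinf_subset[OF sf T(2)])
  have spT: "Cinf_on V T p" by (rule Cinf_subset[OF p(1) T(2)])
  have gV: "g y \<in> V" if "y \<in> U" for y using gT(1)[OF that] T(2) SV by blast
  have DgV: "dir_deriv g y v \<in> V" if "y \<in> U" "v \<in> V" for y v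
    by (rule dir_deriv_in_subspace[OF V U(1) fdV Cinf_Ck[OF sg, of "Suc 0"] gV that])
  have Dg: "blin_on V (dir_deriv g y)" if "y \<in> U" for y
    by (rule blin_on_dir_deriv[OF fdV U(1) Cinf_Ck[OF sg, of "Suc 0"] that])
  have Dpg: "dir_deriv p (g y) (dir_deriv g y v) = A v" if y: "y \<in> U" and v: "v \<in> V" for y v
  proof -
    have "dir_deriv (\<lambda>y. p (g y)) y v = dir_deriv p (g y) (dir_deriv g y v)"
      by (rule dir_deriv_compose[OF V U(1) fdV T(1) Cinf_Ck[OF sg, of "Suc 0"] gT(1) Cinf_Ck[OF spT, of "Suc 0"] y v])
    moreover have "dir_deriv (\<lambda>y. p (g y)) y v = dir_deriv A y v"
      by (rule dir_deriv_cong[OF V U(1) y v]) (use Af gT T(2) in force)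
    ultimately show ?thesis using dir_deriv_blin[OF fdV A _ v] y U(3) by auto
  qed
  have Dgx0: "dir_deriv g (f x0) v = v" if v: "v \<in> V" for v
  proof -
    have "dir_deriv (\<lambda>x. g (f x)) x0 v = dir_deriv g (f x0) (dir_deriv f x0 v)"
      by (rule dir_deriv_compose[OF V T(1) fdV U(1) Cinf_Ck[OF sfT, of "Suc 0"] fU Cinf_Ck[OF sg, of "Suc 0"] T(3) v])
    moreover have "dir_deriv (\<lambda>x. g (f x)) x0 v = v"
    proof (rule dir_derivI)
      have "((\<lambda>t. x0 + t *\<^sub>R v) has_vector_derivative v) (at 0)" by (auto intro!: derivative_eq_intros)
      then show "((\<lambda>t. g (f (x0 + t *\<^sub>R v))) has_vector_derivative v) (at 0)"
        by (rule line_deriv_cong[OF V T(1) T(3) v, rotated]) (simp add: gf)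
    qed
    ultimately show ?thesis using Df[OF v] by simp
  qed
  \<comment> \<open>A smooth family of right inverses of the derivative of \<open>p\<close>: the
    fixed right inverse \<open>R\<close> in the straightened coordinates, carried back by
    \<open>g\<close>.\<close>
  define L where "L x w = dir_deriv g (f x) (R w)" for x w
  have smDg: "Cinf_on V T (\<lambda>x. dir_deriv g (f x) v)" if "v \<in> V" for v
    by (rule Cinf_compose[OF V T(1) fdV U(1) sfT fU Cinf_dir_deriv[OF sg that]])
  \<comment> \<open>An affine section of \<open>A\<close> through \<open>f x0\<close>; carried back
    by \<open>g\<close> it becomes the section \<open>s\<close> of \<open>p\<close>.\<close>
  define h where "h y = f x0 + R (y - p x0)" for y
  have hV: "h y \<in> V" if "y \<in> W" for y
    unfolding h_def using that fV[OF x0] R(2) p(2)[OF x0] by (intro subspace_add[OF V]) (auto intro: subspace_diff[OF W])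
  have Wo: "openin (top_of_set W) W" by simp
  have sh: "Cinf_on W W h" unfolding h_def
    by (intro Cinf_add[OF W Wo] Cinf_const[OF W Wo] Cinf_blin[OF W Wo fdW R(1)] Cinf_diff[OF W Wo] Cinf_id[OF W Wo])
      (use p(2)[OF x0] in \<open>auto intro: subspace_diff[OF W]\<close>)
  define T2 where "T2 = W \<inter> h -` U"
  have T2: "openin (top_of_set W) T2" unfolding T2_def
    by (rule continuous_openin_preimage[of W h V]) (use Ck_continuous[OF Cinf_Ck[OF sh, of 0]] hV U(1) in auto)
  have hU: "h y \<in> U" "y \<in> W" if "y \<in> T2" for y using that by (auto simp: T2_def)
  have shT: "Cinf_on W T2 h" by (rule Cinf_subset[OF sh]) (auto simp: T2_def)
  have hp: "h (p x0) = f x0" using blin_on_zero[OF R(1) W] by (simp add: h_def)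
  define s where "s y = g (h y)" for y
  show ?thesis
  proof (rule that[of T L T2 s])
    show "openin (top_of_set V) T" "T \<subseteq> S" "x0 \<in> T" "openin (top_of_set W) T2" by fact+
    show "Cinf_on V T (\<lambda>x. L x w)" if "w \<in> W" for w unfolding L_def by (rule smDg[OF R(2)[OF that]])
    show "L x w \<in> V" if "x \<in> T" "w \<in> W" for x w unfolding L_def by (rule DgV[OF fU[OF that(1)] R(2)[OF that(2)]])
    show "blin_on W (L x)" if x: "x \<in> T" for x
      by (rule blin_onI[OF fdW]) (simp_all add: L_def blin_onD[OF R(1)] blin_onD[OF Dg[OF fU[OF x]]] R(2))
    show "dir_deriv p x (L x w) = w" if "x \<in> T" "w \<in> W" for x w
      using Dpg[OF fU[OF that(1)] R(2)[OF that(2)]] gf[OF that(1)] R(3)[OF that(2)] by (simp add: L_def)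
    show "p x0 \<in> T2" using hp U(4) p(2)[OF x0] by (simp add: T2_def)
    show "Cinf_on W T2 s" unfolding s_def by (rule Cinf_compose[OF W T2 fdV U(1) shT hU(1) sg])
    show "s (p x0) = x0" using hp gf[OF T(3)] by (simp add: s_def)
    show "s y \<in> T" if "y \<in> T2" for y unfolding s_def by (rule gT(1)[OF hU(1)[OF that]])
    show "p (s y) = y" if y: "y \<in> T2" for y
    proof -
      have "p (s y) = A (h y)" using Af[of "s y"] gT[OF hU(1)[OF y]] T(2) by (auto simp: s_def)
      also have "\<dots> = A (f x0) + A (R (y - p x0))"
        unfolding h_def by (rule blin_onD(1)[OF A fV[OF x0] R(2)]) (use hU(2)[OF y] p(2)[OF x0] in \<open>auto intro: subspace_diff[OF W]\<close>)
      finally show ?thesis using Af[OF x0] R(3)[of "y - p x0"] hU(2)[OF y] p(2)[OF x0] subspace_diff[OF W] by simp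
    qed
    show "dir_deriv s y w = L (s y) w" if y: "y \<in> T2" and w: "w \<in> W" for y w
    proof -
      have "((\<lambda>t. R ((y + t *\<^sub>R w) - p x0)) has_vector_derivative R w) (at 0)"
      proof -
        have c: "((\<lambda>t. (y + t *\<^sub>R w) - p x0) has_vector_derivative w) (at 0)" by (auto intro!: derivative_eq_intros)
        show ?thesis
          using blin_on_has_vector_derivative[OF R(1) W fd_subspace_closed[OF fdW] c, of 1] hU(2)[OF y] w p(2)[OF x0]
          by (simp add: subspace_diff[OF W] subspace_add[OF W] subspace_scale[OF W])
      qed
      then have "dir_deriv h y w = R w" unfolding h_def by (rule dir_deriv_const_add)
      moreover have "dir_deriv s y w = dir_deriv g (h y) (dir_deriv h y w)" unfolding s_def
        by (rule dir_deriv_compose[OF W T2 fdV U(1) Cinf_Ck[OF shT, of "Suc 0"] hU(1) Cinf_Ck[OF sg, of "Suc 0"] y w])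
      ultimately show ?thesis using gT(2)[OF hU(1)[OF y]] by (simp add: L_def s_def)
    qed
    show "\<exists>\<kappa>. Cinf_on V T \<kappa> \<and> (\<forall>x\<in>T. \<kappa> x \<in> V \<and> dir_deriv p x (\<kappa> x) = 0) \<and> \<kappa> x0 = k"
      if k: "k \<in> V" "dir_deriv p x0 k = 0" for k
    proof (intro exI conjI ballI)
      \<comment> \<open>The constant field \<open>k\<close> of the straightened coordinates stays in
        the kernel of \<open>A\<close>, so it is vertical everywhere, and it equals \<open>k\<close>
        at \<open>x0\<close> because \<open>g\<close> has identity derivative there.\<close>
      show "Cinf_on V T (\<lambda>x. dir_deriv g (f x) k)" by (rule smDg[OF k(1)])
      show "dir_deriv g (f x) k \<in> V" if "x \<in> T" for x by (rule DgV[OF fU[OF that] k(1)])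
      show "dir_deriv p x (dir_deriv g (f x) k) = 0" if "x \<in> T" for x
        using Dpg[OF fU[OF that] k(1)] gf[OF that] k(2) by (simp add: A_def)
      show "dir_deriv g (f x0) k = k" by (rule Dgx0[OF k(1)])
    qed
    show "\<exists>c. c 0 = x \<and> c 1 = x' \<and> (\<forall>t\<in>{0..1::real}. c t \<in> T \<and> p (c t) = p x \<and>
          (\<exists>d>0. \<forall>s. \<bar>s - t\<bar> < d \<longrightarrow> c s \<in> T) \<and>
          (\<exists>c'\<in>V. (c has_vector_derivative c') (at t) \<and> dir_deriv p (c t) c' = 0))"
      if x: "x \<in> T" and x': "x' \<in> T" and pp: "p x = p x'" for x x'
    proof -
      \<comment> \<open>In the straightened coordinates two points with the same image under
        \<open>p\<close> differ by a vector of the kernel of \<open>A\<close>, so the segment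
        between them stays in the fibre.\<close>
      define l where "l t = f x + t *\<^sub>R (f x' - f x)" for t
      have k: "f x' - f x \<in> V" using fU[OF x] fU[OF x'] U(3) by (auto intro: subspace_diff[OF V])
      have Ak: "A (f x' - f x) = 0"
        using blin_on_diff[OF A V, of "f x'" "f x"] subsetD[OF U(3) fU[OF x]] subsetD[OF U(3) fU[OF x']]
          Af[OF subsetD[OF T(2) x]] Af[OF subsetD[OF T(2) x']] pp by simp
      have lV: "l t \<in> V" for t unfolding l_def using fU[OF x] U(3) k by (auto intro!: subspace_add[OF V] subspace_scale[OF V])
      have lU: "l t \<in> U" if "t \<in> {0..1}" for t
      proof -
        have "l t = (1 - t) *\<^sub>R f x + t *\<^sub>R f x'" by (simp add: l_def algebra_simps)
        then have "l t \<in> ball (f x0) \<delta>"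
          using convex_ball[of "f x0" \<delta>] fU[OF x] fU[OF x'] that unfolding U_def convex_alt by auto
        then show ?thesis using lV by (simp add: U_def)
      qed
      show ?thesis
      proof (intro exI[of _ "\<lambda>t. g (l t)"] conjI ballI)
        show "g (l 0) = x" "g (l 1) = x'" using gf x x' by (auto simp: l_def)
        fix t :: real assume t: "t \<in> {0..1}"
        show "g (l t) \<in> T" by (rule gT(1)[OF lU[OF t]])
        have "p (g (l t)) = A (l t)" using Af[of "g (l t)"] gT[OF lU[OF t]] T(2) by auto
        also have "\<dots> = A (f x) + A (t *\<^sub>R (f x' - f x))"
          unfolding l_def using fU[OF x] U(3) k by (intro blin_onD(1)[OF A]) (auto intro!: subspace_scale[OF V])
        also have "\<dots> = p x" using Af[of x] x T(2) blin_onD(2)[OF A k, of t] Ak by auto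
        finally show "p (g (l t)) = p x" .
        \<comment> \<open>The curve is defined beyond the unit interval; staying in \<open>T\<close>
          near each parameter makes the two-sided derivative meaningful at the endpoints as
          well.\<close>
        obtain d where d: "d > 0" "\<And>h. \<bar>h\<bar> < d \<Longrightarrow> l t + h *\<^sub>R (f x' - f x) \<in> U"
          using openin_sub_line[OF V U(1) lU[OF t] k] by blast
        have ls: "l s = l t + (s - t) *\<^sub>R (f x' - f x)" for s by (simp add: l_def algebra_simps)
        have "g (l s) \<in> T" if "\<bar>s - t\<bar> < d" for s
          by (subst ls[of s]) (rule gT(1)[OF d(2)[OF that]])
        then show "\<exists>d>0. \<forall>s. \<bar>s - t\<bar> < d \<longrightarrow> g (l s) \<in> T" using d(1) by blast
        have "(l has_vector_derivative (f x' - f x)) (at t)"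
          unfolding l_def by (auto intro!: derivative_eq_intros)
        from Ck_curve[OF fdV U(1) Cinf_Ck[OF sg, of "Suc 0"] this lU[OF t], of 1] lV
        have "((\<lambda>t. g (l t)) has_vector_derivative dir_deriv g (l t) (f x' - f x)) (at t)" by auto
        moreover have "dir_deriv p (g (l t)) (dir_deriv g (l t) (f x' - f x)) = 0"
          using Dpg[OF lU[OF t] k] Ak by simp
        ultimately show "\<exists>c'\<in>V. ((\<lambda>t. g (l t)) has_vector_derivative c') (at t) \<and> dir_deriv p (g (l t)) c' = 0"
          using DgV[OF lU[OF t] k] by blast
      qed
    qed
  qed
qed

section \<open>Manifolds in charts\<close>

locale smooth_mfd =
  fixes M :: "('m, 'e::real_normed_vector) manifold"
  assumes smooth_manifold: "smooth_manifold M"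
begin

abbreviation "E \<equiv> model M"

definition img :: "'m \<Rightarrow> 'e set" where "img p = cmap M p ` cdom M p"

definition tr :: "'m \<Rightarrow> 'm \<Rightarrow> 'e \<Rightarrow> 'e" where "tr p q = cmap M q \<circ> cinv M p"

text \<open>The change of trivialisation of the tangent bundle. Vectors at \<open>q\<close> are read
  in the chart chosen at \<open>q\<close>, and \<open>D q p\<close> at the coordinates of
  \<open>q\<close> converts them to the chart \<open>p\<close>.\<close>

definition D :: "'m \<Rightarrow> 'm \<Rightarrow> 'e \<Rightarrow> 'e \<Rightarrow> 'e" where "D p q x v = dir_deriv (tr p q) x v"

lemma fd: "fd_subspace E" and sub: "subspace E" and hausdorff: "Hausdorff_space (mtop M)"
  and second_countable: "second_countable (mtop M)"
  using smooth_manifold by (auto simp: smooth_manifold_def fd_subspace_def)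

lemma chart:
  assumes "p \<in> points M"
  shows "p \<in> cdom M p" "openin (mtop M) (cdom M p)" "openin (top_of_set E) (img p)"
    "homeomorphic_map (subtopology (mtop M) (cdom M p)) (top_of_set (img p)) (cmap M p)"
    "cdom M p \<subseteq> points M"
  using smooth_manifold assms openin_subset by (auto simp: smooth_manifold_def img_def)

lemma imgE: "p \<in> points M \<Longrightarrow> img p \<subseteq> E"
  using chart(3) openin_imp_subset by blast

lemma cdom_points: "p \<in> points M \<Longrightarrow> q \<in> cdom M p \<Longrightarrow> q \<in> points M"
  using chart(5) by blast

lemma inj_cmap: "p \<in> points M \<Longrightarrow> inj_on (cmap M p) (cdom M p)"
  using homeomorphic_imp_injective_map[OF chart(4)] chart(5) by (simp add: Int_absorb1)

lemma cinv_cmap [simp]: "p \<in> points M \<Longrightarrow> q \<in> cdom M p \<Longrightarrow> cinv M p (cmap M p q) = q"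
  by (simp add: cinv_def inj_cmap)

lemma cmap_cinv [simp]: "x \<in> img p \<Longrightarrow> cmap M p (cinv M p x) = x"
  by (simp add: cinv_def img_def f_inv_into_f)

lemma cinv_cdom [simp]: "x \<in> img p \<Longrightarrow> cinv M p x \<in> cdom M p"
  by (simp add: cinv_def img_def inv_into_into)

lemma cmap_img [simp]: "q \<in> cdom M p \<Longrightarrow> cmap M p q \<in> img p"
  by (simp add: img_def)

lemma cmap_E: "p \<in> points M \<Longrightarrow> q \<in> cdom M p \<Longrightarrow> cmap M p q \<in> E"
  using imgE cmap_img by blast

lemma open_cmap_image:
  assumes p: "p \<in> points M" and W: "openin (mtop M) W" "W \<subseteq> cdom M p"
  shows "openin (top_of_set E) (cmap M p ` W)"
proof -
  have "openin (subtopology (mtop M) (cdom M p)) W"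
    using W chart(2)[OF p] by (simp add: openin_open_subtopology)
  then have "openin (top_of_set (img p)) (cmap M p ` W)"
    using homeomorphic_imp_open_map[OF chart(4)[OF p]] by (simp add: open_map_def)
  then show ?thesis using chart(3)[OF p] openin_trans by blast
qed

lemma open_cmap_vimage:
  assumes p: "p \<in> points M" and T: "openin (top_of_set E) T"
  shows "openin (mtop M) {q \<in> cdom M p. cmap M p q \<in> T}"
proof -
  have "openin (top_of_set (img p)) (T \<inter> img p)"
  proof -
    obtain O' where O': "open O'" "T = E \<inter> O'" using T by (auto simp: openin_open)
    then have "T \<inter> img p = img p \<inter> O'" using imgE[OF p] by blast
    then show ?thesis using O'(1) by (auto simp: openin_open)
  qed
  then have "openin (subtopology (mtop M) (cdom M p)) {q \<in> topspace (subtopology (mtop M) (cdom M p)). cmap M p q \<in> T \<inter> img p}"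
    using openin_continuous_map_preimage[OF homeomorphic_imp_continuous_map[OF chart(4)[OF p]]] by blast
  moreover have "{q \<in> topspace (subtopology (mtop M) (cdom M p)). cmap M p q \<in> T \<inter> img p} = {q \<in> cdom M p. cmap M p q \<in> T}"
    using chart(5)[OF p] by auto
  ultimately show ?thesis using chart(2)[OF p] by (simp add: openin_open_subtopology)
qed

lemma continuous_map_cinv:
  assumes p: "p \<in> points M"
  shows "continuous_map (top_of_set (img p)) (mtop M) (cinv M p)"
  unfolding continuous_map_def
proof (intro conjI allI impI)
  show "cinv M p \<in> topspace (top_of_set (img p)) \<rightarrow> points M" using cdom_points[OF p] by auto
  fix U assume U: "openin (mtop M) U"
  have "openin (top_of_set E) (cmap M p ` (U \<inter> cdom M p))"
    by (rule open_cmap_image[OF p openin_Int[OF U chart(2)[OF p]]]) simp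
  moreover have "cmap M p ` (U \<inter> cdom M p) = {x \<in> topspace (top_of_set (img p)). cinv M p x \<in> U}"
  proof (intro equalityI subsetI)
    fix x assume x: "x \<in> {x \<in> topspace (top_of_set (img p)). cinv M p x \<in> U}"
    then show "x \<in> cmap M p ` (U \<inter> cdom M p)"
      by (intro image_eqI[of _ _ "cinv M p x"]) auto
  qed (use p in auto)
  ultimately show "openin (top_of_set (img p)) {x \<in> topspace (top_of_set (img p)). cinv M p x \<in> U}"
    using openin_subset_trans[OF _ _ imgE[OF p]] by simp
qed

lemma compactin_cinv_image:
  assumes "p \<in> points M" "compact K" "K \<subseteq> img p"
  shows "compactin (mtop M) (cinv M p ` K)"
  by (rule image_compactin[OF _ continuous_map_cinv[OF assms(1)]])
    (use assms in \<open>simp add: compactin_subtopology\<close>)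

lemma tr_smooth: "p \<in> points M \<Longrightarrow> q \<in> points M \<Longrightarrow> Cinf_on E (cmap M p ` (cdom M p \<inter> cdom M q)) (tr p q)"
  using smooth_manifold by (simp add: smooth_manifold_def tr_def)

lemma tr_cmap [simp]: "p \<in> points M \<Longrightarrow> r \<in> cdom M p \<Longrightarrow> tr p q (cmap M p r) = cmap M q r"
  by (simp add: tr_def)

lemma open_overlap:
  assumes "p \<in> points M" "q \<in> points M"
  shows "openin (top_of_set E) (cmap M p ` (cdom M p \<inter> cdom M q))"
  using assms by (intro open_cmap_image openin_Int chart(2)) auto

lemma D_in:
  assumes "p \<in> points M" "q \<in> points M" "r \<in> cdom M p" "r \<in> cdom M q" "v \<in> E"
  shows "D p q (cmap M p r) v \<in> E"
  unfolding D_def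
  by (rule dir_deriv_in_subspace[OF sub open_overlap[OF assms(1,2)] fd Cinf_Ck[OF tr_smooth[OF assms(1,2)], of "Suc 0"]])
    (use assms cmap_E in auto)

lemma D_blin:
  assumes "p \<in> points M" "q \<in> points M" "r \<in> cdom M p" "r \<in> cdom M q"
  shows "blin_on E (D p q (cmap M p r))"
  unfolding D_def[abs_def]
  by (rule blin_on_dir_deriv[OF fd open_overlap[OF assms(1,2)] Cinf_Ck[OF tr_smooth[OF assms(1,2)], of "Suc 0"]])
    (use assms in auto)

lemma D_comp:
  assumes "p \<in> points M" "q \<in> points M" "r \<in> points M" "s \<in> cdom M p" "s \<in> cdom M q" "s \<in> cdom M r" "v \<in> E"
  shows "D q r (cmap M q s) (D p q (cmap M p s) v) = D p r (cmap M p s) v"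
proof -
  let ?W = "cdom M p \<inter> cdom M q \<inter> cdom M r"
  have o: "openin (top_of_set E) (cmap M p ` ?W)"
    using assms by (intro open_cmap_image openin_Int chart(2)) auto
  have c1: "Ck_on (Suc 0) E (cmap M p ` ?W) (tr p q)"
    by (rule Ck_subset[OF Cinf_Ck[OF tr_smooth[OF assms(1,2)]]]) auto
  have "dir_deriv (\<lambda>x. tr q r (tr p q x)) (cmap M p s) v = dir_deriv (tr q r) (tr p q (cmap M p s)) (dir_deriv (tr p q) (cmap M p s) v)"
    by (rule dir_deriv_compose[OF sub o fd open_overlap[OF assms(2,3)] c1 _ Cinf_Ck[OF tr_smooth[OF assms(2,3)]]])
      (use assms in auto)
  moreover have "dir_deriv (\<lambda>x. tr q r (tr p q x)) (cmap M p s) v = dir_deriv (tr p r) (cmap M p s) v"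
    by (rule dir_deriv_cong[OF sub o]) (use assms in auto)
  ultimately show ?thesis using assms by (simp add: D_def)
qed

lemma D_id:
  assumes "p \<in> points M" "s \<in> cdom M p" "v \<in> E"
  shows "D p p (cmap M p s) v = v"
  unfolding D_def
proof (rule dir_derivI)
  have "((\<lambda>t. cmap M p s + t *\<^sub>R v) has_vector_derivative v) (at 0)" by (auto intro!: derivative_eq_intros)
  then show "((\<lambda>t. tr p p (cmap M p s + t *\<^sub>R v)) has_vector_derivative v) (at 0)"
    by (rule line_deriv_cong[OF sub chart(3)[OF assms(1)] _ assms(3), rotated 2]) (use assms in \<open>auto simp: img_def\<close>)
qed

lemma vf_rep_cmap: "p \<in> points M \<Longrightarrow> q \<in> cdom M p \<Longrightarrow> vf_rep M p X (cmap M p q) = D q p (cmap M q q) (X q)"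
  by (simp add: vf_rep_def Let_def D_def tr_def)

lemma vf_rep_E:
  assumes "p \<in> points M" "q \<in> cdom M p" "X q \<in> E"
  shows "vf_rep M p X (cmap M p q) \<in> E"
  using assms cdom_points[OF assms(1,2)] by (simp add: vf_rep_cmap D_in chart(1))

lemma vf_rep_inverse:
  assumes "p \<in> points M" "q \<in> cdom M p" "X q \<in> E"
  shows "D p q (cmap M p q) (vf_rep M p X (cmap M p q)) = X q"
  using assms cdom_points[OF assms(1,2)] by (simp add: vf_rep_cmap D_comp D_id chart(1))

lemma vf_rep_self: "p \<in> points M \<Longrightarrow> X p \<in> E \<Longrightarrow> vf_rep M p X (cmap M p p) = X p"
  by (simp add: vf_rep_cmap D_id chart(1))

lemma vf_rep_change:
  assumes "p \<in> points M" "r \<in> points M" "q \<in> cdom M p" "q \<in> cdom M r" "X q \<in> E"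
  shows "vf_rep M r X (cmap M r q) = D p r (cmap M p q) (vf_rep M p X (cmap M p q))"
  using assms cdom_points[OF assms(1,3)] by (simp add: vf_rep_cmap D_comp chart(1))

lemma vector_fieldD:
  assumes "X \<in> vector_fields M"
  shows "p \<in> points M \<Longrightarrow> X p \<in> E" "p \<in> points M \<Longrightarrow> Cinf_on E (img p) (vf_rep M p X)" "p \<notin> points M \<Longrightarrow> X p = 0"
  using assms by (auto simp: vector_fields_def img_def)

text \<open>One chart around each point is enough. In another chart the field is the transition
  derivative applied to a varying vector; the basis expansion makes this a finite sum of smooth
  products, composed with the transition map.\<close>

lemma vector_fieldI:
  assumes X: "\<And>p. p \<in> points M \<Longrightarrow> X p \<in> E" "\<And>p. p \<notin> points M \<Longrightarrow> X p = 0"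
    and loc: "\<And>q. q \<in> points M \<Longrightarrow> \<exists>p W. p \<in> points M \<and> openin (mtop M) W \<and> q \<in> W \<and> W \<subseteq> cdom M p \<and>
      Cinf_on E (cmap M p ` W) (vf_rep M p X)"
  shows "X \<in> vector_fields M"
proof -
  have "Cinf_on E (img r) (vf_rep M r X)" if r: "r \<in> points M" for r
  proof (rule Cinf_local[OF sub chart(3)[OF r]])
    fix x assume "x \<in> img r"
    then obtain q where q: "q \<in> cdom M r" "x = cmap M r q" by (auto simp: img_def)
    have qp: "q \<in> points M" using cdom_points[OF r q(1)] .
    obtain p W where W: "p \<in> points M" "openin (mtop M) W" "q \<in> W" "W \<subseteq> cdom M p" "Cinf_on E (cmap M p ` W) (vf_rep M p X)"
      using loc[OF qp] by blast
    let ?W = "W \<inter> cdom M r"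
    have Wo: "openin (mtop M) ?W" using W(2) chart(2)[OF r] by blast
    have o1: "openin (top_of_set E) (cmap M p ` ?W)" by (rule open_cmap_image[OF W(1) Wo]) (use W in blast)
    have o2: "openin (top_of_set E) (cmap M r ` ?W)" by (rule open_cmap_image[OF r Wo]) blast
    have rep: "Cinf_on E (cmap M p ` ?W) (vf_rep M p X)" by (rule Cinf_subset[OF W(5)]) blast
    have repE: "vf_rep M p X z \<in> E" if zW: "z \<in> cmap M p ` ?W" for z
    proof -
      obtain s where s: "s \<in> cdom M p" "z = cmap M p s" using zW W(4) by blast
      show ?thesis unfolding s(2) by (rule vf_rep_E[of p s X, OF W(1) s(1) X(1)[OF cdom_points[OF W(1) s(1)]]])
    qed
    have G: "Cinf_on E (cmap M p ` ?W) (\<lambda>z. \<Sum>b\<in>fbasis E. coord E b (vf_rep M p X z) *\<^sub>R D p r z b)"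
    proof (rule Cinf_sum[OF sub o1], rule Cinf_scaleR[OF sub o1])
      fix b assume b: "b \<in> fbasis E"
      show "Cinf_on E (cmap M p ` ?W) (\<lambda>z. coord E b (vf_rep M p X z))"
        by (rule Cinf_blin[OF sub o1 fd blin_on_coord[OF fd] rep repE])
      show "Cinf_on E (cmap M p ` ?W) (\<lambda>z. D p r z b)" unfolding D_def
        by (rule Cinf_subset[OF Cinf_dir_deriv[OF tr_smooth[OF W(1) r]]]) (use b fbasis(4)[OF fd] W(4) in auto)
    qed
    have trW: "tr r p y \<in> cmap M p ` ?W" if "y \<in> cmap M r ` ?W" for y using that r by auto
    have strW: "Cinf_on E (cmap M r ` ?W) (tr r p)"
      by (rule Cinf_subset[OF tr_smooth[OF r W(1)]]) (use W(4) in auto)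
    have "Cinf_on E (cmap M r ` ?W) (\<lambda>y. \<Sum>b\<in>fbasis E. coord E b (vf_rep M p X (tr r p y)) *\<^sub>R D p r (tr r p y) b)"
      by (rule Cinf_compose[OF sub o2 fd o1 strW trW G])
    moreover have "(\<Sum>b\<in>fbasis E. coord E b (vf_rep M p X (tr r p y)) *\<^sub>R D p r (tr r p y) b) = vf_rep M r X y"
      if y: "y \<in> cmap M r ` ?W" for y
    proof -
      obtain s where s: "s \<in> W" "s \<in> cdom M r" "y = cmap M r s" using y by blast
      have sp: "s \<in> cdom M p" using s W(4) by blast
      have XE: "X s \<in> E" using X(1)[OF cdom_points[OF r s(2)]] .
      show ?thesis
        using blin_on_expand[OF fd D_blin[OF W(1) r sp s(2)] vf_rep_E[of p s X, OF W(1) sp XE]] vf_rep_change[of p r s X, OF W(1) r sp s(2) XE] s r sp by simp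
    qed
    ultimately have "Cinf_on E (cmap M r ` ?W) (vf_rep M r X)" using Cinf_cong[OF sub o2] by blast
    then show "\<exists>T. openin (top_of_set E) T \<and> x \<in> T \<and> Cinf_on E T (vf_rep M r X)"
      using o2 q W(3) by blast
  qed
  then show ?thesis unfolding vector_fields_def using X by (simp add: img_def)
qed

lemma smooth_functionD:
  assumes "f \<in> smooth_functions M" "p \<in> points M"
  shows "Cinf_on E (img p) (\<lambda>x. f (cinv M p x))"
  using assms by (auto simp: smooth_functions_def smooth_map_def standard_manifold_def img_def o_def)

text \<open>Smoothness near each point in one chart passes to all charts through the transition
  maps, and continuity on the manifold is recovered from the coordinate functions.\<close>

lemma smooth_functionI:
  assumes loc: "\<And>q. q \<in> points M \<Longrightarrow> \<exists>p W. p \<in> points M \<and> openin (mtop M) W \<and> q \<in> W \<and> W \<subseteq> cdom M p \<and>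
      Cinf_on E (cmap M p ` W) (\<lambda>x. f (cinv M p x) :: real)"
  shows "f \<in> smooth_functions M"
proof -
  have "Cinf_on E (img r) (\<lambda>x. f (cinv M r x))" if r: "r \<in> points M" for r
  proof (rule Cinf_local[OF sub chart(3)[OF r]])
    fix x assume "x \<in> img r"
    then obtain q where q: "q \<in> cdom M r" "x = cmap M r q" by (auto simp: img_def)
    have qp: "q \<in> points M" using cdom_points[OF r q(1)] .
    obtain p W where W: "p \<in> points M" "openin (mtop M) W" "q \<in> W" "W \<subseteq> cdom M p" "Cinf_on E (cmap M p ` W) (\<lambda>x. f (cinv M p x))"
      using loc[OF qp] by blast
    let ?W = "W \<inter> cdom M r"
    have Wo: "openin (mtop M) ?W" using W(2) chart(2)[OF r] by blast
    have o1: "openin (top_of_set E) (cmap M p ` ?W)" by (rule open_cmap_image[OF W(1) Wo]) (use W in blast)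
    have o2: "openin (top_of_set E) (cmap M r ` ?W)" by (rule open_cmap_image[OF r Wo]) blast
    have rep: "Cinf_on E (cmap M p ` ?W) (\<lambda>x. f (cinv M p x))" by (rule Cinf_subset[OF W(5)]) blast
    have trW: "tr r p y \<in> cmap M p ` ?W" if "y \<in> cmap M r ` ?W" for y using that r by auto
    have strW: "Cinf_on E (cmap M r ` ?W) (tr r p)"
      by (rule Cinf_subset[OF tr_smooth[OF r W(1)]]) (use W(4) in auto)
    have c: "Cinf_on E (cmap M r ` ?W) (\<lambda>y. f (cinv M p (tr r p y)))"
      by (rule Cinf_compose[OF sub o2 fd o1 strW trW rep])
    have "Cinf_on E (cmap M r ` ?W) (\<lambda>x. f (cinv M r x))"
      by (rule Cinf_cong[OF sub o2 c]) (use r W(1,4) in auto)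
    then show "\<exists>T. openin (top_of_set E) T \<and> x \<in> T \<and> Cinf_on E T (\<lambda>x. f (cinv M r x))"
      using o2 q W(3) by blast
  qed
  note s = this
  have "continuous_map (mtop M) euclidean f"
    unfolding continuous_map_def
  proof (intro conjI allI impI)
    fix U :: "real set" assume U: "openin euclidean U"
    show "openin (mtop M) {x \<in> points M. f x \<in> U}"
    proof (subst openin_subopen, intro ballI)
      fix q assume q: "q \<in> {x \<in> points M. f x \<in> U}"
      then have qp: "q \<in> points M" by simp
      let ?T = "img q \<inter> (\<lambda>x. f (cinv M q x)) -` U"
      have "openin (top_of_set (img q)) ?T"
        using Ck_continuous[OF Cinf_Ck[OF s[OF qp], of 0]] U by (intro continuous_openin_preimage_gen) simp_all
      then have "openin (top_of_set E) ?T" using chart(3)[OF qp] openin_trans by blast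
      from open_cmap_vimage[OF qp this]
      show "\<exists>T. openin (mtop M) T \<and> q \<in> T \<and> T \<subseteq> {x \<in> points M. f x \<in> U}"
        using q chart(1,5)[OF qp] qp by (intro exI[of _ "{r \<in> cdom M q. cmap M q r \<in> ?T}"]) auto
    qed
  qed simp
  then show ?thesis using s by (auto simp: smooth_functions_def smooth_map_def standard_manifold_def img_def o_def)
qed

end

section \<open>Smooth functions and vector fields: algebra, locality and extension by zero\<close>

context smooth_mfd begin

lemma smooth_function_const: "(\<lambda>_. c) \<in> smooth_functions M"
proof (rule smooth_functionI)
  fix q assume q: "q \<in> points M"
  have "Cinf_on E (cmap M q ` cdom M q) (\<lambda>x. c)"
    using Cinf_const[OF sub chart(3)[OF q]] by (simp add: img_def)
  then show "\<exists>p W. p \<in> points M \<and> openin (mtop M) W \<and> q \<in> W \<and> W \<subseteq> cdom M p \<and> Cinf_on E (cmap M p ` W) (\<lambda>x. c)"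
    using chart(1,2)[OF q] q by blast
qed

lemma smooth_function_chartI:
  assumes "\<And>p. p \<in> points M \<Longrightarrow> Cinf_on E (img p) (\<lambda>x. f (cinv M p x))"
  shows "f \<in> smooth_functions M"
proof (rule smooth_functionI)
  fix q assume q: "q \<in> points M"
  then show "\<exists>p W. p \<in> points M \<and> openin (mtop M) W \<and> q \<in> W \<and> W \<subseteq> cdom M p \<and> Cinf_on E (cmap M p ` W) (\<lambda>x. f (cinv M p x))"
    using chart(1,2)[OF q] assms[OF q, unfolded img_def] by blast
qed

lemma smooth_function_diff: "f \<in> smooth_functions M \<Longrightarrow> g \<in> smooth_functions M \<Longrightarrow> (\<lambda>p. f p - g p) \<in> smooth_functions M"
  by (rule smooth_function_chartI) (rule Cinf_diff[OF sub chart(3)], auto intro: smooth_functionD)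

lemma smooth_function_mult: "f \<in> smooth_functions M \<Longrightarrow> g \<in> smooth_functions M \<Longrightarrow> (\<lambda>p. f p * g p) \<in> smooth_functions M"
  by (rule smooth_function_chartI) (rule Cinf_mult[OF sub chart(3)], auto intro: smooth_functionD)

lemma smooth_function_prod:
  assumes "\<And>i. i \<in> I \<Longrightarrow> f i \<in> smooth_functions M"
  shows "(\<lambda>p. \<Prod>i\<in>I. f i p) \<in> smooth_functions M"
  using assms by (induction I rule: infinite_finite_induct) (auto intro: smooth_function_const smooth_function_mult)

lemma vf_rep_add_scale:
  assumes "p \<in> points M" "q \<in> cdom M p" "X q \<in> E" "Y q \<in> E"
  shows "vf_rep M p (\<lambda>q. f q *\<^sub>R X q + Y q) (cmap M p q) = f q *\<^sub>R vf_rep M p X (cmap M p q) + vf_rep M p Y (cmap M p q)"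
proof -
  have q: "q \<in> points M" using assms cdom_points by blast
  note L = D_blin[OF q assms(1) chart(1)[OF q] assms(2)]
  show ?thesis
    using assms by (simp add: vf_rep_cmap[OF assms(1,2)] blin_onD(1)[OF L subspace_scale[OF sub]] blin_onD(2)[OF L])
qed

lemma vector_field_chartI:
  assumes X: "\<And>p. p \<in> points M \<Longrightarrow> X p \<in> E" "\<And>p. p \<notin> points M \<Longrightarrow> X p = 0"
    and "\<And>p. p \<in> points M \<Longrightarrow> Cinf_on E (img p) (vf_rep M p X)"
  shows "X \<in> vector_fields M"
  using assms unfolding vector_fields_def img_def by auto

lemma vector_field_scale_add:
  assumes f: "f \<in> smooth_functions M" and X: "X \<in> vector_fields M" and Y: "Y \<in> vector_fields M"
  shows "(\<lambda>p. f p *\<^sub>R X p + Y p) \<in> vector_fields M"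
proof (rule vector_field_chartI)
  fix p assume p: "p \<in> points M"
  show "f p *\<^sub>R X p + Y p \<in> E"
    by (intro subspace_add[OF sub] subspace_scale[OF sub] vector_fieldD(1)[OF X p] vector_fieldD(1)[OF Y p])
  have c: "Cinf_on E (img p) (\<lambda>x. f (cinv M p x) *\<^sub>R vf_rep M p X x + vf_rep M p Y x)"
    by (intro Cinf_add[OF sub chart(3)[OF p]] Cinf_scaleR[OF sub chart(3)[OF p]] smooth_functionD[OF f p]
        vector_fieldD(2)[OF X p] vector_fieldD(2)[OF Y p])
  show "Cinf_on E (img p) (vf_rep M p (\<lambda>p. f p *\<^sub>R X p + Y p))"
  proof (rule Cinf_cong[OF sub chart(3)[OF p] c])
    fix x assume "x \<in> img p"
    then obtain q where q: "q \<in> cdom M p" "x = cmap M p q" by (auto simp: img_def)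
    have qp: "q \<in> points M" using cdom_points[OF p q(1)] .
    show "f (cinv M p x) *\<^sub>R vf_rep M p X x + vf_rep M p Y x = vf_rep M p (\<lambda>p. f p *\<^sub>R X p + Y p) x"
      using vf_rep_add_scale[of p q X Y f, OF p q(1) vector_fieldD(1)[OF X qp] vector_fieldD(1)[OF Y qp]] q p by simp
  qed
qed (use vector_fieldD(3)[OF X] vector_fieldD(3)[OF Y] in simp)

lemma vector_field_zero: "(\<lambda>_. 0) \<in> vector_fields M"
proof (rule vector_field_chartI)
  fix p assume p: "p \<in> points M"
  show "Cinf_on E (img p) (vf_rep M p (\<lambda>_. 0))"
  proof (rule Cinf_cong[OF sub chart(3)[OF p] Cinf_const[OF sub chart(3)[OF p], of 0]])
    fix x assume "x \<in> img p"
    then obtain q where q: "q \<in> cdom M p" "x = cmap M p q" by (auto simp: img_def)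
    have qp: "q \<in> points M" using cdom_points[OF p q(1)] .
    show "0 = vf_rep M p (\<lambda>_. 0) x"
      using q p qp blin_on_zero[OF D_blin[OF qp p chart(1)[OF qp] q(1)] sub] by (simp add: vf_rep_cmap)
  qed
qed (use subspace_0[OF sub] in auto)

lemma vector_field_add: "X \<in> vector_fields M \<Longrightarrow> Y \<in> vector_fields M \<Longrightarrow> (\<lambda>p. X p + Y p) \<in> vector_fields M"
  using vector_field_scale_add[OF smooth_function_const[of 1]] by simp

lemma vector_field_scale: "f \<in> smooth_functions M \<Longrightarrow> X \<in> vector_fields M \<Longrightarrow> (\<lambda>p. f p *\<^sub>R X p) \<in> vector_fields M"
  using vector_field_scale_add[OF _ _ vector_field_zero] by simp

lemma vector_field_sum:
  assumes "\<And>i. i \<in> I \<Longrightarrow> X i \<in> vector_fields M"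
  shows "(\<lambda>p. \<Sum>i\<in>I. X i p) \<in> vector_fields M"
  using assms by (induction I rule: infinite_finite_induct) (auto intro: vector_field_zero vector_field_add)

lemma vector_field_local:
  assumes "\<And>p. p \<notin> points M \<Longrightarrow> X p = 0"
    and loc: "\<And>q. q \<in> points M \<Longrightarrow> \<exists>W Y. openin (mtop M) W \<and> q \<in> W \<and> Y \<in> vector_fields M \<and> (\<forall>r\<in>W. X r = Y r)"
  shows "X \<in> vector_fields M"
proof (rule vector_fieldI)
  show "X p \<in> E" if "p \<in> points M" for p using loc[OF that] vector_fieldD(1) that by metis
  fix q assume q: "q \<in> points M"
  obtain W Y where W: "openin (mtop M) W" "q \<in> W" "Y \<in> vector_fields M" "\<forall>r\<in>W. X r = Y r" using loc[OF q] by blast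
  let ?W = "W \<inter> cdom M q"
  have o: "openin (mtop M) ?W" using W(1) chart(2)[OF q] by blast
  have o2: "openin (top_of_set E) (cmap M q ` ?W)" by (rule open_cmap_image[OF q o]) blast
  have "Cinf_on E (cmap M q ` ?W) (vf_rep M q X)"
  proof (rule Cinf_cong[OF sub o2])
    show "Cinf_on E (cmap M q ` ?W) (vf_rep M q Y)"
      by (rule Cinf_subset[OF vector_fieldD(2)[OF W(3) q]]) (auto simp: img_def)
    show "vf_rep M q Y x = vf_rep M q X x" if "x \<in> cmap M q ` ?W" for x
      using that W(4) q by (auto simp: vf_rep_cmap)
  qed
  then show "\<exists>p W. p \<in> points M \<and> openin (mtop M) W \<and> q \<in> W \<and> W \<subseteq> cdom M p \<and> Cinf_on E (cmap M p ` W) (vf_rep M p X)"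
    using q o W(2) chart(1)[OF q] by blast
qed (use assms(1) in blast)

text \<open>The Hausdorff property enters here. It makes the complement of a compact support open,
  which is what extension by zero needs.\<close>

lemma chart_compact_closed:
  assumes p: "p \<in> points M" and K: "compact K" "K \<subseteq> img p"
  shows "closedin (mtop M) (cinv M p ` K)"
  by (rule compactin_imp_closedin[OF hausdorff compactin_cinv_image[OF p K]])

lemma compact_support_subset:
  assumes p: "p \<in> points M" and K: "compact K" "K \<subseteq> img p" and f: "\<And>q. q \<in> points M \<Longrightarrow> f q \<noteq> 0 \<Longrightarrow> q \<in> cinv M p ` K"
  shows "(mtop M) closure_of {q \<in> points M. f q \<noteq> 0} \<subseteq> cinv M p ` K" "compact_support M f"
proof -
  show 1: "(mtop M) closure_of {q \<in> points M. f q \<noteq> 0} \<subseteq> cinv M p ` K"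
    by (rule closure_of_minimal[OF _ chart_compact_closed[OF p K]]) (use f in blast)
  show "compact_support M f" unfolding compact_support_def
    by (rule closed_compactin[OF compactin_cinv_image[OF p K] 1]) simp
qed

definition extend_fun :: "'m \<Rightarrow> 'e set \<Rightarrow> ('e \<Rightarrow> real) \<Rightarrow> 'm \<Rightarrow> real" where
  "extend_fun p T h q = (if q \<in> cdom M p \<and> cmap M p q \<in> T then h (cmap M p q) else 0)"

text \<open>The field \<open>w\<close> is given in the chart at \<open>p\<close>, so each value is
  first converted to the chart chosen at the point \<open>q\<close> where it is placed.\<close>

definition extend_vf :: "'m \<Rightarrow> 'e set \<Rightarrow> ('e \<Rightarrow> 'e) \<Rightarrow> 'm \<Rightarrow> 'e" where
  "extend_vf p T w q = (if q \<in> cdom M p \<and> cmap M p q \<in> T then D p q (cmap M p q) (w (cmap M p q)) else 0)"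

context
  fixes p T K
  assumes p: "p \<in> points M" and T: "openin (top_of_set E) T" "T \<subseteq> img p" and K: "compact K" "K \<subseteq> T"
begin

lemma open_outside: "openin (mtop M) (points M - cinv M p ` K)"
  by (rule openin_diff[OF openin_topspace chart_compact_closed[OF p K(1) order_trans[OF K(2) T(2)]]])

lemma in_cinv_K: "q \<in> cdom M p \<Longrightarrow> cmap M p q \<in> K \<Longrightarrow> q \<in> cinv M p ` K"
  using p by (metis cinv_cmap imageI)

text \<open>These are the two open sets on which an extension by zero is visibly smooth: the
  coordinate domain of the given data, and the complement of the compact support.\<close>

lemma extend_cases:
  assumes q: "q \<in> points M"
  obtains "q \<in> cdom M p" "cmap M p q \<in> T" | "q \<in> points M - cinv M p ` K"
proof (cases "q \<in> cinv M p ` K")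
  case True
  then obtain x where "x \<in> K" "q = cinv M p x" by blast
  moreover have "x \<in> T" "x \<in> img p" using calculation K(2) T(2) by auto
  ultimately show ?thesis using that(1) by simp
qed (use that(2) q in blast)

lemma extend_fun:
  assumes h: "Cinf_on E T h" "\<And>x. x \<in> T - K \<Longrightarrow> h x = 0"
  shows "extend_fun p T h \<in> smooth_functions M" "q \<notin> cinv M p ` K \<Longrightarrow> extend_fun p T h q = 0"
    "extend_fun p T h \<in> smooth_functions_cc M"
proof -
  show zero: "extend_fun p T h q = 0" if "q \<notin> cinv M p ` K" for q
    using that h(2) in_cinv_K by (auto simp: extend_fun_def)
  show sm: "extend_fun p T h \<in> smooth_functions M"
  proof (rule smooth_functionI)
    fix q assume q: "q \<in> points M"
    show "\<exists>r W. r \<in> points M \<and> openin (mtop M) W \<and> q \<in> W \<and> W \<subseteq> cdom M r \<and> Cinf_on E (cmap M r ` W) (\<lambda>x. extend_fun p T h (cinv M r x))"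
    proof (cases rule: extend_cases[OF q])
      case 1
      let ?W = "{q \<in> cdom M p. cmap M p q \<in> T}"
      have oW: "openin (mtop M) ?W" by (rule open_cmap_vimage[OF p T(1)])
      have "openin (top_of_set E) (cmap M p ` ?W)" by (rule open_cmap_image[OF p oW]) blast
      then have "Cinf_on E (cmap M p ` ?W) (\<lambda>x. extend_fun p T h (cinv M p x))"
        by (rule Cinf_cong[OF sub _ Cinf_subset[OF h(1)]]) (use p in \<open>auto simp: extend_fun_def\<close>)
      then show ?thesis using p oW 1 by blast
    next
      case 2
      let ?W = "(points M - cinv M p ` K) \<inter> cdom M q"
      have oW: "openin (mtop M) ?W" using open_outside chart(2)[OF q] by blast
      have o2: "openin (top_of_set E) (cmap M q ` ?W)" by (rule open_cmap_image[OF q oW]) blast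
      have "Cinf_on E (cmap M q ` ?W) (\<lambda>x. extend_fun p T h (cinv M q x))"
        by (rule Cinf_cong[OF sub o2 Cinf_const[OF sub o2, of 0]]) (use q zero in auto)
      then show ?thesis using q oW 2 chart(1)[OF q] by blast
    qed
  qed
  have "compact_support M (extend_fun p T h)"
    by (rule compact_support_subset(2)[OF p K(1)]) (use K(2) T(2) zero in auto)
  then show "extend_fun p T h \<in> smooth_functions_cc M" using sm by (simp add: smooth_functions_cc_def)
qed

lemma extend_vf:
  assumes w: "Cinf_on E T w" "\<And>x. x \<in> T \<Longrightarrow> w x \<in> E" "\<And>x. x \<in> T - K \<Longrightarrow> w x = 0"
  shows "extend_vf p T w \<in> vector_fields M" "q \<notin> cinv M p ` K \<Longrightarrow> extend_vf p T w q = 0"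
    "x \<in> T \<Longrightarrow> vf_rep M p (extend_vf p T w) x = w x"
proof -
  show zero: "extend_vf p T w q = 0" if "q \<notin> cinv M p ` K" for q
  proof (cases "q \<in> cdom M p \<and> cmap M p q \<in> T")
    case True
    then have "w (cmap M p q) = 0" using that w(3) in_cinv_K by blast
    moreover have qp: "q \<in> points M" using True cdom_points[OF p] by blast
    ultimately show ?thesis
      using blin_on_zero[OF D_blin[OF p qp _ chart(1)[OF qp]] sub] True by (simp add: extend_vf_def)
  qed (auto simp: extend_vf_def)
  have inE: "extend_vf p T w q \<in> E" if "q \<in> points M" for q
    using that w(2) chart(1)[OF that] by (auto simp: extend_vf_def subspace_0[OF sub] intro!: D_in[OF p that])
  show rep: "vf_rep M p (extend_vf p T w) x = w x" if x: "x \<in> T" for x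
  proof -
    obtain q where q: "q \<in> cdom M p" "x = cmap M p q" using x T(2) by (auto simp: img_def)
    have qp: "q \<in> points M" using cdom_points[OF p q(1)] .
    show ?thesis using q x w(2)[OF x] D_comp[OF p qp p q(1) chart(1)[OF qp] q(1)] D_id[OF p q(1)]
      by (simp add: vf_rep_cmap[OF p] extend_vf_def)
  qed
  show "extend_vf p T w \<in> vector_fields M"
  proof (rule vector_fieldI)
    show "extend_vf p T w q = 0" if "q \<notin> points M" for q
      using that cdom_points[OF p] by (auto simp: extend_vf_def)
    fix q assume q: "q \<in> points M"
    show "\<exists>r W. r \<in> points M \<and> openin (mtop M) W \<and> q \<in> W \<and> W \<subseteq> cdom M r \<and> Cinf_on E (cmap M r ` W) (vf_rep M r (extend_vf p T w))"
    proof (cases rule: extend_cases[OF q])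
      case 1
      let ?W = "{q \<in> cdom M p. cmap M p q \<in> T}"
      have oW: "openin (mtop M) ?W" by (rule open_cmap_vimage[OF p T(1)])
      have "openin (top_of_set E) (cmap M p ` ?W)" by (rule open_cmap_image[OF p oW]) blast
      then have "Cinf_on E (cmap M p ` ?W) (vf_rep M p (extend_vf p T w))"
        by (rule Cinf_cong[OF sub _ Cinf_subset[OF w(1)]]) (use rep in auto)
      then show ?thesis using p oW 1 by blast
    next
      case 2
      let ?W = "(points M - cinv M p ` K) \<inter> cdom M q"
      have oW: "openin (mtop M) ?W" using open_outside chart(2)[OF q] by blast
      have o2: "openin (top_of_set E) (cmap M q ` ?W)" by (rule open_cmap_image[OF q oW]) blast
      have "Cinf_on E (cmap M q ` ?W) (vf_rep M q (\<lambda>_. 0))"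
        by (rule Cinf_subset[OF vector_fieldD(2)[OF vector_field_zero q]]) (auto simp: img_def)
      then have "Cinf_on E (cmap M q ` ?W) (vf_rep M q (extend_vf p T w))"
        by (rule Cinf_cong[OF sub o2]) (use q zero in \<open>auto simp: vf_rep_cmap\<close>)
      then show ?thesis using q oW 2 chart(1)[OF q] by blast
    qed
  qed (use inE in auto)
qed

end

text \<open>Halving the radius of a ball inside \<open>T\<close> leaves a compact ball outside which
  the bump vanishes.\<close>

lemma chart_bump:
  assumes p: "p \<in> points M" and T: "openin (top_of_set E) T" "T \<subseteq> img p" "cmap M p p \<in> T"
  obtains \<beta> :: "'e \<Rightarrow> real" and K W where "Cinf_on E E \<beta>" "compact K" "K \<subseteq> T" "\<And>x. x \<in> T - K \<Longrightarrow> \<beta> x = 0"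
    "openin (top_of_set E) W" "cmap M p p \<in> W" "W \<subseteq> T" "\<And>x. x \<in> W \<Longrightarrow> \<beta> x = 1"
proof -
  let ?x = "cmap M p p"
  have xE: "?x \<in> E" using cmap_E[OF p chart(1)[OF p]] .
  obtain r where r: "r > 0" "\<And>y. y \<in> E \<Longrightarrow> dist y ?x < r \<Longrightarrow> y \<in> T" using T(1,3) unfolding openin_sub_iff by blast
  have r2: "r / 2 > 0" using r(1) by simp
  obtain \<beta> :: "'e \<Rightarrow> real" and \<delta> where b: "Cinf_on E E \<beta>" "\<delta> > 0" "\<And>y. y \<in> E \<Longrightarrow> dist y ?x < \<delta> \<Longrightarrow> \<beta> y = 1"
    "\<And>y. y \<in> E \<Longrightarrow> r / 2 \<le> dist y ?x \<Longrightarrow> \<beta> y = 0"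
    using bump_function[OF fd xE r2] by blast
  show ?thesis
  proof
    show "Cinf_on E E \<beta>" by fact
    show "compact (E \<inter> cball ?x (r / 2))" by (rule fd_subspace_compact_cball[OF fd])
    show "E \<inter> cball ?x (r / 2) \<subseteq> T" using r by (auto simp: dist_commute)
    show "\<beta> x = 0" if "x \<in> T - E \<inter> cball ?x (r / 2)" for x
      using that T(2) imgE[OF p] by (intro b(4)) (auto simp: dist_commute)
    show "openin (top_of_set E) (E \<inter> ball ?x (min \<delta> r))" by (auto simp: openin_open)
    show "?x \<in> E \<inter> ball ?x (min \<delta> r)" using xE b(2) r(1) by simp
    show "E \<inter> ball ?x (min \<delta> r) \<subseteq> T" using r(2) by (auto simp: dist_commute)
    show "\<beta> x = 1" if "x \<in> E \<inter> ball ?x (min \<delta> r)" for x using that b(3) by (auto simp: dist_commute)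
  qed
qed

end

section \<open>Submersions and pullback foliations\<close>

locale mfd_map = N: smooth_mfd N + M: smooth_mfd M
  for N :: "('n, 'f::real_normed_vector) manifold" and M :: "('m, 'e::real_normed_vector) manifold" +
  fixes f :: "'n \<Rightarrow> 'm"
  assumes smooth_map: "smooth_map N M f"
begin

definition rep :: "'n \<Rightarrow> 'm \<Rightarrow> 'f \<Rightarrow> 'e" where "rep n p = cmap M p \<circ> f \<circ> cinv N n"

definition rdom :: "'n \<Rightarrow> 'm \<Rightarrow> 'f set" where "rdom n p = cmap N n ` {q \<in> cdom N n. f q \<in> cdom M p}"

abbreviation "T \<equiv> tangent_map N M f"

lemma f_points: "q \<in> points N \<Longrightarrow> f q \<in> points M"
  using smooth_map by (auto simp: smooth_map_def continuous_map_def)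

lemma f_open: "openin (mtop M) U \<Longrightarrow> openin (mtop N) {q \<in> points N. f q \<in> U}"
  using smooth_map by (auto simp: smooth_map_def continuous_map_def)

lemma open_pre:
  assumes "n \<in> points N" "p \<in> points M"
  shows "openin (mtop N) {q \<in> cdom N n. f q \<in> cdom M p}"
proof -
  have "{q \<in> cdom N n. f q \<in> cdom M p} = cdom N n \<inter> {q \<in> points N. f q \<in> cdom M p}"
    using N.chart(5)[OF assms(1)] by blast
  then show ?thesis using f_open[OF M.chart(2)[OF assms(2)]] N.chart(2)[OF assms(1)] by (simp add: openin_Int)
qed

lemma rdom_open: "n \<in> points N \<Longrightarrow> p \<in> points M \<Longrightarrow> openin (top_of_set (model N)) (rdom n p)"
  unfolding rdom_def by (rule N.open_cmap_image[OF _ open_pre]) auto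

lemma rdomI: "q \<in> cdom N n \<Longrightarrow> f q \<in> cdom M p \<Longrightarrow> cmap N n q \<in> rdom n p"
  by (auto simp: rdom_def)

lemma rep_cmap [simp]: "n \<in> points N \<Longrightarrow> q \<in> cdom N n \<Longrightarrow> rep n p (cmap N n q) = cmap M p (f q)"
  by (simp add: rep_def)

lemma rep_in: "n \<in> points N \<Longrightarrow> p \<in> points M \<Longrightarrow> x \<in> rdom n p \<Longrightarrow> rep n p x \<in> M.img p"
  by (auto simp: rdom_def)

lemma rep_self: "n \<in> points N \<Longrightarrow> Cinf_on (model N) (rdom n (f n)) (rep n (f n))"
  using smooth_map by (simp add: smooth_map_def rdom_def rep_def)

text \<open>Smoothness of \<open>f\<close> is postulated only between the charts chosen at
  \<open>q\<close> and at \<open>f q\<close>. Near \<open>q\<close> the representative in arbitrary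
  charts factors through that one and two transition maps; smoothness and the chain rule for general
  charts rest on this factorisation.\<close>

lemma overlap:
  assumes n: "n \<in> points N" and p: "p \<in> points M" and q: "q \<in> cdom N n" "f q \<in> cdom M p"
  defines "W \<equiv> {r \<in> cdom N n \<inter> cdom N q. f r \<in> cdom M p \<inter> cdom M (f q)}"
  shows "openin (top_of_set (model N)) (cmap N n ` W)" "q \<in> W" "W \<subseteq> cdom N n"
    "\<And>x. x \<in> cmap N n ` W \<Longrightarrow> N.tr n q x \<in> rdom q (f q)"
    "\<And>x. x \<in> cmap N n ` W \<Longrightarrow> rep q (f q) (N.tr n q x) \<in> cmap M (f q) ` (cdom M (f q) \<inter> cdom M p)"
    "\<And>x. x \<in> cmap N n ` W \<Longrightarrow> rep n p x = M.tr (f q) p (rep q (f q) (N.tr n q x))"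
proof -
  have qp: "q \<in> points N" using N.cdom_points[OF n q(1)] .
  have fq: "f q \<in> points M" using f_points[OF qp] .
  have "W = {r \<in> cdom N n. f r \<in> cdom M p} \<inter> {r \<in> cdom N q. f r \<in> cdom M (f q)}" by (auto simp: W_def)
  then have "openin (mtop N) W" using open_pre[OF n p] open_pre[OF qp fq] by (simp add: openin_Int)
  then show "openin (top_of_set (model N)) (cmap N n ` W)"
    by (rule N.open_cmap_image[OF n]) (auto simp: W_def)
  show "q \<in> W" using q N.chart(1)[OF qp] M.chart(1)[OF fq] by (simp add: W_def)
  show "W \<subseteq> cdom N n" by (auto simp: W_def)
  show "N.tr n q x \<in> rdom q (f q)" "rep q (f q) (N.tr n q x) \<in> cmap M (f q) ` (cdom M (f q) \<inter> cdom M p)"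
    "rep n p x = M.tr (f q) p (rep q (f q) (N.tr n q x))" if "x \<in> cmap N n ` W" for x
    using that n qp fq by (auto simp: W_def intro: rdomI)
qed

lemma rep_smooth:
  assumes n: "n \<in> points N" and p: "p \<in> points M"
  shows "Cinf_on (model N) (rdom n p) (rep n p)"
proof (rule Cinf_local[OF N.sub rdom_open[OF n p]])
  fix x assume "x \<in> rdom n p"
  then obtain q where q: "q \<in> cdom N n" "f q \<in> cdom M p" "x = cmap N n q" by (auto simp: rdom_def)
  have qp: "q \<in> points N" using N.cdom_points[OF n q(1)] .
  have fq: "f q \<in> points M" using f_points[OF qp] .
  note o = overlap[OF n p q(1,2)]
  let ?W = "{r \<in> cdom N n \<inter> cdom N q. f r \<in> cdom M p \<inter> cdom M (f q)}"
  have t: "Cinf_on (model N) (cmap N n ` ?W) (N.tr n q)"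
    by (rule Cinf_subset[OF N.tr_smooth[OF n qp]]) auto
  have r: "Cinf_on (model N) (cmap N n ` ?W) (\<lambda>x. rep q (f q) (N.tr n q x))"
    by (rule Cinf_compose[OF N.sub o(1) N.fd rdom_open[OF qp fq] t o(4) rep_self[OF qp]])
  have "Cinf_on (model N) (cmap N n ` ?W) (\<lambda>x. M.tr (f q) p (rep q (f q) (N.tr n q x)))"
    by (rule Cinf_compose[OF N.sub o(1) M.fd M.open_overlap[OF fq p] r o(5) M.tr_smooth[OF fq p]])
  then have "Cinf_on (model N) (cmap N n ` ?W) (rep n p)"
    by (rule Cinf_cong[OF N.sub o(1)]) (simp add: o(6))
  then show "\<exists>T. openin (top_of_set (model N)) T \<and> x \<in> T \<and> Cinf_on (model N) T (rep n p)"
    using o(1,2) q(3) by blast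
qed

lemma T_rep: "T q v = dir_deriv (rep q (f q)) (cmap N q q) v"
  by (simp add: tangent_map_def rep_def)

lemma rep_E: "n \<in> points N \<Longrightarrow> p \<in> points M \<Longrightarrow> x \<in> rdom n p \<Longrightarrow> rep n p x \<in> model M"
  using rep_in M.imgE by blast

lemma self_rdom: "q \<in> points N \<Longrightarrow> cmap N q q \<in> rdom q (f q)"
  by (intro rdomI N.chart(1) M.chart(1) f_points)

lemma T_in: "q \<in> points N \<Longrightarrow> v \<in> model N \<Longrightarrow> T q v \<in> model M"
  unfolding T_rep
  by (rule dir_deriv_in_subspace[OF N.sub rdom_open M.fd Cinf_Ck[OF rep_self, of _ "Suc 0"] rep_E self_rdom])
    (auto simp: f_points)

lemma T_blin: "q \<in> points N \<Longrightarrow> blin_on (model N) (T q)"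
  unfolding T_rep[abs_def]
  by (rule blin_on_dir_deriv[OF N.fd rdom_open Cinf_Ck[OF rep_self, of _ "Suc 0"] self_rdom]) (auto simp: f_points)

lemma rep_deriv:
  assumes n: "n \<in> points N" and p: "p \<in> points M" and q: "q \<in> cdom N n" "f q \<in> cdom M p" and v: "v \<in> model N"
  shows "dir_deriv (rep n p) (cmap N n q) v = M.D (f q) p (cmap M (f q) (f q)) (T q (N.D n q (cmap N n q) v))"
proof -
  have qp: "q \<in> points N" using N.cdom_points[OF n q(1)] .
  have fq: "f q \<in> points M" using f_points[OF qp] .
  note o = overlap[OF n p q(1,2)]
  let ?W = "{r \<in> cdom N n \<inter> cdom N q. f r \<in> cdom M p \<inter> cdom M (f q)}"
  let ?x = "cmap N n q"
  have x: "?x \<in> cmap N n ` ?W" using o(2) by blast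
  have t: "Cinf_on (model N) (cmap N n ` ?W) (N.tr n q)"
    by (rule Cinf_subset[OF N.tr_smooth[OF n qp]]) auto
  have r: "Cinf_on (model N) (cmap N n ` ?W) (\<lambda>x. rep q (f q) (N.tr n q x))"
    by (rule Cinf_compose[OF N.sub o(1) N.fd rdom_open[OF qp fq] t o(4) rep_self[OF qp]])
  have "dir_deriv (rep n p) ?x v = dir_deriv (\<lambda>x. M.tr (f q) p (rep q (f q) (N.tr n q x))) ?x v"
    by (rule dir_deriv_cong[OF N.sub o(1) x v o(6)])
  also have "\<dots> = dir_deriv (M.tr (f q) p) (rep q (f q) (N.tr n q ?x)) (dir_deriv (\<lambda>x. rep q (f q) (N.tr n q x)) ?x v)"
    by (rule dir_deriv_compose[OF N.sub o(1) M.fd M.open_overlap[OF fq p] Cinf_Ck[OF r, of "Suc 0"] o(5) Cinf_Ck[OF M.tr_smooth[OF fq p], of "Suc 0"] x v])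
  also have "dir_deriv (\<lambda>x. rep q (f q) (N.tr n q x)) ?x v = dir_deriv (rep q (f q)) (N.tr n q ?x) (dir_deriv (N.tr n q) ?x v)"
    by (rule dir_deriv_compose[OF N.sub o(1) N.fd rdom_open[OF qp fq] Cinf_Ck[OF t, of "Suc 0"] o(4) Cinf_Ck[OF rep_self[OF qp], of "Suc 0"] x v])
  finally show ?thesis using n q qp N.chart(1)[OF qp] by (simp add: T_rep M.D_def N.D_def)
qed

lemma rep_deriv_self:
  assumes n: "n \<in> points N" and v: "v \<in> model N"
  shows "dir_deriv (rep n (f n)) (cmap N n n) v = T n v"
  by (simp add: T_rep)

text \<open>The weight \<open>N.extend_fun n S \<beta>\<close> is a function on \<open>N\<close>, so
  the cut off field need not be projectable. It is only an ingredient that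
  \<open>global_lift\<close> glues to a projectable field.\<close>

lemma lift_field:
  assumes n: "n \<in> points N" and p: "p \<in> points M" and S: "openin (top_of_set (model N)) S" "S \<subseteq> rdom n p"
    and K: "compact K" "K \<subseteq> S" and \<beta>: "Cinf_on (model N) (model N) \<beta>" "\<And>x. x \<in> S - K \<Longrightarrow> \<beta> x = 0"
    and w: "Cinf_on (model N) S w" "\<And>x. x \<in> S \<Longrightarrow> w x \<in> model N"
    and X: "X \<in> vector_fields M" "\<And>x. x \<in> S \<Longrightarrow> dir_deriv (rep n p) x (w x) = vf_rep M p X (rep n p x)"
  shows "N.extend_vf n S (\<lambda>x. \<beta> x *\<^sub>R w x) \<in> vector_fields N"
    "q \<in> points N \<Longrightarrow> T q (N.extend_vf n S (\<lambda>x. \<beta> x *\<^sub>R w x) q) = N.extend_fun n S \<beta> q *\<^sub>R X (f q)"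
    "N.extend_fun n S \<beta> \<in> smooth_functions_cc N"
proof -
  have SE: "S \<subseteq> model N" using S(1) openin_imp_subset by blast
  have Simg: "S \<subseteq> N.img n" using S(2) by (auto simp: rdom_def N.img_def)
  have b: "Cinf_on (model N) S \<beta>" by (rule Cinf_subset[OF \<beta>(1) SE])
  show "N.extend_vf n S (\<lambda>x. \<beta> x *\<^sub>R w x) \<in> vector_fields N"
    by (rule N.extend_vf(1)[OF n S(1) Simg K Cinf_scaleR[OF N.sub S(1) b w(1)]])
      (use w(2) \<beta>(2) in \<open>auto intro: subspace_scale[OF N.sub]\<close>)
  show "N.extend_fun n S \<beta> \<in> smooth_functions_cc N"
    by (rule N.extend_fun(3)[OF n S(1) Simg K b \<beta>(2)])
  assume q: "q \<in> points N"
  show "T q (N.extend_vf n S (\<lambda>x. \<beta> x *\<^sub>R w x) q) = N.extend_fun n S \<beta> q *\<^sub>R X (f q)"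
  proof (cases "q \<in> cdom N n \<and> cmap N n q \<in> S")
    case False
    then show ?thesis using blin_on_zero[OF T_blin[OF q] N.sub] by (auto simp: N.extend_vf_def N.extend_fun_def)
  next
    case True
    let ?x = "cmap N n q"
    have fq: "f q \<in> points M" using f_points[OF q] .
    have fqp: "f q \<in> cdom M p"
    proof -
      obtain r where "r \<in> cdom N n" "f r \<in> cdom M p" "?x = cmap N n r" using True S(2) by (auto simp: rdom_def)
      then show ?thesis using True N.inj_cmap[OF n] by (metis inj_onD)
    qed
    have wN: "w ?x \<in> model N" using w(2) True by blast
    let ?v = "N.D n q ?x (w ?x)"
    have vN: "?v \<in> model N" using N.D_in[OF n q _ N.chart(1)[OF q] wN] True by blast
    have XE: "X (f q) \<in> model M" using M.vector_fieldD(1)[OF X(1) fq] .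
    have "M.D (f q) p (cmap M (f q) (f q)) (T q ?v) = vf_rep M p X (cmap M p (f q))"
      using rep_deriv[OF n p _ fqp wN] X(2)[of ?x] True n by simp
    then have "M.D p (f q) (cmap M p (f q)) (M.D (f q) p (cmap M (f q) (f q)) (T q ?v)) = X (f q)"
      using M.vf_rep_inverse[of p "f q" X, OF p fqp XE] by simp
    then have Tv: "T q ?v = X (f q)"
      using M.D_comp[OF fq p fq M.chart(1)[OF fq] fqp M.chart(1)[OF fq] T_in[OF q vN]]
        M.D_id[OF fq M.chart(1)[OF fq] T_in[OF q vN]] by simp
    have "N.extend_vf n S (\<lambda>x. \<beta> x *\<^sub>R w x) q = \<beta> ?x *\<^sub>R ?v"
      using True blin_onD(2)[OF N.D_blin[OF n q _ N.chart(1)[OF q]] wN] by (simp add: N.extend_vf_def)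
    then show ?thesis
      using True Tv blin_onD(2)[OF T_blin[OF q] vN] by (simp add: N.extend_fun_def)
  qed
qed

end

locale submersion = mfd_map N M f for N :: "('n, 'f::real_normed_vector) manifold" and M :: "('m, 'e::real_normed_vector) manifold" and f +
  assumes surj_points: "f ` points N = points M" and surj_T: "\<And>q. q \<in> points N \<Longrightarrow> T q ` model N = model M"
begin

lemma rep_surj: "n \<in> points N \<Longrightarrow> dir_deriv (rep n (f n)) (cmap N n n) ` model N = model M"
  using surj_T[of n] unfolding T_rep[abs_def] by simp

lemma submersion_charts:
  assumes n: "n \<in> points N"
  obtains S L S2 s where "openin (top_of_set (model N)) S" "S \<subseteq> rdom n (f n)" "cmap N n n \<in> S"
    "\<And>w. w \<in> model M \<Longrightarrow> Cinf_on (model N) S (\<lambda>x. L x w)"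
    "\<And>x. x \<in> S \<Longrightarrow> blin_on (model M) (L x)"
    "\<And>x w. x \<in> S \<Longrightarrow> w \<in> model M \<Longrightarrow> L x w \<in> model N"
    "\<And>x w. x \<in> S \<Longrightarrow> w \<in> model M \<Longrightarrow> dir_deriv (rep n (f n)) x (L x w) = w"
    "openin (top_of_set (model M)) S2" "cmap M (f n) (f n) \<in> S2" "Cinf_on (model M) S2 s" "s (cmap M (f n) (f n)) = cmap N n n"
    "\<And>y. y \<in> S2 \<Longrightarrow> s y \<in> S" "\<And>y. y \<in> S2 \<Longrightarrow> rep n (f n) (s y) = y"
    "\<And>y w. y \<in> S2 \<Longrightarrow> w \<in> model M \<Longrightarrow> dir_deriv s y w = L (s y) w"
    "\<And>k. k \<in> model N \<Longrightarrow> T n k = 0 \<Longrightarrow>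
       \<exists>\<kappa>. Cinf_on (model N) S \<kappa> \<and> (\<forall>x\<in>S. \<kappa> x \<in> model N \<and> dir_deriv (rep n (f n)) x (\<kappa> x) = 0) \<and> \<kappa> (cmap N n n) = k"
    "\<And>x x'. x \<in> S \<Longrightarrow> x' \<in> S \<Longrightarrow> rep n (f n) x = rep n (f n) x' \<Longrightarrow> \<exists>c. c 0 = x \<and> c 1 = x' \<and>
       (\<forall>t\<in>{0..1::real}. c t \<in> S \<and> rep n (f n) (c t) = rep n (f n) x \<and>
          (\<exists>d>0. \<forall>s. \<bar>s - t\<bar> < d \<longrightarrow> c s \<in> S) \<and>
          (\<exists>c'\<in>model N. (c has_vector_derivative c') (at t) \<and> dir_deriv (rep n (f n)) (c t) c' = 0))"
proof -
  have fn: "f n \<in> points M" using f_points[OF n] .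
  have r: "rep n (f n) (cmap N n n) = cmap M (f n) (f n)" using n N.chart(1) by simp
  show ?thesis
    apply (rule submersion_local_structure[OF N.fd M.fd rdom_open[OF n fn] rep_smooth[OF n fn] rep_E[OF n fn] self_rdom[OF n] rep_surj[OF n],
          unfolded r T_rep[symmetric]])
     apply assumption
    subgoal for S L S2 s by (rule that[of S L S2 s]) assumption+
    done
qed

text \<open>The operators \<open>L x\<close> are known to be smooth only at fixed vectors; expanding
  the varying vector in the basis of the model space gives the rest.\<close>

lemma lift_rep_smooth:
  assumes n: "n \<in> points N" and S: "openin (top_of_set (model N)) S" "S \<subseteq> rdom n (f n)"
    and L: "\<And>w. w \<in> model M \<Longrightarrow> Cinf_on (model N) S (\<lambda>x. L x w)" "\<And>x. x \<in> S \<Longrightarrow> blin_on (model M) (L x)"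
    and X: "X \<in> vector_fields M"
  shows "Cinf_on (model N) S (\<lambda>x. L x (vf_rep M (f n) X (rep n (f n) x)))"
    "x \<in> S \<Longrightarrow> vf_rep M (f n) X (rep n (f n) x) \<in> model M"
proof -
  have fn: "f n \<in> points M" using f_points[OF n] .
  have E: "vf_rep M (f n) X (rep n (f n) x) \<in> model M" if xS: "x \<in> S" for x
  proof -
    obtain q where q: "q \<in> cdom N n" "f q \<in> cdom M (f n)" "x = cmap N n q" using xS S(2) by (auto simp: rdom_def)
    show ?thesis using M.vf_rep_E[of "f n" "f q" X, OF fn q(2)] M.vector_fieldD(1)[OF X] f_points N.cdom_points[OF n q(1)] q n by simp
  qed
  then show "x \<in> S \<Longrightarrow> vf_rep M (f n) X (rep n (f n) x) \<in> model M" .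
  have r: "Cinf_on (model N) S (rep n (f n))" by (rule Cinf_subset[OF rep_smooth[OF n fn] S(2)])
  have rX: "Cinf_on (model N) S (\<lambda>x. vf_rep M (f n) X (rep n (f n) x))"
    by (rule Cinf_compose[OF N.sub S(1) M.fd M.chart(3)[OF fn] r _ M.vector_fieldD(2)[OF X fn]])
      (use rep_in[OF n fn] S(2) in blast)
  have "Cinf_on (model N) S (\<lambda>x. \<Sum>b\<in>fbasis (model M). coord (model M) b (vf_rep M (f n) X (rep n (f n) x)) *\<^sub>R L x b)"
  proof (rule Cinf_sum[OF N.sub S(1)], rule Cinf_scaleR[OF N.sub S(1)])
    fix b assume b: "b \<in> fbasis (model M)"
    show "Cinf_on (model N) S (\<lambda>x. L x b)" using L(1) b fbasis(4)[OF M.fd] by blast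
    show "Cinf_on (model N) S (\<lambda>x. coord (model M) b (vf_rep M (f n) X (rep n (f n) x)))"
      by (rule Cinf_blin[OF N.sub S(1) M.fd blin_on_coord[OF M.fd] rX E])
  qed
  then show "Cinf_on (model N) S (\<lambda>x. L x (vf_rep M (f n) X (rep n (f n) x)))"
    by (rule Cinf_cong[OF N.sub S(1)]) (use blin_on_expand[OF M.fd L(2) E] in simp)
qed

text \<open>Lifting \<open>X\<close> through the right inverses \<open>L\<close> gives some value
  over \<open>X (f n)\<close> at \<open>n\<close>. It differs from \<open>v\<close> by a vertical
  vector, which is extended to a vertical field and added before cutting off.\<close>

lemma local_lift:
  assumes n: "n \<in> points N" and X: "X \<in> vector_fields M" and v: "v \<in> model N" "T n v = X (f n)"
  obtains W b U where "W \<in> vector_fields N" "b \<in> smooth_functions_cc N" "openin (mtop N) U" "n \<in> U"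
    "\<And>q. q \<in> U \<Longrightarrow> b q = 1" "\<And>q. q \<in> points N \<Longrightarrow> T q (W q) = b q *\<^sub>R X (f q)" "W n = v"
proof -
  have fn: "f n \<in> points M" using f_points[OF n] .
  obtain S L where S: "openin (top_of_set (model N)) S" "S \<subseteq> rdom n (f n)" "cmap N n n \<in> S"
    and L: "\<And>w. w \<in> model M \<Longrightarrow> Cinf_on (model N) S (\<lambda>x. L x w)"
    "\<And>x. x \<in> S \<Longrightarrow> blin_on (model M) (L x)"
    "\<And>x w. x \<in> S \<Longrightarrow> w \<in> model M \<Longrightarrow> L x w \<in> model N"
    "\<And>x w. x \<in> S \<Longrightarrow> w \<in> model M \<Longrightarrow> dir_deriv (rep n (f n)) x (L x w) = w"
    and ker: "\<And>k. k \<in> model N \<Longrightarrow> T n k = 0 \<Longrightarrow>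
       \<exists>\<kappa>. Cinf_on (model N) S \<kappa> \<and> (\<forall>x\<in>S. \<kappa> x \<in> model N \<and> dir_deriv (rep n (f n)) x (\<kappa> x) = 0) \<and> \<kappa> (cmap N n n) = k"
    by (rule submersion_charts[OF n]) (rule that, assumption+)
  let ?x = "cmap N n n"
  define w1 where "w1 x = L x (vf_rep M (f n) X (rep n (f n) x))" for x
  have w1: "Cinf_on (model N) S w1" "\<And>x. x \<in> S \<Longrightarrow> w1 x \<in> model N"
    "\<And>x. x \<in> S \<Longrightarrow> dir_deriv (rep n (f n)) x (w1 x) = vf_rep M (f n) X (rep n (f n) x)"
    unfolding w1_def using lift_rep_smooth[OF n S(1,2) L(1,2) X] L(3,4) by auto
  have "T n (w1 ?x) = X (f n)"
    using w1(3)[OF S(3)] M.vf_rep_self[of "f n" X, OF fn M.vector_fieldD(1)[OF X fn]] N.chart(1)[OF n] n by (simp add: T_rep)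
  then have "T n (v - w1 ?x) = 0" using blin_on_diff[OF T_blin[OF n] N.sub v(1) w1(2)[OF S(3)]] v(2) by simp
  then obtain \<kappa> where \<kappa>: "Cinf_on (model N) S \<kappa>" "\<forall>x\<in>S. \<kappa> x \<in> model N \<and> dir_deriv (rep n (f n)) x (\<kappa> x) = 0" "\<kappa> ?x = v - w1 ?x"
    using ker subspace_diff[OF N.sub v(1) w1(2)[OF S(3)]] by blast
  define w where "w x = w1 x + \<kappa> x" for x
  have w: "Cinf_on (model N) S w" unfolding w_def by (rule Cinf_add[OF N.sub S(1) w1(1) \<kappa>(1)])
  have wN: "w x \<in> model N" if "x \<in> S" for x unfolding w_def using w1(2) \<kappa>(2) that by (intro subspace_add[OF N.sub]) auto
  have wD: "dir_deriv (rep n (f n)) x (w x) = vf_rep M (f n) X (rep n (f n) x)" if x: "x \<in> S" for x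
    unfolding w_def
    using blin_onD(1)[OF blin_on_dir_deriv[OF N.fd rdom_open[OF n fn] Cinf_Ck[OF rep_smooth[OF n fn], of "Suc 0"] subsetD[OF S(2) x]]]
      w1(2,3) \<kappa>(2) x by simp
  have Simg: "S \<subseteq> N.img n" using S(2) by (auto simp: rdom_def N.img_def)
  obtain \<beta> :: "'f \<Rightarrow> real" and K W where b: "Cinf_on (model N) (model N) \<beta>" "compact K" "K \<subseteq> S" "\<And>x. x \<in> S - K \<Longrightarrow> \<beta> x = 0"
    "openin (top_of_set (model N)) W" "?x \<in> W" "W \<subseteq> S" "\<And>x. x \<in> W \<Longrightarrow> \<beta> x = (1::real)"
    by (rule N.chart_bump[OF n S(1) Simg S(3)]) (rule that, assumption+)
  note lf = lift_field[OF n fn S(1,2) b(2,3,1,4) w wN X wD]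
  show ?thesis
  proof (rule that[OF lf(1) lf(3) N.open_cmap_vimage[OF n b(5)]])
    show "n \<in> {q \<in> cdom N n. cmap N n q \<in> W}" using N.chart(1)[OF n] b(6) by simp
    show "N.extend_fun n S \<beta> q = 1" if "q \<in> {q \<in> cdom N n. cmap N n q \<in> W}" for q
      using that b(7,8) by (auto simp: N.extend_fun_def)
    show "N.extend_vf n S (\<lambda>x. \<beta> x *\<^sub>R w x) n = v"
      using N.chart(1)[OF n] S(3) b(8)[OF b(6)] N.D_id[OF n N.chart(1)[OF n] v(1)] \<kappa>(3) by (simp add: N.extend_vf_def w_def)
    show "T q (N.extend_vf n S (\<lambda>x. \<beta> x *\<^sub>R w x) q) = N.extend_fun n S \<beta> q *\<^sub>R X (f q)" if "q \<in> points N" for q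
      by (rule lf(2)[OF _ _ _ that])
  qed
qed

text \<open>The functions b_i (prod_{j < i} (1 - b_j)) form a partition of unity which is finite on
  every set where some b_k equals 1, so no refinement of the cover is needed.\<close>

lemma global_lift:
  assumes X: "X \<in> vector_fields M"
    and W0: "W0 \<in> vector_fields N" "b0 \<in> smooth_functions N" "\<And>q. q \<in> U0 \<Longrightarrow> b0 q = 1" "openin (mtop N) U0"
      "\<And>q. q \<in> points N \<Longrightarrow> T q (W0 q) = b0 q *\<^sub>R X (f q)"
  obtains V where "V \<in> vector_fields N" "\<And>q. q \<in> points N \<Longrightarrow> T q (V q) = X (f q)" "\<And>q. q \<in> U0 \<Longrightarrow> V q = W0 q"
proof (cases "points N = {}")
  \<comment> \<open>An empty manifold is separated because the countable cover is enumerated by the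
    natural numbers below.\<close>
  case True
  show ?thesis
    by (rule that[OF W0(1)]) (use True in auto)
next
  case False
  define Q where "Q n W b U \<longleftrightarrow> W \<in> vector_fields N \<and> b \<in> smooth_functions N \<and> openin (mtop N) U \<and> n \<in> U \<and>
    (\<forall>q\<in>U. b q = 1) \<and> (\<forall>q\<in>points N. T q (W q) = b q *\<^sub>R X (f q))" for n W b U
  have "\<exists>W b U. Q n W b U" if n: "n \<in> points N" for n
  proof -
    obtain v where v: "v \<in> model N" "T n v = X (f n)"
      using surj_T[OF n] M.vector_fieldD(1)[OF X f_points[OF n]] by (metis imageE)
    obtain W b U where "W \<in> vector_fields N" "b \<in> smooth_functions_cc N" "openin (mtop N) U" "n \<in> U"
      "\<And>q. q \<in> U \<Longrightarrow> b q = 1" "\<And>q. q \<in> points N \<Longrightarrow> T q (W q) = b q *\<^sub>R X (f q)" "W n = v"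
      using local_lift[OF n X v] by blast
    then show ?thesis
      by (intro exI[of _ W] exI[of _ b] exI[of _ U]) (simp add: smooth_functions_cc_def Q_def)
  qed
  then obtain W b U where "\<And>n. n \<in> points N \<Longrightarrow> Q n (W n) (b n) (U n)" by metis
  then have WbU: "\<And>n. n \<in> points N \<Longrightarrow> W n \<in> vector_fields N" "\<And>n. n \<in> points N \<Longrightarrow> b n \<in> smooth_functions N"
    "\<And>n. n \<in> points N \<Longrightarrow> openin (mtop N) (U n)" "\<And>n. n \<in> points N \<Longrightarrow> n \<in> U n"
    "\<And>n q. n \<in> points N \<Longrightarrow> q \<in> U n \<Longrightarrow> b n q = 1"
    "\<And>n q. n \<in> points N \<Longrightarrow> q \<in> points N \<Longrightarrow> T q (W n q) = b n q *\<^sub>R X (f q)"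
    unfolding Q_def by simp_all
  have "\<Union>(U ` points N) = points N" using WbU(3,4) openin_subset by blast
  then obtain \<V> where \<V>: "countable \<V>" "\<V> \<subseteq> U ` points N" "\<Union>\<V> = points N"
    using second_countable_imp_Lindelof_space[OF N.second_countable] WbU(3) unfolding Lindelof_space_def
    by (metis (no_types, lifting) imageE)
  have ne: "\<V> \<noteq> {}" using \<V>(3) False by blast
  have "\<forall>i. \<exists>n\<in>points N. from_nat_into \<V> i = U n" using from_nat_into[OF ne] \<V>(2) by blast
  then obtain n where n: "\<And>i::nat. n i \<in> points N" "\<And>i. from_nat_into \<V> i = U (n i)" by metis
  \<comment> \<open>Index 0 is reserved for the given lift, so that on \<open>U0\<close> it survives
    the gluing unchanged.\<close>
  define W' where "W' i = (case i of 0 \<Rightarrow> W0 | Suc j \<Rightarrow> W (n j))" for i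
  define b' where "b' i = (case i of 0 \<Rightarrow> b0 | Suc j \<Rightarrow> b (n j))" for i
  define U' where "U' i = (case i of 0 \<Rightarrow> U0 | Suc j \<Rightarrow> U (n j))" for i
  have W': "W' i \<in> vector_fields N" and b': "b' i \<in> smooth_functions N" and U': "openin (mtop N) (U' i)"
    and b'1: "q \<in> U' i \<Longrightarrow> b' i q = 1" and TW': "q \<in> points N \<Longrightarrow> T q (W' i q) = b' i q *\<^sub>R X (f q)" for i q
    unfolding W'_def b'_def U'_def using W0 WbU n(1) by (auto split: nat.splits)
  have cover: "\<exists>i. q \<in> U' i" if q: "q \<in> points N" for q
  proof -
    obtain A where "A \<in> \<V>" "q \<in> A" using \<V>(3) q by blast
    then obtain i where "from_nat_into \<V> i = A" using from_nat_into_surj[OF \<V>(1)] by blast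
    then show ?thesis using n(2)[of i] \<open>q \<in> A\<close> by (intro exI[of _ "Suc i"]) (simp add: U'_def)
  qed
  define c where "c i q = (\<Prod>j<i. 1 - b' j q)" for i q
  have csm: "c i \<in> smooth_functions N" for i
    unfolding c_def by (intro N.smooth_function_prod N.smooth_function_diff N.smooth_function_const b')
  have c0: "c i q = 0" if "q \<in> U' k" "k < i" for i k q
    unfolding c_def using b'1[OF that(1)] that(2) by (auto intro!: prod_zero)
  define P where "P k q = (\<Sum>i<Suc k. c i q *\<^sub>R W' i q)" for k q
  have P: "P k \<in> vector_fields N" for k
    unfolding P_def by (intro N.vector_field_sum N.vector_field_scale csm W')
  \<comment> \<open>The weights telescope: \<open>c i q * b' i q = c i q - c (Suc i) q\<close>, so
    the partial sums cover the multiple \<open>1 - c k q\<close> of \<open>X\<close>.\<close>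
  have TP: "T q (\<Sum>i<k. c i q *\<^sub>R W' i q) = (1 - c k q) *\<^sub>R X (f q)" if q: "q \<in> points N" for q k
  proof (induction k)
    case 0
    then show ?case using blin_on_zero[OF T_blin[OF q] N.sub] by (simp add: c_def)
  next
    case (Suc k)
    have in1: "W' i q \<in> model N" for i using N.vector_fieldD(1)[OF W' q] .
    have in2: "(\<Sum>i<k. c i q *\<^sub>R W' i q) \<in> model N" by (intro subspace_sum[OF N.sub] subspace_scale[OF N.sub] in1)
    have "c (Suc k) q = c k q * (1 - b' k q)" by (simp add: c_def)
    then have cS: "1 - c (Suc k) q = (1 - c k q) + c k q * b' k q" by (simp add: algebra_simps)
    have "T q (\<Sum>i<Suc k. c i q *\<^sub>R W' i q) = T q (\<Sum>i<k. c i q *\<^sub>R W' i q) + T q (c k q *\<^sub>R W' k q)"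
      using blin_onD(1)[OF T_blin[OF q] in2 subspace_scale[OF N.sub in1]] by simp
    also have "\<dots> = (1 - c k q) *\<^sub>R X (f q) + (c k q * b' k q) *\<^sub>R X (f q)"
      using Suc blin_onD(2)[OF T_blin[OF q] in1] TW'[OF q] by simp
    also have "\<dots> = (1 - c (Suc k) q) *\<^sub>R X (f q)" unfolding cS by (rule scaleR_add_left[symmetric])
    finally show ?case .
  qed
  \<comment> \<open>On \<open>U' k\<close> all partial sums from index \<open>k\<close> on agree;
    the least index merely names this stable value.\<close>
  define V where "V q = P (LEAST k. q \<in> U' k) q" for q
  have VP: "V q = P k q" if "q \<in> U' k" for q k
  proof -
    define l where "l = (LEAST k. q \<in> U' k)"
    have l: "q \<in> U' l" "l \<le> k" unfolding l_def using that by (auto intro: LeastI Least_le)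
    have "(\<Sum>i<Suc k. c i q *\<^sub>R W' i q) = (\<Sum>i<Suc l. c i q *\<^sub>R W' i q)"
      by (rule sum.mono_neutral_right) (use l c0[OF l(1)] in auto)
    then show ?thesis by (simp add: V_def l_def P_def)
  qed
  show ?thesis
  proof
    show "V \<in> vector_fields N"
    proof (rule N.vector_field_local)
      show "V q = 0" if "q \<notin> points N" for q unfolding V_def using N.vector_fieldD(3)[OF P that] .
      fix q assume "q \<in> points N"
      then obtain k where "q \<in> U' k" using cover by blast
      then show "\<exists>W Y. openin (mtop N) W \<and> q \<in> W \<and> Y \<in> vector_fields N \<and> (\<forall>r\<in>W. V r = Y r)"
        using U' P VP by blast
    qed
    show "T q (V q) = X (f q)" if q: "q \<in> points N" for q
    proof -
      obtain k where k: "q \<in> U' k" using cover[OF q] by blast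
      then show ?thesis using VP[OF k] TP[OF q, of "Suc k"] c0[OF k, of "Suc k"] by (simp add: P_def)
    qed
    show "V q = W0 q" if "q \<in> U0" for q
      using VP[of q 0] that by (simp add: U'_def P_def c_def W'_def)
  qed
qed

end

section \<open>Transfer of vector fields through a common pullback foliation\<close>

lemma submersionI:
  assumes "smooth_manifold N" "smooth_manifold M" "surjective_submersion N M f"
  shows "submersion N M f"
proof -
  interpret N: smooth_mfd N by (rule smooth_mfd.intro) fact
  interpret M: smooth_mfd M by (rule smooth_mfd.intro) fact
  show ?thesis using assms(3) by unfold_locales (auto simp: surjective_submersion_def)
qed

lemma singular_foliationD:
  assumes "singular_foliation M F"
  shows "X \<in> F \<Longrightarrow> X \<in> vector_fields M" "(\<lambda>_. 0) \<in> F" "X \<in> F \<Longrightarrow> Y \<in> F \<Longrightarrow> (\<lambda>p. X p + Y p) \<in> F"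
    "h \<in> smooth_functions M \<Longrightarrow> X \<in> F \<Longrightarrow> (\<lambda>p. h p *\<^sub>R X p) \<in> F" "X \<in> F \<Longrightarrow> compact_support M X"
  using assms unfolding singular_foliation_def vector_fields_cc_def by auto

lemma singular_foliation_sum:
  assumes "singular_foliation M F" "\<And>i. i \<in> I \<Longrightarrow> h i \<in> smooth_functions M" "\<And>i. i \<in> I \<Longrightarrow> X i \<in> F"
  shows "(\<lambda>p. \<Sum>i\<in>I. h i p *\<^sub>R X i p) \<in> F"
  using assms(2,3)
proof (induction I rule: infinite_finite_induct)
  case (insert i I)
  then show ?case
    using singular_foliationD(3)[OF assms(1) singular_foliationD(4)[OF assms(1), of "h i" "X i"],
        of "\<lambda>p. \<Sum>i\<in>I. h i p *\<^sub>R X i p"] by simp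
qed (use singular_foliationD(2)[OF assms(1)] in auto)

text \<open>The factor \<open>b\<close> makes the projectable field \<open>V\<close> an element of
  the first pullback. Inclusion writes it as a combination of fields projectable along
  \<open>f2\<close>, whose projections are the \<open>Y i\<close>; the coefficients remain functions
  on \<open>N\<close>.\<close>

lemma pullback_transfer:
  assumes "submersion N M1 f1" "submersion N M2 f2"
    and sub: "pullback_foliation N M1 f1 F1 \<subseteq> pullback_foliation N M2 f2 F2"
    and V: "V \<in> vector_fields N" "X \<in> F1" "\<And>q. q \<in> points N \<Longrightarrow> tangent_map N M1 f1 q (V q) = X (f1 q)"
    and b: "b \<in> smooth_functions_cc N"
  obtains k g Y where "\<And>i. i < (k::nat) \<Longrightarrow> g i \<in> smooth_functions_cc N" "\<And>i. i < k \<Longrightarrow> Y i \<in> F2"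
    "\<And>q. q \<in> points N \<Longrightarrow> tangent_map N M2 f2 q (b q *\<^sub>R V q) = (\<Sum>i<k. g i q *\<^sub>R Y i (f2 q))"
proof -
  interpret f2: submersion N M2 f2 by fact
  have "(\<lambda>q. b q *\<^sub>R V q) \<in> pullback_foliation N M1 f1 F1"
    unfolding pullback_foliation_def cc_span_def
    by (intro CollectI exI[of _ "Suc 0"] exI[of _ "\<lambda>_. b"] exI[of _ "\<lambda>_. V"]) (use V b in \<open>auto simp: projectable_def\<close>)
  then have "(\<lambda>q. b q *\<^sub>R V q) \<in> pullback_foliation N M2 f2 F2" using sub by blast
  then obtain k g W where eq: "(\<lambda>q. b q *\<^sub>R V q) = (\<lambda>q. \<Sum>i<(k::nat). g i q *\<^sub>R W i q)"
    and gW: "\<And>i. i < k \<Longrightarrow> g i \<in> smooth_functions_cc N \<and> projectable N M2 f2 F2 (W i)"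
    unfolding pullback_foliation_def cc_span_def by blast
  have "\<forall>i. \<exists>Y. i < k \<longrightarrow> Y \<in> F2 \<and> (\<forall>q\<in>points N. tangent_map N M2 f2 q (W i q) = Y (f2 q))"
    using gW unfolding projectable_def by metis
  then obtain Y where Y: "\<And>i. i < k \<Longrightarrow> Y i \<in> F2" "\<And>i q. i < k \<Longrightarrow> q \<in> points N \<Longrightarrow> tangent_map N M2 f2 q (W i q) = Y i (f2 q)"
    by metis
  show ?thesis
  proof (rule that[of k g Y])
    fix q assume q: "q \<in> points N"
    have in1: "W i q \<in> model N" if "i < k" for i
      using gW[OF that] f2.N.vector_fieldD(1)[OF _ q] unfolding projectable_def by blast
    have "tangent_map N M2 f2 q (b q *\<^sub>R V q) = tangent_map N M2 f2 q (\<Sum>i<k. g i q *\<^sub>R W i q)"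
      using fun_cong[OF eq, of q] by simp
    also have "\<dots> = (\<Sum>i<k. tangent_map N M2 f2 q (g i q *\<^sub>R W i q))"
      by (rule blin_on_sum[OF f2.T_blin[OF q] f2.N.sub]) (auto intro: subspace_scale[OF f2.N.sub] in1)
    also have "\<dots> = (\<Sum>i<k. g i q *\<^sub>R Y i (f2 q))"
      by (intro sum.cong refl) (simp add: blin_onD(2)[OF f2.T_blin[OF q] in1] Y(2) q)
    finally show "tangent_map N M2 f2 q (b q *\<^sub>R V q) = (\<Sum>i<k. g i q *\<^sub>R Y i (f2 q))" .
  qed (use gW Y in auto)
qed

text \<open>The vector \<open>v\<close> is the value at \<open>n\<close> of a local lift of
  \<open>X\<close>, which is made projectable without change near \<open>n\<close>. After the
  transfer, the coefficients at the single point \<open>n\<close> are constants, so one field of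
  \<open>F2\<close> suffices.\<close>

lemma pullback_transfer_point:
  assumes f1: "submersion N M1 f1" and f2: "submersion N M2 f2"
    and F1: "singular_foliation M1 F1" and F2: "singular_foliation M2 F2"
    and sub: "pullback_foliation N M1 f1 F1 \<subseteq> pullback_foliation N M2 f2 F2"
    and n: "n \<in> points N" and v: "v \<in> model N" and X: "X \<in> F1" "tangent_map N M1 f1 n v = X (f1 n)"
  shows "\<exists>Y\<in>F2. tangent_map N M2 f2 n v = Y (f2 n)"
proof -
  interpret f1: submersion N M1 f1 by fact
  interpret f2: submersion N M2 f2 by fact
  have Xv: "X \<in> vector_fields M1" by (rule singular_foliationD(1)[OF F1 X(1)])
  obtain W b U where W: "W \<in> vector_fields N" "b \<in> smooth_functions_cc N" "openin (mtop N) U" "n \<in> U"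
    "\<And>q. q \<in> U \<Longrightarrow> b q = 1" "\<And>q. q \<in> points N \<Longrightarrow> f1.T q (W q) = b q *\<^sub>R X (f1 q)" "W n = v"
    using f1.local_lift[OF n Xv v X(2)] by blast
  have bs: "b \<in> smooth_functions N" using W(2) by (simp add: smooth_functions_cc_def)
  obtain V where V: "V \<in> vector_fields N" "\<And>q. q \<in> points N \<Longrightarrow> f1.T q (V q) = X (f1 q)" "\<And>q. q \<in> U \<Longrightarrow> V q = W q"
    using f1.global_lift[OF Xv W(1) bs W(5,3,6)] by blast
  obtain k g Y where kgY: "\<And>i. i < (k::nat) \<Longrightarrow> g i \<in> smooth_functions_cc N" "\<And>i. i < k \<Longrightarrow> Y i \<in> F2"
    "\<And>q. q \<in> points N \<Longrightarrow> f2.T q (b q *\<^sub>R V q) = (\<Sum>i<k. g i q *\<^sub>R Y i (f2 q))"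
    using pullback_transfer[OF f1 f2 sub V(1) X(1) V(2) W(2)] by blast
  have "f2.T n v = (\<Sum>i<k. g i n *\<^sub>R Y i (f2 n))" using kgY(3)[OF n] V(3)[OF W(4)] W(5)[OF W(4)] W(7) by simp
  moreover have "(\<lambda>p. \<Sum>i\<in>{..<k}. g i n *\<^sub>R Y i p) \<in> F2"
    by (rule singular_foliation_sum[OF F2]) (use f2.M.smooth_function_const kgY(2) in auto)
  ultimately show ?thesis by (intro bexI[of _ "\<lambda>p. \<Sum>i<k. g i n *\<^sub>R Y i p"]) auto
qed

section \<open>Integral curves of compactly supported vector fields\<close>

text \<open>The oriented integral from 0 to \<open>t\<close>; of the two terms the one over the
  reversed interval vanishes.\<close>

definition ivl_int :: "(real \<Rightarrow> 'a::banach) \<Rightarrow> real \<Rightarrow> 'a" where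
  "ivl_int g t = integral {0..t} g - integral {t..0} g"

lemma ivl_int_eq:
  assumes g: "continuous_on UNIV g" and b: "b \<le> 0" "b \<le> t"
  shows "ivl_int g t = integral {b..t} g - integral {b..0} g"
proof -
  have int: "g integrable_on {c..d}" for c d
    by (rule integrable_continuous_real[OF continuous_on_subset[OF g subset_UNIV]])
  show ?thesis
  proof (cases "0 \<le> t")
    case True
    have "integral {t..0} g = 0" using True by (cases "t = 0") auto
    then show ?thesis using Henstock_Kurzweil_Integration.integral_combine[OF b(1) True int] by (simp add: ivl_int_def algebra_simps)
  next
    case False
    have "integral {0..t} g = 0" using False by simp
    then show ?thesis using Henstock_Kurzweil_Integration.integral_combine[OF b(2) _ int, of 0] False by (simp add: ivl_int_def algebra_simps)
  qed
qed

lemma ivl_int_deriv: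
  assumes g: "continuous_on UNIV g"
  shows "(ivl_int g has_vector_derivative g t) (at t)"
proof -
  define b where "b = min t 0 - 1"
  have "((\<lambda>u. integral {b..u} g) has_vector_derivative g t) (at t within {b..t + 1})"
    by (rule integral_has_vector_derivative[OF continuous_on_subset[OF g subset_UNIV]]) (auto simp: b_def)
  then have "((\<lambda>u. integral {b..u} g) has_vector_derivative g t) (at t)"
    using at_within_Icc_at[of b t "t + 1"] by (simp add: b_def)
  then have "((\<lambda>u. integral {b..u} g - integral {b..0} g) has_vector_derivative g t) (at t)"
    by (auto intro!: derivative_eq_intros)
  then show ?thesis
    by (rule has_vector_derivative_transform_within_open[of _ _ _ "{b<..}"])
      (auto simp: ivl_int_eq[OF g, of b] b_def)
qed

lemma ivl_int_diff:
  assumes "continuous_on UNIV g" "continuous_on UNIV h"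
  shows "ivl_int g t - ivl_int h t = ivl_int (\<lambda>s. g s - h s) t"
proof -
  have int: "g integrable_on {c..d}" "h integrable_on {c..d}" for c d
    using assms by (auto intro!: integrable_continuous_real intro: continuous_on_subset)
  show ?thesis unfolding ivl_int_def
    by (simp add: Henstock_Kurzweil_Integration.integral_diff[OF int])
qed

text \<open>The factor \<open>1 / c\<close> gained by integrating an exponential of rate
  \<open>c\<close> is what produces a contraction for a fast enough weight.\<close>

lemma ivl_int_bound:
  fixes g :: "real \<Rightarrow> 'a::banach"
  assumes g: "continuous_on UNIV g" and c: "c > 0" and b: "\<And>s. norm (g s) \<le> B * exp (c * \<bar>s\<bar>)"
  shows "norm (ivl_int g t) \<le> B / c * (exp (c * \<bar>t\<bar>) - 1)"
proof -
  have int: "g integrable_on {c..d}" for c d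
    by (rule integrable_continuous_real[OF continuous_on_subset[OF g subset_UNIV]])
  have cont: "continuous_on S (\<lambda>s. B * exp (c * \<bar>s\<bar>))" for S :: "real set" by (intro continuous_intros)
  show ?thesis
  proof (cases "0 \<le> t")
    case True
    have e: "integral {t..0} g = 0" using True by (cases "t = 0") auto
    have "((\<lambda>s. B * exp (c * s)) has_integral (B / c * exp (c * t) - B / c * exp (c * 0))) {0..t}"
      using True c by (intro fundamental_theorem_of_calculus) (auto intro!: derivative_eq_intros simp: has_real_derivative_iff_has_vector_derivative[symmetric])
    then have h: "((\<lambda>s. B * exp (c * \<bar>s\<bar>)) has_integral (B / c * (exp (c * t) - 1))) {0..t}"
      by (rule has_integral_eq_rhs[OF has_integral_eq[rotated]]) (auto simp: right_diff_distrib)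
    have "norm (integral {0..t} g) \<le> integral {0..t} (\<lambda>s. B * exp (c * \<bar>s\<bar>))"
      by (rule integral_norm_bound_integral[OF int has_integral_integrable[OF h] b])
    then show ?thesis unfolding integral_unique[OF h] using True e by (simp add: ivl_int_def)
  next
    case False
    have e: "integral {0..t} g = 0" using False by simp
    have "((\<lambda>s. B * exp (- (c * s))) has_integral (- (B / c * exp (- (c * 0))) - - (B / c * exp (- (c * t))))) {t..0}"
      using False c by (intro fundamental_theorem_of_calculus) (auto intro!: derivative_eq_intros simp: has_real_derivative_iff_has_vector_derivative[symmetric])
    then have h: "((\<lambda>s. B * exp (c * \<bar>s\<bar>)) has_integral (B / c * (exp (c * \<bar>t\<bar>) - 1))) {t..0}"
      by (rule has_integral_eq_rhs[OF has_integral_eq[rotated]]) (use False in \<open>auto simp: right_diff_distrib\<close>)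
    have "norm (integral {t..0} g) \<le> integral {t..0} (\<lambda>s. B * exp (c * \<bar>s\<bar>))"
      by (rule integral_norm_bound_integral[OF int has_integral_integrable[OF h] b])
    then show ?thesis unfolding integral_unique[OF h] using e by (simp add: ivl_int_def)
  qed
qed

text \<open>The weight exp (- 2 L |t|) makes the Picard operator a contraction on the whole real line.\<close>

lemma picard_global:
  fixes X :: "'a::banach \<Rightarrow> 'a"
  assumes L: "L > 0" and lip: "\<And>x y. norm (X x - X y) \<le> L * norm (x - y)" and bdd: "\<And>x. norm (X x) \<le> B"
  obtains \<gamma> where "\<gamma> 0 = a" "\<And>t. (\<gamma> has_vector_derivative X (\<gamma> t)) (at t)"
proof -
  have Xc: "continuous_on UNIV X"
  proof (rule lipschitz_on_continuous_on[of L])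
    show "L-lipschitz_on UNIV X" by (rule lipschitz_onI) (use lip L in \<open>auto simp: dist_norm\<close>)
  qed
  have B0: "B \<ge> 0" using bdd[of 0] norm_ge_zero order_trans by blast
  \<comment> \<open>The unknown \<open>w\<close> is a bounded weighted curve; \<open>u w\<close>
    removes the weight and is the curve itself, which may grow exponentially.\<close>
  define u where "u w s = exp (2 * L * \<bar>s\<bar>) *\<^sub>R apply_bcontfun w s" for w :: "real \<Rightarrow>\<^sub>C 'a" and s
  have uc: "continuous_on UNIV (u w)" for w
    unfolding u_def by (intro continuous_intros continuous_on_apply_bcontfun)
  have Xu: "continuous_on UNIV (\<lambda>s. X (u w s))" for w
    by (rule continuous_on_compose2[OF Xc uc]) auto
  have I: "continuous_on UNIV (ivl_int (\<lambda>s. X (u w s)))" for w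
    using ivl_int_deriv[OF Xu] by (intro continuous_at_imp_continuous_on) (auto intro: has_vector_derivative_continuous)
  define T where "T w t = exp (- (2 * L * \<bar>t\<bar>)) *\<^sub>R (a + ivl_int (\<lambda>s. X (u w s)) t)" for w t
  have Tb: "T w \<in> bcontfun" for w
  proof (rule bcontfun_normI)
    show "continuous_on UNIV (T w)" unfolding T_def by (intro continuous_intros I)
    fix t
    have "norm (X (u w s)) \<le> B * exp (2 * L * \<bar>s\<bar>)" for s
      using bdd[of "u w s"] mult_left_mono[of 1 "exp (2 * L * \<bar>s\<bar>)" B] B0 L by simp
    then have "norm (ivl_int (\<lambda>s. X (u w s)) t) \<le> B / (2 * L) * (exp (2 * L * \<bar>t\<bar>) - 1)"
      using L by (intro ivl_int_bound[OF Xu]) auto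
    also have "\<dots> \<le> B / (2 * L) * exp (2 * L * \<bar>t\<bar>)" using B0 L by (intro mult_left_mono) auto
    finally have "norm (a + ivl_int (\<lambda>s. X (u w s)) t) \<le> norm a + B / (2 * L) * exp (2 * L * \<bar>t\<bar>)"
      by (intro norm_triangle_le) simp
    also have "\<dots> \<le> (norm a + B / (2 * L)) * exp (2 * L * \<bar>t\<bar>)"
      using mult_left_mono[of 1 "exp (2 * L * \<bar>t\<bar>)" "norm a"] L by (simp add: distrib_right)
    finally have "exp (- (2 * L * \<bar>t\<bar>)) * norm (a + ivl_int (\<lambda>s. X (u w s)) t)
        \<le> exp (- (2 * L * \<bar>t\<bar>)) * ((norm a + B / (2 * L)) * exp (2 * L * \<bar>t\<bar>))" by (intro mult_left_mono) auto
    also have "\<dots> = norm a + B / (2 * L)" by (simp add: exp_minus)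
    finally show "norm (T w t) \<le> norm a + B / (2 * L)" by (simp add: T_def)
  qed
  define P where "P w = Bcontfun (T w)" for w
  have PT: "apply_bcontfun (P w) t = T w t" for w t
    unfolding P_def by (simp add: Bcontfun_inverse[OF Tb])
  have "\<exists>!w. P w = w"
  proof (rule banach_fix_type[of "1/2"])
    show "\<forall>w v. dist (P w) (P v) \<le> 1/2 * dist w v"
    proof (intro allI dist_bound)
      fix w v t
      have "norm (X (u w s) - X (u v s)) \<le> (L * dist w v) * exp (2 * L * \<bar>s\<bar>)" for s
      proof -
        have "norm (X (u w s) - X (u v s)) \<le> L * norm (u w s - u v s)" by (rule lip)
        also have "u w s - u v s = exp (2 * L * \<bar>s\<bar>) *\<^sub>R (apply_bcontfun w s - apply_bcontfun v s)"
          by (simp add: u_def scaleR_diff_right)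
        also have "L * norm \<dots> \<le> L * (exp (2 * L * \<bar>s\<bar>) * dist w v)"
          using dist_bounded[of w s v] L by (intro mult_left_mono) (auto simp: dist_norm)
        finally show ?thesis by (simp add: mult_ac)
      qed
      \<comment> \<open>The Lipschitz constant \<open>L\<close> over the rate \<open>2 * L\<close>
        is the contraction factor 1/2.\<close>
      then have "norm (ivl_int (\<lambda>s. X (u w s) - X (u v s)) t) \<le> L * dist w v / (2 * L) * (exp (2 * L * \<bar>t\<bar>) - 1)"
        using L by (intro ivl_int_bound continuous_on_diff Xu) auto
      also have "\<dots> \<le> dist w v / 2 * exp (2 * L * \<bar>t\<bar>)" using L by (simp add: right_diff_distrib)
      finally have "exp (- (2 * L * \<bar>t\<bar>)) * norm (ivl_int (\<lambda>s. X (u w s) - X (u v s)) t)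
        \<le> exp (- (2 * L * \<bar>t\<bar>)) * (dist w v / 2 * exp (2 * L * \<bar>t\<bar>))" by (intro mult_left_mono) auto
      also have "\<dots> = 1/2 * dist w v" by (simp add: exp_minus)
      finally show "dist (apply_bcontfun (P w) t) (apply_bcontfun (P v) t) \<le> 1/2 * dist w v"
        unfolding PT T_def dist_norm scaleR_diff_right[symmetric] using ivl_int_diff[OF Xu Xu, of w t v] by simp
    qed
  qed auto
  then obtain w where w: "P w = w" by blast
  have ufix: "u w t = a + ivl_int (\<lambda>s. X (u w s)) t" for t
  proof -
    have "apply_bcontfun w t = T w t" using PT[of w t] w by simp
    then show ?thesis unfolding u_def[of w t] T_def by (simp add: exp_minus)
  qed
  show ?thesis
  proof (rule that[of "u w"])
    show "u w 0 = a" using ufix[of 0] by (simp add: ivl_int_def)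
    fix t
    have "((\<lambda>t. a + ivl_int (\<lambda>s. X (u w s)) t) has_vector_derivative X (u w t)) (at t)"
      using ivl_int_deriv[OF Xu, of w t] by (auto intro!: derivative_eq_intros)
    then show "(u w has_vector_derivative X (u w t)) (at t)" using ufix by (metis (no_types, lifting) ext)
  qed
qed

text \<open>Off \<open>K\<close> the derivatives vanish, since the complement is open, and on
  \<open>K\<close> they are bounded by compactness; a basis expansion and the mean value inequality
  give the Lipschitz bound.\<close>

lemma compact_support_lipschitz:
  fixes X :: "'a::euclidean_space \<Rightarrow> 'b::real_normed_vector"
  assumes X: "Ck_on (Suc k) UNIV UNIV X" and K: "compact K" "\<And>x. x \<notin> K \<Longrightarrow> X x = 0"
  obtains L where "L > 0" "\<And>x y. norm (X x - X y) \<le> L * norm (x - y)"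
proof -
  note fd = fd_subspace_UNIV[where 'a='a]
  have U: "openin (top_of_set UNIV) (UNIV :: 'a set)" by simp
  have "\<exists>C\<ge>0. \<forall>x. norm (dir_deriv X x b) \<le> C" for b
  proof -
    have "Ck_on k UNIV UNIV (\<lambda>x. dir_deriv X x b)" using X by simp
    then have "continuous_on UNIV (\<lambda>x. dir_deriv X x b)" by (rule Ck_continuous)
    then have "compact ((\<lambda>x. dir_deriv X x b) ` K)" using K(1) compact_continuous_image continuous_on_subset subset_UNIV by blast
    then obtain C where C: "C > 0" "\<forall>y\<in>(\<lambda>x. dir_deriv X x b) ` K. norm y \<le> C"
      using compact_imp_bounded bounded_pos by metis
    have "norm (dir_deriv X x b) \<le> C" for x
    proof (cases "x \<in> K")
      case False
      have "open (- K)" using K(1) compact_imp_closed open_Compl by blast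
      then have o: "openin (top_of_set UNIV) (- K)" by simp
      have "dir_deriv X x b = dir_deriv (\<lambda>_. 0) x b"
        by (rule dir_deriv_cong[OF subspace_UNIV o]) (use False K(2) in auto)
      also have "\<dots> = 0" by (rule dir_derivI) (auto intro!: derivative_eq_intros)
      finally show ?thesis using C by simp
    qed (use C in blast)
    then show ?thesis using C by (intro exI[of _ C]) auto
  qed
  then obtain C where C: "\<And>b. C b \<ge> 0" "\<And>b x. norm (dir_deriv X x b) \<le> C b" by metis
  have "\<exists>K. \<forall>b. 0 \<le> K b \<and> (\<forall>x\<in>UNIV. \<bar>coord (UNIV::'a set) b x\<bar> \<le> K b * norm x)"
    using blin_on_coord[OF fd] unfolding blin_on_def real_norm_def by metis
  then obtain K' where K': "\<And>b. 0 \<le> K' b" "\<And>b x. \<bar>coord (UNIV::'a set) b x\<bar> \<le> K' b * norm x" by blast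
  define L where "L = (\<Sum>b\<in>fbasis (UNIV::'a set). K' b * C b) + 1"
  have s0: "(\<Sum>b\<in>fbasis (UNIV::'a set). K' b * C b) \<ge> 0" using K'(1) C(1) by (simp add: sum_nonneg)
  have bd: "norm (dir_deriv X z v) \<le> L * norm v" for z v
  proof -
    have "norm (dir_deriv X z v) = norm (\<Sum>b\<in>fbasis (UNIV::'a set). coord (UNIV::'a set) b v *\<^sub>R dir_deriv X z b)"
      by (rule arg_cong[where f = norm, OF dir_deriv_expand[OF fd U X UNIV_I UNIV_I]])
    also have "\<dots> \<le> (\<Sum>b\<in>fbasis (UNIV::'a set). (K' b * norm v) * C b)"
    proof (rule sum_norm_le)
      show "norm (coord (UNIV::'a set) b v *\<^sub>R dir_deriv X z b) \<le> (K' b * norm v) * C b" for b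
        unfolding norm_scaleR by (rule mult_mono[OF K'(2) C(2)]) (simp_all add: K'(1))
    qed
    also have "\<dots> = (\<Sum>b\<in>fbasis (UNIV::'a set). K' b * C b) * norm v" by (simp add: sum_distrib_left mult_ac)
    also have "\<dots> \<le> L * norm v" by (intro mult_right_mono) (auto simp: L_def)
    finally show ?thesis .
  qed
  show ?thesis
  proof
    show "L > 0" using s0 by (simp add: L_def)
    fix x y
    have "norm (X (y + 1 *\<^sub>R (x - y)) - X (y + 0 *\<^sub>R (x - y)) - 1 *\<^sub>R 0) \<le> (L * norm (x - y)) * \<bar>1\<bar>"
    proof (rule mean_value_segment)
      fix s
      show "((\<lambda>s. X (y + s *\<^sub>R (x - y))) has_vector_derivative dir_deriv X (y + s *\<^sub>R (x - y)) (x - y)) (at s)"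
        by (rule Ck_line_derivative[OF X]) auto
      show "norm (dir_deriv X (y + s *\<^sub>R (x - y)) (x - y) - 0) \<le> L * norm (x - y)" using bd by simp
    qed
    then show "norm (X x - X y) \<le> L * norm (x - y)" by simp
  qed
qed

section \<open>Octonionic lines\<close>

lemma UNIV_8: "(UNIV::8 set) = {0,1,2,3,4,5,6,7}"
proof (rule card_subset_eq[symmetric])
  show "card {0,1,2,3,4,5,6,7::8} = card (UNIV::8 set)" by simp
qed auto

lemma sum_8: "sum f (UNIV::8 set) = f 0 + f 1 + f 2 + f 3 + f 4 + f 5 + f 6 + f 7"
  unfolding UNIV_8 by (simp add: add.assoc)

lemma oct_basis_mult_nth:
  "oct_basis_mult i j $ k = (if i = 0 then of_bool (j = k) else if j = 0 then of_bool (i = k)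
     else if k = 0 then - of_bool (i = j) else oct_eps i j k)"
proof -
  have s: "(\<Sum>l\<in>UNIV - {0}. oct_eps i j l *\<^sub>R oct_basis l) $ k = (if k = 0 then 0 else oct_eps i j k)"
  proof -
    have "(\<Sum>l\<in>UNIV - {0}. oct_eps i j l *\<^sub>R oct_basis l) $ k = (\<Sum>l\<in>UNIV - {0}. if l = k then oct_eps i j l else 0)"
      unfolding sum_component by (rule sum.cong) (auto simp: axis_def)
    then show ?thesis by simp
  qed
  have e: "oct_eps i i l = 0" if "i \<noteq> 0" for l
  proof -
    have "(a, a, c) \<notin> oct_cyclic_triples" for a c
      by (auto simp: oct_cyclic_triples_def oct_triples_def)
    then show ?thesis by (simp add: oct_eps_def)
  qed
  show ?thesis unfolding oct_basis_mult_def using s e by (auto simp: axis_def)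
qed

lemma oct_mult_nth: "(x \<cdot>\<^sub>O y) $ k = (\<Sum>i\<in>UNIV. \<Sum>j\<in>UNIV. x $ i * y $ j * oct_basis_mult i j $ k)"
  by (simp add: oct_mult_def)

text \<open>The multiplication table in full. The octonionic identities below become polynomial
  identities in the coordinates.\<close>

lemma oct_mult_components:
  "(x \<cdot>\<^sub>O y) $ 0 = x$0*y$0 - x$1*y$1 - x$2*y$2 - x$3*y$3 - x$4*y$4 - x$5*y$5 - x$6*y$6 - x$7*y$7"
  "(x \<cdot>\<^sub>O y) $ 1 = x$0*y$1 + x$1*y$0 + x$2*y$3 - x$3*y$2 + x$4*y$5 - x$5*y$4 + x$7*y$6 - x$6*y$7"
  "(x \<cdot>\<^sub>O y) $ 2 = x$0*y$2 + x$2*y$0 + x$3*y$1 - x$1*y$3 + x$4*y$6 - x$6*y$4 + x$5*y$7 - x$7*y$5"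
  "(x \<cdot>\<^sub>O y) $ 3 = x$0*y$3 + x$3*y$0 + x$1*y$2 - x$2*y$1 + x$4*y$7 - x$7*y$4 + x$6*y$5 - x$5*y$6"
  "(x \<cdot>\<^sub>O y) $ 4 = x$0*y$4 + x$4*y$0 + x$5*y$1 - x$1*y$5 + x$6*y$2 - x$2*y$6 + x$7*y$3 - x$3*y$7"
  "(x \<cdot>\<^sub>O y) $ 5 = x$0*y$5 + x$5*y$0 + x$1*y$4 - x$4*y$1 + x$7*y$2 - x$2*y$7 + x$3*y$6 - x$6*y$3"
  "(x \<cdot>\<^sub>O y) $ 6 = x$0*y$6 + x$6*y$0 + x$1*y$7 - x$7*y$1 + x$2*y$4 - x$4*y$2 + x$5*y$3 - x$3*y$5"
  "(x \<cdot>\<^sub>O y) $ 7 = x$0*y$7 + x$7*y$0 + x$2*y$5 - x$5*y$2 + x$3*y$4 - x$4*y$3 + x$6*y$1 - x$1*y$6"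
  by (simp_all add: oct_mult_nth sum_8 oct_basis_mult_nth oct_eps_def oct_cyclic_triples_def oct_triples_def)

lemma forall_8: "(\<forall>i::8. P i) \<longleftrightarrow> P 0 \<and> P 1 \<and> P 2 \<and> P 3 \<and> P 4 \<and> P 5 \<and> P 6 \<and> P 7"
  using UNIV_8 by (metis (mono_tags, opaque_lifting) UNIV_I empty_iff insert_iff)

definition oct_conj :: "octonion \<Rightarrow> octonion" where
  "oct_conj x = (2 * x $ 0) *\<^sub>R oct_basis 0 - x"

lemma oct_conj_components:
  "oct_conj x $ 0 = x $ 0" "oct_conj x $ 1 = - x $ 1" "oct_conj x $ 2 = - x $ 2" "oct_conj x $ 3 = - x $ 3"
  "oct_conj x $ 4 = - x $ 4" "oct_conj x $ 5 = - x $ 5" "oct_conj x $ 6 = - x $ 6" "oct_conj x $ 7 = - x $ 7"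
  by (simp_all add: oct_conj_def axis_def)

lemma oct_norm_square: "(norm (x::octonion))\<^sup>2 = x$0*x$0 + x$1*x$1 + x$2*x$2 + x$3*x$3 + x$4*x$4 + x$5*x$5 + x$6*x$6 + x$7*x$7"
  by (simp add: power2_norm_eq_inner inner_vec_def sum_8)

text \<open>Alternativity in conjugated form. It replaces associativity in all arguments that
  concern a single line.\<close>

lemma oct_mult_conj: "(m \<cdot>\<^sub>O x) \<cdot>\<^sub>O oct_conj x = (norm x)\<^sup>2 *\<^sub>R m"
  unfolding vec_eq_iff forall_8
  by (simp add: oct_norm_square oct_conj_components oct_mult_components) (intro conjI; algebra)

lemma oct_conj_conj: "oct_conj (oct_conj x) = x"
  by (simp add: vec_eq_iff forall_8 oct_conj_components)

lemma norm_oct_conj: "norm (oct_conj x) = norm x"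
proof -
  have "(norm (oct_conj x))\<^sup>2 = (norm x)\<^sup>2" by (simp add: oct_norm_square oct_conj_components)
  then show ?thesis by simp
qed

lemma oct_mult_linear:
  "(a + b) \<cdot>\<^sub>O x = a \<cdot>\<^sub>O x + b \<cdot>\<^sub>O x" "x \<cdot>\<^sub>O (a + b) = x \<cdot>\<^sub>O a + x \<cdot>\<^sub>O b"
  "(r *\<^sub>R a) \<cdot>\<^sub>O x = r *\<^sub>R (a \<cdot>\<^sub>O x)" "x \<cdot>\<^sub>O (r *\<^sub>R a) = r *\<^sub>R (x \<cdot>\<^sub>O a)"
  by (simp_all add: oct_mult_def algebra_simps sum.distrib scaleR_sum_right)

lemma bounded_bilinear_oct_mult: "bounded_bilinear (\<cdot>\<^sub>O)"
proof -
  have "bilinear (\<cdot>\<^sub>O)" unfolding bilinear_def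
    by (auto intro!: linearI simp: oct_mult_linear)
  then show ?thesis by (simp add: bilinear_conv_bounded_bilinear)
qed

interpretation oct: bounded_bilinear "(\<cdot>\<^sub>O)" by (rule bounded_bilinear_oct_mult)

lemma bounded_linear_oct_conj: "bounded_linear oct_conj"
proof -
  have "linear oct_conj" by (rule linearI) (simp_all add: oct_conj_def algebra_simps)
  then show ?thesis by (simp add: linear_conv_bounded_linear)
qed

lemma oct_mult_conj': "(m \<cdot>\<^sub>O oct_conj x) \<cdot>\<^sub>O x = (norm x)\<^sup>2 *\<^sub>R m"
  using oct_mult_conj[of m "oct_conj x"] by (simp add: oct_conj_conj norm_oct_conj)

text \<open>Polarisation of \<open>oct_mult_conj\<close>, which is quadratic in \<open>x\<close>. It
  computes the derivative of the slope along a curve.\<close>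

lemma oct_mult_conj_polar:
  "(m \<cdot>\<^sub>O x) \<cdot>\<^sub>O oct_conj z + (m \<cdot>\<^sub>O z) \<cdot>\<^sub>O oct_conj x = (2 * (x \<bullet> z)) *\<^sub>R m"
proof -
  have c: "oct_conj (x + z) = oct_conj x + oct_conj z" by (simp add: oct_conj_def algebra_simps)
  have "(norm (x + z))\<^sup>2 = (norm x)\<^sup>2 + (norm z)\<^sup>2 + 2 * (x \<bullet> z)"
    by (simp add: power2_norm_eq_inner inner_add_left inner_add_right inner_commute)
  then show ?thesis
    using oct_mult_conj[of m "x + z"] oct_mult_conj[of m x] oct_mult_conj[of m z]
    by (simp add: c oct_mult_linear algebra_simps)
qed

lemma oct_right_cancel:
  assumes "x \<noteq> 0" "m \<cdot>\<^sub>O x = m' \<cdot>\<^sub>O x" shows "m = m'"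
proof -
  have "(norm x)\<^sup>2 *\<^sub>R m = (norm x)\<^sup>2 *\<^sub>R m'"
    unfolding oct_mult_conj[symmetric] assms(2) by (rule refl)
  then show ?thesis using assms(1) by simp
qed

text \<open>The second component times the inverse of the first: the slope of the only line through
  the point when the first component is nonzero.\<close>

definition oct_slope :: "octonion \<times> octonion \<Rightarrow> octonion" where
  "oct_slope a = inverse ((norm (fst a))\<^sup>2) *\<^sub>R (snd a \<cdot>\<^sub>O oct_conj (fst a))"

lemma oct_line_iff: "a \<in> oct_line m \<longleftrightarrow> snd a = m \<cdot>\<^sub>O fst a"
  by (cases a) (auto simp: oct_line_def)

lemma oct_slope:
  assumes "fst a \<noteq> 0" shows "a \<in> oct_line m \<longleftrightarrow> m = oct_slope a"
proof
  assume "a \<in> oct_line m"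
  then show "m = oct_slope a" using assms by (simp add: oct_line_iff oct_slope_def oct_mult_conj)
next
  assume "m = oct_slope a"
  then show "a \<in> oct_line m" using assms by (simp add: oct_line_iff oct_slope_def oct_mult_linear oct_mult_conj')
qed

lemma closed_oct_line: "closed (oct_line m)"
proof -
  have "closed {a. snd a = m \<cdot>\<^sub>O fst a}"
    by (intro closed_Collect_eq continuous_intros oct.continuous_on)
  moreover have "{a. snd a = m \<cdot>\<^sub>O fst a} = oct_line m" by (auto simp: oct_line_iff)
  ultimately show ?thesis by simp
qed

text \<open>Membership in a common leaf, phrased without naming the slope or the radius. The clause
  on first components accounts for the line at infinity.\<close>

definition hopf_equiv :: "octonion \<times> octonion \<Rightarrow> octonion \<times> octonion \<Rightarrow> bool" where
  "hopf_equiv a b \<longleftrightarrow> norm a = norm b \<and> (fst a = 0 \<longleftrightarrow> fst b = 0) \<and> (\<forall>m. a \<in> oct_line m \<longleftrightarrow> b \<in> oct_line m)"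

text \<open>Tangency of \<open>v\<close> to the leaf through \<open>a\<close>. At the origin the
  last two clauses force \<open>v = 0\<close>, as the leaf is a point.\<close>

definition hopf_tangent :: "octonion \<times> octonion \<Rightarrow> octonion \<times> octonion \<Rightarrow> bool" where
  "hopf_tangent a v \<longleftrightarrow> a \<bullet> v = 0 \<and> (fst a = 0 \<longrightarrow> fst v = 0) \<and> (\<forall>m. a \<in> oct_line m \<longrightarrow> v \<in> oct_line m)"

lemma hopf_equiv_refl: "hopf_equiv a a" and hopf_equiv_sym: "hopf_equiv a b \<Longrightarrow> hopf_equiv b a"
  and hopf_equiv_trans: "hopf_equiv a b \<Longrightarrow> hopf_equiv b c \<Longrightarrow> hopf_equiv a c"
  unfolding hopf_equiv_def by auto

text \<open>On a line of slope \<open>m\<close> with tangent velocity, both the product of the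
  second component with the conjugate of the first and the squared norm of the first have
  derivatives in the ratio \<open>m\<close>, by polarisation. Hence their quotient, the slope, has
  derivative 0.\<close>

lemma hopf_slope_const:
  assumes J: "convex J" and c: "\<And>t. t \<in> J \<Longrightarrow> \<exists>c'. (c has_vector_derivative c') (at t) \<and> hopf_tangent (c t) c'"
    and nz: "\<And>t. t \<in> J \<Longrightarrow> fst (c t) \<noteq> 0" and st: "s \<in> J" "t \<in> J"
  shows "oct_slope (c s) = oct_slope (c t)"
proof -
  have "((\<lambda>t. oct_slope (c t)) has_vector_derivative 0) (at t within J)" if t: "t \<in> J" for t
  proof -
    obtain c' where c': "(c has_vector_derivative c') (at t)" "hopf_tangent (c t) c'" using c[OF t] by blast
    define x y x' y' where "x = fst (c t)" and "y = snd (c t)" and "x' = fst c'" and "y' = snd c'"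
    define m where "m = oct_slope (c t)"
    have x0: "x \<noteq> 0" using nz[OF t] by (simp add: x_def)
    have line: "c t \<in> oct_line m" using oct_slope[OF nz[OF t]] by (simp add: m_def)
    then have y: "y = m \<cdot>\<^sub>O x" "y' = m \<cdot>\<^sub>O x'"
      using c'(2) by (auto simp: hopf_tangent_def oct_line_iff x_def y_def x'_def y'_def)
    have dx: "((\<lambda>t. fst (c t)) has_vector_derivative x') (at t)" and dy: "((\<lambda>t. snd (c t)) has_vector_derivative y') (at t)"
      unfolding x'_def y'_def
      using bounded_linear.has_vector_derivative[OF bounded_linear_fst c'(1)] bounded_linear.has_vector_derivative[OF bounded_linear_snd c'(1)] by auto
    have dB: "((\<lambda>t. snd (c t) \<cdot>\<^sub>O oct_conj (fst (c t))) has_vector_derivative (y \<cdot>\<^sub>O oct_conj x' + y' \<cdot>\<^sub>O oct_conj x)) (at t)"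
      using oct.has_vector_derivative[OF dy bounded_linear.has_vector_derivative[OF bounded_linear_oct_conj dx]]
      by (simp add: x_def y_def)
    have "((\<lambda>t. fst (c t) \<bullet> fst (c t)) has_vector_derivative (x \<bullet> x' + x' \<bullet> x)) (at t)"
      using bounded_bilinear.has_vector_derivative[OF bounded_bilinear_inner dx dx] by (simp add: x_def)
    then have dn: "((\<lambda>t. (norm (fst (c t)))\<^sup>2) has_real_derivative 2 * (x \<bullet> x')) (at t)"
      by (simp add: power2_norm_eq_inner has_real_derivative_iff_has_vector_derivative inner_commute)
    have di: "((\<lambda>t. inverse ((norm (fst (c t)))\<^sup>2)) has_real_derivative - (inverse ((norm x)\<^sup>2) * (2 * (x \<bullet> x')) * inverse ((norm x)\<^sup>2))) (at t)"
      using DERIV_inverse'[OF dn] x0 by (simp add: x_def)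
    have "((\<lambda>t. oct_slope (c t)) has_vector_derivative inverse ((norm x)\<^sup>2) *\<^sub>R (y \<cdot>\<^sub>O oct_conj x' + y' \<cdot>\<^sub>O oct_conj x)
        + (- (inverse ((norm x)\<^sup>2) * (2 * (x \<bullet> x')) * inverse ((norm x)\<^sup>2))) *\<^sub>R (y \<cdot>\<^sub>O oct_conj x)) (at t)"
      unfolding oct_slope_def using has_vector_derivative_scaleR[OF di dB] by (simp add: x_def y_def)
    moreover have "y \<cdot>\<^sub>O oct_conj x' + y' \<cdot>\<^sub>O oct_conj x = (2 * (x \<bullet> x')) *\<^sub>R m"
      unfolding y by (rule oct_mult_conj_polar)
    moreover have "y \<cdot>\<^sub>O oct_conj x = (norm x)\<^sup>2 *\<^sub>R m" unfolding y by (rule oct_mult_conj)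
    moreover have "inverse ((norm x)\<^sup>2) * (2 * (x \<bullet> x')) * inverse ((norm x)\<^sup>2) * (norm x)\<^sup>2 = inverse ((norm x)\<^sup>2) * (2 * (x \<bullet> x'))"
      using x0 by simp
    ultimately have "((\<lambda>t. oct_slope (c t)) has_vector_derivative 0) (at t)" by simp
    then show ?thesis by (rule has_vector_derivative_at_within)
  qed
  then obtain k where "\<And>t. t \<in> J \<Longrightarrow> oct_slope (c t) = k"
    using has_vector_derivative_zero_constant[OF J, of "\<lambda>t. oct_slope (c t)"] by blast
  then show ?thesis using st by simp
qed

text \<open>The norm is constant by orthogonality. For a curve away from the origin, the times spent
  on a given line form a closed set, which is also open because the slope is locally constant.
  Points on no line are those with vanishing first component.\<close>

lemma hopf_curve:
  assumes ab: "a \<le> b" and c: "\<And>t. t \<in> {a..b} \<Longrightarrow> \<exists>c'. (c has_vector_derivative c') (at t) \<and> hopf_tangent (c t) c'"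
  shows "hopf_equiv (c a) (c b)"
proof -
  have cont: "continuous_on {a..b} c"
    using c has_vector_derivative_continuous continuous_at_imp_continuous_on by metis
  have "((\<lambda>t. c t \<bullet> c t) has_vector_derivative 0) (at t within {a..b})" if t: "t \<in> {a..b}" for t
  proof -
    obtain c' where c': "(c has_vector_derivative c') (at t)" "hopf_tangent (c t) c'" using c[OF t] by blast
    have "((\<lambda>t. c t \<bullet> c t) has_vector_derivative (c t \<bullet> c' + c' \<bullet> c t)) (at t)"
      by (rule bounded_bilinear.has_vector_derivative[OF bounded_bilinear_inner c'(1) c'(1)])
    then show ?thesis using c'(2) by (auto simp: hopf_tangent_def inner_commute intro: has_vector_derivative_at_within)
  qed
  then obtain k where k: "\<And>t. t \<in> {a..b} \<Longrightarrow> c t \<bullet> c t = k"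
    using has_vector_derivative_zero_constant[of "{a..b}" "\<lambda>t. c t \<bullet> c t"] by auto
  have nc: "norm (c t) = sqrt k" if "t \<in> {a..b}" for t using k[OF that] by (simp add: norm_eq_sqrt_inner)
  show ?thesis
  proof (cases "k = 0")
    case True
    then have "c a = 0" "c b = 0" using k[of a] k[of b] ab by auto
    then show ?thesis by (simp add: hopf_equiv_refl)
  next
    case False
    then have nz: "c t \<noteq> 0" if "t \<in> {a..b}" for t using k[OF that] by auto
    have lineD: "fst (c t) \<noteq> 0" if "t \<in> {a..b}" "c t \<in> oct_line m" for t m
      using nz[OF that(1)] that(2) by (auto simp: oct_line_iff prod_eq_iff oct.zero_right)
    have all: "c t \<in> oct_line m" if s: "s \<in> {a..b}" "c s \<in> oct_line m" and t: "t \<in> {a..b}" for s t m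
    proof -
      define P where "P = {t \<in> {a..b}. c t \<in> oct_line m}"
      have "closedin (top_of_set {a..b}) P"
      proof -
        have "P = {a..b} \<inter> c -` oct_line m" by (auto simp: P_def)
        then show ?thesis using continuous_closedin_preimage[OF cont closed_oct_line] by simp
      qed
      moreover have "openin (top_of_set {a..b}) P"
        unfolding openin_euclidean_subtopology_iff
      proof (intro conjI ballI)
        show "P \<subseteq> {a..b}" by (auto simp: P_def)
        fix r assume r: "r \<in> P"
        then have r0: "r \<in> {a..b}" "c r \<in> oct_line m" by (auto simp: P_def)
        have r1: "r \<in> {a..b}" "fst (c r) \<noteq> 0" "m = oct_slope (c r)"
          using r0(1) lineD[OF r0] oct_slope[OF lineD[OF r0]] r0(2) by blast+
        have "continuous_on {a..b} (\<lambda>t. fst (c t))" by (intro continuous_intros cont)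
        then obtain e where e: "e > 0" "\<And>t. t \<in> {a..b} \<Longrightarrow> dist t r < e \<Longrightarrow> dist (fst (c t)) (fst (c r)) < norm (fst (c r))"
          using r1(1,2) unfolding continuous_on_iff by (metis zero_less_norm_iff)
        have nz2: "fst (c t) \<noteq> 0" if "t \<in> {a..b} \<inter> ball r e" for t
          using e(2)[of t] that by (auto simp: dist_commute dist_norm)
        have J: "convex ({a..b} \<inter> ball r e)" by (intro convex_Int convex_ball) auto
        show "\<exists>e>0. \<forall>t\<in>{a..b}. dist t r < e \<longrightarrow> t \<in> P"
        proof (intro exI conjI ballI impI)
          fix t assume t: "t \<in> {a..b}" "dist t r < e"
          then have tJ: "t \<in> {a..b} \<inter> ball r e" by (auto simp: dist_commute)
          have "oct_slope (c r) = oct_slope (c t)"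
            by (rule hopf_slope_const[OF J, of c]) (use c nz2 tJ r1(1) e(1) in auto)
          then show "t \<in> P" using oct_slope[OF nz2[OF tJ]] r1(3) t(1) by (simp add: P_def)
        qed fact
      qed
      moreover have "P \<noteq> {}" using s by (auto simp: P_def)
      ultimately have "P = {a..b}"
        using connected_Icc[of a b] unfolding connected_clopen by blast
      then have "t \<in> P" using t by blast
      then show ?thesis by (simp add: P_def)
    qed
    have lines: "c a \<in> oct_line m \<longleftrightarrow> c b \<in> oct_line m" for m using all[of a m b] all[of b m a] ab by auto
    have "fst (c t) = 0 \<longleftrightarrow> (\<forall>m. c t \<notin> oct_line m)" if "t \<in> {a..b}" for t
      using lineD[OF that] oct_slope[of "c t"] by blast
    then show ?thesis using lines nc[of a] nc[of b] ab by (simp add: hopf_equiv_def)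
  qed
qed

section \<open>Flows on Euclidean space and the leaves of F0\<close>

lemma standard_simps [simp]:
  "points (standard_manifold :: ('e::real_normed_vector, 'e) manifold) = UNIV"
  "model (standard_manifold :: ('e::real_normed_vector, 'e) manifold) = UNIV"
  "cdom (standard_manifold :: ('e::real_normed_vector, 'e) manifold) p = UNIV"
  "cmap (standard_manifold :: ('e::real_normed_vector, 'e) manifold) p x = x"
  "mtop (standard_manifold :: ('e::real_normed_vector, 'e) manifold) = euclidean"
  by (simp_all add: standard_manifold_def)

lemma cinv_standard [simp]: "cinv (standard_manifold :: ('e::real_normed_vector, 'e) manifold) p x = x"
  unfolding cinv_def standard_simps(3) by (metis UNIV_I f_inv_into_f rangeI standard_simps(4))

lemma vf_rep_standard [simp]: "vf_rep (standard_manifold :: ('e::real_normed_vector, 'e) manifold) p X = X"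
proof
  fix x
  have "dir_deriv (cmap (standard_manifold :: ('e, 'e) manifold) p \<circ> cinv (standard_manifold :: ('e, 'e) manifold) x) x v = v" for v
    by (rule dir_derivI) (auto intro!: derivative_eq_intros)
  then show "vf_rep (standard_manifold :: ('e, 'e) manifold) p X x = X x" by (simp add: vf_rep_def)
qed

lemma integral_curve_standard:
  "integral_curve (standard_manifold :: ('e::real_normed_vector, 'e) manifold) X \<gamma> \<longleftrightarrow>
    (\<forall>t. (\<gamma> has_vector_derivative X (\<gamma> t)) (at t))"
  unfolding integral_curve_def
  by (auto simp: continuous_map_iff_continuous2 intro!: continuous_at_imp_continuous_on has_vector_derivative_continuous)

text \<open>Only flow lines defined for all times count in \<open>leaf\<close>; compact support
  supplies the Lipschitz constant and the bound for the global Picard argument.\<close>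

lemma complete_standard:
  assumes "X \<in> vector_fields_cc (standard_manifold :: ('e::euclidean_space, 'e) manifold)"
  obtains \<gamma> where "integral_curve standard_manifold X \<gamma>" "\<gamma> 0 = a"
proof -
  have X: "Cinf_on UNIV UNIV X" and s: "compact_support standard_manifold X"
    using assms by (auto simp: vector_fields_cc_def vector_fields_def)
  define K where "K = closure {p. X p \<noteq> 0}"
  have K: "compact K" "\<And>x. x \<notin> K \<Longrightarrow> X x = 0"
    using s closure_subset[of "{p. X p \<noteq> 0}"] by (auto simp: compact_support_def K_def)
  obtain L where L: "L > 0" "\<And>x y. norm (X x - X y) \<le> L * norm (x - y)"
    using compact_support_lipschitz[OF Cinf_Ck[OF X, of "Suc 0"] K] by blast
  have "compact (X ` K)"
    using Ck_continuous[OF Cinf_Ck[OF X, of 0]] K(1) continuous_on_subset compact_continuous_image by blast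
  then obtain B where B: "B > 0" "\<And>y. y \<in> X ` K \<Longrightarrow> norm y \<le> B" by (meson compact_imp_bounded bounded_pos)
  have "norm (X x) \<le> B" for x using B K(2)[of x] by (cases "x \<in> K") auto
  then obtain \<gamma> where "\<gamma> 0 = a" "\<And>t. (\<gamma> has_vector_derivative X (\<gamma> t)) (at t)"
    using picard_global[OF L] by blast
  then show ?thesis using that[of \<gamma>] by (simp add: integral_curve_standard)
qed

lemma leaf_refl: "q \<in> leaf M F q"
  by (simp add: leaf_def)

lemma leaf_curve: "X \<in> F \<Longrightarrow> integral_curve M X \<gamma> \<Longrightarrow> \<gamma> 0 \<in> leaf M F q \<Longrightarrow> \<gamma> t \<in> leaf M F q"
  unfolding leaf_def by (auto intro: rtranclp.rtrancl_into_rtrancl)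

lemma oct_sphere_iff: "r \<ge> 0 \<Longrightarrow> a \<in> oct_sphere r \<longleftrightarrow> norm a = r"
  by (cases a) (auto simp: oct_sphere_def norm_prod_def real_sqrt_unique)

lemma oct_mult_zero_right [simp]: "m \<cdot>\<^sub>O 0 = 0"
  by (rule oct.zero_right)

text \<open>Through a nonzero point passes exactly one line, of finite slope or at infinity, so line
  and norm determine the leaf.\<close>

lemma hopf_leaf:
  assumes L: "L \<in> octonionic_hopf_leaves" and a: "a \<in> L"
  shows "b \<in> L \<longleftrightarrow> hopf_equiv a b"
proof -
  consider m r where "L = oct_line m \<inter> oct_sphere r" "r > 0" | r where "L = oct_line_inf \<inter> oct_sphere r" "r > 0" | "L = {(0, 0)}"
    using L by (auto simp: octonionic_hopf_leaves_def)
  then show ?thesis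
  proof cases
    case 1
    have nz: "fst c \<noteq> 0" if "c \<in> oct_line m" "norm c = r" for c
      using that 1(2) by (cases c) (auto simp: oct_line_iff)
    have a': "a \<in> oct_line m" "norm a = r" using a 1 oct_sphere_iff[of r a] by auto
    show ?thesis
    proof
      assume "b \<in> L"
      then have b': "b \<in> oct_line m" "norm b = r" using 1 oct_sphere_iff[of r b] by auto
      show "hopf_equiv a b" unfolding hopf_equiv_def
        using a' b' nz[OF a'] nz[OF b'] oct_slope[OF nz[OF a']] oct_slope[OF nz[OF b']] by auto
    next
      assume "hopf_equiv a b"
      then show "b \<in> L" using a' 1 oct_sphere_iff[of r b] by (simp add: hopf_equiv_def)
    qed
  next
    case 2
    have inf: "c \<in> oct_line_inf \<longleftrightarrow> fst c = 0" for c by (cases c) (auto simp: oct_line_inf_def)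
    have a': "fst a = 0" "norm a = r" using a 2 inf oct_sphere_iff[of r a] by auto
    have nl: "c \<notin> oct_line m" if "fst c = 0" "norm c = r" for c m
      using that 2(2) by (cases c) (auto simp: oct_line_iff)
    show ?thesis
    proof
      assume "b \<in> L"
      then have b': "fst b = 0" "norm b = r" using 2 inf oct_sphere_iff[of r b] by auto
      show "hopf_equiv a b" unfolding hopf_equiv_def using a' b' nl[OF a'] nl[OF b'] by simp
    next
      assume "hopf_equiv a b"
      then show "b \<in> L" using a' 2 inf oct_sphere_iff[of r b] by (simp add: hopf_equiv_def)
    qed
  next
    case 3
    then have "a = 0" using a by (simp add: zero_prod_def)
    then show ?thesis using 3 by (auto simp: hopf_equiv_def zero_prod_def[symmetric])
  qed
qed

context
  fixes F0 :: "(octonion \<times> octonion \<Rightarrow> octonion \<times> octonion) set"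
  assumes fol: "singular_foliation standard_manifold F0"
    and dec: "leaf_decomposition standard_manifold F0 = octonionic_hopf_leaves"
begin

lemma leaf_F0_iff: "b \<in> leaf standard_manifold F0 a \<longleftrightarrow> hopf_equiv a b"
proof -
  have "leaf standard_manifold F0 a \<in> octonionic_hopf_leaves"
    unfolding dec[symmetric] leaf_decomposition_def by simp
  then show ?thesis by (rule hopf_leaf) (rule leaf_refl)
qed

text \<open>The flow line through \<open>a\<close> stays in the leaf of \<open>a\<close>, so the
  equations that describe this leaf (constant norm, and membership in a line) can be differentiated
  along it at time 0.\<close>

lemma F0_tangent:
  assumes X: "X \<in> F0" shows "hopf_tangent a (X a)"
proof -
  have "X \<in> vector_fields_cc standard_manifold" using fol X by (auto simp: singular_foliation_def)
  then obtain \<gamma> where \<gamma>: "integral_curve standard_manifold X \<gamma>" "\<gamma> 0 = a" using complete_standard by blast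
  have eq: "hopf_equiv a (\<gamma> t)" for t
    using leaf_curve[OF X \<gamma>(1), of a t] \<gamma>(2) hopf_equiv_refl[of a] by (simp add: leaf_F0_iff)
  have d: "(\<gamma> has_vector_derivative X a) (at 0)" using \<gamma> by (auto simp: integral_curve_standard)
  have "((\<lambda>t. \<gamma> t \<bullet> \<gamma> t) has_vector_derivative (\<gamma> 0 \<bullet> X a + X a \<bullet> \<gamma> 0)) (at 0)"
    by (rule bounded_bilinear.has_vector_derivative[OF bounded_bilinear_inner d d])
  moreover have "(\<lambda>t. \<gamma> t \<bullet> \<gamma> t) = (\<lambda>t. (norm a)\<^sup>2)" using eq by (simp add: hopf_equiv_def power2_norm_eq_inner[symmetric])
  ultimately have "((\<lambda>t. (norm a)\<^sup>2) has_vector_derivative (\<gamma> 0 \<bullet> X a + X a \<bullet> \<gamma> 0)) (at (0::real))" by simp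
  from vector_derivative_unique_at[OF this has_vector_derivative_const]
  have 1: "a \<bullet> X a = 0" using \<gamma>(2) by (simp add: inner_commute)
  have df: "((\<lambda>t. fst (\<gamma> t)) has_vector_derivative fst (X a)) (at 0)" and ds: "((\<lambda>t. snd (\<gamma> t)) has_vector_derivative snd (X a)) (at 0)"
    by (rule bounded_linear.has_vector_derivative[OF bounded_linear_fst d], rule bounded_linear.has_vector_derivative[OF bounded_linear_snd d])
  have 2: "fst (X a) = 0" if "fst a = 0"
  proof -
    have "(\<lambda>t. fst (\<gamma> t)) = (\<lambda>t. 0)" using eq that by (simp add: hopf_equiv_def)
    then have "((\<lambda>t. 0) has_vector_derivative fst (X a)) (at (0::real))" using df by simp
    from vector_derivative_unique_at[OF this has_vector_derivative_const] show ?thesis .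
  qed
  have 3: "X a \<in> oct_line m" if "a \<in> oct_line m" for m
  proof -
    have "((\<lambda>t. snd (\<gamma> t) - m \<cdot>\<^sub>O fst (\<gamma> t)) has_vector_derivative (snd (X a) - m \<cdot>\<^sub>O fst (X a))) (at 0)"
      by (rule has_vector_derivative_diff[OF ds bounded_linear.has_vector_derivative[OF oct.bounded_linear_right df]])
    moreover have "\<gamma> t \<in> oct_line m" for t using eq[of t] that unfolding hopf_equiv_def by blast
    then have "(\<lambda>t. snd (\<gamma> t) - m \<cdot>\<^sub>O fst (\<gamma> t)) = (\<lambda>t. 0)" by (simp add: oct_line_iff)
    ultimately have "((\<lambda>t. 0) has_vector_derivative (snd (X a) - m \<cdot>\<^sub>O fst (X a))) (at (0::real))" by simp
    from vector_derivative_unique_at[OF this has_vector_derivative_const] show ?thesis by (simp add: oct_line_iff)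
  qed
  show ?thesis using 1 2 3 by (simp add: hopf_tangent_def)
qed

end

lemma hopf_equiv_zero: "hopf_equiv 0 a \<longleftrightarrow> a = 0"
  by (auto simp: hopf_equiv_def)

text \<open>Up to small errors \<open>A\<close> acts as (x, y) \<mapsto> (f x, s y) with
  \<open>f e0\<close> near e1. The points (e0, e6) and (e0, e4) give s e6 near e6 e1 = e7 and s e4
  near e4 e1 = -e5; the diagonal point (e4, e4) gives f e4 near s e4. The point (e4, e6) of slope e2
  then puts s e6 near e2 (-e5) = -e7.\<close>

lemma no_almost_linear_hopf_map:
  fixes A :: "octonion \<times> octonion \<Rightarrow> octonion \<times> octonion"
  assumes lin: "linear A" and near: "\<And>a. norm a \<le> 2 \<Longrightarrow> \<exists>z. norm (A a - z) \<le> 1/100 \<and> hopf_equiv a z"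
    and base: "norm (A (oct_basis 0, 0) - (oct_basis 1, 0)) \<le> 1/100"
  shows False
proof -
  have comp: "\<bar>fst u $ i - fst v $ i\<bar> \<le> 1/100" "\<bar>snd u $ i - snd v $ i\<bar> \<le> 1/100" if "norm (u - v) \<le> 1/100"
    for u v :: "octonion \<times> octonion" and i
  proof -
    have "\<bar>fst (u - v) $ i\<bar> \<le> norm (u - v)"
      using component_le_norm_cart[of "fst (u - v)" i] norm_fst_le[of "fst (u - v)" "snd (u - v)"] by (simp only: prod.collapse)
    moreover have "\<bar>snd (u - v) $ i\<bar> \<le> norm (u - v)"
      using component_le_norm_cart[of "snd (u - v)" i] norm_snd_le[of "snd (u - v)" "fst (u - v)"] by (simp only: prod.collapse)
    ultimately show "\<bar>fst u $ i - fst v $ i\<bar> \<le> 1/100" "\<bar>snd u $ i - snd v $ i\<bar> \<le> 1/100" using that by auto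
  qed
  have n2: "norm (a, b) \<le> 2" if "norm a \<le> 1" "norm b \<le> 1" for a b :: octonion
  proof -
    have "norm (a, b) \<le> norm a + norm b" by (simp add: norm_Pair sqrt_add_le_add_sqrt[of "(norm a)\<^sup>2" "(norm b)\<^sup>2", simplified])
    then show ?thesis using that by simp
  qed
  have nb: "norm (oct_basis i) \<le> 1" for i by simp
  define f where "f a = fst (A a)" for a
  define s where "s a = snd (A a)" for a
  have add: "f (x, y) = f (x, 0) + f (0, y)" "s (x, y) = s (x, 0) + s (0, y)" for x y
    using linear_add[OF lin, of "(x, 0)" "(0, y)"] by (simp_all add: f_def s_def)
  have b: "\<bar>f (oct_basis 0, 0) $ 1 - 1\<bar> \<le> 1/100" "\<bar>s (oct_basis 0, 0) $ i\<bar> \<le> 1/100" for i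
    using comp[OF base, of 1] comp(2)[OF base, of i] by (simp_all add: f_def s_def axis_def)
  have l0: "\<bar>s (x, 0) $ i\<bar> \<le> 1/100" if nx: "norm x \<le> 1" for x i
  proof -
    obtain z where z: "norm (A (x, 0) - z) \<le> 1/100" "hopf_equiv (x, 0) z" using near[of "(x, 0)"] n2[OF nx, of 0] by auto
    have "(x, 0) \<in> oct_line 0" by (simp add: oct_line_iff oct.zero_left)
    then have "z \<in> oct_line 0" using z(2) unfolding hopf_equiv_def by blast
    then have "snd z = 0" by (simp add: oct_line_iff oct.zero_left)
    then show ?thesis using comp(2)[OF z(1), of i] by (simp add: s_def)
  qed
  have linf: "\<bar>f (0, y) $ i\<bar> \<le> 1/100" if ny: "norm y \<le> 1" for y i
  proof -
    obtain z where z: "norm (A (0, y) - z) \<le> 1/100" "hopf_equiv (0, y) z" using near[of "(0, y)"] n2[OF _ ny, of 0] by auto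
    have "fst z = 0" using z(2) by (simp add: hopf_equiv_def)
    then show ?thesis using comp(1)[OF z(1), of i] by (simp add: f_def)
  qed
  have lm: "\<exists>w. \<bar>f (oct_basis j, oct_basis k) $ l - w $ l\<bar> \<le> 1/100 \<and> \<bar>s (oct_basis j, oct_basis k) $ i - (oct_basis m \<cdot>\<^sub>O w) $ i\<bar> \<le> 1/100"
    if eq: "oct_basis k = oct_basis m \<cdot>\<^sub>O oct_basis j" for j k l i m
  proof -
    let ?a = "(oct_basis j, oct_basis k)"
    obtain z where z: "norm (A ?a - z) \<le> 1/100" "hopf_equiv ?a z" using near[of ?a] n2[OF nb nb] by blast
    have "?a \<in> oct_line (oct_basis m)" using eq by (simp add: oct_line_iff)
    then have "snd z = oct_basis m \<cdot>\<^sub>O fst z" using z(2) by (simp add: hopf_equiv_def oct_line_iff[symmetric])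
    then show ?thesis using comp(1)[OF z(1), of l] comp(2)[OF z(1), of i] by (intro exI[of _ "fst z"]) (simp add: f_def s_def)
  qed
  have e: "oct_basis 6 = oct_basis 6 \<cdot>\<^sub>O oct_basis 0" "oct_basis 4 = oct_basis 4 \<cdot>\<^sub>O oct_basis 0"
    "oct_basis 4 = oct_basis 0 \<cdot>\<^sub>O oct_basis 4" "oct_basis 6 = oct_basis 2 \<cdot>\<^sub>O oct_basis 4"
    by (simp_all add: vec_eq_iff forall_8 oct_mult_components axis_def)
  have c: "(oct_basis 6 \<cdot>\<^sub>O w) $ 7 = w $ 1" "(oct_basis 4 \<cdot>\<^sub>O w) $ 5 = - w $ 1" "(oct_basis 0 \<cdot>\<^sub>O w) $ 5 = w $ 5"
    "(oct_basis 2 \<cdot>\<^sub>O w) $ 7 = w $ 5" for w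
    by (simp_all add: oct_mult_components axis_def)
  note bounds = l0[OF nb] linf[OF nb] b
  \<comment> \<open>Five errors of 1/100 enter here; this bound and the next ones are rounded up,
    far below the gap of 2 that is contradicted at the end.\<close>
  have r1: "\<bar>s (0, oct_basis 6) $ 7 - 1\<bar> \<le> 6/100"
    using lm[OF e(1), of 1 7] b(1) b(2)[of 7] linf[OF nb, of 6 1] unfolding c add[of "oct_basis 0" "oct_basis 6"] vector_add_component
    by (elim exE conjE) linarith
  have r2: "\<bar>s (0, oct_basis 4) $ 5 + 1\<bar> \<le> 6/100"
    using lm[OF e(2), of 1 5] b(1) b(2)[of 5] linf[OF nb, of 4 1] unfolding c add[of "oct_basis 0" "oct_basis 4"] vector_add_component
    by (elim exE conjE) linarith
  have r3: "\<bar>f (oct_basis 4, 0) $ 5 + 1\<bar> \<le> 12/100"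
    using lm[OF e(3), of 5 5] r2 l0[OF nb, of 4 5] linf[OF nb, of 4 5] unfolding c add[of "oct_basis 4" "oct_basis 4"] vector_add_component
    by (elim exE conjE) linarith
  show False
    using lm[OF e(4), of 5 7] r1 r3 l0[OF nb, of 4 7] linf[OF nb, of 6 5] unfolding c add[of "oct_basis 4" "oct_basis 6"] vector_add_component
    by (elim exE conjE) linarith
qed

section \<open>Isometries of open submanifolds\<close>

lemma open_submanifold_simps [simp]:
  "mtop (open_submanifold M U) = subtopology (mtop M) U" "model (open_submanifold M U) = model M"
  "cdom (open_submanifold M U) p = cdom M p \<inter> U" "cmap (open_submanifold M U) = cmap M"
  by (simp_all add: open_submanifold_def)

lemma riemannian_metricD:
  assumes "riemannian_metric M g" "p \<in> points M" "u \<in> model M" "v \<in> model M"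
  shows "g p u v = g p v u" "u \<noteq> 0 \<Longrightarrow> g p u u > 0"
    "w \<in> model M \<Longrightarrow> g p (a *\<^sub>R u + b *\<^sub>R v) w = a * g p u w + b * g p v w"
  using assms unfolding riemannian_metric_def by blast+

context smooth_mfd begin

text \<open>The submanifold inverts its charts on smaller domains, so its inverse charts agree with
  those of \<open>M\<close> only at coordinates of points of \<open>U\<close>.\<close>

lemma cinv_sub: "p \<in> points M \<Longrightarrow> q \<in> cdom M p \<Longrightarrow> q \<in> U \<Longrightarrow> cinv (open_submanifold M U) p (cmap M p q) = q"
  by (simp add: cinv_def inv_into_f_f inj_on_subset[OF inj_cmap])

lemma smooth_open_submanifold:
  assumes U: "openin (mtop M) U"
  shows "smooth_manifold (open_submanifold M U)"
proof -
  have UM: "U \<subseteq> points M" using U openin_subset by blast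
  have o: "openin (subtopology (mtop M) U) (cdom M p \<inter> U)" if "p \<in> points M" for p
    using chart(2)[OF that] by (auto simp: openin_subtopology)
  have oi: "openin (top_of_set E) (cmap M p ` (cdom M p \<inter> U))" if "p \<in> points M" for p
    using that U by (intro open_cmap_image openin_Int chart(2)) auto
  have h: "homeomorphic_map (subtopology (subtopology (mtop M) U) (cdom M p \<inter> U))
      (top_of_set (cmap M p ` (cdom M p \<inter> U))) (cmap M p)" if p: "p \<in> points M" for p
  proof -
    have "homeomorphic_map (subtopology (subtopology (mtop M) (cdom M p)) (cdom M p \<inter> U))
      (subtopology (top_of_set (img p)) (cmap M p ` (cdom M p \<inter> U))) (cmap M p)"
    proof (rule homeomorphic_map_subtopologies[OF chart(4)[OF p]])
      show "cmap M p ` (topspace (subtopology (mtop M) (cdom M p)) \<inter> (cdom M p \<inter> U)) =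
        topspace (top_of_set (img p)) \<inter> cmap M p ` (cdom M p \<inter> U)"
        using chart(5)[OF p] by (auto simp: img_def)
    qed
    moreover have "cdom M p \<inter> (cdom M p \<inter> U) = U \<inter> (cdom M p \<inter> U)" "img p \<inter> cmap M p ` (cdom M p \<inter> U) = cmap M p ` (cdom M p \<inter> U)"
      by (auto simp: img_def)
    ultimately show ?thesis by (simp add: subtopology_subtopology)
  qed
  have t: "Cinf_on E (cmap M p ` (cdom M p \<inter> U \<inter> (cdom M q \<inter> U))) (cmap M q \<circ> cinv (open_submanifold M U) p)"
    if pq: "p \<in> points M" "q \<in> points M" for p q
  proof (rule Cinf_cong[OF sub])
    show "openin (top_of_set E) (cmap M p ` (cdom M p \<inter> U \<inter> (cdom M q \<inter> U)))"
      using pq U by (intro open_cmap_image openin_Int chart(2)) auto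
    show "Cinf_on E (cmap M p ` (cdom M p \<inter> U \<inter> (cdom M q \<inter> U))) (tr p q)"
      by (rule Cinf_subset[OF tr_smooth[OF pq]]) auto
    show "tr p q x = (cmap M q \<circ> cinv (open_submanifold M U) p) x"
      if "x \<in> cmap M p ` (cdom M p \<inter> U \<inter> (cdom M q \<inter> U))" for x
      using that pq by (auto simp: cinv_sub)
  qed
  have fd': "subspace E \<and> (\<exists>B. finite B \<and> span B = E)" using fd by (simp add: fd_subspace_def)
  show ?thesis
    unfolding smooth_manifold_def open_submanifold_simps
    using Hausdorff_space_subtopology[OF hausdorff] second_countable_subtopology[OF second_countable] fd' o oi h t chart(1) UM
    by auto
qed

end

locale sub_mfd = smooth_mfd M for M :: "('m, 'e::real_normed_vector) manifold" +
  fixes U assumes U: "openin (mtop M) U"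

sublocale sub_mfd \<subseteq> MU: smooth_mfd "open_submanifold M U"
  by (rule smooth_mfd.intro) (rule smooth_open_submanifold[OF U])

context sub_mfd begin

lemma UM: "U \<subseteq> points M" using U openin_subset by blast

lemma U_points [simp]: "q \<in> U \<Longrightarrow> q \<in> points M" using UM by blast

lemma points_U [simp]: "points (open_submanifold M U) = U" using UM by auto

lemma D_sub:
  assumes "p \<in> U" "r \<in> U" "q \<in> cdom M p" "q \<in> cdom M r" "q \<in> U" "v \<in> E"
  shows "MU.D p r (cmap M p q) v = D p r (cmap M p q) v"
proof -
  have pr: "p \<in> points M" "r \<in> points M" using assms UM by auto
  have o: "openin (top_of_set E) (cmap M p ` (cdom M p \<inter> cdom M r \<inter> U))"
    using pr U by (intro open_cmap_image openin_Int chart(2)) auto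
  show ?thesis unfolding D_def MU.D_def
    by (rule dir_deriv_cong[OF sub o]) (use assms pr in \<open>auto simp: MU.tr_def cinv_sub\<close>)
qed

lemma img_sub: "MU.img p = cmap M p ` (cdom M p \<inter> U)"
  by (simp add: MU.img_def)

lemma img_sub_subset: "MU.img p \<subseteq> img p"
  by (auto simp: img_sub img_def)

lemma cinv_sub_img: "p \<in> points M \<Longrightarrow> x \<in> MU.img p \<Longrightarrow> cinv (open_submanifold M U) p x = cinv M p x"
  by (auto simp: img_sub cinv_sub)

lemma isometryD:
  assumes "\<phi> \<in> isometries (open_submanifold M U) g"
  shows "mfd_map (open_submanifold M U) (open_submanifold M U) \<phi>" "q \<in> U \<Longrightarrow> \<phi> q \<in> U"
    "q \<in> U \<Longrightarrow> u \<in> E \<Longrightarrow> v \<in> E \<Longrightarrow> g (\<phi> q) (tangent_map (open_submanifold M U) (open_submanifold M U) \<phi> q u)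
      (tangent_map (open_submanifold M U) (open_submanifold M U) \<phi> q v) = g q u v"
proof -
  have a: "\<phi> \<in> Bij U" "smooth_map (open_submanifold M U) (open_submanifold M U) \<phi>"
    "\<forall>p\<in>U. \<forall>u\<in>E. \<forall>v\<in>E. g (\<phi> p) (tangent_map (open_submanifold M U) (open_submanifold M U) \<phi> p u)
      (tangent_map (open_submanifold M U) (open_submanifold M U) \<phi> p v) = g p u v"
    using assms UM unfolding isometries_def by (simp_all add: Int_absorb1)
  show "mfd_map (open_submanifold M U) (open_submanifold M U) \<phi>" by unfold_locales (rule a(2))
  show "q \<in> U \<Longrightarrow> \<phi> q \<in> U" using a(1) by (auto simp: Bij_def bij_betw_def)
  show "q \<in> U \<Longrightarrow> u \<in> E \<Longrightarrow> v \<in> E \<Longrightarrow> g (\<phi> q) (tangent_map (open_submanifold M U) (open_submanifold M U) \<phi> q u)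
      (tangent_map (open_submanifold M U) (open_submanifold M U) \<phi> q v) = g q u v" using a(3) by blast
qed

text \<open>The metric pulled back by the inverse chart at \<open>p\<close>. The transition
  derivative is that of the submanifold, on which the isometries live.\<close>

definition chart_metric :: "('m \<Rightarrow> 'e \<Rightarrow> 'e \<Rightarrow> real) \<Rightarrow> 'm \<Rightarrow> 'e \<Rightarrow> 'e \<Rightarrow> 'e \<Rightarrow> real" where
  "chart_metric g p x u v = g (cinv M p x) (MU.D p (cinv M p x) x u) (MU.D p (cinv M p x) x v)"

text \<open>Smoothness of \<open>g\<close> is stated for global vector fields. Constant coordinate
  fields are therefore cut off and extended to fields on all of \<open>M\<close>, and the chart
  metric is smooth where the cutoff equals 1.\<close>

lemma chart_metric_local:
  assumes g: "riemannian_metric M g" and p: "p \<in> U"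
  obtains S where "cmap M p p \<in> S" "S \<subseteq> MU.img p" "local_metric E S (chart_metric g p)"
proof -
  have pM: "p \<in> points M" using p UM by blast
  have T: "openin (top_of_set E) (MU.img p)" using MU.chart(3)[of p] p pM by simp
  have x0: "cmap M p p \<in> MU.img p" using MU.cmap_img[of p p] MU.chart(1)[of p] p by simp
  obtain \<beta> :: "'e \<Rightarrow> real" and K W where b: "Cinf_on E E \<beta>" "compact K" "K \<subseteq> MU.img p" "\<And>x. x \<in> MU.img p - K \<Longrightarrow> \<beta> x = 0"
    "openin (top_of_set E) W" "cmap M p p \<in> W" "W \<subseteq> MU.img p" "\<And>x. x \<in> W \<Longrightarrow> \<beta> x = 1"
    by (rule chart_bump[OF pM T img_sub_subset x0]) (rule that, assumption+)
  have imgE: "MU.img p \<subseteq> E" using T openin_imp_subset by blast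
  define X where "X u = extend_vf p (MU.img p) (\<lambda>x. \<beta> x *\<^sub>R u)" for u
  have X: "X u \<in> vector_fields M" if u: "u \<in> E" for u unfolding X_def
  proof (rule extend_vf(1)[OF pM T img_sub_subset b(2,3)])
    show "Cinf_on E (MU.img p) (\<lambda>x. \<beta> x *\<^sub>R u)"
      by (rule Cinf_scaleR[OF sub T Cinf_subset[OF b(1) imgE] Cinf_const[OF sub T]])
  qed (use u b(4) in \<open>auto intro: subspace_scale[OF sub]\<close>)
  have pt: "cinv M p x \<in> U" "cinv M p x \<in> cdom M p" "cmap M p (cinv M p x) = x" if "x \<in> W" for x
    using that b(7) pM by (auto simp: img_sub)
  have DE: "MU.D p (cinv M p x) x u \<in> E" if "x \<in> W" "u \<in> E" for x u
    using MU.D_in[of p "cinv M p x" "cinv M p x" u] pt[OF that(1)] that(2) p MU.chart(1)[of "cinv M p x"] by simp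
  have DL: "blin_on E (MU.D p (cinv M p x) x)" if "x \<in> W" for x
    using MU.D_blin[of p "cinv M p x" "cinv M p x"] pt[OF that(1)] p MU.chart(1)[of "cinv M p x"] by simp
  have DX: "MU.D p (cinv M p x) x u = X u (cinv M p x)" if x: "x \<in> W" and u: "u \<in> E" for x u
    using pt[OF x] b(8)[OF x] b(7) x p u chart(1)[of "cinv M p x"] UM D_sub[of p "cinv M p x" "cinv M p x" u]
    by (auto simp: X_def extend_vf_def)
  show ?thesis
  proof (rule that[OF b(6,7)], unfold_locales)
    show "fd_subspace E" "openin (top_of_set E) W" by (fact fd, fact b(5))
    fix x u assume x: "x \<in> W" and u: "u \<in> E"
    have q: "cinv M p x \<in> points M" using pt[OF x] UM by blast
    show "chart_metric g p x u v = chart_metric g p x v u" if "v \<in> E" for v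
      unfolding chart_metric_def by (rule riemannian_metricD(1)[OF g q DE[OF x u] DE[OF x that]])
    show "blin_on E (chart_metric g p x u)"
    proof (rule blin_onI[OF fd])
      fix v w a assume v: "v \<in> E"
      note s = riemannian_metricD(1)[OF g q DE[OF x u]]
      show "chart_metric g p x u (v + w) = chart_metric g p x u v + chart_metric g p x u w" if w: "w \<in> E"
        unfolding chart_metric_def blin_onD(1)[OF DL[OF x] v w] s[OF DE[OF x v]] s[OF DE[OF x w]] s[OF subspace_add[OF sub DE[OF x v] DE[OF x w]]]
        using riemannian_metricD(3)[OF g q DE[OF x v] DE[OF x w] DE[OF x u], of 1 1] by simp
      show "chart_metric g p x u (a *\<^sub>R v) = a *\<^sub>R chart_metric g p x u v"
        unfolding chart_metric_def blin_onD(2)[OF DL[OF x] v] s[OF DE[OF x v]] s[OF subspace_scale[OF sub DE[OF x v]]]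
        using riemannian_metricD(3)[OF g q DE[OF x v] DE[OF x v] DE[OF x u], of a 0] by simp
    qed
    show "0 < chart_metric g p x u u" if "u \<noteq> 0"
    proof -
      have "MU.D p (cinv M p x) x u \<noteq> 0"
      proof
        assume z: "MU.D p (cinv M p x) x u = 0"
        have c: "cinv M p x \<in> cdom M p" "cinv M p x \<in> U" "cinv M p x \<in> cdom M (cinv M p x)" "cmap M p (cinv M p x) = x"
          using pt[OF x] chart(1)[OF q] by auto
        have "MU.D (cinv M p x) p (cmap M (cinv M p x) (cinv M p x)) (MU.D p (cinv M p x) x u) = u"
          using MU.D_comp[of p "cinv M p x" p "cinv M p x" u] MU.D_id[of p "cinv M p x" u] c p u by simp
        moreover have "MU.D (cinv M p x) p (cmap M (cinv M p x) (cinv M p x)) 0 = 0"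
          using blin_on_zero[OF MU.D_blin[of "cinv M p x" p "cinv M p x"] ] c p sub by simp
        ultimately show False using z that by simp
      qed
      then show ?thesis unfolding chart_metric_def by (rule riemannian_metricD(2)[OF g q DE[OF x u] DE[OF x u]])
    qed
  next
    fix u v assume u: "u \<in> E" and v: "v \<in> E"
    have "\<forall>X\<in>vector_fields M. \<forall>Y\<in>vector_fields M. (\<lambda>p. g p (X p) (Y p)) \<in> smooth_functions M"
      using g unfolding riemannian_metric_def by (rule conjunct2)
    from bspec[OF bspec[OF this X[OF u]] X[OF v]]
    have "(\<lambda>q. g q (X u q) (X v q)) \<in> smooth_functions M" .
    from smooth_functionD[OF this pM]
    have "Cinf_on E W (\<lambda>x. g (cinv M p x) (X u (cinv M p x)) (X v (cinv M p x)))"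
      by (rule Cinf_subset) (use b(7) img_sub_subset in blast)
    then show "Cinf_on E W (\<lambda>x. chart_metric g p x u v)"
      by (rule Cinf_cong[OF sub b(5)]) (simp add: chart_metric_def DX u v)
  qed
qed

lemma chart_metric_isometry:
  assumes \<phi>: "\<phi> \<in> isometries (open_submanifold M U) g" and p: "p \<in> U"
    and q: "q \<in> cdom M p" "q \<in> U" "\<phi> q \<in> cdom M p" and uv: "u \<in> E" "v \<in> E"
  defines "f \<equiv> mfd_map.rep (open_submanifold M U) (open_submanifold M U) \<phi> p p"
  shows "chart_metric g p (f (cmap M p q)) (dir_deriv f (cmap M p q) u) (dir_deriv f (cmap M p q) v) = chart_metric g p (cmap M p q) u v"
proof -
  interpret \<phi>: mfd_map "open_submanifold M U" "open_submanifold M U" \<phi> by (rule isometryD(1)[OF \<phi>])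
  have pM: "p \<in> points M" using p UM by blast
  have \<phi>q: "\<phi> q \<in> U" by (rule isometryD(2)[OF \<phi> q(2)])
  have c: "cdom M q \<inter> U \<subseteq> U" "q \<in> cdom M q" "\<phi> q \<in> cdom M (\<phi> q)" using q(2) \<phi>q UM chart(1) by auto
  have f: "f (cmap M p q) = cmap M p (\<phi> q)" unfolding f_def using \<phi>.rep_cmap[of p q p] p pM q by simp
  have D: "MU.D p (\<phi> q) (cmap M p (\<phi> q)) (dir_deriv f (cmap M p q) w) = \<phi>.T q (MU.D p q (cmap M p q) w)" if w: "w \<in> E" for w
  proof -
    have w1: "MU.D p q (cmap M p q) w \<in> E" using MU.D_in[of p q q w] p q c w by simp
    have w2: "\<phi>.T q (MU.D p q (cmap M p q) w) \<in> E" using \<phi>.T_in[of q "MU.D p q (cmap M p q) w"] q(2) w1 by simp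
    have "dir_deriv f (cmap M p q) w = MU.D (\<phi> q) p (cmap M (\<phi> q) (\<phi> q)) (\<phi>.T q (MU.D p q (cmap M p q) w))"
      unfolding f_def using \<phi>.rep_deriv[of p p q w] p q \<phi>q w by simp
    then show ?thesis
      using MU.D_comp[of "\<phi> q" p "\<phi> q" "\<phi> q" "\<phi>.T q (MU.D p q (cmap M p q) w)"]
        MU.D_id[of "\<phi> q" "\<phi> q" "\<phi>.T q (MU.D p q (cmap M p q) w)"] \<phi>q p q c w2 by simp
  qed
  have w1: "MU.D p q (cmap M p q) w \<in> E" if "w \<in> E" for w using MU.D_in[of p q q w] p q c that by simp
  show ?thesis
    unfolding chart_metric_def f cinv_cmap[OF pM q(3)] cinv_cmap[OF pM q(1)] D[OF uv(1)] D[OF uv(2)]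
    by (rule isometryD(3)[OF \<phi> q(2) w1[OF uv(1)] w1[OF uv(2)]])
qed

end

section \<open>Uniform estimates for isometries\<close>

context sub_mfd begin

text \<open>The bound on first derivatives keeps the image of the small ball inside the chart, and
  the bound on second derivatives makes the isometry nearly affine there. Both depend on the metric
  alone, so \<open>d\<close> serves all isometries that move one point of the ball to a point near
  the centre.\<close>

lemma isometries_uniformly_affine:
  assumes g: "riemannian_metric M g" and p: "p \<in> U"
  obtains C where "C \<ge> 0" "\<And>e. e > 0 \<Longrightarrow> \<exists>d>0. E \<inter> ball (cmap M p p) d \<subseteq> MU.img p \<and>
    (\<forall>\<phi>\<in>isometries (open_submanifold M U) g. \<forall>x1\<in>E \<inter> ball (cmap M p p) d.
      \<phi> (cinv M p x1) \<in> cdom M p \<longrightarrow> dist (cmap M p (\<phi> (cinv M p x1))) (cmap M p p) < d \<longrightarrow>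
      (\<exists>L. blin_on E L \<and> (\<forall>v\<in>E. L v \<in> E \<and> norm (L v) \<le> C * norm v) \<and>
        (\<forall>x\<in>E \<inter> ball (cmap M p p) d. \<phi> (cinv M p x) \<in> cdom M p \<and> dist (cmap M p (\<phi> (cinv M p x))) (cmap M p p) < e) \<and>
        (\<forall>x\<in>E \<inter> ball (cmap M p p) d. \<forall>y\<in>E \<inter> ball (cmap M p p) d.
          norm (cmap M p (\<phi> (cinv M p x)) - cmap M p (\<phi> (cinv M p y)) - L (x - y)) \<le> e * norm (x - y))))"
proof -
  let ?x0 = "cmap M p p"
  have pM: "p \<in> points M" using p UM by blast
  obtain S where S: "?x0 \<in> S" "S \<subseteq> MU.img p" "local_metric E S (chart_metric g p)"
    using chart_metric_local[OF g p] by blast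
  interpret LM: local_metric E S "chart_metric g p" by (rule S(3))
  show ?thesis
  proof (rule LM.isometry_bounds[OF S(1)])
    fix \<rho> C assume \<rho>: "\<rho> > 0" "E \<inter> ball ?x0 \<rho> \<subseteq> S" and C: "C \<ge> 0" and bd:
      "\<And>A f x u w. openin (top_of_set E) A \<Longrightarrow> Cinf_on E A f \<Longrightarrow> A \<subseteq> E \<inter> ball ?x0 \<rho> \<Longrightarrow>
      (\<And>x. x \<in> A \<Longrightarrow> f x \<in> E \<inter> ball ?x0 \<rho>) \<Longrightarrow>
      (\<And>x u v. x \<in> A \<Longrightarrow> u \<in> E \<Longrightarrow> v \<in> E \<Longrightarrow> chart_metric g p (f x) (dir_deriv f x u) (dir_deriv f x v) = chart_metric g p x u v) \<Longrightarrow>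
      x \<in> A \<Longrightarrow> u \<in> E \<Longrightarrow> w \<in> E \<Longrightarrow>
      norm (dir_deriv f x u) \<le> C * norm u \<and> norm (dir_deriv (\<lambda>x. dir_deriv f x u) x w) \<le> C * (norm u * norm w)"
  show ?thesis
  proof (rule that[OF C])
    fix e :: real assume e: "e > 0"
    define m where "m = min e \<rho>"
    \<comment> \<open>This choice gives \<open>d + 2 * (C * d) \<le> m / 2\<close>, which confines
      the images, and \<open>2 * (C * d) \<le> e\<close>, which bounds the variation of the
      derivative.\<close>
    define d where "d = m / (4 * (C + 1))"
    have m: "m > 0" "m \<le> e" "m \<le> \<rho>" using e \<rho>(1) by (auto simp: m_def)
    have dm: "d * (4 * (C + 1)) = m" using C unfolding d_def by simp
    have d: "d > 0" using m C by (simp add: d_def)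
    have Cd: "0 \<le> C * d" using C d by simp
    have dm': "4 * d + 4 * (C * d) = m" using dm by (simp add: algebra_simps)
    have d1: "d \<le> \<rho>" "d + 2 * (C * d) \<le> m / 2" "2 * (C * d) \<le> e" using dm' d m Cd by linarith+
    let ?B = "E \<inter> ball ?x0 d"
    have BS: "?B \<subseteq> MU.img p" using \<rho>(2) S(2) d1(1) by auto
    show "\<exists>d>0. E \<inter> ball ?x0 d \<subseteq> MU.img p \<and>
    (\<forall>\<phi>\<in>isometries (open_submanifold M U) g. \<forall>x1\<in>E \<inter> ball ?x0 d.
      \<phi> (cinv M p x1) \<in> cdom M p \<longrightarrow> dist (cmap M p (\<phi> (cinv M p x1))) ?x0 < d \<longrightarrow>
      (\<exists>L. blin_on E L \<and> (\<forall>v\<in>E. L v \<in> E \<and> norm (L v) \<le> C * norm v) \<and>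
        (\<forall>x\<in>E \<inter> ball ?x0 d. \<phi> (cinv M p x) \<in> cdom M p \<and> dist (cmap M p (\<phi> (cinv M p x))) ?x0 < e) \<and>
        (\<forall>x\<in>E \<inter> ball ?x0 d. \<forall>y\<in>E \<inter> ball ?x0 d.
          norm (cmap M p (\<phi> (cinv M p x)) - cmap M p (\<phi> (cinv M p y)) - L (x - y)) \<le> e * norm (x - y))))"
    proof (intro exI[of _ d] conjI ballI impI d BS)
      fix \<phi> x1
      assume \<phi>: "\<phi> \<in> isometries (open_submanifold M U) g" and x1: "x1 \<in> ?B"
        and x1c: "\<phi> (cinv M p x1) \<in> cdom M p" and x1d: "dist (cmap M p (\<phi> (cinv M p x1))) ?x0 < d"
      interpret \<phi>: mfd_map "open_submanifold M U" "open_submanifold M U" \<phi> by (rule isometryD(1)[OF \<phi>])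
      define f where "f = \<phi>.rep p p"
      define R where "R = \<phi>.rdom p p"
      have fR: "openin (top_of_set E) R" "Cinf_on E R f" "\<And>x. x \<in> R \<Longrightarrow> f x \<in> E"
        using \<phi>.rdom_open[of p p] \<phi>.rep_smooth[of p p] \<phi>.rep_E[of p p] p pM by (auto simp: f_def R_def)
      have RE: "R \<subseteq> E" using fR(1) openin_imp_subset by blast
      have pt: "cinv M p x \<in> U" "cinv M p x \<in> cdom M p" "cmap M p (cinv M p x) = x" if "x \<in> MU.img p" for x
        using that pM by (auto simp: img_sub)
      have fx: "f x = cmap M p (\<phi> (cinv M p x))" if "x \<in> MU.img p" for x
        using that by (simp add: f_def \<phi>.rep_def cinv_sub_img[OF pM])
      have xR: "x \<in> R \<longleftrightarrow> \<phi> (cinv M p x) \<in> cdom M p" if x: "x \<in> MU.img p" for x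
      proof
        assume "\<phi> (cinv M p x) \<in> cdom M p"
        then have "cmap M p (cinv M p x) \<in> R" unfolding R_def
          using pt[OF x] isometryD(2)[OF \<phi>] \<phi>.rdomI[of "cinv M p x" p p] by simp
        then show "x \<in> R" using pt[OF x] by simp
      next
        assume "x \<in> R"
        then obtain q where q: "q \<in> cdom M p \<inter> U" "\<phi> q \<in> cdom M p" "x = cmap M p q"
          by (auto simp: R_def \<phi>.rdom_def)
        then show "\<phi> (cinv M p x) \<in> cdom M p" using pM by simp
      qed
      \<comment> \<open>The derivative bounds apply where both the point and its image lie in the
        ball of radius \<open>\<rho>\<close>. That \<open>A\<close> contains the whole small ball
        has to be proved.\<close>
      define A where "A = (R \<inter> ball ?x0 \<rho>) \<inter> f -` (E \<inter> ball ?x0 \<rho>)"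
      have Rb: "openin (top_of_set E) (R \<inter> ball ?x0 \<rho>)" using fR(1) by (simp add: openin_Int_open)
      have "openin (top_of_set (R \<inter> ball ?x0 \<rho>)) A" unfolding A_def
        by (rule continuous_openin_preimage[of _ f E])
          (use continuous_on_subset[OF Ck_continuous[OF Cinf_Ck[OF fR(2), of 0]]] fR(3) in \<open>auto simp: openin_Int_open\<close>)
      then have Ao: "openin (top_of_set E) A" using Rb openin_trans by blast
      have AR: "A \<subseteq> R" and AB: "A \<subseteq> E \<inter> ball ?x0 \<rho>" and fA: "\<And>x. x \<in> A \<Longrightarrow> f x \<in> E \<inter> ball ?x0 \<rho>"
        using RE by (auto simp: A_def)
      have fsm: "Cinf_on E A f" by (rule Cinf_subset[OF fR(2) AR])
      have iso: "chart_metric g p (f x) (dir_deriv f x u) (dir_deriv f x v) = chart_metric g p x u v"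
        if x: "x \<in> A" and uv: "u \<in> E" "v \<in> E" for x u v
      proof -
        obtain q where q: "q \<in> cdom M p \<inter> U" "\<phi> q \<in> cdom M p" "x = cmap M p q"
          using x AR by (auto simp: R_def \<phi>.rdom_def)
        show ?thesis unfolding q(3) f_def by (rule chart_metric_isometry[OF \<phi> p _ _ _ uv]) (use q in auto)
      qed
      have D1: "norm (dir_deriv f x u) \<le> C * norm u" if "x \<in> A" "u \<in> E" for x u
        using bd[OF Ao fsm AB fA iso that that(2)] by blast
      have D2: "norm (dir_deriv (\<lambda>x. dir_deriv f x u) x w) \<le> C * (norm u * norm w)" if "x \<in> A" "u \<in> E" "w \<in> E" for x u w
        using bd[OF Ao fsm AB fA iso that] by blast
      have x1A: "x1 \<in> A"
      proof -
        have "x1 \<in> MU.img p" using x1 BS by blast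
        then show ?thesis
          using x1 x1c x1d xR fx d1(1) fR(3)[of x1] by (auto simp: A_def dist_commute)
      qed
      have conv: "x + s *\<^sub>R (y - x) \<in> ?B" if "x \<in> ?B" "y \<in> ?B" "s \<in> {0..1}" for x y s
      proof -
        have "x + s *\<^sub>R (y - x) = (1 - s) *\<^sub>R x + s *\<^sub>R y" by (simp add: algebra_simps)
        then show ?thesis
          using that convex_ball[of ?x0 d] subspace_imp_convex[OF sub] unfolding convex_alt by auto
      qed
      have near: "norm (x - y) \<le> 2 * d" if "x \<in> ?B" "y \<in> ?B" for x y
        using that dist_triangle2[of x y ?x0] by (simp add: dist_norm norm_minus_commute)
      have move: "norm (f (x1 + r *\<^sub>R (x - x1)) - f x1) \<le> 2 * (C * d)"
        if x: "x \<in> ?B" and r: "r \<in> {0..1}" and A: "\<And>s. s \<in> {0..r} \<Longrightarrow> x1 + s *\<^sub>R (x - x1) \<in> A" for x r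
      proof -
        have xE: "x - x1 \<in> E" using x x1 by (auto intro: subspace_diff[OF sub])
        have "norm (f (x1 + r *\<^sub>R (x - x1)) - f (x1 + 0 *\<^sub>R (x - x1)) - r *\<^sub>R 0) \<le> (C * norm (x - x1)) * \<bar>r\<bar>"
        proof (rule mean_value_segment)
          fix s assume "s \<in> closed_segment 0 r"
          then have sA: "x1 + s *\<^sub>R (x - x1) \<in> A" using r by (intro A) (auto simp: closed_segment_eq_real_ivl)
          show "((\<lambda>s. f (x1 + s *\<^sub>R (x - x1))) has_vector_derivative dir_deriv f (x1 + s *\<^sub>R (x - x1)) (x - x1)) (at s)"
            by (rule Ck_line_derivative[OF Cinf_Ck[OF fsm, of "Suc 0"] sA xE])
          show "norm (dir_deriv f (x1 + s *\<^sub>R (x - x1)) (x - x1) - 0) \<le> C * norm (x - x1)" using D1[OF sA xE] by simp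
        qed
        also have "\<dots> \<le> (C * (2 * d)) * 1"
          using near[OF x x1] C r d by (intro mult_mono mult_left_mono mult_nonneg_nonneg) auto
        finally show ?thesis by simp
      qed
      have fx1: "dist ?x0 (f x1) < d" using x1d fx[of x1] x1 BS by (auto simp: dist_commute)
      \<comment> \<open>A first exit argument on the segment from \<open>x1\<close> to
        \<open>x\<close>: up to the first time \<open>s1\<close> outside \<open>A\<close> the
        derivative bound controls the image, and the limit at \<open>s1\<close> turns out to lie in
        \<open>A\<close>.\<close>
      have BA: "x \<in> A" if x: "x \<in> ?B" for x
      proof (rule ccontr)
        assume xA: "x \<notin> A"
        define l where "l s = x1 + s *\<^sub>R (x - x1)" for s
        have lB: "l s \<in> ?B" if "s \<in> {0..1}" for s unfolding l_def by (rule conv[OF x1 x that])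
        have lc: "continuous_on T l" for T unfolding l_def by (intro continuous_intros)
        define Z where "Z = {0..1} - ({0..1} \<inter> l -` A)"
        have "openin (top_of_set {0..1}) ({0..1} \<inter> l -` A)"
          by (rule continuous_openin_preimage[OF lc _ Ao]) (use lB in auto)
        then have "closedin (top_of_set {0..1}) Z" unfolding Z_def by (simp add: closedin_diff)
        then have cZ: "compact Z" using closedin_compact compact_Icc by blast
        have "1 \<in> Z" using xA by (simp add: Z_def l_def)
        then obtain s1 where s1: "s1 \<in> Z" "\<And>s. s \<in> Z \<Longrightarrow> s1 \<le> s"
          using compact_attains_inf[OF cZ] by blast
        have lA: "l r \<in> A" if "0 \<le> r" "r < s1" for r
        proof (rule ccontr)
          assume "l r \<notin> A"
          then have "r \<in> Z" using that s1(1) by (simp add: Z_def)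
          then show False using s1(2) that by fastforce
        qed
        have s1': "0 \<le> s1" "s1 \<le> 1" "l s1 \<notin> A" using s1(1) by (auto simp: Z_def)
        have "s1 \<noteq> 0" using s1'(3) x1A by (auto simp: l_def)
        then have s1pos: "0 < s1" using s1' by simp
        \<comment> \<open>The image stays in this compact coordinate ball, which is closed in the
          manifold. Hence the image cannot leave the chart domain in the limit at \<open>s1\<close>,
          although the chart says nothing about points outside its domain.\<close>
        let ?K = "E \<inter> cball ?x0 (m / 2)"
        have KE: "?K \<subseteq> E \<inter> ball ?x0 \<rho>" using m by auto
        have KS: "?K \<subseteq> MU.img p" using KE \<rho>(2) S(2) by blast
        let ?KM = "cinv (open_submanifold M U) p ` ?K"
        have KM: "closedin (mtop (open_submanifold M U)) ?KM"
          by (rule MU.chart_compact_closed[OF _ fd_subspace_compact_cball[OF fd] KS]) (use p pM in simp)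
        let ?c = "\<lambda>r. \<phi> (cinv (open_submanifold M U) p (l r))"
        have "continuous_map (top_of_set {0..s1}) (mtop (open_submanifold M U)) ?c"
        proof -
          have 1: "continuous_map (top_of_set {0..s1}) (top_of_set (MU.img p)) l"
            using lc lB BS s1' by (auto simp: continuous_map_in_subtopology)
          have 2: "continuous_map (top_of_set (MU.img p)) (mtop (open_submanifold M U)) (cinv (open_submanifold M U) p)"
            by (rule MU.continuous_map_cinv) (use p pM in simp)
          have 3: "continuous_map (mtop (open_submanifold M U)) (mtop (open_submanifold M U)) \<phi>"
            using \<phi>.smooth_map by (simp add: smooth_map_def)
          show ?thesis using continuous_map_compose[OF continuous_map_compose[OF 1 2] 3] by (simp add: o_def)
        qed
        from closedin_continuous_map_preimage[OF this KM]
        have "closedin (top_of_set {0..s1}) {r \<in> {0..s1}. ?c r \<in> ?KM}" by simp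
        then have cl: "closed {r \<in> {0..s1}. ?c r \<in> ?KM}" using closedin_closed_trans closed_atLeastAtMost by blast
        have "{0..<s1} \<subseteq> {r \<in> {0..s1}. ?c r \<in> ?KM}"
        proof
          fix r assume r: "r \<in> {0..<s1}"
          have lr: "l r \<in> A" using lA r by simp
          have lri: "l r \<in> MU.img p" using lB[of r] r s1' BS by auto
          have "norm (f (x1 + r *\<^sub>R (x - x1)) - f x1) \<le> 2 * (C * d)"
            by (rule move[OF x]) (use r s1' lA in \<open>auto simp: l_def\<close>)
          then have "dist ?x0 (f (l r)) \<le> d + 2 * (C * d)"
            using dist_triangle[of ?x0 "f (l r)" "f x1"] fx1 by (simp add: dist_norm norm_minus_commute l_def)
          then have "f (l r) \<in> ?K" using d1(2) fA[OF lr] by simp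
          moreover have "?c r = cinv (open_submanifold M U) p (f (l r))"
          proof -
            have "\<phi> (cinv M p (l r)) \<in> cdom M p" using xR[OF lri] lr AR by blast
            moreover have "\<phi> (cinv M p (l r)) \<in> U" using isometryD(2)[OF \<phi>] pt[OF lri] by blast
            ultimately show ?thesis using cinv_sub[OF pM] cinv_sub_img[OF pM lri] fx[OF lri] by simp
          qed
          ultimately show "r \<in> {r \<in> {0..s1}. ?c r \<in> ?KM}" using r by auto
        qed
        then have "closure {0..<s1} \<subseteq> {r \<in> {0..s1}. ?c r \<in> ?KM}" by (rule closure_minimal[OF _ cl])
        moreover have "s1 \<in> closure {0..<s1}" using s1pos by simp
        ultimately have "s1 \<in> {r \<in> {0..s1}. ?c r \<in> ?KM}" by (rule subsetD)
        then have "?c s1 \<in> ?KM" by simp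
        then obtain y where y: "y \<in> ?K" "?c s1 = cinv (open_submanifold M U) p y" by blast
        have ls: "l s1 \<in> MU.img p" "l s1 \<in> ?B" using lB[of s1] s1' BS by auto
        have yi: "y \<in> MU.img p" using y KS by blast
        have e1: "\<phi> (cinv M p (l s1)) = cinv M p y" using y(2) cinv_sub_img[OF pM] ls(1) yi by simp
        then have "l s1 \<in> R" using xR[OF ls(1)] pt[OF yi] by simp
        moreover have "f (l s1) = y" using fx[OF ls(1)] e1 pt[OF yi] by simp
        ultimately have "l s1 \<in> A" using y(1) KE ls(2) d1(1) by (auto simp: A_def)
        then show False using s1'(3) by simp
      qed
      have BAimg: "x \<in> MU.img p" if "x \<in> ?B" for x using that BS by blast
      let ?L = "dir_deriv f x1"
      have L: "blin_on E ?L" by (rule blin_on_dir_deriv[OF fd Ao Cinf_Ck[OF fsm, of "Suc 0"] x1A])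
      have LE: "?L v \<in> E" if "v \<in> E" for v
        by (rule dir_deriv_in_subspace[OF sub Ao fd Cinf_Ck[OF fsm, of "Suc 0"] _ x1A that]) (use fA in blast)
      have dist_e: "dist (f x) ?x0 < e" if x: "x \<in> ?B" for x
      proof -
        have "norm (f (x1 + 1 *\<^sub>R (x - x1)) - f x1) \<le> 2 * (C * d)"
          by (rule move[OF x]) (use conv[OF x1 x] BA in auto)
        then have "dist ?x0 (f x) \<le> d + 2 * (C * d)"
          using dist_triangle[of ?x0 "f x" "f x1"] fx1 by (simp add: dist_norm norm_minus_commute)
        then show ?thesis using d1(2) m by (simp add: dist_commute)
      qed
      \<comment> \<open>A mean value inequality for \<open>f\<close>, with a second one for its
        derivative inside: between two points at most \<open>2 * d\<close> apart the derivative
        changes by at most \<open>2 * (C * d)\<close>.\<close>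
      have aff: "norm (f x - f y - ?L (x - y)) \<le> e * norm (x - y)" if x: "x \<in> ?B" and y: "y \<in> ?B" for x y
      proof -
        have u: "x - y \<in> E" using x y by (auto intro: subspace_diff[OF sub])
        have "norm (f (y + 1 *\<^sub>R (x - y)) - f (y + 0 *\<^sub>R (x - y)) - 1 *\<^sub>R ?L (x - y)) \<le> (2 * (C * d) * norm (x - y)) * \<bar>1\<bar>"
        proof (rule mean_value_segment)
          fix s :: real assume "s \<in> closed_segment 0 1"
          then have s: "s \<in> {0..1}" by (simp add: closed_segment_eq_real_ivl)
          let ?z = "y + s *\<^sub>R (x - y)"
          have z: "?z \<in> ?B" by (rule conv[OF y x s])
          show "((\<lambda>s. f (y + s *\<^sub>R (x - y))) has_vector_derivative dir_deriv f ?z (x - y)) (at s)"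
            by (rule Ck_line_derivative[OF Cinf_Ck[OF fsm, of "Suc 0"] BA[OF z] u])
          have w: "?z - x1 \<in> E" using z x1 by (auto intro: subspace_diff[OF sub])
          have "norm (dir_deriv f (x1 + 1 *\<^sub>R (?z - x1)) (x - y) - dir_deriv f (x1 + 0 *\<^sub>R (?z - x1)) (x - y) - 1 *\<^sub>R 0)
              \<le> (C * (norm (x - y) * norm (?z - x1))) * \<bar>1\<bar>"
          proof (rule mean_value_segment)
            fix r :: real assume "r \<in> closed_segment 0 1"
            then have r: "r \<in> {0..1}" by (simp add: closed_segment_eq_real_ivl)
            have rA: "x1 + r *\<^sub>R (?z - x1) \<in> A" by (rule BA[OF conv[OF x1 z r]])
            show "((\<lambda>r. dir_deriv f (x1 + r *\<^sub>R (?z - x1)) (x - y)) has_vector_derivative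
                dir_deriv (\<lambda>x'. dir_deriv f x' (x - y)) (x1 + r *\<^sub>R (?z - x1)) (?z - x1)) (at r)"
              by (rule Ck_line_derivative[OF Cinf_Ck[OF Cinf_dir_deriv[OF fsm u], of "Suc 0"] rA w])
            show "norm (dir_deriv (\<lambda>x'. dir_deriv f x' (x - y)) (x1 + r *\<^sub>R (?z - x1)) (?z - x1) - 0) \<le> C * (norm (x - y) * norm (?z - x1))"
              using D2[OF rA u w] by simp
          qed
          also have "\<dots> \<le> (C * (norm (x - y) * (2 * d))) * 1"
            using near[OF z x1] C order_trans[OF norm_ge_zero near[OF z x1]] by (intro mult_mono mult_left_mono) auto
          finally show "norm (dir_deriv f ?z (x - y) - ?L (x - y)) \<le> 2 * (C * d) * norm (x - y)"
            by (simp add: mult_ac)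
        qed
        also have "\<dots> \<le> e * norm (x - y)" using d1(3) by (simp add: mult_right_mono)
        finally show ?thesis by simp
      qed
      show "\<exists>L. blin_on E L \<and> (\<forall>v\<in>E. L v \<in> E \<and> norm (L v) \<le> C * norm v) \<and>
        (\<forall>x\<in>?B. \<phi> (cinv M p x) \<in> cdom M p \<and> dist (cmap M p (\<phi> (cinv M p x))) ?x0 < e) \<and>
        (\<forall>x\<in>?B. \<forall>y\<in>?B.
          norm (cmap M p (\<phi> (cinv M p x)) - cmap M p (\<phi> (cinv M p y)) - L (x - y)) \<le> e * norm (x - y))"
      proof (intro exI[of _ ?L] conjI ballI L LE)
        show "norm (?L v) \<le> C * norm v" if "v \<in> E" for v by (rule D1[OF x1A that])
        show "\<phi> (cinv M p x) \<in> cdom M p" if "x \<in> ?B" for x using xR[OF BAimg[OF that]] BA[OF that] AR by blast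
        show "dist (cmap M p (\<phi> (cinv M p x))) ?x0 < e" if "x \<in> ?B" for x using dist_e[OF that] fx[OF BAimg[OF that]] by simp
        show "norm (cmap M p (\<phi> (cinv M p x)) - cmap M p (\<phi> (cinv M p y)) - ?L (x - y)) \<le> e * norm (x - y)"
          if "x \<in> ?B" "y \<in> ?B" for x y
          using aff[OF that] fx[OF BAimg[OF that(1)]] fx[OF BAimg[OF that(2)]] by simp
      qed
    qed
  qed
qed
qed

end

section \<open>Leaves under Hausdorff Morita equivalence\<close>

text \<open>The class of \<open>x\<close> and the set of points outside it are both open relative to
  \<open>C\<close>, so a connected \<open>C\<close> consists of one class.\<close>

lemma connectedin_equivalence:
  assumes C: "connectedin X C" and loc: "\<And>x. x \<in> C \<Longrightarrow> \<exists>U. openin X U \<and> x \<in> U \<and> (\<forall>y\<in>U \<inter> C. R x y)"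
    and sym: "\<And>x y. R x y \<Longrightarrow> R y x" and trans: "\<And>x y z. y \<in> C \<Longrightarrow> R x y \<Longrightarrow> R y z \<Longrightarrow> R x z"
    and xy: "x \<in> C" "y \<in> C"
  shows "R x y"
proof (rule ccontr)
  assume not: "\<not> R x y"
  define E1 where "E1 = \<Union>{U. openin X U \<and> (\<forall>z\<in>U \<inter> C. R x z)}"
  define E2 where "E2 = \<Union>{U. openin X U \<and> (\<forall>z\<in>U \<inter> C. \<not> R x z)}"
  have "openin X E1" "openin X E2" unfolding E1_def E2_def by (auto intro!: openin_Union)
  moreover have cov: "z \<in> E1 \<and> R x z \<or> z \<in> E2 \<and> \<not> R x z" if z: "z \<in> C" for z
  proof -
    obtain U where U: "openin X U" "z \<in> U" "\<And>y. y \<in> U \<Longrightarrow> y \<in> C \<Longrightarrow> R z y" using loc[OF z] by auto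
    show ?thesis
    proof (cases "R x z")
      case True
      have "\<forall>y\<in>U \<inter> C. R x y" using U(3) trans[OF z True] by blast
      then show ?thesis using U True unfolding E1_def by blast
    next
      case False
      have "\<forall>y\<in>U \<inter> C. \<not> R x y" using U(3) trans[of _ x z] sym False by blast
      then show ?thesis using U False unfolding E2_def by blast
    qed
  qed
  moreover have "E1 \<inter> E2 \<inter> C = {}" unfolding E1_def E2_def by blast
  moreover have "x \<in> E1"
  proof -
    obtain U where "openin X U" "x \<in> U" "\<forall>y\<in>U \<inter> C. R x y" using loc[OF xy(1)] by blast
    then show ?thesis unfolding E1_def by blast
  qed
  moreover have "y \<in> E2" using cov[OF xy(2)] not by blast
  moreover have "C \<subseteq> E1 \<union> E2" using cov by blast
  ultimately show False using C xy unfolding connectedin by blast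
qed

lemma smooth_standard: "smooth_manifold (standard_manifold :: ('e::euclidean_space, 'e) manifold)"
proof -
  have c: "cmap standard_manifold q \<circ> cinv standard_manifold p = (\<lambda>x::'e. x)" for p q by (auto simp: fun_eq_iff)
  have h: "Hausdorff_space (euclidean :: 'e topology)" by (simp add: Hausdorff_space_euclidean)
  have s: "second_countable (euclidean :: 'e topology)"
  proof -
    obtain B :: "'e set set" where B: "countable B" "topological_basis B" by (rule exE[OF ex_countable_basis]) blast
    have "\<exists>V\<in>B. x \<in> V \<and> V \<subseteq> U" if U: "open U" "x \<in> U" for U x
      by (rule topological_basisE[OF B(2) U]) (rule bexI, rule conjI)
    then have "countable B \<and> (\<forall>V\<in>B. openin euclidean V) \<and> (\<forall>U x. openin euclidean U \<and> x \<in> U \<longrightarrow> (\<exists>V\<in>B. x \<in> V \<and> V \<subseteq> U))"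
      using B(1) topological_basis_open[OF B(2)] by simp
    then show ?thesis unfolding second_countable_def by (rule exI)
  qed
  have f: "\<exists>B::'e set. finite B \<and> span B = UNIV" using fd_subspace_UNIV unfolding fd_subspace_def by blast
  have i: "Cinf_on UNIV UNIV (\<lambda>x::'e. x)" by (rule Cinf_id) auto
  have m: "cmap standard_manifold p = (\<lambda>x::'e. x)" for p by (auto simp: fun_eq_iff)
  have hm: "homeomorphic_map euclidean euclidean (\<lambda>x::'e. x)" using homeomorphic_map_id[of euclidean euclidean] by (simp add: id_def)
  show ?thesis unfolding smooth_manifold_def c using h s f i hm by (simp add: m)
qed

lemma dir_deriv_ident [simp]: "dir_deriv (\<lambda>x. x) x v = v"
  by (rule dir_derivI) (auto intro!: derivative_eq_intros)

lemma dir_deriv_zero [simp]: "dir_deriv f x 0 = 0"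
  by (rule dir_derivI) simp

lemma tr_standard:
  fixes p q :: "'e::real_normed_vector"
  assumes "smooth_mfd (standard_manifold :: ('e, 'e) manifold)"
  shows "smooth_mfd.tr standard_manifold p q = (\<lambda>x. x)"
  using smooth_mfd.tr_def[OF assms] by (auto simp: fun_eq_iff)

section \<open>Integral curves in charts and on open submanifolds\<close>

context smooth_mfd begin

text \<open>The definition tests the velocity at each time in the chart chosen at that point of the
  curve; a transition map brings it to one fixed chart.\<close>

lemma integral_curve_chart:
  assumes Y: "\<And>q. q \<in> points M \<Longrightarrow> Y q \<in> E" and m: "integral_curve M Y m" and p: "p \<in> points M" and mt: "m t \<in> cdom M p"
  shows "((\<lambda>r. cmap M p (m r)) has_vector_derivative vf_rep M p Y (cmap M p (m t))) (at t)"
proof -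
  have mc: "continuous_map euclideanreal (mtop M) m" and
    md: "((\<lambda>s. cmap M (m t) (m s)) has_vector_derivative Y (m t)) (at t)"
    using m by (auto simp: integral_curve_def)
  have q: "m t \<in> points M" using cdom_points[OF p mt] .
  have "openin euclideanreal {r \<in> topspace euclideanreal. m r \<in> cdom M (m t) \<inter> cdom M p}"
    by (rule openin_continuous_map_preimage[OF mc openin_Int[OF chart(2)[OF q] chart(2)[OF p]]])
  then have "open {r. m r \<in> cdom M (m t) \<inter> cdom M p}" by simp
  then obtain d where d: "d > 0" "\<And>r. dist r t < d \<Longrightarrow> m r \<in> cdom M (m t) \<inter> cdom M p"
    using mt chart(1)[OF q] unfolding open_dist by blast
  have "((\<lambda>r. tr (m t) p (cmap M (m t) (m r))) has_vector_derivative
      dir_deriv (tr (m t) p) (cmap M (m t) (m t)) (Y (m t))) (at t)"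
  proof (rule conjunct2[OF Ck_curve[OF fd open_overlap[OF q p] Cinf_Ck[OF tr_smooth[OF q p], of "Suc 0"] md _ d(1)]])
    show "cmap M (m t) (m t) \<in> cmap M (m t) ` (cdom M (m t) \<inter> cdom M p)" using mt chart(1)[OF q] by blast
    show "cmap M (m t) (m r) \<in> E" if "\<bar>r - t\<bar> < d" for r
      using d(2)[of r] that by (intro cmap_E[OF q]) (simp add: dist_real_def)
  qed
  then have "((\<lambda>r. cmap M p (m r)) has_vector_derivative dir_deriv (tr (m t) p) (cmap M (m t) (m t)) (Y (m t))) (at t)"
    by (rule has_vector_derivative_local[OF _ d(1)]) (use d(2) q in \<open>simp add: dist_real_def\<close>)
  then show ?thesis using vf_rep_cmap[OF p mt, of Y] by (simp add: D_def)
qed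

lemma integral_curve_chartI:
  assumes Y: "\<And>q. q \<in> points M \<Longrightarrow> Y q \<in> E" and p: "p \<in> points M" and ci: "\<And>t. c t \<in> img p"
    and c: "\<And>t. (c has_vector_derivative vf_rep M p Y (c t)) (at t)"
  shows "integral_curve M Y (\<lambda>t. cinv M p (c t))"
proof -
  have "continuous_on UNIV c" using c has_vector_derivative_continuous continuous_at_imp_continuous_on by blast
  then have "continuous_map euclideanreal (top_of_set (img p)) c"
    using ci by (auto simp: continuous_map_in_subtopology)
  from continuous_map_compose[OF this continuous_map_cinv[OF p]]
  have cc: "continuous_map euclideanreal (mtop M) (\<lambda>t. cinv M p (c t))" by (simp add: o_def)
  have "((\<lambda>s. cmap M (cinv M p (c t)) (cinv M p (c s))) has_vector_derivative Y (cinv M p (c t))) (at t)" for t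
  proof -
    let ?q = "cinv M p (c t)"
    have qc: "?q \<in> cdom M p" using ci by simp
    have q: "?q \<in> points M" using cdom_points[OF p qc] .
    have ct: "cmap M p ?q = c t" using ci by simp
    have "((\<lambda>s. tr p ?q (c s)) has_vector_derivative dir_deriv (tr p ?q) (c t) (vf_rep M p Y (c t))) (at t)"
    proof (rule conjunct2[OF Ck_curve[OF fd open_overlap[OF p q] Cinf_Ck[OF tr_smooth[OF p q], of "Suc 0"] c _ zero_less_one]])
      show "c t \<in> cmap M p ` (cdom M p \<inter> cdom M ?q)" by (rule image_eqI[of _ _ ?q]) (use ct qc chart(1)[OF q] in auto)
      show "c r \<in> E" for r using ci imgE[OF p] by blast
    qed
    moreover have "dir_deriv (tr p ?q) (c t) (vf_rep M p Y (c t)) = Y ?q"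
      using vf_rep_inverse[of p ?q Y, OF p qc Y[OF q]] ct by (simp add: D_def)
    ultimately show ?thesis by (simp add: tr_def)
  qed
  then show ?thesis using cc unfolding integral_curve_def by blast
qed

end

lemma integral_curve_sub:
  assumes "integral_curve (open_submanifold M U) (\<lambda>q. if q \<in> U then X q else 0) \<gamma>"
  shows "integral_curve M X \<gamma>"
proof -
  have c: "continuous_map euclideanreal (subtopology (mtop M) U) \<gamma>" and
    d: "\<And>t. ((\<lambda>s. cmap M (\<gamma> t) (\<gamma> s)) has_vector_derivative (if \<gamma> t \<in> U then X (\<gamma> t) else 0)) (at t)"
    using assms by (auto simp: integral_curve_def)
  have "\<gamma> t \<in> U" for t using c by (auto simp: continuous_map_in_subtopology)
  then show ?thesis using c d by (simp add: integral_curve_def continuous_map_in_subtopology)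
qed

lemma integral_curve_subI:
  assumes "integral_curve M X \<gamma>" "\<And>t. \<gamma> t \<in> U"
  shows "integral_curve (open_submanifold M U) (\<lambda>q. if q \<in> U then X q else 0) \<gamma>"
  using assms by (auto simp: integral_curve_def continuous_map_in_subtopology)

section \<open>Two submersions with a common pullback foliation\<close>

locale morita = N: smooth_mfd N + M: smooth_mfd M + S1: submersion N "standard_manifold :: (octonion \<times> octonion, octonion \<times> octonion) manifold" f1
  + S2: submersion N M f2
  for N :: "('n, 'f::real_normed_vector) manifold" and M :: "('m, 'e::real_normed_vector) manifold" and f1 f2 +
  fixes F0 :: "(octonion \<times> octonion \<Rightarrow> octonion \<times> octonion) set" and F :: "('m \<Rightarrow> 'e) set"
  assumes fol0: "singular_foliation standard_manifold F0"
    and dec: "leaf_decomposition standard_manifold F0 = octonionic_hopf_leaves"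
    and fol: "singular_foliation M F"
    and pb: "pullback_foliation N standard_manifold f1 F0 = pullback_foliation N M f2 F"
    and conn: "connected_fibers N M f2"
begin

lemma rdom1: "S1.rdom n p = N.img n"
  by (auto simp: S1.rdom_def N.img_def)

lemma rep1: "S1.rep n p x = f1 (cinv N n x)"
  by (simp add: S1.rep_def)

text \<open>Converts an equation between coordinate vectors in fixed charts into the form with the
  tangent map that \<open>pullback_transfer_point\<close> expects.\<close>

lemma T_eq:
  assumes n: "n \<in> points N" and p: "p \<in> points M" and q: "q \<in> cdom N n" "f2 q \<in> cdom M p" and c: "c \<in> model N"
    and Y: "Y \<in> F" and eq: "dir_deriv (S2.rep n p) (cmap N n q) c = vf_rep M p Y (cmap M p (f2 q))"
  shows "S2.T q (N.D n q (cmap N n q) c) = Y (f2 q)"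
proof -
  have qp: "q \<in> points N" using N.cdom_points[OF n q(1)] .
  have fq: "f2 q \<in> points M" using S2.f_points[OF qp] .
  let ?v = "N.D n q (cmap N n q) c"
  have v: "?v \<in> model N" by (rule N.D_in[OF n qp q(1) N.chart(1)[OF qp] c])
  have YE: "Y (f2 q) \<in> model M" using M.vector_fieldD(1)[OF singular_foliationD(1)[OF fol Y] fq] .
  have "M.D (f2 q) p (cmap M (f2 q) (f2 q)) (S2.T q ?v) = vf_rep M p Y (cmap M p (f2 q))"
    using S2.rep_deriv[OF n p q c] eq by simp
  then have "M.D p (f2 q) (cmap M p (f2 q)) (M.D (f2 q) p (cmap M (f2 q) (f2 q)) (S2.T q ?v)) = Y (f2 q)"
    using M.vf_rep_inverse[of p "f2 q" Y, OF p q(2) YE] by simp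
  then show ?thesis
    using M.D_comp[OF fq p fq M.chart(1)[OF fq] q(2) M.chart(1)[OF fq] S2.T_in[OF qp v]]
      M.D_id[OF fq M.chart(1)[OF fq] S2.T_in[OF qp v]] by simp
qed

lemma rep1_deriv:
  assumes n: "n \<in> points N" and q: "q \<in> cdom N n" and c: "c \<in> model N"
  shows "dir_deriv (S1.rep n p) (cmap N n q) c = S1.T q (N.D n q (cmap N n q) c)"
  using S1.rep_deriv[OF n _ q _ c, of p] tr_standard[OF S1.M.smooth_mfd_axioms] by (simp add: S1.M.D_def)

text \<open>Each velocity of the curve in \<open>N\<close> covers a vector of \<open>F\<close>,
  hence also one of \<open>F0\<close>, which is tangent to a Hopf leaf. The image under
  \<open>f1\<close> is therefore a curve of the kind treated in \<open>hopf_curve\<close>.\<close>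

lemma lifted_curve:
  assumes n: "n \<in> points N" and p: "p \<in> points M" and ab: "a \<le> b"
    and c: "\<And>t. t \<in> {a..b} \<Longrightarrow> c t \<in> S2.rdom n p" "\<And>t. t \<in> {a..b} \<Longrightarrow> \<exists>d>0. \<forall>s. \<bar>s - t\<bar> < d \<longrightarrow> c s \<in> model N"
    "\<And>t. t \<in> {a..b} \<Longrightarrow> \<exists>c'\<in>model N. (c has_vector_derivative c') (at t) \<and>
      (\<exists>Y\<in>F. dir_deriv (S2.rep n p) (c t) c' = vf_rep M p Y (S2.rep n p (c t)))"
  shows "hopf_equiv (f1 (cinv N n (c a))) (f1 (cinv N n (c b)))"
proof (rule hopf_curve[OF ab, of "\<lambda>t. f1 (cinv N n (c t))"])
  fix t assume t: "t \<in> {a..b}"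
  obtain q where q: "q \<in> cdom N n" "f2 q \<in> cdom M p" "c t = cmap N n q" using c(1)[OF t] by (auto simp: S2.rdom_def)
  have qp: "q \<in> points N" using N.cdom_points[OF n q(1)] .
  have qc: "cinv N n (c t) = q" using q n by simp
  obtain c' Y where c': "c' \<in> model N" "(c has_vector_derivative c') (at t)" and Y: "Y \<in> F"
    "dir_deriv (S2.rep n p) (c t) c' = vf_rep M p Y (S2.rep n p (c t))"
    using c(3)[OF t] by blast
  obtain d where d: "d > 0" "\<And>s. \<bar>s - t\<bar> < d \<Longrightarrow> c s \<in> model N" using c(2)[OF t] by blast
  let ?v = "N.D n q (cmap N n q) c'"
  have v: "?v \<in> model N" by (rule N.D_in[OF n qp q(1) N.chart(1)[OF qp] c'(1)])
  have "dir_deriv (S2.rep n p) (cmap N n q) c' = vf_rep M p Y (cmap M p (f2 q))" using Y(2) q n by simp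
  then have "S2.T q ?v = Y (f2 q)" by (rule T_eq[OF n p q(1,2) c'(1) Y(1)])
  then obtain X where X: "X \<in> F0" "S1.T q ?v = X (f1 q)"
    using pullback_transfer_point[OF S2.submersion_axioms S1.submersion_axioms fol fol0 equalityD2[OF pb] qp v Y(1)] by blast
  have "((\<lambda>s. S1.rep n (f1 n) (c s)) has_vector_derivative dir_deriv (S1.rep n (f1 n)) (c t) c') (at t)"
    by (rule conjunct2[OF Ck_curve[OF N.fd S1.rdom_open[OF n, of "f1 n"] Cinf_Ck[OF S1.rep_smooth[OF n], of _ "Suc 0"] c'(2) _ d]])
      (use q in \<open>simp_all add: rdom1\<close>)
  then have "((\<lambda>s. f1 (cinv N n (c s))) has_vector_derivative X (f1 (cinv N n (c t)))) (at t)"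
    using rep1_deriv[OF n q(1) c'(1)] X(2) q(3) qc by (simp add: rep1)
  then show "\<exists>c'. ((\<lambda>t. f1 (cinv N n (c t))) has_vector_derivative c') (at t) \<and> hopf_tangent (f1 (cinv N n (c t))) c'"
    using F0_tangent[OF fol0 dec X(1)] by blast
qed

lemma zero_in_F: "(\<lambda>_. 0) \<in> F"
  using singular_foliationD(2)[OF fol] .

lemma vf_rep_zero [simp]: "vf_rep M p (\<lambda>_. 0) x = 0"
  by (simp add: vf_rep_def Let_def)

text \<open>Nearby points of a fibre are joined by vertical curves, which cover the zero field of
  \<open>F\<close>; connectedness of the fibre makes the local statement global.\<close>

lemma fibre_hopf:
  assumes n: "n \<in> points N" "n' \<in> points N" "f2 n = f2 n'"
  shows "hopf_equiv (f1 n) (f1 n')"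
proof (rule connectedin_equivalence[where R = "\<lambda>n n'. hopf_equiv (f1 n) (f1 n')" and X = "mtop N" and C = "{q \<in> points N. f2 q = f2 n}"])
  show "connectedin (mtop N) {q \<in> points N. f2 q = f2 n}"
    using conn S2.f_points[OF n(1)] by (simp add: connected_fibers_def)
  fix x assume "x \<in> {q \<in> points N. f2 q = f2 n}"
  then have x: "x \<in> points N" and fx: "f2 x = f2 n" by auto
  obtain S where S: "openin (top_of_set (model N)) S" "S \<subseteq> S2.rdom x (f2 x)" "cmap N x x \<in> S"
    and path: "\<And>y y'. y \<in> S \<Longrightarrow> y' \<in> S \<Longrightarrow> S2.rep x (f2 x) y = S2.rep x (f2 x) y' \<Longrightarrow> \<exists>c. c 0 = y \<and> c 1 = y' \<and>
       (\<forall>t\<in>{0..1::real}. c t \<in> S \<and> S2.rep x (f2 x) (c t) = S2.rep x (f2 x) y \<and>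
          (\<exists>d>0. \<forall>s. \<bar>s - t\<bar> < d \<longrightarrow> c s \<in> S) \<and>
          (\<exists>c'\<in>model N. (c has_vector_derivative c') (at t) \<and> dir_deriv (S2.rep x (f2 x)) (c t) c' = 0))"
  proof (rule S2.submersion_charts[OF x])
  qed (rule that, assumption+)
  show "\<exists>U. openin (mtop N) U \<and> x \<in> U \<and> (\<forall>y\<in>U \<inter> {q \<in> points N. f2 q = f2 n}. hopf_equiv (f1 x) (f1 y))"
  proof (intro exI conjI ballI)
    show "openin (mtop N) {q \<in> cdom N x. cmap N x q \<in> S}" by (rule N.open_cmap_vimage[OF x S(1)])
    show "x \<in> {q \<in> cdom N x. cmap N x q \<in> S}" using S(3) N.chart(1)[OF x] by blast
    fix y assume "y \<in> {q \<in> cdom N x. cmap N x q \<in> S} \<inter> {q \<in> points N. f2 q = f2 n}"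
    then have y: "y \<in> cdom N x" "cmap N x y \<in> S" "f2 y = f2 x" using fx by auto
    have "S2.rep x (f2 x) (cmap N x x) = S2.rep x (f2 x) (cmap N x y)" using x y N.chart(1) by simp
    from path[OF S(3) y(2) this] obtain c where c: "c 0 = cmap N x x" "c 1 = cmap N x y"
      and call: "\<forall>t\<in>{0..1::real}. c t \<in> S \<and> S2.rep x (f2 x) (c t) = S2.rep x (f2 x) (cmap N x x) \<and>
          (\<exists>d>0. \<forall>s. \<bar>s - t\<bar> < d \<longrightarrow> c s \<in> S) \<and>
          (\<exists>c'\<in>model N. (c has_vector_derivative c') (at t) \<and> dir_deriv (S2.rep x (f2 x)) (c t) c' = 0)"
      by (elim exE conjE)
    have ct: "c t \<in> S" "\<exists>d>0. \<forall>s. \<bar>s - t\<bar> < d \<longrightarrow> c s \<in> S"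
      "\<exists>c'\<in>model N. (c has_vector_derivative c') (at t) \<and> dir_deriv (S2.rep x (f2 x)) (c t) c' = 0" if "t \<in> {0..1}" for t
      using call[rule_format, OF that] by simp_all
    have "hopf_equiv (f1 (cinv N x (c 0))) (f1 (cinv N x (c 1)))"
    proof (rule lifted_curve[OF x S2.f_points[OF x] zero_le_one])
      fix t :: real assume t: "t \<in> {0..1}"
      show "c t \<in> S2.rdom x (f2 x)" using ct(1)[OF t] S(2) by blast
      show "\<exists>d>0. \<forall>s. \<bar>s - t\<bar> < d \<longrightarrow> c s \<in> model N" using ct(2)[OF t] openin_imp_subset[OF S(1)] by blast
      show "\<exists>c'\<in>model N. (c has_vector_derivative c') (at t) \<and>
        (\<exists>Y\<in>F. dir_deriv (S2.rep x (f2 x)) (c t) c' = vf_rep M (f2 x) Y (S2.rep x (f2 x) (c t)))"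
      proof -
        obtain c' where "c' \<in> model N" "(c has_vector_derivative c') (at t)" "dir_deriv (S2.rep x (f2 x)) (c t) c' = 0" using ct(3)[OF t] by blast
        then show ?thesis by (intro bexI[of _ c'] conjI bexI[OF _ zero_in_F]) simp_all
      qed
    qed
    then show "hopf_equiv (f1 x) (f1 y)" using c x y N.chart(1) by simp
  qed
next
  show "hopf_equiv (f1 y) (f1 x)" if "hopf_equiv (f1 x) (f1 y)" for x y using hopf_equiv_sym[OF that] .
  show "hopf_equiv (f1 x) (f1 z)" if "hopf_equiv (f1 x) (f1 y)" "hopf_equiv (f1 y) (f1 z)" for x y z using hopf_equiv_trans[OF that] .
qed (use n in simp_all)

text \<open>The curve is lifted piecewise by local sections of \<open>f2\<close>. The pieces need
  not match, but at a common point of \<open>M\<close> their ends lie in one fibre, where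
  \<open>fibre_hopf\<close> bridges the gap.\<close>

lemma integral_curve_hopf:
  assumes Y: "Y \<in> F" and m: "integral_curve M Y m"
    and n: "n \<in> points N" "n' \<in> points N" "f2 n = m s" "f2 n' = m t"
  shows "hopf_equiv (f1 n) (f1 n')"
proof -
  \<comment> \<open>Quantifying over all lifts makes the relation depend on the times alone, so the
    connectedness argument can run over the real line.\<close>
  define R where "R s t \<longleftrightarrow> (\<forall>n\<in>points N. \<forall>n'\<in>points N. f2 n = m s \<longrightarrow> f2 n' = m t \<longrightarrow> hopf_equiv (f1 n) (f1 n'))" for s t
  have mc: "continuous_map euclideanreal (mtop M) m" using m by (simp add: integral_curve_def)
  have YE: "\<And>q. q \<in> points M \<Longrightarrow> Y q \<in> model M" using M.vector_fieldD(1)[OF singular_foliationD(1)[OF fol Y]] .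
  have mp: "m s \<in> points M" for s using mc by (auto simp: continuous_map_def)
  have lift: "\<exists>n\<in>points N. f2 n = m s" for s using mp[of s] S2.surj_points by (metis imageE)
  have "R s t"
  proof (rule connectedin_equivalence[where X = euclideanreal and C = UNIV])
    show "connectedin euclideanreal UNIV" by (simp add: connected_UNIV)
    show "R x y \<Longrightarrow> R y x" for x y unfolding R_def using hopf_equiv_sym by blast
    show "R x y \<Longrightarrow> R y z \<Longrightarrow> R x z" for x y z unfolding R_def using lift[of y] hopf_equiv_trans by blast
    fix s0 :: real
    obtain n0 where n0: "n0 \<in> points N" "f2 n0 = m s0" using lift by blast
    let ?p = "f2 n0"
    have p: "?p \<in> points M" using S2.f_points n0 by blast
    obtain S L S' \<sigma> where S: "openin (top_of_set (model N)) S" "S \<subseteq> S2.rdom n0 ?p"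
      and L: "\<And>x w. x \<in> S \<Longrightarrow> w \<in> model M \<Longrightarrow> L x w \<in> model N"
        "\<And>x w. x \<in> S \<Longrightarrow> w \<in> model M \<Longrightarrow> dir_deriv (S2.rep n0 ?p) x (L x w) = w"
      and S': "openin (top_of_set (model M)) S'" "cmap M ?p ?p \<in> S'" "Cinf_on (model M) S' \<sigma>"
        "\<And>y. y \<in> S' \<Longrightarrow> \<sigma> y \<in> S" "\<And>y. y \<in> S' \<Longrightarrow> S2.rep n0 ?p (\<sigma> y) = y"
        "\<And>y w. y \<in> S' \<Longrightarrow> w \<in> model M \<Longrightarrow> dir_deriv \<sigma> y w = L (\<sigma> y) w"
    proof (rule S2.submersion_charts[OF n0(1)])
    qed (rule that, assumption+)
    have "openin euclideanreal {r \<in> topspace euclideanreal. m r \<in> {q \<in> cdom M ?p. cmap M ?p q \<in> S'}}"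
      by (rule openin_continuous_map_preimage[OF mc M.open_cmap_vimage[OF p S'(1)]])
    then have "open {r. m r \<in> {q \<in> cdom M ?p. cmap M ?p q \<in> S'}}" by simp
    then obtain d where d: "d > 0" "ball s0 d \<subseteq> {r. m r \<in> {q \<in> cdom M ?p. cmap M ?p q \<in> S'}}"
      using S'(2) M.chart(1)[OF p] n0(2) unfolding open_contains_ball by force
    have dm: "m r \<in> cdom M ?p" "cmap M ?p (m r) \<in> S'" if "r \<in> ball s0 d" for r using d(2) that by auto
    define c where "c r = \<sigma> (cmap M ?p (m r))" for r
    have cS: "c r \<in> S" "S2.rep n0 ?p (c r) = cmap M ?p (m r)" if "r \<in> ball s0 d" for r
      unfolding c_def using dm[OF that] S'(4,5) by blast+
    have seg: "hopf_equiv (f1 (cinv N n0 (c a))) (f1 (cinv N n0 (c b)))" if ab: "a \<le> b" "a \<in> ball s0 d" "b \<in> ball s0 d" for a b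
    proof (rule lifted_curve[OF n0(1) p ab(1)])
      fix t assume t: "t \<in> {a..b}"
      have tb: "t \<in> ball s0 d" using t ab by (auto simp: dist_real_def)
      show "c t \<in> S2.rdom n0 ?p" using cS(1)[OF tb] S(2) by blast
      obtain e where e: "e > 0" "ball t e \<subseteq> ball s0 d" using tb open_ball open_contains_ball by blast
      have eb: "r \<in> ball s0 d" if "\<bar>r - t\<bar> < e" for r
        by (rule subsetD[OF e(2)]) (use that in \<open>simp add: dist_real_def abs_minus_commute\<close>)
      show "\<exists>d>0. \<forall>s. \<bar>s - t\<bar> < d \<longrightarrow> c s \<in> model N" using e(1) eb cS(1) openin_imp_subset[OF S(1)] by blast
      let ?w = "vf_rep M ?p Y (cmap M ?p (m t))"
      have k: "((\<lambda>r. cmap M ?p (m r)) has_vector_derivative ?w) (at t)"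
        by (rule M.integral_curve_chart[OF YE m p dm(1)[OF tb]])
      have kE: "cmap M ?p (m r) \<in> model M" if "\<bar>r - t\<bar> < e" for r
        using dm(2)[OF eb[OF that]] openin_imp_subset[OF S'(1)] by blast
      have w: "?w \<in> model M" and cd: "(c has_vector_derivative dir_deriv \<sigma> (cmap M ?p (m t)) ?w) (at t)"
        using Ck_curve[OF M.fd S'(1) Cinf_Ck[OF S'(3), of "Suc 0"] k dm(2)[OF tb] e(1) kE] unfolding c_def by blast+
      have "dir_deriv \<sigma> (cmap M ?p (m t)) ?w = L (c t) ?w" using S'(6)[OF dm(2)[OF tb] w] by (simp add: c_def)
      then show "\<exists>c'\<in>model N. (c has_vector_derivative c') (at t) \<and>
        (\<exists>Y\<in>F. dir_deriv (S2.rep n0 ?p) (c t) c' = vf_rep M ?p Y (S2.rep n0 ?p (c t)))"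
        using cd L(1)[OF cS(1)[OF tb] w] L(2)[OF cS(1)[OF tb] w] cS(2)[OF tb] Y by (intro bexI[of _ "L (c t) ?w"]) auto
    qed
    have bk: "cinv N n0 (c r) \<in> points N" "f2 (cinv N n0 (c r)) = m r" if r: "r \<in> ball s0 d" for r
    proof -
      obtain q where q: "q \<in> cdom N n0" "f2 q \<in> cdom M ?p" "c r = cmap N n0 q" using cS(1)[OF r] S(2) by (auto simp: S2.rdom_def)
      have qc: "cinv N n0 (c r) = q" using q n0 by simp
      have "cmap M ?p (f2 q) = cmap M ?p (m r)" using cS(2)[OF r] q n0 by simp
      then have "cinv M ?p (cmap M ?p (f2 q)) = cinv M ?p (cmap M ?p (m r))" by (rule arg_cong)
      then have "f2 q = m r" unfolding M.cinv_cmap[OF p q(2)] M.cinv_cmap[OF p dm(1)[OF r]] .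
      then show "cinv N n0 (c r) \<in> points N" "f2 (cinv N n0 (c r)) = m r" using qc N.cdom_points[OF n0(1) q(1)] by auto
    qed
    have s0: "s0 \<in> ball s0 d" using d(1) by simp
    have "R s0 t" if t: "t \<in> ball s0 d" for t
    proof -
      have e: "hopf_equiv (f1 (cinv N n0 (c s0))) (f1 (cinv N n0 (c t)))"
        using seg[OF _ s0 t] seg[OF _ t s0] hopf_equiv_sym linear by blast
      show ?thesis unfolding R_def
      proof (intro ballI impI)
        fix n n' assume n: "n \<in> points N" "n' \<in> points N" "f2 n = m s0" "f2 n' = m t"
        have "hopf_equiv (f1 n) (f1 (cinv N n0 (c s0)))" by (rule fibre_hopf[OF n(1) bk(1)[OF s0] trans[OF n(3) bk(2)[OF s0, symmetric]]])
        moreover have "hopf_equiv (f1 (cinv N n0 (c t))) (f1 n')" by (rule fibre_hopf[OF bk(1)[OF t] n(2) trans[OF bk(2)[OF t] n(4)[symmetric]]])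
        ultimately show "hopf_equiv (f1 n) (f1 n')" using e hopf_equiv_trans by blast
      qed
    qed
    then show "\<exists>U. openin euclideanreal U \<and> s0 \<in> U \<and> (\<forall>y\<in>U \<inter> UNIV. R s0 y)"
      using s0 by (intro exI[of _ "ball s0 d"]) simp
  qed simp_all
  then show ?thesis using n unfolding R_def by blast
qed

text \<open>Flows of the restricted foliation are flows of \<open>F\<close> that stay in
  \<open>U\<close>. Induction along the chain of flows, with a lift chosen over each intermediate
  point.\<close>

lemma leaf_hopf:
  assumes q': "q' \<in> leaf (open_submanifold M U) (restrict_foliation M U F) q"
    and n: "n \<in> points N" "n' \<in> points N" "f2 n = q" "f2 n' = q'"
  shows "hopf_equiv (f1 n) (f1 n')"
proof -
  have "(\<lambda>a b. \<exists>X\<in>restrict_foliation M U F. \<exists>\<gamma> t. integral_curve (open_submanifold M U) X \<gamma> \<and> \<gamma> 0 = a \<and> \<gamma> t = b)\<^sup>*\<^sup>* q q'"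
    using q' by (simp add: leaf_def)
  then have "\<forall>n'\<in>points N. f2 n' = q' \<longrightarrow> hopf_equiv (f1 n) (f1 n')"
  proof (induction rule: rtranclp_induct)
    case base
    then show ?case using fibre_hopf n by auto
  next
    case (step a b)
    then obtain X \<gamma> t where X: "X \<in> restrict_foliation M U F" "integral_curve (open_submanifold M U) X \<gamma>" "\<gamma> 0 = a" "\<gamma> t = b" by blast
    then obtain Y where Y: "Y \<in> F" "X = (\<lambda>q. if q \<in> U then Y q else 0)" by (auto simp: restrict_foliation_def)
    have ic: "integral_curve M Y \<gamma>" by (rule integral_curve_sub) (use X(2) Y(2) in simp)
    have "a \<in> points M" using ic X(3) by (auto simp: integral_curve_def continuous_map_def)
    then obtain na where na: "na \<in> points N" "f2 na = a" using S2.surj_points by (metis imageE)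
    show ?case
    proof (intro ballI impI)
      fix n' assume n': "n' \<in> points N" "f2 n' = b"
      have "hopf_equiv (f1 na) (f1 n')" by (rule integral_curve_hopf[OF Y(1) ic na(1) n'(1), of 0 t]) (use na n' X in auto)
      then show "hopf_equiv (f1 n) (f1 n')" using step.IH na hopf_equiv_trans by blast
    qed
  qed
  then show ?thesis using n by blast
qed

end

section \<open>Slices transporting leaves\<close>

lemma openin_preimage_on:
  assumes "openin (top_of_set V) S" "continuous_on S f" "\<And>x. x \<in> S \<Longrightarrow> f x \<in> W" "openin (top_of_set W) T"
  shows "openin (top_of_set V) {x \<in> S. f x \<in> T}"
proof -
  have "openin (top_of_set S) (S \<inter> f -` T)"
    by (rule continuous_openin_preimage[OF assms(2) _ assms(4)]) (use assms(3) in blast)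
  moreover have "S \<inter> f -` T = {x \<in> S. f x \<in> T}" by blast
  ultimately show ?thesis using openin_trans[OF _ assms(1)] by simp
qed

lemma (in smooth_mfd) vf_rep_sum:
  assumes p: "p \<in> points M" and q: "q \<in> cdom M p" and Y: "\<And>i. i \<in> I \<Longrightarrow> Y i q \<in> E"
  shows "vf_rep M p (\<lambda>r. \<Sum>i\<in>I. h i r *\<^sub>R Y i r) (cmap M p q) = (\<Sum>i\<in>I. h i q *\<^sub>R vf_rep M p (Y i) (cmap M p q))"
proof -
  have qp: "q \<in> points M" using cdom_points[OF p q] .
  have L: "blin_on E (D q p (cmap M q q))" by (rule D_blin[OF qp p chart(1)[OF qp] q])
  have "D q p (cmap M q q) (\<Sum>i\<in>I. h i q *\<^sub>R Y i q) = (\<Sum>i\<in>I. D q p (cmap M q q) (h i q *\<^sub>R Y i q))"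
    by (rule blin_on_sum[OF L sub]) (use Y subspace_scale[OF sub] in blast)
  also have "\<dots> = (\<Sum>i\<in>I. h i q *\<^sub>R D q p (cmap M q q) (Y i q))"
    by (rule sum.cong[OF refl]) (use blin_onD(2)[OF L Y] in blast)
  finally show ?thesis by (simp add: vf_rep_cmap[OF p q])
qed

context morita begin

text \<open>Every field of \<open>F0\<close> is lifted to \<open>N\<close> by the same operators
  \<open>L\<close> that give the derivative of the section \<open>s\<close>, then projected to
  \<open>M\<close> by the pullback condition. The neighbourhood \<open>W\<close> is chosen before
  the field, because one slice has to serve all fields of \<open>F0\<close>.\<close>

lemma exists_transfer:
  assumes n: "n \<in> points N"
  obtains S L S' s W where "openin (top_of_set (model N)) S" "S \<subseteq> N.img n" "cmap N n n \<in> S"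
    "\<And>x w. x \<in> S \<Longrightarrow> L x w \<in> model N" "\<And>x w. x \<in> S \<Longrightarrow> dir_deriv (S1.rep n (f1 n)) x (L x w) = w"
    "openin (top_of_set UNIV) S'" "f1 n \<in> S'" "Cinf_on UNIV S' s" "s (f1 n) = cmap N n n"
    "\<And>y. y \<in> S' \<Longrightarrow> s y \<in> S" "\<And>y. y \<in> S' \<Longrightarrow> f1 (cinv N n (s y)) = y"
    "\<And>y w. y \<in> S' \<Longrightarrow> dir_deriv s y w = L (s y) w"
    "openin (top_of_set (model N)) W" "cmap N n n \<in> W" "W \<subseteq> S"
    "\<And>X. X \<in> F0 \<Longrightarrow> \<exists>k g Y. (\<forall>i<k::nat. g i \<in> smooth_functions_cc N \<and> Y i \<in> F) \<and>
      (\<forall>x\<in>W \<inter> S2.rdom n (f2 n). dir_deriv (S2.rep n (f2 n)) x (L x (X (f1 (cinv N n x)))) =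
        (\<Sum>i<k. g i (cinv N n x) *\<^sub>R vf_rep M (f2 n) (Y i) (S2.rep n (f2 n) x)))"
proof -
  let ?p = "f2 n"
  have p: "?p \<in> points M" using S2.f_points[OF n] .
  obtain S L S' s where S: "openin (top_of_set (model N)) S" "S \<subseteq> S1.rdom n (f1 n)" "cmap N n n \<in> S"
    and L: "\<And>w. w \<in> UNIV \<Longrightarrow> Cinf_on (model N) S (\<lambda>x. L x w)" "\<And>x. x \<in> S \<Longrightarrow> blin_on UNIV (L x)"
    "\<And>x w. x \<in> S \<Longrightarrow> w \<in> UNIV \<Longrightarrow> L x w \<in> model N"
    "\<And>x w. x \<in> S \<Longrightarrow> w \<in> UNIV \<Longrightarrow> dir_deriv (S1.rep n (f1 n)) x (L x w) = w"
    and s: "openin (top_of_set UNIV) S'" "f1 n \<in> S'" "Cinf_on UNIV S' s" "s (f1 n) = cmap N n n"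
    "\<And>y. y \<in> S' \<Longrightarrow> s y \<in> S" "\<And>y. y \<in> S' \<Longrightarrow> S1.rep n (f1 n) (s y) = y"
    "\<And>y w. y \<in> S' \<Longrightarrow> w \<in> UNIV \<Longrightarrow> dir_deriv s y w = L (s y) w"
  proof (rule S1.submersion_charts[OF n, unfolded standard_simps])
  qed (rule that, assumption+)
  have Simg: "S \<subseteq> N.img n" using S(2) rdom1 by blast
  obtain \<beta> :: "'f \<Rightarrow> real" and K W where b: "Cinf_on (model N) (model N) \<beta>" "compact K" "K \<subseteq> S" "\<And>x. x \<in> S - K \<Longrightarrow> \<beta> x = 0"
    "openin (top_of_set (model N)) W" "cmap N n n \<in> W" "W \<subseteq> S" "\<And>x. x \<in> W \<Longrightarrow> \<beta> x = (1::real)"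
    by (rule N.chart_bump[OF n S(1) Simg S(3)]) (rule that, assumption+)
  have tr: "\<exists>k g Y. (\<forall>i<k::nat. g i \<in> smooth_functions_cc N \<and> Y i \<in> F) \<and>
      (\<forall>x\<in>W \<inter> S2.rdom n ?p. dir_deriv (S2.rep n ?p) x (L x (X (f1 (cinv N n x)))) =
        (\<Sum>i<k. g i (cinv N n x) *\<^sub>R vf_rep M ?p (Y i) (S2.rep n ?p x)))" if X: "X \<in> F0" for X
  proof -
    have Xv: "X \<in> vector_fields standard_manifold" using singular_foliationD(1)[OF fol0 X] .
    let ?w = "\<lambda>x. L x (X (f1 (cinv N n x)))"
    have w: "Cinf_on (model N) S ?w"
      using S1.lift_rep_smooth(1)[OF n S(1,2), of L, unfolded standard_simps, OF L(1,2) Xv] by (simp add: rep1)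
    have wN: "?w x \<in> model N" if "x \<in> S" for x using L(3)[OF that] by simp
    have wD: "dir_deriv (S1.rep n (f1 n)) x (?w x) = vf_rep standard_manifold (f1 n) X (S1.rep n (f1 n) x)" if "x \<in> S" for x
      using L(4)[OF that] by (simp add: rep1)
    let ?W0 = "N.extend_vf n S (\<lambda>x. \<beta> x *\<^sub>R ?w x)" and ?b0 = "N.extend_fun n S \<beta>"
    have f1p: "f1 n \<in> points standard_manifold" by simp
    have W0: "?W0 \<in> vector_fields N"
      by (rule S1.lift_field(1)[OF n f1p S(1,2) b(2,3,1,4) w wN Xv wD])
    have TW0: "S1.T q (?W0 q) = ?b0 q *\<^sub>R X (f1 q)" if q: "q \<in> points N" for q
      by (rule S1.lift_field(2)[OF n f1p S(1,2) b(2,3,1,4) w wN Xv wD q])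
    have b0cc: "?b0 \<in> smooth_functions_cc N"
      by (rule S1.lift_field(3)[OF n f1p S(1,2) b(2,3,1,4) w wN Xv wD])
    let ?U0 = "{q \<in> cdom N n. cmap N n q \<in> W}"
    have U0: "openin (mtop N) ?U0" by (rule N.open_cmap_vimage[OF n b(5)])
    have b1: "?b0 q = 1" if "q \<in> ?U0" for q using that b(7,8) by (auto simp: N.extend_fun_def)
    have b0s: "?b0 \<in> smooth_functions N" using b0cc by (simp add: smooth_functions_cc_def)
    obtain V where V: "V \<in> vector_fields N" "\<And>q. q \<in> points N \<Longrightarrow> S1.T q (V q) = X (f1 q)" "\<And>q. q \<in> ?U0 \<Longrightarrow> V q = ?W0 q"
    proof (rule S1.global_lift[OF Xv W0 b0s b1 U0 TW0])
    qed (assumption | (rule that, assumption+))+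
    obtain k g Y where g: "\<And>i. i < (k::nat) \<Longrightarrow> g i \<in> smooth_functions_cc N" "\<And>i. i < k \<Longrightarrow> Y i \<in> F"
      and gY: "\<And>q. q \<in> points N \<Longrightarrow> S2.T q (?b0 q *\<^sub>R V q) = (\<Sum>i<k. g i q *\<^sub>R Y i (f2 q))"
    proof (rule pullback_transfer[OF S1.submersion_axioms S2.submersion_axioms equalityD1[OF pb] V(1) X V(2) b0cc])
    qed (assumption | (rule that, assumption+))+
    have YE: "Y i q \<in> model M" if "i < k" "q \<in> points M" for i q
      using M.vector_fieldD(1)[OF singular_foliationD(1)[OF fol g(2)[OF that(1)]] that(2)] .
    have "dir_deriv (S2.rep n ?p) x (?w x) = (\<Sum>i<k. g i (cinv N n x) *\<^sub>R vf_rep M ?p (Y i) (S2.rep n ?p x))"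
      if x: "x \<in> W \<inter> S2.rdom n ?p" for x
    proof -
      obtain q where q: "q \<in> cdom N n" "f2 q \<in> cdom M ?p" "x = cmap N n q" using x by (auto simp: S2.rdom_def)
      have qp: "q \<in> points N" using N.cdom_points[OF n q(1)] .
      have fq: "f2 q \<in> points M" using S2.f_points[OF qp] .
      have qc: "cinv N n x = q" using q n by simp
      have xW: "x \<in> W" and xS: "x \<in> S" using x b(7) by blast+
      have qU: "q \<in> ?U0" using q xW by simp
      have Vq: "?b0 q *\<^sub>R V q = N.D n q x (?w x)"
        using V(3)[OF qU] b1[OF qU] q xS b(8)[OF xW] by (simp add: N.extend_vf_def)
      have "dir_deriv (S2.rep n ?p) x (?w x) = M.D (f2 q) ?p (cmap M (f2 q) (f2 q)) (S2.T q (N.D n q x (?w x)))"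
        using S2.rep_deriv[OF n p q(1,2) wN[OF xS]] q(3) by simp
      also have "S2.T q (N.D n q x (?w x)) = (\<Sum>i<k. g i q *\<^sub>R Y i (f2 q))" using gY[OF qp] Vq by simp
      also have "M.D (f2 q) ?p (cmap M (f2 q) (f2 q)) (\<Sum>i<k. g i q *\<^sub>R Y i (f2 q)) =
          (\<Sum>i<k. g i q *\<^sub>R vf_rep M ?p (Y i) (cmap M ?p (f2 q)))"
        using M.vf_rep_sum[OF p q(2), of "{..<k}" Y "\<lambda>i _. g i q"] YE[OF _ fq] by (simp add: M.vf_rep_cmap[OF p q(2)])
      finally show ?thesis using qc q n by simp
    qed
    then show ?thesis using g by (intro exI[of _ k] exI[of _ g] exI[of _ Y]) simp
  qed
  show ?thesis
  proof (rule that[of S L S' s W, OF S(1) Simg S(3) _ _ s(1-5) _ _ b(5-7) tr])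
    show "L x w \<in> model N" "dir_deriv (S1.rep n (f1 n)) x (L x w) = w" if "x \<in> S" for x w using L(3,4)[OF that] by simp_all
    show "f1 (cinv N n (s y)) = y" "dir_deriv s y w = L (s y) w" if "y \<in> S'" for y w using s(6,7)[OF that] by (simp_all add: rep1)
  qed
qed

end

context morita begin

text \<open>In coordinates \<open>y\<close> is \<open>f2\<close> after a section of
  \<open>f1\<close>, and \<open>P\<close> is \<open>f1\<close> after a section of \<open>f2\<close>,
  both sections passing through \<open>n\<close>. Local invertibility of \<open>P o y\<close> allows
  coefficients living on \<open>N\<close> to be moved to \<open>M\<close>, so that the image of an
  integral curve of \<open>F0\<close> becomes an integral curve of one field of \<open>F\<close>
  supported in \<open>U\<close>.\<close>

lemma slice:
  assumes n: "n \<in> points N" and f1n: "f1 n = 0" and U: "openin (mtop M) U" "f2 n \<in> U"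
  obtains r y P SP where "r > 0" "Cinf_on UNIV (ball 0 r) y" "y 0 = cmap M (f2 n) (f2 n)"
    "\<And>x. x \<in> ball 0 r \<Longrightarrow> y x \<in> cmap M (f2 n) ` (cdom M (f2 n) \<inter> U)"
    "\<And>x. x \<in> ball 0 r \<Longrightarrow> \<exists>q\<in>points N. f2 q = cinv M (f2 n) (y x) \<and> f1 q = x"
    "openin (top_of_set (model M)) SP" "cmap M (f2 n) (f2 n) \<in> SP" "Cinf_on (model M) SP P"
    "\<And>z. z \<in> SP \<Longrightarrow> \<exists>q\<in>points N. f2 q = cinv M (f2 n) z \<and> f1 q = P z"
    "\<And>v. dir_deriv P (cmap M (f2 n) (f2 n)) (dir_deriv y 0 v) = v" "P (cmap M (f2 n) (f2 n)) = 0"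
    "\<And>x x'. x \<in> ball 0 r \<Longrightarrow> hopf_equiv x x' \<Longrightarrow>
      cinv M (f2 n) (y x') \<in> leaf (open_submanifold M U) (restrict_foliation M U F) (cinv M (f2 n) (y x))"
proof -
  let ?p = "f2 n" and ?x0 = "cmap N n n" and ?E = "UNIV :: (octonion \<times> octonion) set"
  let ?z0 = "cmap M ?p ?p" and ?R = "S2.rep n ?p"
  have p: "?p \<in> points M" using S2.f_points[OF n] .
  obtain S L S' s W where S: "openin (top_of_set (model N)) S" "S \<subseteq> N.img n" "?x0 \<in> S"
    and L: "\<And>x w. x \<in> S \<Longrightarrow> L x w \<in> model N" "\<And>x w. x \<in> S \<Longrightarrow> dir_deriv (S1.rep n (f1 n)) x (L x w) = w"
    and s: "openin (top_of_set ?E) S'" "f1 n \<in> S'" "Cinf_on UNIV S' s" "s (f1 n) = ?x0"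
    "\<And>y. y \<in> S' \<Longrightarrow> s y \<in> S" "\<And>y. y \<in> S' \<Longrightarrow> f1 (cinv N n (s y)) = y"
    "\<And>y w. y \<in> S' \<Longrightarrow> dir_deriv s y w = L (s y) w"
    and W: "openin (top_of_set (model N)) W" "?x0 \<in> W" "W \<subseteq> S"
    and tr: "\<And>X. X \<in> F0 \<Longrightarrow> \<exists>k g Y. (\<forall>i<k::nat. g i \<in> smooth_functions_cc N \<and> Y i \<in> F) \<and>
      (\<forall>x\<in>W \<inter> S2.rdom n ?p. dir_deriv ?R x (L x (X (f1 (cinv N n x)))) =
        (\<Sum>i<k. g i (cinv N n x) *\<^sub>R vf_rep M ?p (Y i) (?R x)))"
    by (rule exists_transfer[OF n]) (rule that, assumption+)
  obtain Sb Lb B b where Sb: "Sb \<subseteq> S2.rdom n ?p" and Lb: "\<And>x w. x \<in> Sb \<Longrightarrow> w \<in> model M \<Longrightarrow> Lb x w \<in> model N"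
      "\<And>x w. x \<in> Sb \<Longrightarrow> w \<in> model M \<Longrightarrow> dir_deriv ?R x (Lb x w) = w"
    and b: "openin (top_of_set (model M)) B" "?z0 \<in> B" "Cinf_on (model M) B b" "b ?z0 = ?x0"
      "\<And>z. z \<in> B \<Longrightarrow> b z \<in> Sb" "\<And>z. z \<in> B \<Longrightarrow> ?R (b z) = z"
      "\<And>z w. z \<in> B \<Longrightarrow> w \<in> model M \<Longrightarrow> dir_deriv b z w = Lb (b z) w"
  proof (rule S2.submersion_charts[OF n])
  qed (rule that, assumption+)
  have rdo: "openin (top_of_set (model N)) (S2.rdom n ?p)" by (rule S2.rdom_open[OF n p])
  have Rsm: "Cinf_on (model N) (S2.rdom n ?p) ?R" by (rule S2.rep_smooth[OF n p])
  have subE: "subspace ?E" by (rule subspace_UNIV)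
  have fdE: "fd_subspace ?E" by (rule fd_subspace_UNIV)
  have SN: "S \<subseteq> model N" using openin_imp_subset[OF S(1)] .
  have pt: "\<exists>q\<in>points N. cinv N n x = q \<and> f2 q = cinv M ?p (?R x)" if x: "x \<in> S2.rdom n ?p" for x
  proof -
    obtain q where q: "q \<in> cdom N n" "f2 q \<in> cdom M ?p" "x = cmap N n q" using x by (auto simp: S2.rdom_def)
    show ?thesis using q n p N.cdom_points[OF n q(1)] by (intro bexI[of _ q]) simp_all
  qed
  define y where "y x = ?R (s x)" for x
  define Y1 where "Y1 = {x \<in> S'. s x \<in> S2.rdom n ?p}"
  have Y1S: "Y1 \<subseteq> S'" unfolding Y1_def by blast
  have Y1o: "openin (top_of_set ?E) Y1" unfolding Y1_def
    by (rule openin_preimage_on[OF s(1) Ck_continuous[OF Cinf_Ck[OF s(3), of 0]] _ rdo]) (use s(5) SN in blast)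
  have ysm: "Cinf_on ?E Y1 y" unfolding y_def
    by (rule Cinf_compose[OF subE Y1o N.fd rdo Cinf_subset[OF s(3) Y1S] _ Rsm]) (simp add: Y1_def)
  have yimg: "y x \<in> M.img ?p" if "x \<in> Y1" for x unfolding y_def using S2.rep_in[OF n p] that by (simp add: Y1_def)
  have y0: "y 0 = ?z0" unfolding y_def using s(4) f1n n N.chart(1)[OF n] by simp
  have zero_Y1: "0 \<in> Y1" unfolding Y1_def using s(2,4) f1n S2.self_rdom[OF n] by simp
  define P where "P z = f1 (cinv N n (b z))" for z
  have rd1: "S1.rdom n (f1 n) = N.img n" by (rule rdom1)
  have Psm: "Cinf_on (model M) B P"
  proof -
    have "Cinf_on (model M) B (\<lambda>z. S1.rep n (f1 n) (b z))"
    proof (rule Cinf_compose[OF M.sub b(1) N.fd N.chart(3)[OF n] b(3)])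
      show "Cinf_on (model N) (N.img n) (S1.rep n (f1 n))" using S1.rep_smooth[OF n, of "f1 n"] rd1 by simp
      show "b z \<in> N.img n" if "z \<in> B" for z using b(5)[OF that] Sb by (auto simp: S2.rdom_def N.img_def)
    qed
    then show ?thesis by (simp add: rep1 P_def[abs_def])
  qed
  have P0: "P ?z0 = 0" unfolding P_def using b(4) f1n n N.chart(1)[OF n] by simp
  define K where "K = {x \<in> Y1. y x \<in> B}"
  have Ko: "openin (top_of_set ?E) K" unfolding K_def
    by (rule openin_preimage_on[OF Y1o Ck_continuous[OF Cinf_Ck[OF ysm, of 0]] _ b(1)]) (use yimg M.imgE[OF p] in blast)
  have KY: "K \<subseteq> Y1" unfolding K_def by blast
  have zero_K: "0 \<in> K" unfolding K_def using zero_Y1 y0 b(2) by simp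
  have ksm: "Cinf_on ?E K (\<lambda>x. P (y x))"
    by (rule Cinf_compose[OF subE Ko M.fd b(1) Cinf_subset[OF ysm KY] _ Psm]) (simp add: K_def)
  \<comment> \<open>The two sections lift the same vector of \<open>M\<close> to vectors that differ
    by one covering the zero field of \<open>F\<close>. That difference also covers a field of
    \<open>F0\<close> at the origin, which vanishes there, so \<open>f1\<close> does not see
    it.\<close>
  have id: "dir_deriv P ?z0 (dir_deriv y 0 v) = v" for v
  proof -
    let ?u = "L ?x0 v"
    have uN: "?u \<in> model N" using L(1)[OF S(3)] .
    have dy: "dir_deriv y 0 v = S2.T n ?u"
    proof -
      have "dir_deriv y 0 v = dir_deriv ?R (s 0) (dir_deriv s 0 v)" unfolding y_def
        by (rule dir_deriv_compose[OF subE Y1o N.fd rdo Cinf_Ck[OF Cinf_subset[OF s(3) Y1S], of "Suc 0"] _ Cinf_Ck[OF Rsm, of "Suc 0"] zero_Y1 UNIV_I])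
          (simp add: Y1_def)
      then show ?thesis using s(2,4) s(7)[OF s(2)] f1n S2.rep_deriv_self[OF n uN] by simp
    qed
    let ?e = "S2.T n ?u"
    have eM: "?e \<in> model M" by (rule S2.T_in[OF n uN])
    have x0b: "?x0 \<in> Sb" using b(5)[OF b(2)] b(4) by simp
    let ?u' = "Lb ?x0 ?e"
    have u'N: "?u' \<in> model N" using Lb(1)[OF x0b eM] .
    have dP: "dir_deriv P ?z0 ?e = S1.T n ?u'"
    proof -
      have "dir_deriv (\<lambda>z. S1.rep n (f1 n) (b z)) ?z0 ?e = dir_deriv (S1.rep n (f1 n)) (b ?z0) (dir_deriv b ?z0 ?e)"
      proof (rule dir_deriv_compose[OF M.sub b(1) N.fd N.chart(3)[OF n] Cinf_Ck[OF b(3), of "Suc 0"] _ _ b(2) eM])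
        show "Ck_on (Suc 0) (model N) (N.img n) (S1.rep n (f1 n))" using Cinf_Ck[OF S1.rep_smooth[OF n, of "f1 n"], of "Suc 0"] rd1 by simp
        show "b z \<in> N.img n" if "z \<in> B" for z using b(5)[OF that] Sb by (auto simp: S2.rdom_def N.img_def)
      qed
      moreover have "dir_deriv b ?z0 ?e = ?u'" using b(7)[OF b(2) eM] b(4) by simp
      ultimately have "dir_deriv (\<lambda>z. S1.rep n (f1 n) (b z)) ?z0 ?e = S1.T n ?u'"
        using S1.rep_deriv_self[OF n u'N] b(4) by simp
      then show ?thesis by (simp add: rep1 P_def[abs_def])
    qed
    have "S2.T n ?u' = ?e" using Lb(2)[OF x0b eM] S2.rep_deriv_self[OF n u'N] by simp
    then have "S2.T n (?u' - ?u) = (\<lambda>_. 0) (f2 n)" using blin_on_diff[OF S2.T_blin[OF n] N.sub u'N uN] by simp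
    then obtain X where X: "X \<in> F0" "S1.T n (?u' - ?u) = X (f1 n)"
      using pullback_transfer_point[OF S2.submersion_axioms S1.submersion_axioms fol fol0 equalityD2[OF pb] n subspace_diff[OF N.sub u'N uN] zero_in_F]
      by blast
    have "hopf_tangent 0 (X 0)" by (rule F0_tangent[OF fol0 dec X(1)])
    then have "fst (X 0) = 0" "X 0 \<in> oct_line 0" by (auto simp: hopf_tangent_def oct_line_iff)
    then have "X 0 = 0" by (simp add: oct_line_iff prod_eq_iff)
    then have "S1.T n ?u' = S1.T n ?u" using X(2) f1n blin_on_diff[OF S1.T_blin[OF n] N.sub u'N uN] by simp
    also have "\<dots> = v" using L(2)[OF S(3)] S1.rep_deriv_self[OF n uN] by simp
    finally show ?thesis using dy dP by simp
  qed
  have kid: "dir_deriv (\<lambda>x. P (y x)) 0 v = v" for v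
  proof -
    have "dir_deriv (\<lambda>x. P (y x)) 0 v = dir_deriv P (y 0) (dir_deriv y 0 v)"
      by (rule dir_deriv_compose[OF subE Ko M.fd b(1) Cinf_Ck[OF Cinf_subset[OF ysm KY], of "Suc 0"] _ Cinf_Ck[OF Psm, of "Suc 0"] zero_K UNIV_I])
        (simp add: K_def)
    then show ?thesis using id y0 by simp
  qed
  \<comment> \<open>\<open>h\<close> after \<open>P\<close> is a left inverse of \<open>y\<close>;
    it extends functions given along the slice to a neighbourhood in \<open>M\<close>.\<close>
  obtain K' T h where K': "openin (top_of_set ?E) K'" "K' \<subseteq> K" "0 \<in> K'" and T: "openin (top_of_set ?E) T" "P (y 0) \<in> T"
    and h: "Cinf_on ?E T h" "\<And>z. z \<in> T \<Longrightarrow> h z \<in> K'" "\<And>x. x \<in> K' \<Longrightarrow> P (y x) \<in> T" "\<And>x. x \<in> K' \<Longrightarrow> h (P (y x)) = x"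
    by (rule inverse_function[OF fdE Ko ksm UNIV_I zero_K kid]) (rule that, assumption+)
  define H where "H = {z \<in> B. P z \<in> T} \<inter> cmap M ?p ` (cdom M ?p \<inter> U)"
  have UI: "openin (top_of_set (model M)) (cmap M ?p ` (cdom M ?p \<inter> U))"
    by (rule M.open_cmap_image[OF p openin_Int[OF M.chart(2)[OF p] U(1)]]) blast
  have Ho: "openin (top_of_set (model M)) H" unfolding H_def
    by (rule openin_Int[OF openin_preimage_on[OF b(1) Ck_continuous[OF Cinf_Ck[OF Psm, of 0]] UNIV_I T(1)] UI])
  have Himg: "H \<subseteq> M.img ?p" unfolding H_def M.img_def by blast
  have HB: "H \<subseteq> B" unfolding H_def by blast
  have z0H: "?z0 \<in> H" unfolding H_def using b(2) T(2) y0 M.chart(1)[OF p] U(2) by simp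
  obtain \<beta> :: "'e \<Rightarrow> real" and C Wb where be: "Cinf_on (model M) (model M) \<beta>" "compact C" "C \<subseteq> H" "\<And>z. z \<in> H - C \<Longrightarrow> \<beta> z = 0"
    "openin (top_of_set (model M)) Wb" "?z0 \<in> Wb" "Wb \<subseteq> H" "\<And>z. z \<in> Wb \<Longrightarrow> \<beta> z = (1::real)"
    by (rule M.chart_bump[OF p Ho Himg z0H]) (rule that, assumption+)
  have K'Y: "K' \<subseteq> Y1" using K'(2) KY by blast
  have K'S: "K' \<subseteq> S'" using K'Y Y1S by blast
  define A where "A = {x \<in> K'. s x \<in> W} \<inter> {x \<in> K'. y x \<in> Wb}"
  have Ao: "openin (top_of_set ?E) A" unfolding A_def
  proof (rule openin_Int)
    show "openin (top_of_set ?E) {x \<in> K'. s x \<in> W}"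
      by (rule openin_preimage_on[OF K'(1) Ck_continuous[OF Cinf_Ck[OF Cinf_subset[OF s(3) K'S], of 0]] _ W(1)]) (use s(5) SN K'S in blast)
    show "openin (top_of_set ?E) {x \<in> K'. y x \<in> Wb}"
      by (rule openin_preimage_on[OF K'(1) Ck_continuous[OF Cinf_Ck[OF Cinf_subset[OF ysm K'Y], of 0]] _ be(5)])
        (use yimg M.imgE[OF p] K'Y in blast)
  qed
  have "0 \<in> A" unfolding A_def using K'(3) s(4) f1n W(2) y0 be(6) by simp
  then obtain r where r: "r > 0" "ball 0 r \<subseteq> A" using Ao openE by (metis open_openin subtopology_UNIV)
  have rA: "x \<in> K'" "s x \<in> W" "y x \<in> Wb" "x \<in> Y1" "x \<in> S'" "s x \<in> S2.rdom n ?p" "y x \<in> H" if x: "x \<in> ball 0 r" for x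
  proof -
    have xA: "x \<in> A" using r(2) x by blast
    then show "x \<in> K'" "s x \<in> W" "y x \<in> Wb" unfolding A_def by blast+
    then show "x \<in> Y1" "x \<in> S'" "y x \<in> H" using K'Y K'S be(7) by blast+
    then show "s x \<in> S2.rdom n ?p" by (simp add: Y1_def)
  qed
  have yU: "y x \<in> cmap M ?p ` (cdom M ?p \<inter> U)" if "x \<in> ball 0 r" for x using rA(7)[OF that] unfolding H_def by blast
  have UC: "cinv M ?p z \<in> U" if zH: "z \<in> H" for z
  proof -
    obtain q where "q \<in> cdom M ?p" "q \<in> U" "z = cmap M ?p q" using zH unfolding H_def by blast
    then show ?thesis using p by simp
  qed
  let ?leaf = "leaf (open_submanifold M U) (restrict_foliation M U F)"
  have step: "cinv M ?p (y (c t)) \<in> ?leaf q0"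
    if X: "X \<in> F0" and ic: "integral_curve standard_manifold X c" and c0: "c 0 \<in> ball 0 r"
      and q0: "cinv M ?p (y (c 0)) \<in> ?leaf q0" for X c t q0
  proof -
    have cd: "(c has_vector_derivative X (c t)) (at t)" for t using ic by (simp add: integral_curve_standard)
    \<comment> \<open>Leaves of \<open>F0\<close> lie in spheres about the origin, so the curve
      never leaves the ball on which the slice is defined.\<close>
    have cb: "c t \<in> ball 0 r" for t
    proof -
      have "c t \<in> leaf standard_manifold F0 (c 0)" by (rule leaf_curve[OF X ic leaf_refl])
      then have "hopf_equiv (c 0) (c t)" by (simp add: leaf_F0_iff[OF fol0 dec])
      then show ?thesis using c0 by (simp add: hopf_equiv_def)
    qed
    obtain k g Y where g: "\<And>i. i < (k::nat) \<Longrightarrow> g i \<in> smooth_functions_cc N" "\<And>i. i < k \<Longrightarrow> Y i \<in> F"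
      and gY: "\<And>x. x \<in> W \<Longrightarrow> x \<in> S2.rdom n ?p \<Longrightarrow> dir_deriv ?R x (L x (X (f1 (cinv N n x)))) =
        (\<Sum>i<k. g i (cinv N n x) *\<^sub>R vf_rep M ?p (Y i) (?R x))"
    proof -
      from tr[OF X] obtain k g Y where *: "(\<forall>i<k::nat. g i \<in> smooth_functions_cc N \<and> Y i \<in> F) \<and>
        (\<forall>x\<in>W \<inter> S2.rdom n ?p. dir_deriv ?R x (L x (X (f1 (cinv N n x)))) =
          (\<Sum>i<k. g i (cinv N n x) *\<^sub>R vf_rep M ?p (Y i) (?R x)))" by (elim exE)
      show ?thesis by (rule that[of k g Y]) (use * in \<open>simp_all only: Int_iff Ball_def\<close>)
    qed
    \<comment> \<open>The coefficient \<open>g i\<close> along the section, made a function near the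
      slice by means of \<open>h (P z)\<close>, and cut off so that it extends to \<open>M\<close>
      with support in \<open>U\<close>.\<close>
    define hh where "hh i z = \<beta> z * g i (cinv N n (s (h (P z))))" for i z
    let ?hM = "\<lambda>i. M.extend_fun ?p H (hh i)"
    have hsm: "Cinf_on (model M) H (hh i)" if i: "i < k" for i
    proof -
      have gs: "g i \<in> smooth_functions N" using g(1)[OF i] by (simp add: smooth_functions_cc_def)
      have 1: "Cinf_on (model M) H (\<lambda>z. h (P z))"
        by (rule Cinf_compose[OF M.sub Ho fdE T(1) Cinf_subset[OF Psm HB] _ h(1)]) (simp add: H_def)
      have m1: "h (P z) \<in> S'" if "z \<in> H" for z using h(2)[of "P z"] that K'S by (auto simp: H_def)
      have 2: "Cinf_on (model M) H (\<lambda>z. s (h (P z)))"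
        by (rule Cinf_compose[OF M.sub Ho fdE s(1) 1 m1 s(3)])
      have "Cinf_on (model M) H (\<lambda>z. g i (cinv N n (s (h (P z)))))"
        by (rule Cinf_compose[OF M.sub Ho N.fd N.chart(3)[OF n] 2 _ N.smooth_functionD[OF gs n]]) (use m1 s(5) S(2) in blast)
      then show ?thesis unfolding hh_def
        by (rule Cinf_mult[OF M.sub Ho Cinf_subset[OF be(1) openin_imp_subset[OF Ho]]])
    qed
    have h0: "hh i z = 0" if "z \<in> H - C" for i z using be(4)[OF that] by (simp add: hh_def)
    have hMs: "?hM i \<in> smooth_functions M" if i: "i < k" for i
      by (rule M.extend_fun(1)[OF p Ho Himg be(2,3) hsm[OF i] h0])
    have hM0: "?hM i q = 0" if i: "i < k" and q: "q \<notin> cinv M ?p ` C" for i q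
      by (rule M.extend_fun(2)[OF p Ho Himg be(2,3) hsm[OF i] h0 q])
    define Z where "Z = (\<lambda>q. \<Sum>i\<in>{..<k}. ?hM i q *\<^sub>R Y i q)"
    have ZF: "Z \<in> F" unfolding Z_def
      by (rule singular_foliation_sum[OF fol]) (use hMs g(2) in simp_all)
    have ZE: "Z q \<in> model M" if "q \<in> points M" for q using M.vector_fieldD(1)[OF singular_foliationD(1)[OF fol ZF] that] .
    have CU: "cinv M ?p ` C \<subseteq> U" using UC be(3) by blast
    have "mtop M closure_of {q \<in> points M. Z q \<noteq> 0} \<subseteq> cinv M ?p ` C"
    proof (rule closure_of_minimal)
      have "Z q = 0" if q: "q \<notin> cinv M ?p ` C" for q unfolding Z_def
        by (rule sum.neutral) (use hM0 q in simp)
      then show "{q \<in> points M. Z q \<noteq> 0} \<subseteq> cinv M ?p ` C" by blast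
      show "closedin (mtop M) (cinv M ?p ` C)" by (rule M.chart_compact_closed[OF p be(2)]) (use be(3) Himg in blast)
    qed
    then have ZU: "(\<lambda>q. if q \<in> U then Z q else 0) \<in> restrict_foliation M U F"
      unfolding restrict_foliation_def using ZF CU by blast
    \<comment> \<open>Along the slice the cutoff is 1 and \<open>h\<close> inverts
      \<open>P o y\<close>, so \<open>Z\<close> has there exactly the value that the transfer
      assigns to the velocity of \<open>c\<close>.\<close>
    have "integral_curve M Z (\<lambda>t. cinv M ?p (y (c t)))"
    proof (rule M.integral_curve_chartI[OF ZE p])
      show "y (c t) \<in> M.img ?p" for t by (rule yimg[OF rA(4)[OF cb]])
      fix t
      let ?x = "s (c t)" and ?q = "cinv M ?p (y (c t))"
      have sd: "((\<lambda>t. s (c t)) has_vector_derivative L ?x (X (c t))) (at t)"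
        using conjunct2[OF Ck_curve[OF fdE s(1) Cinf_Ck[OF s(3), of "Suc 0"] cd rA(5)[OF cb] zero_less_one UNIV_I]] s(7)[OF rA(5)[OF cb]]
        by simp
      have "((\<lambda>t. ?R (s (c t))) has_vector_derivative dir_deriv ?R ?x (L ?x (X (c t)))) (at t)"
        by (rule conjunct2[OF Ck_curve[OF N.fd rdo Cinf_Ck[OF Rsm, of "Suc 0"] sd rA(6)[OF cb] zero_less_one]])
          (use s(5)[OF rA(5)[OF cb]] SN in blast)
      moreover have "dir_deriv ?R ?x (L ?x (X (c t))) = (\<Sum>i<k. g i (cinv N n ?x) *\<^sub>R vf_rep M ?p (Y i) (y (c t)))"
        using gY[OF rA(2)[OF cb] rA(6)[OF cb]] s(6)[OF rA(5)[OF cb]] by (simp add: y_def)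
      moreover have "vf_rep M ?p Z (y (c t)) = (\<Sum>i<k. g i (cinv N n ?x) *\<^sub>R vf_rep M ?p (Y i) (y (c t)))"
      proof -
        have yi: "y (c t) \<in> M.img ?p" by (rule yimg[OF rA(4)[OF cb]])
        have qd: "?q \<in> cdom M ?p" and qy: "cmap M ?p ?q = y (c t)" using yi by simp_all
        have qp: "?q \<in> points M" by (rule M.cdom_points[OF p qd])
        have hv: "?hM i ?q = g i (cinv N n ?x)" for i
          using qd qy rA(7)[OF cb[of t]] be(8)[OF rA(3)[OF cb]] h(4)[OF rA(1)[OF cb]] by (simp add: M.extend_fun_def hh_def)
        have "vf_rep M ?p Z (cmap M ?p ?q) = (\<Sum>i\<in>{..<k}. ?hM i ?q *\<^sub>R vf_rep M ?p (Y i) (cmap M ?p ?q))" unfolding Z_def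
          by (rule M.vf_rep_sum[OF p qd]) (use M.vector_fieldD(1)[OF singular_foliationD(1)[OF fol g(2)] qp] in simp)
        then show ?thesis by (simp only: qy hv)
      qed
      ultimately show "((\<lambda>t. y (c t)) has_vector_derivative vf_rep M ?p Z (y (c t))) (at t)" by (simp only: y_def)
    qed
    then have "integral_curve (open_submanifold M U) (\<lambda>q. if q \<in> U then Z q else 0) (\<lambda>t. cinv M ?p (y (c t)))"
      by (rule integral_curve_subI) (rule UC[OF rA(7)[OF cb]])
    from leaf_curve[OF ZU this q0] show ?thesis .
  qed
  show ?thesis
  proof (rule that[of r y B P, OF r(1) _ y0 yU _ b(1,2) Psm _ id P0])
    show "Cinf_on UNIV (ball 0 r) y" by (rule Cinf_subset[OF ysm]) (use rA(4) in blast)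
    show "\<exists>q\<in>points N. f2 q = cinv M ?p (y x) \<and> f1 q = x" if x: "x \<in> ball 0 r" for x
      using pt[OF rA(6)[OF x]] s(6)[OF rA(5)[OF x]] unfolding y_def by blast
    show "\<exists>q\<in>points N. f2 q = cinv M ?p z \<and> f1 q = P z" if z: "z \<in> B" for z
      using pt[of "b z"] b(5)[OF z] Sb b(6)[OF z] unfolding P_def by auto
    fix x x' assume x: "x \<in> ball 0 r" and hx: "hopf_equiv x x'"
    have "x' \<in> leaf standard_manifold F0 x" using hx by (simp add: leaf_F0_iff[OF fol0 dec])
    then have "(\<lambda>a b. \<exists>X\<in>F0. \<exists>\<gamma> t. integral_curve standard_manifold X \<gamma> \<and> \<gamma> 0 = a \<and> \<gamma> t = b)\<^sup>*\<^sup>* x x'"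
      by (simp add: leaf_def)
    then show "cinv M ?p (y x') \<in> ?leaf (cinv M ?p (y x))"
    proof (induction rule: rtranclp_induct)
      case base
      show ?case by (rule leaf_refl)
    next
      case (step a a')
      have "a \<in> leaf standard_manifold F0 x" using step.hyps(1) by (simp add: leaf_def)
      then have "hopf_equiv x a" by (simp add: leaf_F0_iff[OF fol0 dec])
      then have ab: "a \<in> ball 0 r" using x by (simp add: hopf_equiv_def)
      obtain X \<gamma> t where X: "X \<in> F0" "integral_curve standard_manifold X \<gamma>" "\<gamma> 0 = a" "\<gamma> t = a'" using step.hyps(2) by blast
      show ?case using \<open>\<And>X q0 c t. X \<in> F0 \<Longrightarrow> integral_curve standard_manifold X c \<Longrightarrow> c 0 \<in> ball 0 r \<Longrightarrow>
          cinv M ?p (y (c 0)) \<in> ?leaf q0 \<Longrightarrow> cinv M ?p (y (c t)) \<in> ?leaf q0\<close>[OF X(1,2), of _ t] X(3,4) ab step.IH by simp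
    qed
  qed
qed

end

section \<open>Homogeneous foliations\<close>

text \<open>The hypothesis equates two families of sets and does not match the orbit of a point with
  the leaf of the same point. A leaf containing \<open>a\<close> and \<open>a'\<close> is the orbit
  of some \<open>q\<close>, and the group element wanted is \<phi>2 after the inverse of
  \<phi>1.\<close>

lemma homogeneous_orbits:
  fixes M :: "('m, 'e::real_normed_vector) manifold"
  assumes hom: "homogeneous_foliation M g F"
  obtains H where "H \<subseteq> isometries M g"
    "\<And>\<phi> b. \<phi> \<in> H \<Longrightarrow> b \<in> points M \<Longrightarrow> \<exists>q\<in>points M. b \<in> leaf M F q \<and> \<phi> b \<in> leaf M F q"
    "\<And>a a'. a \<in> points M \<Longrightarrow> a' \<in> leaf M F a \<Longrightarrow> \<exists>\<phi>\<in>H. \<phi> a = a'"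
proof -
  have "\<exists>H. subgroup H (isometry_group M g) \<and> group (isometry_group M g\<lparr>carrier := H\<rparr>) \<and>
      (\<lambda>q. {\<phi> q | \<phi>. \<phi> \<in> H}) ` points M = leaf_decomposition M F"
    using hom unfolding homogeneous_foliation_def lie_group_def by blast
  then obtain H where H: "subgroup H (isometry_group M g)" and gr: "group (isometry_group M g\<lparr>carrier := H\<rparr>)"
    and orb: "(\<lambda>q. {\<phi> q | \<phi>. \<phi> \<in> H}) ` points M = leaf M F ` points M"
    unfolding leaf_decomposition_def by blast
  let ?G = "isometry_group M g\<lparr>carrier := H\<rparr>"
  have HI: "H \<subseteq> isometries M g" using subgroup.subset[OF H] by (simp add: isometry_group_def)
  then have HB: "\<phi> \<in> Bij (points M)" if "\<phi> \<in> H" for \<phi> using that by (auto simp: isometries_def)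
  have mult: "(\<phi> \<otimes>\<^bsub>?G\<^esub> \<psi>) b = \<phi> (\<psi> b)" if "\<phi> \<in> H" "\<psi> \<in> H" "b \<in> points M" for \<phi> \<psi> b
    using HB that by (simp add: isometry_group_def BijGroup_def compose_def)
  have one: "\<one>\<^bsub>?G\<^esub> b = b" if "b \<in> points M" for b using that by (simp add: isometry_group_def BijGroup_def)
  have oneH: "\<one>\<^bsub>?G\<^esub> \<in> H" using monoid.one_closed[OF group.is_monoid[OF gr]] by simp
  show ?thesis
  proof (rule that[OF HI])
    fix \<phi> b assume \<phi>: "\<phi> \<in> H" and b: "b \<in> points M"
    have "{\<phi> b | \<phi>. \<phi> \<in> H} \<in> leaf M F ` points M" using orb b by blast
    then obtain q where q: "q \<in> points M" "{\<phi> b | \<phi>. \<phi> \<in> H} = leaf M F q" by blast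
    have "\<phi> b \<in> leaf M F q" "\<one>\<^bsub>?G\<^esub> b \<in> leaf M F q" using q(2) \<phi> oneH by blast+
    then show "\<exists>q\<in>points M. b \<in> leaf M F q \<and> \<phi> b \<in> leaf M F q" using q(1) one[OF b] by auto
  next
    fix a a' assume a: "a \<in> points M" and a': "a' \<in> leaf M F a"
    have "leaf M F a \<in> (\<lambda>q. {\<phi> q | \<phi>. \<phi> \<in> H}) ` points M" using orb a by blast
    then obtain q where q: "q \<in> points M" "leaf M F a = {\<phi> q | \<phi>. \<phi> \<in> H}" by blast
    have "a \<in> leaf M F a" by (rule leaf_refl)
    then obtain \<phi>1 \<phi>2 where \<phi>: "\<phi>1 \<in> H" "a = \<phi>1 q" "\<phi>2 \<in> H" "a' = \<phi>2 q" using q(2) a' by auto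
    let ?\<psi> = "inv\<^bsub>?G\<^esub> \<phi>1"
    have \<psi>: "?\<psi> \<in> H" using group.inv_closed[OF gr, of \<phi>1] \<phi>(1) by simp
    have "?\<psi> \<otimes>\<^bsub>?G\<^esub> \<phi>1 = \<one>\<^bsub>?G\<^esub>" using group.l_inv[OF gr, of \<phi>1] \<phi>(1) by simp
    then have "?\<psi> (\<phi>1 q) = q" using mult[OF \<psi> \<phi>(1) q(1)] one[OF q(1)] by simp
    then have "(\<phi>2 \<otimes>\<^bsub>?G\<^esub> ?\<psi>) a = a'" using mult[OF \<phi>(3) \<psi> a] \<phi> by simp
    moreover have "\<phi>2 \<otimes>\<^bsub>?G\<^esub> ?\<psi> \<in> H" using monoid.m_closed[OF group.is_monoid[OF gr], of \<phi>2 ?\<psi>] \<phi>(3) \<psi> by simp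
    ultimately show "\<exists>\<phi>\<in>H. \<phi> a = a'" by blast
  qed
qed

section \<open>Rescaling near the origin\<close>

lemma hopf_equiv_scale:
  assumes "hopf_equiv a b" "t \<noteq> 0"
  shows "hopf_equiv (t *\<^sub>R a) (t *\<^sub>R b)"
  using assms by (auto simp: hopf_equiv_def oct_line_iff oct_mult_linear)

text \<open>Both are unit points of the line of slope 0, and the absence of zero divisors keeps them
  off all other lines of finite slope.\<close>

lemma hopf_equiv_basis: "hopf_equiv (oct_basis 0, 0) (oct_basis 1, 0)"
proof -
  have m: "m \<cdot>\<^sub>O x = 0 \<longleftrightarrow> m = 0" if "x \<noteq> 0" for m x
    using oct_right_cancel[OF that, of m 0] by (auto simp: oct_mult_def)
  have "oct_basis i \<noteq> 0" for i by (simp add: axis_eq_0_iff)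
  then show ?thesis by (auto simp: hopf_equiv_def oct_line_iff norm_prod_def m eq_commute[of 0])
qed

context morita begin

text \<open>Three approximations are chained, those of \<open>y\<close>, of the isometry and of
  \<open>P\<close>, each with relative error \<open>e\<close>. Since \<open>B\<close> dominates
  every operator bound, each contributes at most \<open>B * B * e\<close> times the norm of
  \<open>x\<close>, whence the factor 3.\<close>

lemma affine_estimate:
  fixes y :: "octonion \<times> octonion \<Rightarrow> 'e" and P :: "'e \<Rightarrow> octonion \<times> octonion"
  assumes B: "B \<ge> 1" "Ky + 1 \<le> B" "Kp \<le> B" "C + 1 \<le> B" "C \<ge> 0" "Kp \<ge> 0" and e: "e \<ge> 0" "e \<le> 1" "3 * (B * B) * e \<le> 1 / 400"
    and DP: "blin_on (model M) DP" "\<And>v. v \<in> model M \<Longrightarrow> norm (DP v) \<le> Kp * norm v"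
    and L: "blin_on (model M) L" "\<And>v. v \<in> model M \<Longrightarrow> L v \<in> model M" "\<And>v. v \<in> model M \<Longrightarrow> norm (L v) \<le> C * norm v"
    and Dy: "Dyx \<in> model M" "norm Dyx \<le> Ky * norm x" and yx: "z \<in> model M" "z0 \<in> model M"
      "norm (z - z0 - Dyx) \<le> e * norm (x :: octonion \<times> octonion)"
    and a: "a \<in> model M" "a0 \<in> model M" "norm (a - a0 - L (z - z0)) \<le> e * norm (z - z0)"
    and P: "norm (Pa - P0 - DP (a - a0)) \<le> e * norm (a - a0)"
  shows "norm (z - z0) \<le> B * norm x" "norm (Pa - P0 - DP (L Dyx)) \<le> 1 / 400 * norm x"
proof -
  let ?x = "norm x"
  have zE: "z - z0 \<in> model M" "a - a0 \<in> model M" by (auto intro: subspace_diff[OF M.sub] yx a)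
  have "norm (z - z0) \<le> norm (z - z0 - Dyx) + norm Dyx" using norm_triangle_sub[of "z - z0" Dyx] by simp
  also have "\<dots> \<le> (Ky + 1) * ?x"
    using yx(3) Dy(2) mult_right_mono[OF e(2), of ?x] by (simp add: distrib_right)
  also have "\<dots> \<le> B * ?x" using B(2) by (simp add: mult_right_mono)
  finally show z: "norm (z - z0) \<le> B * ?x" .
  have "norm (a - a0) \<le> norm (a - a0 - L (z - z0)) + norm (L (z - z0))" using norm_triangle_sub[of "a - a0" "L (z - z0)"] by simp
  also have "\<dots> \<le> (C + 1) * norm (z - z0)"
    using a(3) L(3)[OF zE(1)] mult_right_mono[OF e(2), of "norm (z - z0)"] by (simp add: distrib_right)
  also have "\<dots> \<le> B * (B * ?x)" using B(1,4,5) z by (intro mult_mono) auto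
  finally have aa: "norm (a - a0) \<le> B * (B * ?x)" .
  have s: "a - a0 - L Dyx = (a - a0 - L (z - z0)) + L (z - z0 - Dyx)"
    using blin_on_diff[OF L(1) M.sub zE(1) Dy(1)] by simp
  have zD: "z - z0 - Dyx \<in> model M" by (rule subspace_diff[OF M.sub zE(1) Dy(1)])
  have "norm (a - a0 - L Dyx) \<le> e * norm (z - z0) + C * norm (z - z0 - Dyx)"
    unfolding s using a(3) L(3)[OF zD] norm_triangle_ineq[of "a - a0 - L (z - z0)" "L (z - z0 - Dyx)"] by linarith
  also have "\<dots> \<le> e * (B * ?x) + B * (e * ?x)"
    using z yx(3) e(1) B by (intro add_mono mult_mono) auto
  finally have l: "norm (a - a0 - L Dyx) \<le> 2 * (B * (e * ?x))" by (simp add: mult_ac)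
  have t: "Pa - P0 - DP (L Dyx) = (Pa - P0 - DP (a - a0)) + DP (a - a0 - L Dyx)"
    using blin_on_diff[OF DP(1) M.sub zE(2) L(2)[OF Dy(1)]] by simp
  have aD: "a - a0 - L Dyx \<in> model M" by (rule subspace_diff[OF M.sub zE(2) L(2)[OF Dy(1)]])
  have "norm (Pa - P0 - DP (L Dyx)) \<le> e * norm (a - a0) + Kp * norm (a - a0 - L Dyx)"
    unfolding t using P DP(2)[OF aD] norm_triangle_ineq[of "Pa - P0 - DP (a - a0)" "DP (a - a0 - L Dyx)"] by linarith
  also have "\<dots> \<le> e * (B * (B * ?x)) + B * (2 * (B * (e * ?x)))"
    using aa l e(1) B by (intro add_mono mult_mono) auto
  also have "\<dots> = (3 * (B * B) * e) * ?x" by (simp add: algebra_simps)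
  also have "\<dots> \<le> 1 / 400 * ?x" using e(3) by (rule mult_right_mono) simp
  finally show "norm (Pa - P0 - DP (L Dyx)) \<le> 1 / 400 * ?x" .
qed

end

context morita begin

lemma not_locally_homogeneous:
  assumes g: "riemannian_metric M g"
  shows "\<not> locally_homogeneous_foliation M g F"
proof
  assume lh: "locally_homogeneous_foliation M g F"
  let ?v = "(oct_basis 0, 0) :: octonion \<times> octonion" and ?v' = "(oct_basis 1, 0) :: octonion \<times> octonion"
  have "0 \<in> f1 ` points N" using S1.surj_points by simp
  then obtain n where n: "n \<in> points N" "f1 n = 0" by (metis imageE)
  let ?p = "f2 n"
  let ?z0 = "cmap M ?p ?p" and ?E = "model M"
  have p: "?p \<in> points M" using S2.f_points[OF n(1)] .
  obtain U where U: "openin (mtop M) U" "?p \<in> U"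
    and hom: "homogeneous_foliation (open_submanifold M U) g (restrict_foliation M U F)"
    using lh p unfolding locally_homogeneous_foliation_def by blast
  interpret sub: sub_mfd M U by unfold_locales (rule U(1))
  let ?leaf = "leaf (open_submanifold M U) (restrict_foliation M U F)"
  obtain H where HI: "H \<subseteq> isometries (open_submanifold M U) g"
    and H1: "\<And>\<phi> b. \<phi> \<in> H \<Longrightarrow> b \<in> points (open_submanifold M U) \<Longrightarrow>
      \<exists>q\<in>points (open_submanifold M U). b \<in> ?leaf q \<and> \<phi> b \<in> ?leaf q"
    and H2: "\<And>a a'. a \<in> points (open_submanifold M U) \<Longrightarrow> a' \<in> ?leaf a \<Longrightarrow> \<exists>\<phi>\<in>H. \<phi> a = a'"
    by (rule homogeneous_orbits[OF hom]) (rule that, assumption+)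
  obtain r y P SP where r: "r > 0" and y: "Cinf_on UNIV (ball 0 r) y" "y 0 = ?z0"
    and yU: "\<And>x. x \<in> ball 0 r \<Longrightarrow> y x \<in> cmap M ?p ` (cdom M ?p \<inter> U)"
    and ylift: "\<And>x. x \<in> ball 0 r \<Longrightarrow> \<exists>q\<in>points N. f2 q = cinv M ?p (y x) \<and> f1 q = x"
    and SP: "openin (top_of_set ?E) SP" "?z0 \<in> SP" and P: "Cinf_on ?E SP P"
    and Plift: "\<And>z. z \<in> SP \<Longrightarrow> \<exists>q\<in>points N. f2 q = cinv M ?p z \<and> f1 q = P z"
    and DPy: "\<And>v. dir_deriv P ?z0 (dir_deriv y 0 v) = v" and P0: "P ?z0 = 0"
    and yleaf: "\<And>x x'. x \<in> ball 0 r \<Longrightarrow> hopf_equiv x x' \<Longrightarrow> cinv M ?p (y x') \<in> ?leaf (cinv M ?p (y x))"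
    by (rule slice[OF n U]) (rule that, assumption+)
  have yc: "cinv M ?p (y x) \<in> cdom M ?p" "cinv M ?p (y x) \<in> U" "cmap M ?p (cinv M ?p (y x)) = y x" "y x \<in> ?E"
    if x: "x \<in> ball 0 r" for x
  proof -
    obtain q where q: "q \<in> cdom M ?p" "q \<in> U" "y x = cmap M ?p q" using yU[OF x] by blast
    have "cinv M ?p (y x) = q" using q p by simp
    then show "cinv M ?p (y x) \<in> cdom M ?p" "cinv M ?p (y x) \<in> U" "cmap M ?p (cinv M ?p (y x)) = y x" "y x \<in> ?E"
      using q M.cmap_E[OF p q(1)] by simp_all
  qed
  have z0E: "?z0 \<in> ?E" by (rule M.cmap_E[OF p M.chart(1)[OF p]])
  have fdE: "fd_subspace (UNIV :: (octonion \<times> octonion) set)" by (rule fd_subspace_UNIV)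
  have bo: "openin (top_of_set UNIV) (ball (0 :: octonion \<times> octonion) r)" by simp
  have b0: "0 \<in> ball (0 :: octonion \<times> octonion) r" using r by simp
  let ?Dy = "dir_deriv y 0" and ?DP = "dir_deriv P ?z0"
  have Dy: "blin_on UNIV ?Dy" by (rule blin_on_dir_deriv[OF fdE bo Cinf_Ck[OF y(1), of "Suc 0"] b0])
  have DyE: "?Dy v \<in> ?E" for v
    by (rule dir_deriv_in_subspace[OF subspace_UNIV bo M.fd Cinf_Ck[OF y(1), of "Suc 0"] yc(4) b0 UNIV_I])
  have DP: "blin_on ?E ?DP" by (rule blin_on_dir_deriv[OF M.fd SP(1) Cinf_Ck[OF P, of "Suc 0"] SP(2)])
  obtain Ky where Ky: "Ky \<ge> 0" "\<And>v. norm (?Dy v) \<le> Ky * norm v" by (rule blin_on_bound[OF Dy]) (rule that, simp_all)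
  obtain Kp where Kp: "Kp \<ge> 0" "\<And>v. v \<in> ?E \<Longrightarrow> norm (?DP v) \<le> Kp * norm v" by (rule blin_on_bound[OF DP]) (rule that, assumption+)
  obtain C where C: "C \<ge> 0" and aff: "\<And>e. e > 0 \<Longrightarrow> \<exists>d>0. ?E \<inter> ball ?z0 d \<subseteq> sub.MU.img ?p \<and>
    (\<forall>\<phi>\<in>isometries (open_submanifold M U) g. \<forall>x1\<in>?E \<inter> ball ?z0 d.
      \<phi> (cinv M ?p x1) \<in> cdom M ?p \<longrightarrow> dist (cmap M ?p (\<phi> (cinv M ?p x1))) ?z0 < d \<longrightarrow>
      (\<exists>L. blin_on ?E L \<and> (\<forall>v\<in>?E. L v \<in> ?E \<and> norm (L v) \<le> C * norm v) \<and>
        (\<forall>x\<in>?E \<inter> ball ?z0 d. \<phi> (cinv M ?p x) \<in> cdom M ?p \<and> dist (cmap M ?p (\<phi> (cinv M ?p x))) ?z0 < e) \<and>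
        (\<forall>x\<in>?E \<inter> ball ?z0 d. \<forall>y\<in>?E \<inter> ball ?z0 d.
          norm (cmap M ?p (\<phi> (cinv M ?p x)) - cmap M ?p (\<phi> (cinv M ?p y)) - L (x - y)) \<le> e * norm (x - y))))"
    by (rule sub.isometries_uniformly_affine[OF g U(2)]) (rule that, assumption+)
  \<comment> \<open>The summand 2 covers \<open>C + 1\<close> and \<open>Ky + 1\<close>, and also
    the bound 1 of the identity, which takes the place of the isometry in
    \<open>base\<close>.\<close>
  define B where "B = C + Ky + Kp + 2"
  have B: "B \<ge> 1" "Ky + 1 \<le> B" "Kp \<le> B" "C + 1 \<le> B" "1 + 1 \<le> B" using C Ky(1) Kp(1) by (simp_all add: B_def)
  \<comment> \<open>Solves \<open>3 * (B * B) * e = 1 / 400\<close>.\<close>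
  define e where "e = 1 / (1200 * (B * B))"
  have BB: "B * B \<ge> 1" using mult_mono[of 1 B 1 B] B(1) by simp
  have e: "e > 0" "e \<le> 1" "3 * (B * B) * e \<le> 1 / 400" using BB by (simp_all add: e_def field_simps)
  obtain d1 where d1: "d1 > 0" "?E \<inter> ball ?z0 d1 \<subseteq> SP"
    "\<And>a b. a \<in> ?E \<inter> ball ?z0 d1 \<Longrightarrow> b \<in> ?E \<inter> ball ?z0 d1 \<Longrightarrow> norm (P a - P b - ?DP (a - b)) \<le> e * norm (a - b)"
    by (rule strict_differentiability'[OF M.fd SP(1) Cinf_Ck[OF P, of "Suc 0"] SP(2) e(1)]) (rule that, assumption+)
  obtain d3 where d3: "d3 > 0" "UNIV \<inter> ball 0 d3 \<subseteq> ball (0 :: octonion \<times> octonion) r"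
    "\<And>x x'. x \<in> UNIV \<inter> ball 0 d3 \<Longrightarrow> x' \<in> UNIV \<inter> ball 0 d3 \<Longrightarrow> norm (y x - y x' - ?Dy (x - x')) \<le> e * norm (x - x')"
    by (rule strict_differentiability'[OF fdE bo Cinf_Ck[OF y(1), of "Suc 0"] b0 e(1)]) (rule that, assumption+)
  \<comment> \<open>Besides the relative error, this tolerance bounds how far images under the
    isometry are from the centre; \<open>d1\<close> keeps them in the domain where \<open>P\<close>
    is nearly linear.\<close>
  define e' where "e' = min e d1"
  have e': "e' > 0" using e d1 by (simp add: e'_def)
  obtain d2 where d2: "d2 > 0" and aff2: "\<And>\<phi> x1. \<phi> \<in> isometries (open_submanifold M U) g \<Longrightarrow> x1 \<in> ?E \<inter> ball ?z0 d2 \<Longrightarrow>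
      \<phi> (cinv M ?p x1) \<in> cdom M ?p \<Longrightarrow> dist (cmap M ?p (\<phi> (cinv M ?p x1))) ?z0 < d2 \<Longrightarrow>
      \<exists>L. blin_on ?E L \<and> (\<forall>v\<in>?E. L v \<in> ?E \<and> norm (L v) \<le> C * norm v) \<and>
        (\<forall>x\<in>?E \<inter> ball ?z0 d2. \<phi> (cinv M ?p x) \<in> cdom M ?p \<and> dist (cmap M ?p (\<phi> (cinv M ?p x))) ?z0 < e') \<and>
        (\<forall>x\<in>?E \<inter> ball ?z0 d2. \<forall>y\<in>?E \<inter> ball ?z0 d2.
          norm (cmap M ?p (\<phi> (cinv M ?p x)) - cmap M ?p (\<phi> (cinv M ?p y)) - L (x - y)) \<le> e' * norm (x - y))"
  proof -
    from aff[OF e'] obtain d where d: "d > 0" and *: "\<forall>\<phi>\<in>isometries (open_submanifold M U) g. \<forall>x1\<in>?E \<inter> ball ?z0 d.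
      \<phi> (cinv M ?p x1) \<in> cdom M ?p \<longrightarrow> dist (cmap M ?p (\<phi> (cinv M ?p x1))) ?z0 < d \<longrightarrow>
      (\<exists>L. blin_on ?E L \<and> (\<forall>v\<in>?E. L v \<in> ?E \<and> norm (L v) \<le> C * norm v) \<and>
        (\<forall>x\<in>?E \<inter> ball ?z0 d. \<phi> (cinv M ?p x) \<in> cdom M ?p \<and> dist (cmap M ?p (\<phi> (cinv M ?p x))) ?z0 < e') \<and>
        (\<forall>x\<in>?E \<inter> ball ?z0 d. \<forall>y\<in>?E \<inter> ball ?z0 d.
          norm (cmap M ?p (\<phi> (cinv M ?p x)) - cmap M ?p (\<phi> (cinv M ?p y)) - L (x - y)) \<le> e' * norm (x - y)))"
      by (elim exE conjE)
    show ?thesis by (rule that[OF d]) (rule *[THEN bspec, THEN bspec, THEN mp, THEN mp])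
  qed
  \<comment> \<open>Points of norm up to \<open>2 * t\<close> must lie in the domain of the slice
    and be mapped by \<open>y\<close> into the ball of radius \<open>d2\<close>. The factor 2 makes
    room for test points such as (e4, e6).\<close>
  define t where "t = min (d3 / 4) (d2 / (4 * B))"
  have t: "t > 0" "2 * t < d3" "B * (2 * t) < d2"
  proof -
    show "t > 0" using d2 d3 B by (simp add: t_def)
    show "2 * t < d3" using d3(1) by (simp add: t_def min_def)
    have "t \<le> d2 / (4 * B)" by (simp add: t_def)
    then have "4 * (B * t) \<le> d2" using B(1) by (simp add: field_simps)
    then show "B * (2 * t) < d2" using d2 by linarith
  qed
  have small: "x \<in> ball 0 r" "norm (y x - ?z0 - ?Dy x) \<le> e * norm x" "norm (y x - ?z0) \<le> B * norm x" "y x \<in> ?E \<inter> ball ?z0 d2"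
    if x: "norm x \<le> 2 * t" for x
  proof -
    have xd: "x \<in> UNIV \<inter> ball 0 d3" "0 \<in> UNIV \<inter> ball (0 :: octonion \<times> octonion) d3" using x t(2) d3(1) by simp_all
    show xr: "x \<in> ball 0 r" using xd d3(2) by blast
    show yx: "norm (y x - ?z0 - ?Dy x) \<le> e * norm x" using d3(3)[OF xd] y(2) by simp
    have "norm (y x - ?z0) \<le> norm (y x - ?z0 - ?Dy x) + norm (?Dy x)" using norm_triangle_sub[of "y x - ?z0" "?Dy x"] by simp
    also have "\<dots> \<le> (Ky + 1) * norm x" using yx Ky(2)[of x] mult_right_mono[OF e(2), of "norm x"] by (simp add: distrib_right)
    also have "\<dots> \<le> B * norm x" using B(2) by (simp add: mult_right_mono)
    finally show yB: "norm (y x - ?z0) \<le> B * norm x" .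
    also have "\<dots> \<le> B * (2 * t)" using x B(1) by (simp add: mult_left_mono)
    also have "\<dots> < d2" by (rule t(3))
    finally show "y x \<in> ?E \<inter> ball ?z0 d2" using yc(4)[OF xr] by (simp add: dist_norm norm_minus_commute)
  qed
  let ?x = "t *\<^sub>R ?v" and ?x' = "t *\<^sub>R ?v'"
  have nv: "norm ?v = 1" "norm ?v' = 1" by (simp_all add: norm_prod_def)
  have nx: "norm ?x \<le> 2 * t" "norm ?x' \<le> 2 * t" "norm ?x' = t" using nv t(1) by (simp_all only: norm_scaleR)
  have "hopf_equiv ?x ?x'" using hopf_equiv_scale[OF hopf_equiv_basis] t(1) by simp
  then have "cinv M ?p (y ?x') \<in> ?leaf (cinv M ?p (y ?x))" by (rule yleaf[OF small(1)[OF nx(1)]])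
  then obtain \<phi> where \<phi>: "\<phi> \<in> H" and \<phi>x: "\<phi> (cinv M ?p (y ?x)) = cinv M ?p (y ?x')"
    using H2[of "cinv M ?p (y ?x)"] yc(2)[OF small(1)[OF nx(1)]] sub.points_U by blast
  have \<phi>I: "\<phi> \<in> isometries (open_submanifold M U) g" using HI \<phi> by blast
  let ?k = "\<lambda>z. cmap M ?p (\<phi> (cinv M ?p z))"
  have kx: "?k (y ?x) = y ?x'" using \<phi>x yc(3)[OF small(1)[OF nx(2)]] by simp
  have "\<exists>L. blin_on ?E L \<and> (\<forall>v\<in>?E. L v \<in> ?E \<and> norm (L v) \<le> C * norm v) \<and>
        (\<forall>x\<in>?E \<inter> ball ?z0 d2. \<phi> (cinv M ?p x) \<in> cdom M ?p \<and> dist (?k x) ?z0 < e') \<and>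
        (\<forall>x\<in>?E \<inter> ball ?z0 d2. \<forall>y\<in>?E \<inter> ball ?z0 d2. norm (?k x - ?k y - L (x - y)) \<le> e' * norm (x - y))"
  \<comment> \<open>The point required to be moved to a place near the centre is
    \<open>y ?x\<close>, whose image is \<open>y ?x'\<close>.\<close>
  proof (rule aff2[OF \<phi>I small(4)[OF nx(1)]])
    show "\<phi> (cinv M ?p (y ?x)) \<in> cdom M ?p" using \<phi>x yc(1)[OF small(1)[OF nx(2)]] by simp
    show "dist (?k (y ?x)) ?z0 < d2" unfolding kx using small(4)[OF nx(2)] by (simp add: dist_commute)
  qed
  then obtain L where L: "blin_on ?E L" "\<And>v. v \<in> ?E \<Longrightarrow> L v \<in> ?E" "\<And>v. v \<in> ?E \<Longrightarrow> norm (L v) \<le> C * norm v"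
    and Lk: "\<And>x. x \<in> ?E \<inter> ball ?z0 d2 \<Longrightarrow> \<phi> (cinv M ?p x) \<in> cdom M ?p"
      "\<And>x. x \<in> ?E \<inter> ball ?z0 d2 \<Longrightarrow> dist (?k x) ?z0 < e'"
      "\<And>x y. x \<in> ?E \<inter> ball ?z0 d2 \<Longrightarrow> y \<in> ?E \<inter> ball ?z0 d2 \<Longrightarrow> norm (?k x - ?k y - L (x - y)) \<le> e' * norm (x - y)"
  proof (elim exE conjE)
    fix L assume *: "blin_on ?E L" "\<forall>v\<in>?E. L v \<in> ?E \<and> norm (L v) \<le> C * norm v"
      "\<forall>x\<in>?E \<inter> ball ?z0 d2. \<phi> (cinv M ?p x) \<in> cdom M ?p \<and> dist (?k x) ?z0 < e'"
      "\<forall>x\<in>?E \<inter> ball ?z0 d2. \<forall>y\<in>?E \<inter> ball ?z0 d2. norm (?k x - ?k y - L (x - y)) \<le> e' * norm (x - y)"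
    show thesis
      by (rule that[OF *(1) *(2)[THEN bspec, THEN conjunct1] *(2)[THEN bspec, THEN conjunct2]
        *(3)[THEN bspec, THEN conjunct1] *(3)[THEN bspec, THEN conjunct2] *(4)[THEN bspec, THEN bspec]])
  qed
  have kE: "?k z \<in> ?E \<inter> ball ?z0 d1" "?k z \<in> SP" if z: "z \<in> ?E \<inter> ball ?z0 d2" for z
  proof -
    have "dist (?k z) ?z0 < d1" using Lk(2)[OF z] by (simp add: e'_def)
    then show "?k z \<in> ?E \<inter> ball ?z0 d1" using M.cmap_E[OF p Lk(1)[OF z]] by (simp add: dist_commute)
    then show "?k z \<in> SP" using d1(2) by blast
  qed
  \<comment> \<open>The point below \<open>y x\<close> and its image under \<phi> lie in one leaf of
    the restricted foliation. Their lifts from \<open>ylift\<close> and \<open>Plift\<close> have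
    \<open>x\<close> and \<open>P (?k (y x))\<close> as images under \<open>f1\<close>.\<close>
  have hopf: "hopf_equiv x (P (?k (y x)))" if x: "norm x \<le> 2 * t" for x
  proof -
    let ?b = "cinv M ?p (y x)"
    note xr = small(1)[OF x]
    have "\<exists>q\<in>points (open_submanifold M U). ?b \<in> ?leaf q \<and> \<phi> ?b \<in> ?leaf q" by (rule H1[OF \<phi>]) (use yc(2)[OF xr] sub.points_U in blast)
    then obtain q where q: "q \<in> U" "?b \<in> ?leaf q" "\<phi> ?b \<in> ?leaf q" using sub.points_U by blast
    have "q \<in> f2 ` points N" using S2.surj_points q(1) by simp
    then obtain nq where nq: "nq \<in> points N" "f2 nq = q" by blast
    obtain n1 where n1: "n1 \<in> points N" "f2 n1 = ?b" "f1 n1 = x" using ylift[OF xr] by blast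
    obtain n2 where n2: "n2 \<in> points N" "f2 n2 = cinv M ?p (?k (y x))" "f1 n2 = P (?k (y x))"
      using Plift[OF kE(2)[OF small(4)[OF x]]] by blast
    have "f2 n2 = \<phi> ?b" using n2(2) M.cinv_cmap[OF p Lk(1)[OF small(4)[OF x]]] by simp
    then have "hopf_equiv (f1 nq) (f1 n1)" "hopf_equiv (f1 nq) (f1 n2)"
      using leaf_hopf[OF q(2) nq(1) n1(1) nq(2) n1(2)] leaf_hopf[OF q(3) nq(1) n2(1) nq(2)] by blast+
    then have "hopf_equiv (f1 n1) (f1 n2)" using hopf_equiv_sym hopf_equiv_trans by blast
    then show ?thesis using n1(3) n2(3) by simp
  qed
  have z0d: "?z0 \<in> ?E \<inter> ball ?z0 d2" using z0E d2 by simp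
  \<comment> \<open>The isometry need not fix \<open>?p\<close>, but the image of \<open>?p\<close>
    is a point that \<open>P\<close> sends into the leaf of the origin, which is the origin
    alone.\<close>
  have Pk0: "P (?k ?z0) = 0" using hopf[of 0] t(1) y(2) hopf_equiv_zero by simp
  let ?A = "\<lambda>x. ?DP (L (?Dy x))"
  have e0: "e \<ge> 0" using e by simp
  have est: "norm (P (?k (y x)) - ?A x) \<le> 1 / 400 * norm x" if x: "norm x \<le> 2 * t" for x
  proof -
    have k: "norm (?k (y x) - ?k ?z0 - L (y x - ?z0)) \<le> e * norm (y x - ?z0)"
      using Lk(3)[OF small(4)[OF x] z0d] mult_right_mono[of e' e "norm (y x - ?z0)"] by (simp add: e'_def)
    have "norm (P (?k (y x)) - P (?k ?z0) - ?A x) \<le> 1 / 400 * norm x"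
      by (rule affine_estimate(2)[OF B(1-4) C Kp(1) e0 e(2,3) DP Kp(2) L DyE Ky(2) yc(4)[OF small(1)[OF x]] z0E small(2)[OF x]
          IntD1[OF kE(1)[OF small(4)[OF x]]] IntD1[OF kE(1)[OF z0d]] k d1(3)[OF kE(1)[OF small(4)[OF x]] kE(1)[OF z0d]]])
    then show ?thesis using Pk0 by simp
  qed
  \<comment> \<open>The same estimate with the identity in place of the isometry; by
    \<open>DPy\<close> the linear part is then the identity of the octonionic plane.\<close>
  have base: "norm (P (y ?x') - ?x') \<le> 1 / 400 * t"
  proof -
    have yd: "y ?x' \<in> ?E \<inter> ball ?z0 d1" using kE(1)[OF small(4)[OF nx(1)]] kx by simp
    have "norm (P (y ?x') - P ?z0 - ?DP ((\<lambda>v. v) (?Dy ?x'))) \<le> 1 / 400 * norm ?x'"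
    proof (rule affine_estimate(2)[where L = "\<lambda>v. v" and C = 1, OF B(1-3,5) _ Kp(1) e0 e(2,3) DP Kp(2) _ _ _ DyE Ky(2)
          yc(4)[OF small(1)[OF nx(2)]] z0E small(2)[OF nx(2)] IntD1[OF yd] z0E _ d1(3)[OF yd]])
      show "blin_on ?E (\<lambda>v. v)" unfolding blin_on_def by (auto intro!: exI[of _ 1])
      show "?z0 \<in> ?E \<inter> ball ?z0 d1" using z0E d1(1) by simp
    qed (use e0 in simp_all)
    then show ?thesis using DPy P0 nx(3) by simp
  qed
  have lin: "linear ?A"
  proof
    show "?A (a + b) = ?A a + ?A b" for a b
      using blin_onD(1)[OF Dy, of a b] blin_onD(1)[OF L(1) DyE DyE, of a b] blin_onD(1)[OF DP L(2)[OF DyE] L(2)[OF DyE], of a b] by simp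
    show "?A (c *\<^sub>R a) = c *\<^sub>R ?A a" for c a
      using blin_onD(2)[OF Dy, of a c] blin_onD(2)[OF L(1) DyE, of c a] blin_onD(2)[OF DP L(2)[OF DyE], of c a] by simp
  qed
  have At: "?A (t *\<^sub>R a) = t *\<^sub>R ?A a" for a by (rule linear_scale[OF lin])
  have scale: "norm (?A a - (1 / t) *\<^sub>R w) = norm (?A (t *\<^sub>R a) - w) / t" for a w
  proof -
    have "?A a - (1 / t) *\<^sub>R w = (1 / t) *\<^sub>R (?A (t *\<^sub>R a) - w)" using t(1) At[of a] by (simp add: scaleR_diff_right)
    then show ?thesis using t(1) by simp
  qed
  show False
  proof (rule no_almost_linear_hopf_map[OF lin])
    fix a :: "octonion \<times> octonion" assume a: "norm a \<le> 2"
    let ?w = "P (?k (y (t *\<^sub>R a)))"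
    have ta: "norm (t *\<^sub>R a) \<le> 2 * t" using a t(1) by (simp add: mult.commute)
    have "hopf_equiv ((1 / t) *\<^sub>R (t *\<^sub>R a)) ((1 / t) *\<^sub>R ?w)"
      by (rule hopf_equiv_scale[OF hopf[OF ta]]) (use t(1) in simp)
    then have h: "hopf_equiv a ((1 / t) *\<^sub>R ?w)" using t(1) by simp
    have "norm (?A (t *\<^sub>R a) - ?w) \<le> 1 / 400 * norm (t *\<^sub>R a)" using est[OF ta] by (simp add: norm_minus_commute)
    \<comment> \<open>Division by \<open>t\<close> leaves the error 2 / 400, within the
      tolerance.\<close>
    also have "\<dots> \<le> 1 / 400 * (2 * t)" using ta by simp
    finally have "norm (?A (t *\<^sub>R a) - ?w) / t \<le> 1 / 100" using t(1) by (simp add: field_simps)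
    then show "\<exists>z. norm (?A a - z) \<le> 1 / 100 \<and> hopf_equiv a z" using h scale[of a ?w] by (intro exI[of _ "(1 / t) *\<^sub>R ?w"]) simp
  next
    have nxt: "norm ?x = t" using nv(1) t(1) by (simp only: norm_scaleR)
    have "norm (P (y ?x') - ?A ?x) \<le> 1 / 400 * t" using est[OF nx(1)] unfolding kx nxt .
    then have "norm (?A ?x - P (y ?x')) \<le> 1 / 400 * t" by (subst norm_minus_commute)
    moreover have "norm (?A ?x - ?x') \<le> norm (?A ?x - P (y ?x')) + norm (P (y ?x') - ?x')"
      using dist_triangle[of "?A ?x" ?x' "P (y ?x')"] unfolding dist_norm .
    \<comment> \<open>One error comes from the isometry, which maps \<open>y ?x\<close> to
      \<open>y ?x'\<close>, and one from the slice at \<open>?x'\<close>.\<close>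
    ultimately have "norm (?A ?x - ?x') \<le> 1 / 400 * t + 1 / 400 * t" using base by linarith
    then have "norm (?A ?x - ?x') / t \<le> 1 / 100" using t(1) by (simp add: field_simps)
    then show "norm (?A ?v - ?v') \<le> 1 / 100" using scale[of ?v ?x'] t(1) by simp
  qed
qed

end

theorem theorem2:
  fixes F0 :: "(octonion \<times> octonion \<Rightarrow> octonion \<times> octonion) set"
    and M :: "('m, 'e::real_normed_vector) manifold"
    and g :: "'m \<Rightarrow> 'e \<Rightarrow> 'e \<Rightarrow> real"
    and F :: "('m \<Rightarrow> 'e) set"
  assumes "singular_foliation standard_manifold F0"
    and "leaf_decomposition standard_manifold F0 = octonionic_hopf_leaves"
    and "smooth_manifold M" and "riemannian_metric M g"
    and "singular_foliation M F"
    and "locally_homogeneous_foliation M g F"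
  shows "\<not> hausdorff_morita_equivalent TYPE(('n, 'f::real_normed_vector) manifold)
            standard_manifold F0 M F"
proof
  assume "hausdorff_morita_equivalent TYPE(('n, 'f) manifold) standard_manifold F0 M F"
  then obtain N :: "('n, 'f) manifold" and f1 f2 where N: "smooth_manifold N"
    and f1: "surjective_submersion N (standard_manifold :: (octonion \<times> octonion, octonion \<times> octonion) manifold) f1"
    and f2: "surjective_submersion N M f2" "connected_fibers N M f2"
    and pb: "pullback_foliation N standard_manifold f1 F0 = pullback_foliation N M f2 F"
    unfolding hausdorff_morita_equivalent_def by blast
  interpret morita N M f1 f2 F0 F
    by (intro morita.intro smooth_mfd.intro morita_axioms.intro submersionI N f1 f2 pb assms smooth_standard)
  show False using not_locally_homogeneous[OF assms(4)] assms(6) by blast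
qed

end
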